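(* Let $n\ge2$ and let $\alpha_1,\ldots,\alpha_n$ be nonpositive real numbers. Define $$\beta_1=-\alpha_1^2+\frac14,\qquad\beta_i=-\alpha_i^2+\Big(\alpha_{i-1}-\frac12\Big)^2,\quad i=2,\ldots,n,$$ and consider the Hardy inequality $$\int_{\mathbb{R}^n_+}|\nabla\varphi|^2\,dx\ \ge\ \int_{\mathbb{R}^n_+}\Big(\frac{\beta_1}{x_1^2}+\frac{\beta_2}{x_1^2+x_2^2}+\cdots+\frac{\beta_n}{x_1^2+\cdots+x_n^2}\Big)\varphi^2\,dx\qquad\forall\varphi\in C_0^\infty(\mathbb{R}^n_+).\qquad( * )$$ Assume that $\alpha_n=0$, and that $\alpha_1,\ldots,\alpha_{n-1}$ are either all distinct, or all negative. Then the operator $P:=-\Delta-V(\beta_1,\ldots,\beta_n)$ is critical in $\mathbb{R}^n_+$, i.e. the Hardy inequality $( * )$ cannot be improved (no term $\int_{\mathbb{R}^n_+}W\varphi^2dx$ with $W\ge0$, $W\ne0$, can be added to its right-hand side). Furthermore, the weight $\beta_n|x|^{-2}$ is an optimal weight for the subcritical operator $-\Delta-V(\beta_1,\ldots,\beta_{n-1})$ in $\mathbb{R}^n_+$.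
   Context: $\mathbb{R}^n_+:=\{x=(x_1,\ldots,x_n)\in\mathbb{R}^n: x_1>0\}$. For $1\le j\le n$, $$V(\beta_1,\ldots,\beta_j):=\frac{\beta_1}{x_1^2}+\frac{\beta_2}{x_1^2+x_2^2}+\cdots+\frac{\beta_j}{x_1^2+\cdots+x_j^2}.$$ A symmetric second-order elliptic operator $P$ with nonnegative quadratic form $q$ on $C_0^\infty(D)$ is subcritical in $D$ if there is a nonnegative function $W\neq0$ with $q(\varphi)\ge\int_DW\varphi^2dx$ for all $\varphi\in C_0^\infty(D)$, and critical in $D$ otherwise. Optimality of a weight $W=c|x|^{-2}$, $c>0$, for a subcritical operator $P_0$ with quadratic form $q_0$ in $\mathbb{R}^n_+$ means: (a) $q_0(\varphi)\ge\int_{\mathbb{R}^n_+}W\varphi^2dx$ for all $\varphi\in C_0^\infty(\mathbb{R}^n_+)$, and $P_0-W$ is critical in $\mathbb{R}^n_+$; (b) $1$ is also the best constant $\lambda$ in $q_0(\varphi)\ge\lambda\int_{\mathbb{R}^n_+} W\varphi^2dx$ for test functions $\varphi\in C_0^\infty$ supported in $\mathbb{R}^n_+\cap\{|x|<R\}$, and for those supported in $\mathbb{R}^n_+\cap\{|x|>R\}$, for any fixed $R>0$; (c) $P_0-W$ is null-critical: the variational problem $\inf q_0(\varphi)/\int_{\mathbb{R}^n_+}W\varphi^2dx$ over the completion of $C_0^\infty(\mathbb{R}^n_+)$ in the norm $\sqrt{q_0}$ admits no minimizer; (d) the spectrum and the essential spectrum of the Friedrichs extension of $W^{-1}P_0$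 on $L^2(\mathbb{R}^n_+,W\,dx)$ are both equal to $[1,\infty)$. *)

theory Defs
  imports "HOL-Analysis.Analysis"
begin

subsection \<open>Smooth functions and test functions\<close>

definition partial :: "'n::finite \<Rightarrow> (real ^ 'n \<Rightarrow> 'b::real_normed_vector) \<Rightarrow> real ^ 'n \<Rightarrow> 'b"
  where "partial i f x = frechet_derivative f (at x) (axis i 1)"

primrec Ck :: "nat \<Rightarrow> (real ^ 'n::finite \<Rightarrow> 'b::real_normed_vector) \<Rightarrow> bool"
  where
    "Ck 0 f \<longleftrightarrow> continuous_on UNIV f"
  | "Ck (Suc k) f \<longleftrightarrow> (\<forall>x. f differentiable (at x)) \<and> (\<forall>i. Ck k (partial i f))"

text \<open>A function compactly supported in an open set \<open>D\<close> is represented by its extension by zero,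
  which is smooth on the whole space.  The codomain is left open because the quadratic forms are
  tested on real functions, whereas spectra are taken in a complex \<open>L\<^sup>2\<close> space.\<close>

definition test_functions :: "(real ^ 'n::finite) set \<Rightarrow> (real ^ 'n \<Rightarrow> 'b::real_normed_vector) set"
  where "test_functions D =
    {\<phi>. (\<forall>k. Ck k \<phi>) \<and> compact (closure {x. \<phi> x \<noteq> 0}) \<and> closure {x. \<phi> x \<noteq> 0} \<subseteq> D}"

definition laplacian :: "(real ^ 'n::finite \<Rightarrow> 'b::real_normed_vector) \<Rightarrow> real ^ 'n \<Rightarrow> 'b"
  where "laplacian f x = (\<Sum>i\<in>UNIV. partial i (partial i f) x)"


subsection \<open>The half-space and the potentials\<close>

text \<open>The coordinates are numbered by a bijection \<open>e\<close> from \<open>{1..n}\<close> to the index type,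
  so that \<open>x $ e i\<close> is the \<open>i\<close>-th coordinate of \<open>x\<close>.\<close>

definition half_space :: "(nat \<Rightarrow> 'n::finite) \<Rightarrow> (real ^ 'n) set"
  where "half_space e = {x. x $ e 1 > 0}"

definition hardy_potential ::
    "(nat \<Rightarrow> 'n::finite) \<Rightarrow> (nat \<Rightarrow> real) \<Rightarrow> nat \<Rightarrow> real ^ 'n \<Rightarrow> real"
  where "hardy_potential e \<beta> j x = (\<Sum>i=1..j. \<beta> i / (\<Sum>k=1..i. (x $ e k)\<^sup>2))"


subsection \<open>Schroedinger operators, subcriticality and criticality\<close>

definition schroedinger ::
    "(real ^ 'n::finite \<Rightarrow> real) \<Rightarrow> (real ^ 'n \<Rightarrow> 'b::real_normed_vector) \<Rightarrow> real ^ 'n \<Rightarrow> 'b"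
  where "schroedinger V \<phi> x = - laplacian \<phi> x - V x *\<^sub>R \<phi> x"

definition quad_form ::
    "(real ^ 'n::finite) set \<Rightarrow> (real ^ 'n \<Rightarrow> real) \<Rightarrow> (real ^ 'n \<Rightarrow> real) \<Rightarrow> real"
  where "quad_form D V \<phi> =
    (LINT x:D|lborel. (\<Sum>i\<in>UNIV. (partial i \<phi> x)\<^sup>2) - V x * (\<phi> x)\<^sup>2)"

definition weighted_mass ::
    "(real ^ 'n::finite) set \<Rightarrow> (real ^ 'n \<Rightarrow> real) \<Rightarrow> (real ^ 'n \<Rightarrow> real) \<Rightarrow> real"
  where "weighted_mass D W \<phi> = (LINT x:D|lborel. W x * (\<phi> x)\<^sup>2)"

definition nonneg_form ::
    "(real ^ 'n::finite) set \<Rightarrow> ((real ^ 'n \<Rightarrow> real) \<Rightarrow> real) \<Rightarrow> bool"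
  where "nonneg_form D q \<longleftrightarrow> (\<forall>\<phi>\<in>test_functions D. 0 \<le> q \<phi>)"

text \<open>No local integrability is imposed on the weight \<open>W\<close>, so its integral is taken in
  \<open>[0,\<infinity>]\<close>: with the Bochner integral a non-integrable \<open>W \<phi>\<^sup>2\<close> would contribute \<open>0\<close>.\<close>

definition subcritical ::
    "(real ^ 'n::finite) set \<Rightarrow> ((real ^ 'n \<Rightarrow> real) \<Rightarrow> real) \<Rightarrow> bool"
  where "subcritical D q \<longleftrightarrow> nonneg_form D q \<and>
    (\<exists>W \<in> borel_measurable lborel.
        (\<forall>x\<in>D. 0 \<le> W x) \<and> \<not> (AE x in lborel. x \<in> D \<longrightarrow> W x = 0) \<and>
        (\<forall>\<phi>\<in>test_functions D.
           (\<integral>\<^sup>+x\<in>D. ennreal (W x * (\<phi> x)\<^sup>2) \<partial>lborel) \<le> ennreal (q \<phi>)))"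

definition critical ::
    "(real ^ 'n::finite) set \<Rightarrow> ((real ^ 'n \<Rightarrow> real) \<Rightarrow> real) \<Rightarrow> bool"
  where "critical D q \<longleftrightarrow> nonneg_form D q \<and> \<not> subcritical D q"


subsection \<open>Best constants, and minimizers in the completion\<close>

definition best_constant ::
    "'f set \<Rightarrow> ('f \<Rightarrow> real) \<Rightarrow> ('f \<Rightarrow> real) \<Rightarrow> real \<Rightarrow> bool"
  where "best_constant T q m c \<longleftrightarrow>
    (\<forall>\<phi>\<in>T. c * m \<phi> \<le> q \<phi>) \<and> (\<forall>c'. (\<forall>\<phi>\<in>T. c' * m \<phi> \<le> q \<phi>) \<longrightarrow> c' \<le> c)"

text \<open>Elements of the completion of \<open>T\<close> in the norm \<open>sqrt q\<close> are represented by Cauchy sequences.\<close>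

definition completion ::
    "('a \<Rightarrow> real) set \<Rightarrow> (('a \<Rightarrow> real) \<Rightarrow> real) \<Rightarrow> (nat \<Rightarrow> 'a \<Rightarrow> real) set"
  where "completion T q =
    {\<Phi>. (\<forall>k. \<Phi> k \<in> T) \<and>
         (\<forall>\<epsilon>>0. \<exists>N. \<forall>k\<ge>N. \<forall>l\<ge>N. sqrt (q (\<lambda>x. \<Phi> k x - \<Phi> l x)) < \<epsilon>)}"

text \<open>Extension by continuity of a functional to the completion.  It is used for \<open>q\<close> itself and for
  a weighted mass dominated by \<open>q\<close>; for these the limit exists and depends only on the class of
  the Cauchy sequence.\<close>

definition extend :: "('f \<Rightarrow> real) \<Rightarrow> (nat \<Rightarrow> 'f) \<Rightarrow> real"
  where "extend F \<Phi> = lim (\<lambda>k. F (\<Phi> k))"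

definition rayleigh_minimizer ::
    "('a \<Rightarrow> real) set \<Rightarrow> (('a \<Rightarrow> real) \<Rightarrow> real) \<Rightarrow> (('a \<Rightarrow> real) \<Rightarrow> real) \<Rightarrow> (nat \<Rightarrow> 'a \<Rightarrow> real) \<Rightarrow> bool"
  where "rayleigh_minimizer T q m \<Phi> \<longleftrightarrow>
    \<Phi> \<in> completion T q \<and> extend m \<Phi> \<noteq> 0 \<and>
    (\<forall>\<Psi>\<in>completion T q. extend m \<Psi> \<noteq> 0 \<longrightarrow>
       extend q \<Phi> / extend m \<Phi> \<le> extend q \<Psi> / extend m \<Psi>)"


subsection \<open>Unbounded operators in a complex \<open>L\<^sup>2\<close> space\<close>

text \<open>Elements of \<open>L\<^sup>2\<close> are represented by functions, and an unbounded operator by its graph, a set of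
  pairs of functions; equalities between elements of \<open>L\<^sup>2\<close> are equalities almost everywhere.\<close>

definition L2 :: "'a measure \<Rightarrow> ('a \<Rightarrow> complex) set"
  where "L2 M = {f \<in> borel_measurable M. integrable M (\<lambda>x. (cmod (f x))\<^sup>2)}"

definition L2_inner :: "'a measure \<Rightarrow> ('a \<Rightarrow> complex) \<Rightarrow> ('a \<Rightarrow> complex) \<Rightarrow> complex"
  where "L2_inner M f g = (LINT x|M. f x * cnj (g x))"

definition L2_norm :: "'a measure \<Rightarrow> ('a \<Rightarrow> complex) \<Rightarrow> real"
  where "L2_norm M f = sqrt (LINT x|M. (cmod (f x))\<^sup>2)"

text \<open>The Friedrichs extension of a nonnegative symmetric operator \<open>A\<close> with dense domain \<open>T\<close>: the
  restriction of the adjoint of \<open>A\<close> to the domain of the closure of the form \<open>\<phi> \<mapsto> \<langle>A \<phi>, \<phi>\<rangle>\<close>.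
  A function \<open>u\<close> is in the latter if it is an \<open>L\<^sup>2\<close> limit of a sequence in \<open>T\<close> that is Cauchy
  for the form.\<close>

definition form_domain ::
    "'a measure \<Rightarrow> ('a \<Rightarrow> complex) set \<Rightarrow> (('a \<Rightarrow> complex) \<Rightarrow> 'a \<Rightarrow> complex) \<Rightarrow> ('a \<Rightarrow> complex) set"
  where "form_domain M T A =
    {u \<in> L2 M. \<exists>\<Phi> :: nat \<Rightarrow> 'a \<Rightarrow> complex. (\<forall>k. \<Phi> k \<in> T) \<and>
       (\<lambda>k. L2_norm M (\<lambda>x. \<Phi> k x - u x)) \<longlonglongrightarrow> 0 \<and>
       (\<forall>\<epsilon>>0. \<exists>N. \<forall>k\<ge>N. \<forall>l\<ge>N.
          Re (L2_inner M (A (\<lambda>x. \<Phi> k x - \<Phi> l x)) (\<lambda>x. \<Phi> k x - \<Phi> l x)) < \<epsilon>)}"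

definition friedrichs ::
    "'a measure \<Rightarrow> ('a \<Rightarrow> complex) set \<Rightarrow> (('a \<Rightarrow> complex) \<Rightarrow> 'a \<Rightarrow> complex) \<Rightarrow>
     (('a \<Rightarrow> complex) \<times> ('a \<Rightarrow> complex)) set"
  where "friedrichs M T A =
    {(u, g). u \<in> form_domain M T A \<and> g \<in> L2 M \<and>
       (\<forall>\<phi>\<in>T. L2_inner M (A \<phi>) u = L2_inner M \<phi> g)}"

definition resolvent_set ::
    "'a measure \<Rightarrow> (('a \<Rightarrow> complex) \<times> ('a \<Rightarrow> complex)) set \<Rightarrow> complex set"
  where "resolvent_set M G =
    {z. (\<exists>C. \<forall>(u, g)\<in>G. L2_norm M u \<le> C * L2_norm M (\<lambda>x. g x - z * u x)) \<and>
        (\<forall>f\<in>L2 M. \<exists>(u, g)\<in>G. AE x in M. g x - z * u x = f x)}"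

definition op_spectrum ::
    "'a measure \<Rightarrow> (('a \<Rightarrow> complex) \<times> ('a \<Rightarrow> complex)) set \<Rightarrow> complex set"
  where "op_spectrum M G = - resolvent_set M G"

definition eigenspace ::
    "'a measure \<Rightarrow> (('a \<Rightarrow> complex) \<times> ('a \<Rightarrow> complex)) set \<Rightarrow> complex \<Rightarrow> ('a \<Rightarrow> complex) set"
  where "eigenspace M G z = {u. \<exists>g. (u, g) \<in> G \<and> (AE x in M. g x = z * u x)}"

text \<open>The discrete spectrum of a self-adjoint operator consists of the isolated points of the spectrum
  that are eigenvalues of finite multiplicity; the essential spectrum is the rest of the spectrum.\<close>

definition discrete_spectrum ::
    "'a measure \<Rightarrow> (('a \<Rightarrow> complex) \<times> ('a \<Rightarrow> complex)) set \<Rightarrow> complex set"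
  where "discrete_spectrum M G =
    {z. z isolated_in op_spectrum M G \<and>
        (\<exists>u\<in>eigenspace M G z. \<not> (AE x in M. u x = 0)) \<and>
        (\<exists>B. finite B \<and> B \<subseteq> eigenspace M G z \<and>
           (\<forall>u\<in>eigenspace M G z. \<exists>c. AE x in M. u x = (\<Sum>b\<in>B. c b * b x)))}"

definition essential_spectrum ::
    "'a measure \<Rightarrow> (('a \<Rightarrow> complex) \<times> ('a \<Rightarrow> complex)) set \<Rightarrow> complex set"
  where "essential_spectrum M G = op_spectrum M G - discrete_spectrum M G"


subsection \<open>Optimal weights\<close>

definition weighted_measure ::
    "(real ^ 'n::finite) set \<Rightarrow> (real ^ 'n \<Rightarrow> real) \<Rightarrow> (real ^ 'n) measure"
  where "weighted_measure D W = density lborel (\<lambda>x. indicator D x * ennreal (W x))"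

definition weighted_friedrichs ::
    "(real ^ 'n::finite) set \<Rightarrow> (real ^ 'n \<Rightarrow> real) \<Rightarrow> (real ^ 'n \<Rightarrow> real) \<Rightarrow>
     ((real ^ 'n \<Rightarrow> complex) \<times> (real ^ 'n \<Rightarrow> complex)) set"
  where "weighted_friedrichs D V W =
    friedrichs (weighted_measure D W) (test_functions D)
      (\<lambda>\<phi> x. (1 / W x) *\<^sub>R schroedinger V \<phi> x)"

text \<open>Optimality in \<open>D\<close> of the weight \<open>W = c |x|\<^sup>-\<^sup>2\<close> for the subcritical operator \<open>- \<Delta> - V\<close>.\<close>

definition optimal_weight ::
    "(real ^ 'n::finite) set \<Rightarrow> (real ^ 'n \<Rightarrow> real) \<Rightarrow> real \<Rightarrow> bool"
  where "optimal_weight D V c \<longleftrightarrow>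
    (let W = (\<lambda>x. c / (norm x)\<^sup>2);
         q = quad_form D V;
         m = weighted_mass D W;
         M = weighted_measure D W;
         G = weighted_friedrichs D V W
     in
       0 < c \<and> subcritical D q \<and>
       (\<forall>\<phi>\<in>test_functions D. m \<phi> \<le> q \<phi>) \<and>
       critical D (quad_form D (\<lambda>x. V x + W x)) \<and>
       (\<forall>R>0. best_constant (test_functions (D \<inter> {x. norm x < R})) q m 1 \<and>
              best_constant (test_functions (D \<inter> {x. norm x > R})) q m 1) \<and>
       (\<nexists>\<Phi>. rayleigh_minimizer (test_functions D) q m \<Phi>) \<and>
       op_spectrum M G = complex_of_real ` {1..} \<and>
       essential_spectrum M G = complex_of_real ` {1..})"

end

theory Submission
  imports Defs
begin

text \<open>
  Write \<open>r\<^sub>j\<^sup>2 = x\<^sub>1\<^sup>2 + \<dots> + x\<^sub>j\<^sup>2\<close> and \<open>\<alpha>\<^sub>0 = 1\<close>.  The function \<open>u = \<Prod>\<^sub>j r\<^sub>j powr (\<alpha>\<^sub>j\<^sub>-\<^sub>1 - \<alpha>\<^sub>j - 1/2)\<close> is a positive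
  solution of \<open>- \<Delta>u = V u\<close>, homogeneous of degree \<open>- (n - 2) / 2\<close>, so that
  \<open>\<integral> |\<nabla>\<phi>|\<^sup>2 - V \<phi>\<^sup>2 = \<integral> u\<^sup>2 |\<nabla>(\<phi> / u)|\<^sup>2\<close>.  Moreover
  \<open>u\<^sup>2 = r\<^sub>1 / (r\<^sub>2 \<dots> r\<^sub>n) \<Prod>\<^sub>j (r\<^sub>j / r\<^sub>j\<^sub>+\<^sub>1) powr (- 2 \<alpha>\<^sub>j)\<close>, and the hypothesis leaves at most one \<open>\<alpha>\<^sub>j\<close>,
  \<open>j < n\<close>, equal to zero.  Hence on an annulus \<open>\<integral> g(x\<^sub>1) u\<^sup>2 \<le> C \<integral> g(s) s ds\<close>, so that cutting \<open>u\<close> off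
  logarithmically in \<open>x\<^sub>1\<close> costs no energy.  A logarithmic cutoff in \<open>|x|\<close> then gives a null sequence
  (criticality; the best constants follow by dilation), and \<open>u |x| powr (\<i> \<kappa>)\<close> gives approximate
  eigenfunctions of \<open>W\<^sup>-\<^sup>1 P\<^sub>0\<close> for \<open>1 + \<kappa>\<^sup>2 / \<beta>\<^sub>n\<close>; points off \<open>[1, \<infinity>)\<close> are in the resolvent set by the
  numerical range.  For a minimizer, \<open>\<integral> u\<^sup>2 |\<nabla>(\<phi> / u)|\<^sup>2\<close> would tend to zero along a sequence, so its
  limit would be invariant under the unitary dilations of \<open>L\<^sup>2(W dx)\<close> and therefore vanish.
\<close>

subsection \<open>Functions that are k times continuously differentiable on an open set\<close>

text \<open>The obstacle is the boundary x_1 = 0. When \<open>\<alpha> 1\<close> is zero, u behaves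
  like the square root of x_1 near a generic boundary point, so |grad u|^2 is not integrable there
  and a cutoff on a linear scale costs a fixed amount of energy. The logarithmic cutoff works if
  integrating u^2 over the other coordinates leaves no more than a factor x_1. Two vanishing
  \<open>\<alpha> j\<close> with j < n can bring in an extra ln (1 / x_1), and then the energy of
  this cutoff no longer tends to zero. A single vanishing \<open>\<alpha> j\<close> is harmless: the
  ratios r_i / r_(i+1) on either side of it still decay, and this decay can be shared out so that
  every one-dimensional integral is bounded uniformly in x_1.

  The remaining direction behaves like a free particle. In t = ln |x| the measure u^2 / |x|^2 dx is
  translation invariant, and \<open>A\<close> acts on u v(t) as v - v'' / \<open>\<beta> n\<close>.
  The half-line [1, infinity), the lack of a minimizer and the relation kappa^2 =
  \<open>\<beta> n\<close> (mu - 1) all reflect -d^2/dt^2 on the whole line.\<close>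

primrec Ck_on :: "nat \<Rightarrow> (real ^ 'n::finite) set \<Rightarrow> (real ^ 'n \<Rightarrow> 'b::real_normed_vector) \<Rightarrow> bool"
  where
    "Ck_on 0 S f \<longleftrightarrow> continuous_on S f"
  | "Ck_on (Suc k) S f \<longleftrightarrow> (\<forall>x\<in>S. f differentiable (at x)) \<and> (\<forall>i. Ck_on k S (partial i f))"

text \<open>The localization to a set is there because the ground state and the coefficients are
  smooth only in the open half-space, whereas test functions are smooth on the whole space.\<close>

lemma Ck_on_UNIV: "Ck_on k UNIV f = Ck k f"
  by (induction k arbitrary: f) auto

lemma partial_eqI: "(f has_derivative F) (at x) \<Longrightarrow> partial i f x = F (axis i 1)"
  unfolding partial_def by (metis frechet_derivative_at)

lemma partial_cong:
  assumes "open S" "x \<in> S" "\<And>y. y \<in> S \<Longrightarrow> f y = g y"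
  shows "partial i f x = partial i g x"
proof -
  have "(f has_derivative F) (at x) = (g has_derivative F) (at x)" for F
    using has_derivative_transform_within_open[of f F x UNIV S g]
      has_derivative_transform_within_open[of g F x UNIV S f] assms by auto
  then show ?thesis unfolding partial_def frechet_derivative_def by simp
qed

lemma differentiable_cong_open:
  assumes "open S" "x \<in> S" "\<And>y. y \<in> S \<Longrightarrow> f y = g y" "f differentiable (at x)"
  shows "g differentiable (at x)"
proof -
  obtain F where "(f has_derivative F) (at x)" using assms(4) unfolding differentiable_def by auto
  then have "(g has_derivative F) (at x)" by (rule has_derivative_transform_within_open) (use assms in auto)
  then show ?thesis unfolding differentiable_def by auto
qed

text \<open>On an open set a derivative depends only on the values in that set. The closure rules
  below compute \<open>partial\<close> pointwise on S and then transfer smoothness of the resulting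
  formula with this lemma.\<close>

lemma Ck_on_cong_imp:
  assumes "open S" "\<And>x. x \<in> S \<Longrightarrow> f x = g x" "Ck_on k S f"
  shows "Ck_on k S g"
  using assms
proof (induction k arbitrary: f g)
  case 0 then show ?case using continuous_on_cong by fastforce
next
  case (Suc k)
  have "Ck_on k S (partial i g)" for i
  proof (rule Suc.IH)
    show "open S" by fact
    show "partial i f x = partial i g x" if "x \<in> S" for x
      by (rule partial_cong[OF Suc.prems(1) that]) (rule Suc.prems(2))
    show "Ck_on k S (partial i f)" using Suc.prems by simp
  qed
  moreover have "g differentiable (at x)" if "x \<in> S" for x
    by (rule differentiable_cong_open[OF Suc.prems(1) that Suc.prems(2)]) (use Suc.prems(3) that in auto)
  ultimately show ?case by simp
qed

lemma Ck_on_subset: "Ck_on k S f \<Longrightarrow> S' \<subseteq> S \<Longrightarrow> Ck_on k S' f"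
  by (induction k arbitrary: f) (auto intro: continuous_on_subset)

lemma Ck_on_Suc_imp: "Ck_on (Suc k) S f \<Longrightarrow> Ck_on k S f"
proof (induction k arbitrary: f)
  case 0 then show ?case
    by (auto simp: differentiable_imp_continuous_within intro!: continuous_at_imp_continuous_on)
next
  case (Suc k)
  then show ?case by (metis Ck_on.simps(2))
qed

lemma Ck_on_Un: "open S \<Longrightarrow> open S' \<Longrightarrow> Ck_on k S f \<Longrightarrow> Ck_on k S' f \<Longrightarrow> Ck_on k (S \<union> S') f"
  by (induction k arbitrary: f) (auto intro: continuous_on_open_Un)

lemma partial_const [simp]: "partial i (\<lambda>x. c) = (\<lambda>x. 0)"
  by (rule ext) (simp add: partial_eqI[OF has_derivative_const])

lemma Ck_on_const [simp]: "Ck_on k S (\<lambda>x. c)"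
  by (induction k arbitrary: c) auto

lemma partial_bounded_linear:
  assumes "bounded_linear L" "f differentiable (at x)"
  shows "partial i (\<lambda>x. L (f x)) x = L (partial i f x)"
proof -
  have "((\<lambda>x. L (f x)) has_derivative (\<lambda>v. L (frechet_derivative f (at x) v))) (at x)"
    by (rule bounded_linear.has_derivative[OF assms(1)]) (use assms(2) frechet_derivative_works in blast)
  then show ?thesis unfolding partial_def by (subst frechet_derivative_at[symmetric]) auto
qed

lemma differentiable_bounded_linear:
  "bounded_linear L \<Longrightarrow> f differentiable (at x) \<Longrightarrow> (\<lambda>x. L (f x)) differentiable (at x)"
  unfolding differentiable_def using bounded_linear.has_derivative[of L f _ "at x"] by blast

lemma Ck_on_bounded_linear:
  assumes "open S" "bounded_linear L" "Ck_on k S f"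
  shows "Ck_on k S (\<lambda>x. L (f x))"
  using assms(3)
proof (induction k arbitrary: f)
  case 0 then show ?case using assms by (simp add: bounded_linear.continuous_on)
next
  case (Suc k)
  have "Ck_on k S (partial i (\<lambda>x. L (f x)))" for i
    by (rule Ck_on_cong_imp[OF assms(1) _ Suc.IH[of "partial i f"]])
       (use Suc.prems assms in \<open>auto simp: partial_bounded_linear\<close>)
  then show ?case using Suc.prems assms by (auto intro: differentiable_bounded_linear)
qed

lemma partial_add:
  assumes "f differentiable (at x)" "g differentiable (at x)"
  shows "partial i (\<lambda>x. f x + g x) x = partial i f x + partial i g x"
proof -
  have "((\<lambda>x. f x + g x) has_derivative
     (\<lambda>v. frechet_derivative f (at x) v + frechet_derivative g (at x) v)) (at x)"
    by (intro has_derivative_add; use assms frechet_derivative_works in blast)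
  then show ?thesis unfolding partial_def by (subst frechet_derivative_at[symmetric]) auto
qed

lemma Ck_on_add:
  assumes "open S" "Ck_on k S f" "Ck_on k S g"
  shows "Ck_on k S (\<lambda>x. f x + g x)"
  using assms(2,3)
proof (induction k arbitrary: f g)
  case 0 then show ?case by (simp add: continuous_on_add)
next
  case (Suc k)
  have "Ck_on k S (partial i (\<lambda>x. f x + g x))" for i
    by (rule Ck_on_cong_imp[OF assms(1) _ Suc.IH[of "partial i f" "partial i g"]])
       (use Suc.prems assms in \<open>auto simp: partial_add\<close>)
  then show ?case using Suc.prems by auto
qed

lemma partial_bilinear:
  assumes "bounded_bilinear pr" "f differentiable (at x)" "g differentiable (at x)"
  shows "partial i (\<lambda>x. pr (f x) (g x)) x = pr (partial i f x) (g x) + pr (f x) (partial i g x)"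
proof -
  have "((\<lambda>x. pr (f x) (g x)) has_derivative
     (\<lambda>v. pr (f x) (frechet_derivative g (at x) v) + pr (frechet_derivative f (at x) v) (g x))) (at x)"
    by (rule bounded_bilinear.FDERIV[OF assms(1)]; use assms frechet_derivative_works in blast)
  then show ?thesis unfolding partial_def by (subst frechet_derivative_at[symmetric]) (auto simp: add.commute)
qed

text \<open>A general bounded bilinear product covers real products, complex products and scalar
  multiples at once.\<close>

lemma Ck_on_bilinear:
  assumes "open S" "bounded_bilinear pr" "Ck_on k S f" "Ck_on k S g"
  shows "Ck_on k S (\<lambda>x. pr (f x) (g x))"
  using assms(3,4)
proof (induction k arbitrary: f g)
  case 0 then show ?case using assms(2) by (simp add: bounded_bilinear.continuous_on)
next
  case (Suc k)
  have "(\<lambda>x. pr (f x) (g x)) differentiable (at x)" if "x \<in> S" for x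
    using Suc.prems that bounded_bilinear.FDERIV[OF assms(2), of f _ x UNIV g]
    unfolding differentiable_def Ck_on.simps by blast
  moreover have "Ck_on k S (partial i (\<lambda>x. pr (f x) (g x)))" for i
    by (rule Ck_on_cong_imp[OF assms(1) _ Ck_on_add[OF assms(1)
          Suc.IH[of "partial i f" g] Suc.IH[of f "partial i g"]]])
       (use Suc.prems assms in \<open>auto simp: partial_bilinear intro: Ck_on_Suc_imp[of k S, simplified]\<close>)
  ultimately show ?case by auto
qed

lemmas Ck_on_mult = Ck_on_bilinear[OF _ bounded_bilinear_mult]
lemmas partial_mult = partial_bilinear[OF bounded_bilinear_mult]
lemmas partial_scaleR = partial_bilinear[OF bounded_bilinear_scaleR]

lemma Ck_on_sum:
  "open S \<Longrightarrow> (\<And>i. i \<in> I \<Longrightarrow> Ck_on k S (f i)) \<Longrightarrow> Ck_on k S (\<lambda>x. \<Sum>i\<in>I. f i x)"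
  by (induction I rule: infinite_finite_induct) (auto intro: Ck_on_add)

lemma partial_minus:
  "f differentiable (at x) \<Longrightarrow> partial i (\<lambda>x. - f x) x = - partial i f x"
  using partial_bounded_linear[OF bounded_linear_minus[OF bounded_linear_ident]] by blast

lemma partial_diff:
  assumes "f differentiable (at x)" "g differentiable (at x)"
  shows "partial i (\<lambda>x. f x - g x) x = partial i f x - partial i g x"
  using partial_add[OF assms(1), of "\<lambda>x. - g x"] assms by (simp add: partial_minus)

lemma partial_sum:
  assumes "\<And>j. j \<in> J \<Longrightarrow> f j differentiable (at x)"
  shows "partial i (\<lambda>x. \<Sum>j\<in>J. f j x) x = (\<Sum>j\<in>J. partial i (f j) x)"
  using assms
  by (induction J rule: infinite_finite_induct) (simp_all add: partial_add)

lemma has_derivative_nth: "((\<lambda>x::real^'n::finite. x $ j) has_derivative (\<lambda>v. v $ j)) (at x)"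
  by (rule bounded_linear_imp_has_derivative[OF bounded_linear_vec_nth])

lemma partial_nth: "partial i (\<lambda>x. x $ j) = (\<lambda>x. if i = j then 1 else 0)"
  by (rule ext) (auto simp: partial_eqI[OF has_derivative_nth] axis_def)

lemma Ck_on_nth [simp]: "Ck_on k S (\<lambda>x. x $ j)"
proof (cases k)
  case 0 then show ?thesis by (simp add: continuous_on_component)
next
  case (Suc m) then show ?thesis
    using has_derivative_nth unfolding Suc by (auto simp: partial_nth differentiable_def)
qed

lemma Ck_on_power: "open S \<Longrightarrow> Ck_on k S f \<Longrightarrow> Ck_on k S (\<lambda>x. (f x :: real) ^ m)"
  by (induction m) (auto intro: Ck_on_mult)


subsection \<open>Functions of one variable\<close>

text \<open>The derivative is quantified existentially, so that the closure rules can supply a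
  formula for it without identifying \<open>deriv\<close>.\<close>

primrec Dk_on :: "nat \<Rightarrow> real set \<Rightarrow> (real \<Rightarrow> real) \<Rightarrow> bool"
  where
    "Dk_on 0 U h \<longleftrightarrow> continuous_on U h"
  | "Dk_on (Suc k) U h \<longleftrightarrow> (\<exists>h'. (\<forall>x\<in>U. (h has_real_derivative h' x) (at x)) \<and> Dk_on k U h')"

lemma Dk_on_Suc_imp: "Dk_on (Suc k) U h \<Longrightarrow> Dk_on k U h"
proof (induction k arbitrary: h)
  case 0 then show ?case
    by (auto intro!: continuous_at_imp_continuous_on dest: DERIV_isCont)
next
  case (Suc k)
  then show ?case by (metis Dk_on.simps(2))
qed

lemma Dk_on_subset: "Dk_on k U h \<Longrightarrow> U' \<subseteq> U \<Longrightarrow> Dk_on k U' h"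
  by (induction k arbitrary: h) (auto intro: continuous_on_subset)

lemma Dk_on_const [simp]: "Dk_on k U (\<lambda>x. c)"
  by (induction k arbitrary: c) (auto intro!: exI[of _ "\<lambda>x. 0"])

lemma Dk_on_ident [simp]: "Dk_on k U (\<lambda>x. x)"
  by (cases k) (auto intro!: exI[of _ "\<lambda>x. 1"])

lemma Dk_on_add: "Dk_on k U f \<Longrightarrow> Dk_on k U g \<Longrightarrow> Dk_on k U (\<lambda>x. f x + g x)"
proof (induction k arbitrary: f g)
  case 0 then show ?case by (simp add: continuous_on_add)
next
  case (Suc k)
  then obtain f' g' where "\<forall>x\<in>U. (f has_real_derivative f' x) (at x)" "Dk_on k U f'"
     "\<forall>x\<in>U. (g has_real_derivative g' x) (at x)" "Dk_on k U g'" by auto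
  then show ?case by (auto intro!: exI[of _ "\<lambda>x. f' x + g' x"] Suc.IH derivative_intros)
qed

lemma Dk_on_mult: "Dk_on k U f \<Longrightarrow> Dk_on k U g \<Longrightarrow> Dk_on k U (\<lambda>x. f x * g x)"
proof (induction k arbitrary: f g)
  case 0 then show ?case by (simp add: continuous_on_mult)
next
  case (Suc k)
  then obtain f' g' where *: "\<forall>x\<in>U. (f has_real_derivative f' x) (at x)" "Dk_on k U f'"
     "\<forall>x\<in>U. (g has_real_derivative g' x) (at x)" "Dk_on k U g'" by auto
  have "Dk_on k U (\<lambda>x. f x * g' x + f' x * g x)"
    using Suc.IH[OF Dk_on_Suc_imp[OF Suc.prems(1)] *(4)] Suc.IH[OF *(2) Dk_on_Suc_imp[OF Suc.prems(2)]]
    by (rule Dk_on_add)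
  then show ?case using * by (auto intro!: exI[of _ "\<lambda>x. f x * g' x + f' x * g x"] derivative_eq_intros)
qed

lemma Dk_on_compose:
  "Dk_on k V f \<Longrightarrow> Dk_on k U g \<Longrightarrow> g ` U \<subseteq> V \<Longrightarrow> Dk_on k U (\<lambda>x. f (g x))"
proof (induction k arbitrary: f)
  case 0 then show ?case by (auto intro: continuous_on_compose2)
next
  case (Suc k)
  then obtain f' g' where *: "\<forall>x\<in>V. (f has_real_derivative f' x) (at x)" "Dk_on k V f'"
     "\<forall>x\<in>U. (g has_real_derivative g' x) (at x)" "Dk_on k U g'" by auto
  have "Dk_on k U (\<lambda>x. f' (g x) * g' x)"
    using Suc.IH[OF *(2) Dk_on_Suc_imp[OF Suc.prems(2)] Suc.prems(3)] *(4) by (rule Dk_on_mult)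
  moreover have "((\<lambda>x. f (g x)) has_real_derivative f' (g x) * g' x) (at x)" if "x \<in> U" for x
    using DERIV_chain2[OF bspec[OF *(1)] bspec[OF *(3) that]] Suc.prems(3) that by auto
  ultimately show ?case unfolding Dk_on.simps by (intro exI[of _ "\<lambda>x. f' (g x) * g' x"]) auto
qed

lemma Dk_on_inverse: "Dk_on k (- {0}) inverse"
proof (induction k)
  case 0 then show ?case by (auto intro!: continuous_intros)
next
  case (Suc k)
  have "Dk_on k (- {0}) (\<lambda>x. (-1) * (inverse x * inverse x))"
    by (intro Dk_on_mult Suc Dk_on_const)
  then show ?case
    by (auto intro!: exI[of _ "\<lambda>x. (-1) * (inverse x * inverse x)"] derivative_eq_intros simp: power2_eq_square)
qed

lemma Dk_on_exp [simp]: "Dk_on k U exp"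
  by (induction k) (auto intro!: continuous_intros exI[of _ exp] derivative_eq_intros)

lemma Dk_on_ln: "Dk_on k {0<..} ln"
proof (cases k)
  case 0 then show ?thesis by (auto intro!: continuous_intros)
next
  case (Suc m)
  have "Dk_on m {0<..} inverse" by (rule Dk_on_subset[OF Dk_on_inverse]) auto
  then show ?thesis unfolding Suc
    by (auto intro!: exI[of _ inverse] derivative_eq_intros simp: divide_inverse)
qed

lemma Dk_on_sin_cos: "Dk_on k U sin \<and> Dk_on k U cos"
proof (induction k)
  case 0 then show ?case by (auto intro!: continuous_intros)
next
  case (Suc k)
  have "Dk_on k U (\<lambda>x. (-1) * sin x)" using Suc by (intro Dk_on_mult) auto
  then show ?case unfolding Dk_on.simps using Suc
    by (intro conjI exI[of _ cos] exI[of _ "\<lambda>x. (-1) * sin x"]) (auto intro!: derivative_eq_intros)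
qed

lemma partial_compose:
  assumes "(h has_real_derivative h') (at (f x))" "f differentiable (at x)"
  shows "partial i (\<lambda>x. h (f x)) x = h' * partial i f x"
    and "(\<lambda>x. h (f x)) differentiable (at x)"
proof -
  have "((\<lambda>x. h (f x)) has_derivative (\<lambda>v. h' * frechet_derivative f (at x) v)) (at x)"
    using has_derivative_compose[of f "frechet_derivative f (at x)" x UNIV h "(*) h'"] assms
      frechet_derivative_works[of f "at x"]
    by (simp add: has_field_derivative_def)
  then show "partial i (\<lambda>x. h (f x)) x = h' * partial i f x" "(\<lambda>x. h (f x)) differentiable (at x)"
    unfolding partial_def by (subst frechet_derivative_at[symmetric], auto) (auto simp: differentiable_def)
qed

lemma Ck_on_compose:
  assumes "open S"
  shows "Dk_on k U h \<Longrightarrow> Ck_on k S f \<Longrightarrow> f ` S \<subseteq> U \<Longrightarrow> Ck_on k S (\<lambda>x. h (f x))"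
proof (induction k arbitrary: h)
  case 0 then show ?case by (auto intro: continuous_on_compose2)
next
  case (Suc k)
  then obtain h' where *: "\<forall>x\<in>U. (h has_real_derivative h' x) (at x)" "Dk_on k U h'" by auto
  have d: "(\<lambda>x. h (f x)) differentiable (at x)" "partial i (\<lambda>x. h (f x)) x = h' (f x) * partial i f x"
    if "x \<in> S" for x i
    using partial_compose[of h "h' (f x)" f x] * Suc.prems that by auto
  have "Ck_on k S (partial i (\<lambda>x. h (f x)))" for i
    by (rule Ck_on_cong_imp[OF assms _ Ck_on_mult[OF assms
          Suc.IH[OF *(2) Ck_on_Suc_imp[OF Suc.prems(2)] Suc.prems(3)], of "partial i f"]])
      (use Suc.prems d in auto)
  then show ?case using d by auto
qed

text \<open>The functions x^(-m) exp (-1/x) are closed under differentiation: the derivative of the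
  m-th is the (m+2)-nd minus m times the (m+1)-st. Hence the induction on k must keep m
  arbitrary.\<close>

lemma Dk_on_bump_aux: "Dk_on k UNIV (\<lambda>x::real. if x > 0 then inverse x ^ m * exp (- inverse x) else 0)"
proof (induction k arbitrary: m)
  have lim: "((\<lambda>x::real. inverse x ^ m * exp (- inverse x)) \<longlongrightarrow> 0) (at_right 0)" for m
  proof -
    have "((\<lambda>y::real. y ^ m / exp y) \<longlongrightarrow> 0) at_top" by (rule tendsto_power_div_exp_0)
    then have "((\<lambda>x::real. inverse x ^ m / exp (inverse x)) \<longlongrightarrow> 0) (at_right 0)"
      by (rule filterlim_compose[OF _ filterlim_inverse_at_top_right])
    then show ?thesis by (simp add: exp_minus divide_inverse)
  qed
  let ?f = "\<lambda>m (x::real). if x > 0 then inverse x ^ m * exp (- inverse x) else 0"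
  have lim0: "(?f m \<longlongrightarrow> 0) (at 0)" for m
    unfolding filterlim_at_split
  proof
    show "(?f m \<longlongrightarrow> 0) (at_left 0)"
      by (rule tendsto_eventually) (auto simp: eventually_at_left_field intro: exI[of _ "-1"])
    have "eventually (\<lambda>x. inverse x ^ m * exp (- inverse x) = ?f m x) (at_right (0::real))"
      unfolding eventually_at_right_field by (auto intro: exI[of _ 1])
    then show "(?f m \<longlongrightarrow> 0) (at_right 0)" using lim by (rule Lim_transform_eventually[rotated])
  qed
  have der: "(?f m has_real_derivative ?f (m+2) x + (- real m) * ?f (m+1) x) (at x)" for m x
  proof (cases "x = 0")
    case True
    \<comment> \<open>At the origin the difference quotient of the m-th function is the (m+1)-st
      function, so the limit already proved for all m gives derivative zero.\<close>
    have "((\<lambda>h. ?f m h / h) \<longlongrightarrow> 0) (at 0)"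
      by (rule Lim_transform_eventually[OF lim0[of "Suc m"]])
         (auto simp: eventually_at_filter divide_inverse intro!: always_eventually)
    then show ?thesis using True by (simp add: DERIV_def cong: if_cong)
  next
    case False
    show ?thesis
    proof (cases "x > 0")
      case True
      have "((\<lambda>x. inverse x ^ m * exp (- inverse x)) has_real_derivative ?f (m+2) x + (- real m) * ?f (m+1) x) (at x)"
        using True
        by (cases m) (auto intro!: derivative_eq_intros simp: power2_eq_square algebra_simps, metis One_nat_def power_eq_if)
      then show ?thesis
        by (rule has_field_derivative_transform_within_open[where S="{0<..}"]) (use True in auto)
    next
      case nx: False
      have "((\<lambda>x. 0) has_real_derivative ?f (m+2) x + (- real m) * ?f (m+1) x) (at x)"
        using nx by auto
      then show ?thesis
        by (rule has_field_derivative_transform_within_open[where S="{..<0}"]) (use nx False in auto)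
    qed
  qed
  { case 0 show ?case using der[of m] DERIV_isCont by (auto intro!: continuous_at_imp_continuous_on)
  next
    case (Suc k)
    have "Dk_on k UNIV (\<lambda>x. ?f (m+2) x + (- real m) * ?f (m+1) x)"
      by (intro Dk_on_add Dk_on_mult Suc Dk_on_const)
    then show ?case unfolding Dk_on.simps
      by (intro exI[of _ "\<lambda>x. ?f (m+2) x + (- real m) * ?f (m+1) x"] conjI ballI der)
  }
qed


section \<open>Smooth step and bump functions on the line\<close>

definition bump_aux :: "real \<Rightarrow> real"
  where "bump_aux x = (if x > 0 then exp (- inverse x) else 0)"

definition smooth_step :: "real \<Rightarrow> real"
  where "smooth_step x = bump_aux x / (bump_aux x + bump_aux (1 - x))"

definition smooth_bump :: "real \<Rightarrow> real"
  where "smooth_bump x = smooth_step (2 - x) * smooth_step (2 + x)"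

lemma Dk_on_bump_aux': "Dk_on k UNIV bump_aux"
  using Dk_on_bump_aux[of k 0] by (simp add: bump_aux_def[abs_def] cong: if_cong)

lemma bump_aux_sum_pos: "bump_aux x + bump_aux (1 - x) > 0"
  unfolding bump_aux_def by (auto intro: add_pos_pos)

lemma Dk_on_affine: "Dk_on k U (\<lambda>x. a + b * x)"
  by (intro Dk_on_add Dk_on_mult) auto

lemma Dk_on_smooth_step: "Dk_on k UNIV smooth_step"
proof -
  have a: "Dk_on k UNIV (\<lambda>x. bump_aux (1 - x))"
    using Dk_on_compose[OF Dk_on_bump_aux' Dk_on_affine[of k UNIV 1 "-1"]] by simp
  have "Dk_on k UNIV (\<lambda>x. bump_aux x + bump_aux (1 - x))"
    by (intro Dk_on_add a Dk_on_bump_aux')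
  then have "Dk_on k UNIV (\<lambda>x. inverse (bump_aux x + bump_aux (1 - x)))"
    by (rule Dk_on_compose[OF Dk_on_inverse]) (use bump_aux_sum_pos in \<open>auto simp: less_le\<close>)
  then have "Dk_on k UNIV (\<lambda>x. bump_aux x * inverse (bump_aux x + bump_aux (1 - x)))"
    by (intro Dk_on_mult Dk_on_bump_aux')
  then show ?thesis by (simp add: smooth_step_def[abs_def] divide_inverse)
qed

lemma smooth_step_eq_0 [simp]: "x \<le> 0 \<Longrightarrow> smooth_step x = 0"
  and smooth_step_eq_1 [simp]: "x \<ge> 1 \<Longrightarrow> smooth_step x = 1"
  by (auto simp: smooth_step_def bump_aux_def)

lemma smooth_step_bounds: "0 \<le> smooth_step x" "smooth_step x \<le> 1"
  using bump_aux_sum_pos[of x] by (auto simp: smooth_step_def bump_aux_def divide_le_eq)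

lemma Dk_on_smooth_bump: "Dk_on k UNIV smooth_bump"
  unfolding smooth_bump_def[abs_def]
  using Dk_on_compose[OF Dk_on_smooth_step Dk_on_affine[of k UNIV 2 "-1"]]
    Dk_on_compose[OF Dk_on_smooth_step Dk_on_affine[of k UNIV 2 1]]
  by (intro Dk_on_mult) auto

lemma smooth_bump_eq_0 [simp]: "\<bar>x\<bar> \<ge> 2 \<Longrightarrow> smooth_bump x = 0"
  and smooth_bump_eq_1 [simp]: "\<bar>x\<bar> \<le> 1 \<Longrightarrow> smooth_bump x = 1"
  by (auto simp: smooth_bump_def abs_if split: if_splits)

text \<open>For each k the definition of \<open>Dk_on\<close> may provide a different witness;
  uniqueness of derivatives identifies all of them with \<open>deriv f\<close>, so that one function
  serves for every k.\<close>

lemma Dk_on_derivs2: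
  assumes "\<And>k. Dk_on k UNIV f"
  obtains f' f'' where "\<And>x. (f has_real_derivative f' x) (at x)" "\<And>x. (f' has_real_derivative f'' x) (at x)"
    "\<And>k. Dk_on k UNIV f'" "\<And>k. Dk_on k UNIV f''"
proof -
  have deriv: "(g has_real_derivative deriv g x) (at x) \<and> Dk_on k UNIV (deriv g)"
    if g: "\<And>k. Dk_on k UNIV g" for g k x
  proof -
    obtain g' where g': "\<forall>x\<in>UNIV. (g has_real_derivative g' x) (at x)" "Dk_on k UNIV g'"
      using g[of "Suc k"] by auto
    then have "deriv g = g'" by (auto simp: fun_eq_iff intro!: DERIV_imp_deriv)
    with g' show ?thesis by auto
  qed
  show ?thesis
    by (rule that[of "deriv f" "deriv (deriv f)"]) (use deriv assms in \<open>blast+\<close>)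
qed

lemma bounded_of_eq_0_outside:
  fixes f :: "real \<Rightarrow> real"
  assumes "continuous_on UNIV f" "\<And>x. \<bar>x\<bar> > c \<Longrightarrow> f x = 0"
  obtains B where "B > 0" "\<And>x. \<bar>f x\<bar> \<le> B"
proof -
  have "bounded (f ` {-c..c})"
    by (intro compact_imp_bounded compact_continuous_image continuous_on_subset[OF assms(1)]) auto
  then obtain B where "B > 0" "\<And>x. x \<in> {-c..c} \<Longrightarrow> \<bar>f x\<bar> \<le> B"
    unfolding bounded_pos by auto
  moreover have "\<bar>f x\<bar> \<le> B" if "x \<notin> {-c..c}" for x
    using assms(2)[of x] that \<open>B > 0\<close> by (simp add: not_le) linarith
  ultimately show ?thesis using that by blast
qed

lemma DERIV_eq_0_open:
  assumes "(f has_real_derivative d) (at x)" "open S" "x \<in> S" "\<And>y. y \<in> S \<Longrightarrow> f y = c"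
  shows "d = 0"
proof -
  have "((\<lambda>_. c) has_real_derivative d) (at x)"
    by (rule has_field_derivative_transform_within_open[OF assms(1-3)]) (use assms(4) in auto)
  then show ?thesis using DERIV_unique DERIV_const by blast
qed


subsection \<open>Test functions\<close>

text \<open>Any compact set outside of which the function vanishes replaces the closed support. Such
  a set is easier to supply, and finite unions and dilations of such sets are easy to
  handle.\<close>

lemma test_functions_iff:
  "\<phi> \<in> test_functions D \<longleftrightarrow>
     (\<forall>k. Ck_on k UNIV \<phi>) \<and> (\<exists>K. compact K \<and> K \<subseteq> D \<and> (\<forall>x. x \<notin> K \<longrightarrow> \<phi> x = 0))"
proof
  assume "\<phi> \<in> test_functions D"
  then show "(\<forall>k. Ck_on k UNIV \<phi>) \<and> (\<exists>K. compact K \<and> K \<subseteq> D \<and> (\<forall>x. x \<notin> K \<longrightarrow> \<phi> x = 0))"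
    unfolding test_functions_def Ck_on_UNIV
    by (auto intro!: exI[of _ "closure {x. \<phi> x \<noteq> 0}"] dest: contra_subsetD[OF closure_subset])
next
  assume *: "(\<forall>k. Ck_on k UNIV \<phi>) \<and> (\<exists>K. compact K \<and> K \<subseteq> D \<and> (\<forall>x. x \<notin> K \<longrightarrow> \<phi> x = 0))"
  then obtain K where K: "compact K" "K \<subseteq> D" "\<forall>x. x \<notin> K \<longrightarrow> \<phi> x = 0" by auto
  have "closure {x. \<phi> x \<noteq> 0} \<subseteq> K"
    using K by (intro closure_minimal compact_imp_closed) auto
  with K * show "\<phi> \<in> test_functions D"
    unfolding test_functions_def Ck_on_UNIV
    by (auto simp: compact_eq_bounded_closed intro: bounded_subset)
qed

lemma test_functionsE:
  assumes "\<phi> \<in> test_functions D"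
  obtains K where "compact K" "K \<subseteq> D" "\<And>x. x \<notin> K \<Longrightarrow> \<phi> x = 0" "\<And>k. Ck_on k UNIV \<phi>"
  using assms unfolding test_functions_iff by auto

text \<open>D and the complement of K are open and cover the space, and the function is smooth on
  each of them. No regularity at the boundary of D has to be checked, which is what admits functions
  built from the ground state.\<close>

lemma test_functionsI:
  assumes "open D" "\<And>k. Ck_on k D \<phi>" "compact K" "K \<subseteq> D" "\<And>x. x \<notin> K \<Longrightarrow> \<phi> x = 0"
  shows "\<phi> \<in> test_functions D"
proof -
  have o: "open (- K)" using assms(3) compact_imp_closed by blast
  have "Ck_on k UNIV \<phi>" for k
  proof -
    have "Ck_on k (- K) \<phi>" by (rule Ck_on_cong_imp[OF o, of "\<lambda>x. 0"]) (use assms in auto)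
    then have "Ck_on k (D \<union> - K) \<phi>" using assms o by (intro Ck_on_Un) auto
    moreover have "D \<union> - K = UNIV" using assms by auto
    ultimately show ?thesis by simp
  qed
  then show ?thesis using assms unfolding test_functions_iff by auto
qed

lemma test_functions_mono: "D \<subseteq> D' \<Longrightarrow> \<phi> \<in> test_functions D \<Longrightarrow> \<phi> \<in> test_functions D'"
  unfolding test_functions_iff by blast

lemma test_functions_Ck: "\<phi> \<in> test_functions D \<Longrightarrow> Ck_on k S \<phi>"
  unfolding test_functions_iff using Ck_on_subset by blast

lemma test_functions_differentiable: "\<phi> \<in> test_functions D \<Longrightarrow> \<phi> differentiable (at x)"
  using test_functions_Ck[of \<phi> D "Suc 0" UNIV] by simp

lemma test_functions_zero: "\<phi> \<in> test_functions D \<Longrightarrow> x \<notin> D \<Longrightarrow> \<phi> x = 0"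
  unfolding test_functions_iff by blast

lemma test_functions_const_0 [simp]: "(\<lambda>x. 0) \<in> test_functions D"
  unfolding test_functions_iff by (auto intro!: exI[of _ "{}"])

lemma test_functions_partial:
  assumes "\<phi> \<in> test_functions D"
  shows "partial i \<phi> \<in> test_functions D"
proof -
  obtain K where K: "compact K" "K \<subseteq> D" "\<And>x. x \<notin> K \<Longrightarrow> \<phi> x = 0" "\<And>k. Ck_on k UNIV \<phi>"
    using test_functionsE[OF assms] by metis
  have "partial i \<phi> x = 0" if "x \<notin> K" for x
    using partial_cong[of "- K" x \<phi> "\<lambda>x. 0" i] K that compact_imp_closed[OF K(1)] by auto
  moreover have "Ck_on k UNIV (partial i \<phi>)" for k using K(4)[of "Suc k"] by simp
  ultimately show ?thesis using K(1,2) unfolding test_functions_iff by auto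
qed

text \<open>The factor f may be singular at the boundary of D, since the product vanishes off a
  compact subset of D.\<close>

lemma test_functions_bilinear:
  assumes "bounded_bilinear pr" "open D" "\<And>k. Ck_on k D f" "\<phi> \<in> test_functions D"
  shows "(\<lambda>x. pr (f x) (\<phi> x)) \<in> test_functions D"
proof -
  obtain K where K: "compact K" "K \<subseteq> D" "\<And>x. x \<notin> K \<Longrightarrow> \<phi> x = 0" "\<And>k. Ck_on k UNIV \<phi>"
    using test_functionsE[OF assms(4)] by metis
  have "Ck_on k D (\<lambda>x. pr (f x) (\<phi> x))" for k
    by (rule Ck_on_bilinear[OF assms(2,1,3) test_functions_Ck[OF assms(4)]])
  moreover have "pr (f x) (\<phi> x) = 0" if "x \<notin> K" for x
    using K(3)[OF that] by (simp add: bounded_bilinear.zero_right[OF assms(1)])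
  ultimately show ?thesis using test_functionsI[OF assms(2) _ K(1,2)] by blast
qed

lemma test_functions_bounded_linear:
  assumes "bounded_linear L" "\<phi> \<in> test_functions D"
  shows "(\<lambda>x. L (\<phi> x)) \<in> test_functions D"
proof -
  have "L 0 = 0" using assms(1) by (simp add: bounded_linear.linear linear_0)
  then show ?thesis
    using assms(2) Ck_on_bounded_linear[OF open_UNIV assms(1)] unfolding test_functions_iff by metis
qed

lemma test_functions_add:
  assumes "\<phi> \<in> test_functions D" "\<psi> \<in> test_functions D"
  shows "(\<lambda>x. \<phi> x + \<psi> x) \<in> test_functions D"
proof -
  obtain K where K: "compact K" "K \<subseteq> D" "\<And>x. x \<notin> K \<Longrightarrow> \<phi> x = 0" "\<And>k. Ck_on k UNIV \<phi>"
    using test_functionsE[OF assms(1)] by metis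
  obtain K' where K': "compact K'" "K' \<subseteq> D" "\<And>x. x \<notin> K' \<Longrightarrow> \<psi> x = 0" "\<And>k. Ck_on k UNIV \<psi>"
    using test_functionsE[OF assms(2)] by metis
  show ?thesis unfolding test_functions_iff
    by (intro conjI allI exI[of _ "K \<union> K'"] Ck_on_add) (use K K' in auto)
qed

lemmas test_functions_scaleR = test_functions_bilinear[OF bounded_bilinear_scaleR]
lemmas test_functions_mult = test_functions_bilinear[OF bounded_bilinear_mult]

lemma test_functions_cmult:
  fixes \<phi> :: "real ^ 'n::finite \<Rightarrow> 'b::real_normed_algebra"
  shows "\<phi> \<in> test_functions D \<Longrightarrow> (\<lambda>x. c * \<phi> x) \<in> test_functions D"
  by (rule test_functions_bounded_linear[OF bounded_linear_mult_right])

lemma test_functions_minus: "\<phi> \<in> test_functions D \<Longrightarrow> (\<lambda>x. - \<phi> x) \<in> test_functions D"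
  by (rule test_functions_bounded_linear[OF bounded_linear_minus[OF bounded_linear_ident]])

lemma test_functions_diff:
  "\<phi> \<in> test_functions D \<Longrightarrow> \<psi> \<in> test_functions D \<Longrightarrow> (\<lambda>x. \<phi> x - \<psi> x) \<in> test_functions D"
  using test_functions_add[of \<phi> D "\<lambda>x. - \<psi> x"] test_functions_minus by force

lemma test_functions_sum:
  "(\<And>i. i \<in> I \<Longrightarrow> \<phi> i \<in> test_functions D) \<Longrightarrow> (\<lambda>x. \<Sum>i\<in>I. \<phi> i x) \<in> test_functions D"
  by (induction I rule: infinite_finite_induct) (auto intro: test_functions_add)

lemma test_functions_laplacian: "\<phi> \<in> test_functions D \<Longrightarrow> laplacian \<phi> \<in> test_functions D"
  unfolding laplacian_def[abs_def] by (intro test_functions_sum test_functions_partial)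

lemma test_functions_continuous: "\<phi> \<in> test_functions D \<Longrightarrow> continuous_on S \<phi>"
  using test_functions_Ck[of \<phi> D 0 S] by simp

lemma test_functions_integrable:
  fixes \<phi> :: "real ^ 'n::finite \<Rightarrow> 'b::{banach, second_countable_topology}"
  assumes "\<phi> \<in> test_functions D"
  shows "integrable lborel \<phi>"
proof -
  obtain K where K: "compact K" "\<And>x. x \<notin> K \<Longrightarrow> \<phi> x = 0" using test_functionsE[OF assms] by metis
  have "integrable lborel (\<lambda>x. indicator K x *\<^sub>R \<phi> x)"
    using K(1) test_functions_continuous[OF assms] by (rule borel_integrable_compact)
  moreover have "(\<lambda>x. indicator K x *\<^sub>R \<phi> x) = \<phi>" using K(2) by (auto simp: indicator_def)
  ultimately show ?thesis by simp
qed

lemma test_functions_measurable: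
  "\<phi> \<in> test_functions D \<Longrightarrow> \<phi> \<in> borel_measurable borel"
  by (intro borel_measurable_continuous_onI test_functions_continuous)

lemma test_functions_bounded:
  assumes "\<phi> \<in> test_functions D"
  obtains B where "B > 0" "\<And>x. norm (\<phi> x) \<le> B"
proof -
  obtain K where K: "compact K" "\<And>x. x \<notin> K \<Longrightarrow> \<phi> x = 0" using test_functionsE[OF assms] by metis
  have "bounded (\<phi> ` K)"
    by (intro compact_imp_bounded compact_continuous_image test_functions_continuous[OF assms] K(1))
  then obtain B where "B > 0" "\<And>x. x \<in> K \<Longrightarrow> norm (\<phi> x) \<le> B" unfolding bounded_pos by auto
  then show ?thesis using K(2) that by (metis less_imp_le norm_zero)
qed

lemma has_vector_derivative_axis:
  assumes "\<phi> differentiable (at (x + t *\<^sub>R axis i 1))"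
  shows "((\<lambda>t. \<phi> (x + t *\<^sub>R axis i 1)) has_vector_derivative partial i \<phi> (x + t *\<^sub>R axis i 1)) (at t)"
proof -
  let ?F = "frechet_derivative \<phi> (at (x + t *\<^sub>R axis i 1))"
  have F: "(\<phi> has_derivative ?F) (at (x + t *\<^sub>R axis i 1))"
    using assms frechet_derivative_works by blast
  have "((\<lambda>t. \<phi> (x + t *\<^sub>R axis i 1)) has_derivative (\<lambda>s. ?F (s *\<^sub>R axis i 1))) (at t)"
    by (rule has_derivative_compose[where f="\<lambda>t. x + t *\<^sub>R axis i 1" and g=\<phi>, OF _ F])
       (auto intro!: derivative_eq_intros)
  moreover have "?F (s *\<^sub>R axis i 1) = s *\<^sub>R partial i \<phi> (x + t *\<^sub>R axis i 1)" for s
    unfolding partial_def using F by (simp add: has_derivative_linear linear_scale)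
  ultimately show ?thesis by (simp add: has_vector_derivative_def)
qed

lemma vector_derivative_quotient:
  assumes "(f has_vector_derivative d) (at (0::real))"
  shows "((\<lambda>t. (1 / t) *\<^sub>R (f t - f 0)) \<longlongrightarrow> d) (at 0)"
proof -
  have "((\<lambda>t. norm (f t - f 0 - t *\<^sub>R d) / norm t) \<longlongrightarrow> 0) (at 0)"
    using assms unfolding has_vector_derivative_def has_derivative_at by auto
  then have "((\<lambda>t. norm ((1 / t) *\<^sub>R (f t - f 0) - d)) \<longlongrightarrow> 0) (at 0)"
  proof (rule Lim_transform_eventually)
    have "norm (f t - f 0 - t *\<^sub>R d) / norm t = norm ((1 / t) *\<^sub>R (f t - f 0) - d)" if "t \<noteq> 0" for t
    proof -
      have "(1 / t) *\<^sub>R (f t - f 0) - d = (1 / t) *\<^sub>R (f t - f 0 - t *\<^sub>R d)"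
        using that by (simp add: scaleR_diff_right)
      then show ?thesis by (simp add: divide_inverse mult.commute)
    qed
    then show "\<forall>\<^sub>F t in at 0. norm (f t - f 0 - t *\<^sub>R d) / norm t = norm ((1 / t) *\<^sub>R (f t - f 0) - d)"
      by (auto simp: eventually_at_filter)
  qed
  then have "((\<lambda>t. (1 / t) *\<^sub>R (f t - f 0) - d) \<longlongrightarrow> 0) (at 0)" by (rule tendsto_norm_zero_cancel)
  then show ?thesis by (subst Lim_null)
qed

text \<open>The difference quotients have integral zero by translation invariance.\<close>

lemma integral_partial_test_function:
  fixes \<phi> :: "real ^ 'n::finite \<Rightarrow> 'b::euclidean_space"
  assumes "\<phi> \<in> test_functions D"
  shows "(\<integral>x. partial i \<phi> x \<partial>lborel) = 0"
proof -
  obtain B where B: "\<And>x. norm (partial i \<phi> x) \<le> B" "B > 0"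
    using test_functions_bounded[OF test_functions_partial[OF assms]] by metis
  obtain K where K: "compact K" "\<And>x. x \<notin> K \<Longrightarrow> \<phi> x = 0" using test_functionsE[OF assms] by metis
  obtain R where R: "\<And>x. x \<in> K \<Longrightarrow> norm x \<le> R" using compact_imp_bounded[OF K(1)] unfolding bounded_iff by auto
  define t where "t k = inverse (real (Suc k))" for k
  have t: "t k > 0" "t k \<le> 1" for k by (auto simp: t_def inverse_le_1_iff)
  have t0: "t \<longlonglongrightarrow> 0" unfolding t_def by (rule LIMSEQ_inverse_real_of_nat)
  let ?f = "\<lambda>k x. (1 / t k) *\<^sub>R (\<phi> (x + t k *\<^sub>R axis i 1) - \<phi> x)"
  have int: "integrable lborel \<phi>" by (rule test_functions_integrable[OF assms])
  have shift: "distr lborel borel (\<lambda>x. x + a) = lborel" for a :: "real^'n"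
    using lborel_distr_plus[of a] by (simp add: add.commute[of _ a])
  have int': "integrable lborel (\<lambda>x. \<phi> (x + a))" for a
    using int integrable_distr[of "\<lambda>x. x + a" lborel borel \<phi>] unfolding shift by simp
  have eq: "(\<integral>x. \<phi> (x + a) \<partial>lborel) = (\<integral>x. \<phi> x \<partial>lborel)" for a
    using integral_distr[of "\<lambda>x. x + a" lborel borel \<phi>] test_functions_measurable[OF assms] unfolding shift by simp
  have f0: "(\<integral>x. ?f k x \<partial>lborel) = 0" for k
    using int int' by (simp add: eq)
  \<comment> \<open>All shifts have length at most one, so every quotient lives in the ball of
    radius R + 1, and the mean value inequality bounds it by B.\<close>
  have "(\<lambda>k. \<integral>x. ?f k x \<partial>lborel) \<longlonglongrightarrow> (\<integral>x. partial i \<phi> x \<partial>lborel)"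
  proof (rule integral_dominated_convergence[where w="\<lambda>x. indicator (cball 0 (R + 1)) x *\<^sub>R B"])
    show "partial i \<phi> \<in> borel_measurable lborel"
      using test_functions_measurable[OF test_functions_partial[OF assms]] by simp
    show "?f k \<in> borel_measurable lborel" for k
      using borel_measurable_integrable[OF int'] borel_measurable_integrable[OF int] by measurable
    show "integrable lborel (\<lambda>x::real^'n. indicator (cball 0 (R + 1)) x *\<^sub>R B)"
      by (rule borel_integrable_compact) auto
    show "AE x in lborel. (\<lambda>k. ?f k x) \<longlonglongrightarrow> partial i \<phi> x"
    proof (rule AE_I2)
      fix x :: "real^'n"
      have "((\<lambda>t. \<phi> (x + t *\<^sub>R axis i 1)) has_vector_derivative partial i \<phi> x) (at 0)"
        using has_vector_derivative_axis[where x=x and t=0 and i=i, OF test_functions_differentiable[OF assms]] by simp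
      then have "((\<lambda>t. (1 / t) *\<^sub>R (\<phi> (x + t *\<^sub>R axis i 1) - \<phi> x)) \<longlongrightarrow> partial i \<phi> x) (at 0)"
        using vector_derivative_quotient by fastforce
      then show "(\<lambda>k. ?f k x) \<longlonglongrightarrow> partial i \<phi> x"
        by (rule filterlim_compose) (use t t0 in \<open>auto simp: filterlim_at less_le\<close>)
    qed
    show "AE x in lborel. norm (?f k x) \<le> indicator (cball 0 (R + 1)) x *\<^sub>R B" for k
    proof (rule AE_I2)
      fix x :: "real^'n"
      have "norm (\<phi> (x + t k *\<^sub>R axis i 1) - \<phi> (x + 0 *\<^sub>R axis i 1)) \<le> B * norm (t k - 0)"
        by (rule differentiable_bound[where S=UNIV and f'="\<lambda>t s. s *\<^sub>R partial i \<phi> (x + t *\<^sub>R axis i 1)"])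
          (use B(1) has_vector_derivative_axis[OF test_functions_differentiable[OF assms]] in
            \<open>auto simp: has_vector_derivative_def mult.commute[of B] intro!: onorm_le mult_left_mono\<close>)
      then have 1: "norm (?f k x) \<le> B" using t[of k] unfolding norm_scaleR by (simp add: field_simps)
      show "norm (?f k x) \<le> indicator (cball 0 (R + 1)) x *\<^sub>R B"
      proof (cases "x \<in> cball 0 (R + 1)")
        case False
        have "norm x \<le> norm (x + t k *\<^sub>R axis i 1) + norm (t k *\<^sub>R axis i (1::real))"
          by (metis norm_triangle_ineq4 add_diff_cancel)
        then have "norm (x + t k *\<^sub>R axis i 1) > R" using False t[of k] by auto
        then have "\<phi> (x + t k *\<^sub>R axis i 1) = 0" "\<phi> x = 0" using K(2) R False by fastforce+
        then show ?thesis using False by simp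
      qed (use 1 in auto)
    qed
  qed
  then show ?thesis unfolding f0 using LIMSEQ_unique tendsto_const by metis
qed


subsection \<open>Semi-inner products\<close>

text \<open>Only semidefinite, because functions stand for classes modulo null sets. There are two
  uses: the inner product of \<open>L2 M\<close>, and the energy form of an operator on its test
  space.\<close>

locale semi_inner =
  fixes T :: "('a \<Rightarrow> complex) set" and B :: "('a \<Rightarrow> complex) \<Rightarrow> ('a \<Rightarrow> complex) \<Rightarrow> complex"
  assumes zero_T: "(\<lambda>x. 0) \<in> T"
    and lin_T: "\<And>f g c. f \<in> T \<Longrightarrow> g \<in> T \<Longrightarrow> (\<lambda>x. f x + c * g x) \<in> T"
    and lin_left: "\<And>f g k c. f \<in> T \<Longrightarrow> g \<in> T \<Longrightarrow> k \<in> T \<Longrightarrow> B (\<lambda>x. f x + c * g x) k = B f k + c * B g k"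
    and herm: "\<And>f g. f \<in> T \<Longrightarrow> g \<in> T \<Longrightarrow> B g f = cnj (B f g)"
    and nonneg: "\<And>f. f \<in> T \<Longrightarrow> 0 \<le> Re (B f f)"
begin

lemma diff_T: "f \<in> T \<Longrightarrow> g \<in> T \<Longrightarrow> (\<lambda>x. f x - g x) \<in> T"
  using lin_T[of f g "-1"] by simp

lemma diag_real: "f \<in> T \<Longrightarrow> B f f = of_real (Re (B f f))"
  using herm[of f f] by (simp add: complex_eq_iff)

lemma lin_right:
  assumes "f \<in> T" "g \<in> T" "k \<in> T"
  shows "B k (\<lambda>x. f x + c * g x) = B k f + cnj c * B k g"
  using assms lin_left[of f g k c] herm[of _ k] lin_T[of f g c] by simp

lemma diff_left: "f \<in> T \<Longrightarrow> g \<in> T \<Longrightarrow> k \<in> T \<Longrightarrow> B (\<lambda>x. f x - g x) k = B f k - B g k"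
  using lin_left[of f g k "-1"] by simp

lemma diff_right: "f \<in> T \<Longrightarrow> g \<in> T \<Longrightarrow> k \<in> T \<Longrightarrow> B k (\<lambda>x. f x - g x) = B k f - B k g"
  using lin_right[of f g k "-1"] by simp

lemma expand:
  assumes "f \<in> T" "g \<in> T"
  shows "Re (B (\<lambda>x. f x + c * g x) (\<lambda>x. f x + c * g x)) =
    Re (B f f) + 2 * Re (c * B g f) + (cmod c)\<^sup>2 * Re (B g g)"
proof -
  have "B (\<lambda>x. f x + c * g x) (\<lambda>x. f x + c * g x) = B f f + cnj c * cnj (B g f) + c * B g f + (c * cnj c) * B g g"
    using assms lin_T[of f g c] by (simp add: lin_left lin_right herm[of g f] algebra_simps)
  moreover have "c * cnj c = of_real ((cmod c)\<^sup>2)" using complex_norm_square[of c] by simp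
  ultimately show ?thesis by simp
qed

lemma Cauchy_Schwarz:
  assumes "f \<in> T" "g \<in> T"
  shows "cmod (B f g) \<le> sqrt (Re (B f f)) * sqrt (Re (B g g))"
proof -
  let ?p = "Re (B f f)" and ?q = "Re (B g g)" and ?b = "cmod (B g f)"
  have nn: "0 \<le> ?p" "0 \<le> ?q" using assms nonneg by auto
  \<comment> \<open>A real multiple of \<open>cnj (B g f)\<close> as coefficient makes the cross
    term real and equal to -2 s times the square of \<open>?b\<close>.\<close>
  have ineq: "0 \<le> ?p - 2 * s * ?b\<^sup>2 + s\<^sup>2 * ?b\<^sup>2 * ?q" for s :: real
  proof -
    have "0 \<le> Re (B (\<lambda>x. f x + (- of_real s * cnj (B g f)) * g x) (\<lambda>x. f x + (- of_real s * cnj (B g f)) * g x))"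
      by (intro nonneg lin_T assms)
    moreover have "Re (cnj (B g f) * B g f) = ?b\<^sup>2" by (simp add: cmod_power2) (simp add: power2_eq_square)
    ultimately show ?thesis
      using expand[OF assms, of "- of_real s * cnj (B g f)"]
      by (simp add: norm_mult power_mult_distrib cmod_power2 power2_eq_square algebra_simps)
  qed
  have "?b\<^sup>2 \<le> ?p * ?q"
  proof (cases "?q = 0")
    case True
    have "?b = 0"
    proof (rule ccontr)
      assume "?b \<noteq> 0"
      \<comment> \<open>With \<open>?q\<close> zero the inequality is affine in s; this s makes the
        linear term equal to \<open>?p\<close> + 1 and so violates it.\<close>
      then have "2 * ((?p + 1) / (2 * ?b\<^sup>2)) * ?b\<^sup>2 = ?p + 1" by simp
      then show False using ineq[of "(?p + 1) / (2 * ?b\<^sup>2)"] True by simp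
    qed
    then show ?thesis using True by simp
  next
    case False
    then have "?q > 0" using nn by simp
    then show ?thesis using ineq[of "1 / ?q"] by (simp add: field_simps power2_eq_square)
  qed
  then have "?b \<le> sqrt (?p * ?q)" by (rule real_le_rsqrt)
  then show ?thesis using herm[OF assms(2,1)] assms by (simp add: real_sqrt_mult)
qed

lemma triangle:
  assumes "f \<in> T" "g \<in> T"
  shows "sqrt (Re (B (\<lambda>x. f x + g x) (\<lambda>x. f x + g x))) \<le> sqrt (Re (B f f)) + sqrt (Re (B g g))"
proof -
  have "Re (B (\<lambda>x. f x + g x) (\<lambda>x. f x + g x)) = Re (B f f) + 2 * Re (B g f) + Re (B g g)"
    using expand[OF assms, of 1] by simp
  also have "\<dots> \<le> Re (B f f) + 2 * (sqrt (Re (B f f)) * sqrt (Re (B g g))) + Re (B g g)"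
    using Cauchy_Schwarz[OF assms(2,1)] complex_Re_le_cmod[of "B g f"] by (simp add: mult.commute)
  also have "\<dots> = (sqrt (Re (B f f)) + sqrt (Re (B g g)))\<^sup>2"
    using nonneg assms by (simp add: power2_eq_square algebra_simps)
  finally show ?thesis
    using nonneg assms by (intro real_le_lsqrt) (auto intro: add_nonneg_nonneg)
qed

lemma triangle_diff:
  assumes "f \<in> T" "g \<in> T" "k \<in> T"
  shows "sqrt (Re (B (\<lambda>x. f x - k x) (\<lambda>x. f x - k x))) \<le>
    sqrt (Re (B (\<lambda>x. f x - g x) (\<lambda>x. f x - g x))) + sqrt (Re (B (\<lambda>x. g x - k x) (\<lambda>x. g x - k x)))"
  using triangle[OF diff_T[OF assms(1,2)] diff_T[OF assms(2,3)]] by simp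

lemma diff_commute:
  assumes "f \<in> T" "g \<in> T"
  shows "B (\<lambda>x. f x - g x) (\<lambda>x. f x - g x) = B (\<lambda>x. g x - f x) (\<lambda>x. g x - f x)"
  using assms by (simp add: diff_left diff_right diff_T)

lemma seminorm_diff:
  assumes "f \<in> T" "g \<in> T"
  shows "\<bar>sqrt (Re (B f f)) - sqrt (Re (B g g))\<bar> \<le> sqrt (Re (B (\<lambda>x. f x - g x) (\<lambda>x. f x - g x)))"
  using triangle[OF diff_T[OF assms] assms(2)] triangle[OF diff_T[OF assms(2,1)] assms(1)]
    diff_commute[OF assms] by simp

text \<open>The seminorm is Lipschitz with respect to itself, so the norms converge even when the
  sequence has no limit in T. This gives a meaning to the energy of an element of the
  completion.\<close>

lemma Cauchy_diag_convergent:
  assumes "\<And>k. \<Phi> k \<in> T"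
    and "\<forall>\<epsilon>>0. \<exists>N. \<forall>k\<ge>N. \<forall>l\<ge>N. sqrt (Re (B (\<lambda>x. \<Phi> k x - \<Phi> l x) (\<lambda>x. \<Phi> k x - \<Phi> l x))) < \<epsilon>"
  shows "convergent (\<lambda>k. Re (B (\<Phi> k) (\<Phi> k)))"
proof -
  have "Cauchy (\<lambda>k. sqrt (Re (B (\<Phi> k) (\<Phi> k))))"
    unfolding Cauchy_def dist_real_def
    using assms(2) order_le_less_trans[OF seminorm_diff[OF assms(1) assms(1)]] by meson
  then have "convergent (\<lambda>k. (sqrt (Re (B (\<Phi> k) (\<Phi> k))))\<^sup>2)"
    using real_Cauchy_convergent convergent_def tendsto_power by metis
  then show ?thesis using assms nonneg by simp
qed

end


subsection \<open>The complex L2 space\<close>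

lemma L2_integrable: "f \<in> L2 M \<Longrightarrow> integrable M (\<lambda>x. (cmod (f x))\<^sup>2)"
  by (auto simp: L2_def)

lemma L2_mult_integrable:
  assumes "f \<in> L2 M" "g \<in> L2 M"
  shows "integrable M (\<lambda>x. f x * cnj (g x))"
proof (rule Bochner_Integration.integrable_bound)
  show "integrable M (\<lambda>x. (cmod (f x))\<^sup>2 + (cmod (g x))\<^sup>2)"
    using assms by (auto simp: L2_def)
  have [measurable]: "f \<in> borel_measurable M" "g \<in> borel_measurable M" using assms by (auto simp: L2_def)
  have "cnj \<in> borel_measurable borel" by (intro borel_measurable_continuous_onI continuous_intros)
  then show "(\<lambda>x. f x * cnj (g x)) \<in> borel_measurable M" by measurable
  have "cmod (f x * cnj (g x)) \<le> (cmod (f x))\<^sup>2 + (cmod (g x))\<^sup>2" for x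
  proof -
    have "0 \<le> (cmod (f x) - cmod (g x))\<^sup>2" "0 \<le> cmod (f x) * cmod (g x)" by auto
    then have "cmod (f x) * cmod (g x) \<le> (cmod (f x))\<^sup>2 + (cmod (g x))\<^sup>2"
      unfolding power2_diff by linarith
    then show ?thesis by (simp add: norm_mult)
  qed
  then show "AE x in M. cmod (f x * cnj (g x)) \<le> norm ((cmod (f x))\<^sup>2 + (cmod (g x))\<^sup>2)"
    by simp
qed

lemma cmod_add_sq: "(cmod (a + b))\<^sup>2 \<le> 2 * (cmod a)\<^sup>2 + 2 * (cmod b)\<^sup>2"
proof -
  have "(cmod (a + b))\<^sup>2 \<le> (cmod a + cmod b)\<^sup>2" by (intro power_mono norm_triangle_ineq) auto
  also have "\<dots> \<le> 2 * (cmod a)\<^sup>2 + 2 * (cmod b)\<^sup>2"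
    using sum_squares_bound[of "cmod a" "cmod b"] by (simp add: power2_eq_square algebra_simps)
  finally show ?thesis .
qed

lemma L2_lin:
  assumes "f \<in> L2 M" "g \<in> L2 M"
  shows "(\<lambda>x. f x + c * g x) \<in> L2 M"
  unfolding L2_def
proof (intro CollectI conjI)
  have [measurable]: "f \<in> borel_measurable M" "g \<in> borel_measurable M" using assms by (auto simp: L2_def)
  show "(\<lambda>x. f x + c * g x) \<in> borel_measurable M" by measurable
  have "integrable M (\<lambda>x. 2 * (cmod (f x))\<^sup>2 + 2 * ((cmod c)\<^sup>2 * (cmod (g x))\<^sup>2))"
    using assms by (auto simp: L2_def)
  then show "integrable M (\<lambda>x. (cmod (f x + c * g x))\<^sup>2)"
    by (rule Bochner_Integration.integrable_bound)
       (use cmod_add_sq[of "f _" "c * g _"] in \<open>auto simp: norm_mult power_mult_distrib\<close>)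
qed

lemma L2_inner_self: "L2_inner M f f = of_real (LINT x|M. (cmod (f x))\<^sup>2)"
  unfolding L2_inner_def by (simp add: complex_norm_square[symmetric] flip: integral_complex_of_real)

lemma L2_norm_eq: "L2_norm M f = sqrt (Re (L2_inner M f f))"
  by (simp add: L2_inner_self L2_norm_def)

interpretation L2: semi_inner "L2 M" "L2_inner M" for M
proof
  show "(\<lambda>x. 0) \<in> L2 M" by (auto simp: L2_def)
  fix f g k :: "'a \<Rightarrow> complex" and c
  assume f: "f \<in> L2 M" and g: "g \<in> L2 M"
  show "(\<lambda>x. f x + c * g x) \<in> L2 M" by (rule L2_lin[OF f g])
  show "L2_inner M g f = cnj (L2_inner M f g)"
    unfolding L2_inner_def Bochner_Integration.integral_cnj[symmetric]
    by (simp add: mult.commute del: Bochner_Integration.integral_cnj)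
  show "0 \<le> Re (L2_inner M f f)" by (simp add: L2_inner_self)
  assume k: "k \<in> L2 M"
  show "L2_inner M (\<lambda>x. f x + c * g x) k = L2_inner M f k + c * L2_inner M g k"
    using L2_mult_integrable[OF f k] L2_mult_integrable[OF g k]
    unfolding L2_inner_def by (simp add: distrib_right mult.assoc)
qed

lemma L2_norm_nonneg [simp]: "0 \<le> L2_norm M f"
  by (simp add: L2_norm_def)

lemma L2_inner_self_norm: "L2_inner M f f = of_real ((L2_norm M f)\<^sup>2)"
  by (simp add: L2_inner_self L2_norm_def)

lemma L2_norm_sq: "(L2_norm M f)\<^sup>2 = (LINT x|M. (cmod (f x))\<^sup>2)"
  by (simp add: L2_norm_def)

lemma L2_Cauchy_Schwarz: "f \<in> L2 M \<Longrightarrow> g \<in> L2 M \<Longrightarrow> cmod (L2_inner M f g) \<le> L2_norm M f * L2_norm M g"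
  using L2.Cauchy_Schwarz by (simp add: L2_norm_eq)

lemma L2_norm_triangle: "f \<in> L2 M \<Longrightarrow> g \<in> L2 M \<Longrightarrow> L2_norm M (\<lambda>x. f x + g x) \<le> L2_norm M f + L2_norm M g"
  using L2.triangle by (simp add: L2_norm_eq)

lemma L2_norm_triangle_diff:
  "f \<in> L2 M \<Longrightarrow> g \<in> L2 M \<Longrightarrow> k \<in> L2 M \<Longrightarrow>
   L2_norm M (\<lambda>x. f x - k x) \<le> L2_norm M (\<lambda>x. f x - g x) + L2_norm M (\<lambda>x. g x - k x)"
  using L2.triangle_diff by (simp add: L2_norm_eq)

lemma L2_norm_diff_commute: "L2_norm M (\<lambda>x. f x - g x) = L2_norm M (\<lambda>x. g x - f x)"
  by (simp add: L2_norm_def norm_minus_commute)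

lemma L2_norm_cmult: "L2_norm M (\<lambda>x. c * f x) = cmod c * L2_norm M f"
  by (simp add: L2_norm_def norm_mult power_mult_distrib real_sqrt_mult)

lemma L2_norm_cong_AE:
  assumes "AE x in M. f x = g x" "f \<in> borel_measurable M" "g \<in> borel_measurable M"
  shows "L2_norm M f = L2_norm M g"
proof -
  have "(LINT x|M. (cmod (f x))\<^sup>2) = (LINT x|M. (cmod (g x))\<^sup>2)"
    by (rule integral_cong_AE) (use assms in auto)
  then show ?thesis by (simp add: L2_norm_def)
qed

lemma L2_norm_eq_0_AE:
  assumes "f \<in> L2 M" "L2_norm M f = 0"
  shows "AE x in M. f x = 0"
proof -
  have "(LINT x|M. (cmod (f x))\<^sup>2) = 0" using assms(2) by (simp add: L2_norm_def)
  then have "AE x in M. (cmod (f x))\<^sup>2 = 0"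
    using integral_nonneg_eq_0_iff_AE[OF L2_integrable[OF assms(1)]] by auto
  then show ?thesis by auto
qed

lemma L2_inner_tendsto_right:
  assumes "f \<in> L2 M" "\<And>k. \<Phi> k \<in> L2 M" "u \<in> L2 M" "(\<lambda>k. L2_norm M (\<lambda>x. \<Phi> k x - u x)) \<longlonglongrightarrow> 0"
  shows "(\<lambda>k. L2_inner M f (\<Phi> k)) \<longlonglongrightarrow> L2_inner M f u"
proof -
  have "(\<lambda>k. L2_inner M f (\<Phi> k) - L2_inner M f u) \<longlonglongrightarrow> 0"
  proof (rule Lim_null_comparison)
    show "\<forall>\<^sub>F k in sequentially. norm (L2_inner M f (\<Phi> k) - L2_inner M f u) \<le>
        L2_norm M f * L2_norm M (\<lambda>x. \<Phi> k x - u x)"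
      using L2_Cauchy_Schwarz[OF assms(1) L2.diff_T[OF assms(2,3)]] assms by (simp add: L2.diff_right)
    show "(\<lambda>k. L2_norm M f * L2_norm M (\<lambda>x. \<Phi> k x - u x)) \<longlonglongrightarrow> 0"
      using tendsto_mult_right_zero[OF assms(4)] by simp
  qed
  then show ?thesis by (simp add: Lim_null[symmetric])
qed

lemma L2_inner_tendsto_left:
  assumes "f \<in> L2 M" "\<And>k. \<Phi> k \<in> L2 M" "u \<in> L2 M" "(\<lambda>k. L2_norm M (\<lambda>x. \<Phi> k x - u x)) \<longlonglongrightarrow> 0"
  shows "(\<lambda>k. L2_inner M (\<Phi> k) f) \<longlonglongrightarrow> L2_inner M u f"
  using tendsto_cnj[OF L2_inner_tendsto_right[OF assms]] L2.herm[OF assms(1)] assms by simp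

lemma L2_norm_tendsto:
  assumes "\<And>k. \<Phi> k \<in> L2 M" "u \<in> L2 M" "(\<lambda>k. L2_norm M (\<lambda>x. \<Phi> k x - u x)) \<longlonglongrightarrow> 0"
  shows "(\<lambda>k. L2_norm M (\<Phi> k)) \<longlonglongrightarrow> L2_norm M u"
proof -
  have "(\<lambda>k. L2_norm M (\<Phi> k) - L2_norm M u) \<longlonglongrightarrow> 0"
    using L2.seminorm_diff[OF assms(1,2)]
    by (intro Lim_null_comparison[OF _ assms(3)]) (simp add: L2_norm_eq)
  then show ?thesis by (simp add: Lim_null[symmetric])
qed

text \<open>By Cauchy-Schwarz, multiplication by such a function turns an L2 Cauchy sequence into an
  L1 Cauchy sequence, although the measure may be infinite. It is the square root of a positive
  integrable function.\<close>

lemma (in sigma_finite_measure) L2_weight: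
  obtains \<rho> :: "'a \<Rightarrow> real" where "\<rho> \<in> borel_measurable M" "\<And>x. x \<in> space M \<Longrightarrow> \<rho> x > 0" "integrable M (\<lambda>x. (\<rho> x)\<^sup>2)"
proof -
  obtain h where h: "h \<in> borel_measurable M" "integral\<^sup>N M h \<noteq> \<infinity>" "\<forall>x\<in>space M. 0 < h x \<and> h x < \<infinity>"
    using Ex_finite_integrable_function by auto
  have "integrable M (\<lambda>x. enn2real (h x))"
  proof (rule integrableI_bounded)
    have "(\<integral>\<^sup>+x. ennreal (norm (enn2real (h x))) \<partial>M) = integral\<^sup>N M h"
      by (rule nn_integral_cong) (use h(3) in auto)
    then show "(\<integral>\<^sup>+x. ennreal (norm (enn2real (h x))) \<partial>M) < \<infinity>" using h(2) by (simp add: less_top)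
  qed (use h(1) in measurable)
  then show ?thesis using h
    by (intro that[of "\<lambda>x. sqrt (enn2real (h x))"]) (auto simp: enn2real_positive_iff)
qed

text \<open>The weighted sequence is Cauchy in L1, hence has a subsequence converging almost
  everywhere; the weight is positive and can be divided out. Fatou's lemma then turns the Cauchy
  estimate into convergence in norm of the whole sequence.\<close>

lemma (in sigma_finite_measure) L2_complete:
  assumes F: "\<And>k. F k \<in> L2 M"
    and C: "\<forall>\<epsilon>>0. \<exists>N. \<forall>k\<ge>N. \<forall>l\<ge>N. L2_norm M (\<lambda>x. F k x - F l x) < \<epsilon>"
  obtains u where "u \<in> L2 M" "(\<lambda>k. L2_norm M (\<lambda>x. F k x - u x)) \<longlonglongrightarrow> 0"
proof -
  have [measurable]: "F k \<in> borel_measurable M" for k using F by (auto simp: L2_def)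
  obtain \<rho> :: "'a \<Rightarrow> real" where \<rho>[measurable]: "\<rho> \<in> borel_measurable M" "\<And>x. x \<in> space M \<Longrightarrow> \<rho> x > 0"
    "integrable M (\<lambda>x. (\<rho> x)\<^sup>2)" using L2_weight by blast
  have \<rho>2: "(\<lambda>x. of_real (\<rho> x)) \<in> L2 M" using \<rho> by (auto simp: L2_def)
  let ?s = "\<lambda>k x. F k x * cnj (of_real (\<rho> x))"
  have int: "integrable M (?s k)" for k by (rule L2_mult_integrable[OF F \<rho>2])
  have *: "(LINT x|M. norm (?s k x - ?s l x)) \<le> L2_norm M (\<lambda>x. F k x - F l x) * L2_norm M (\<lambda>x. of_real (\<rho> x))" for k l
  proof -
    let ?d = "\<lambda>x. complex_of_real (cmod (F k x - F l x))"
    have d: "?d \<in> L2 M" using L2.diff_T[OF F[of k] F[of l]] by (auto simp: L2_def)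
    have "(LINT x|M. norm (?s k x - ?s l x)) = (LINT x|M. cmod (F k x - F l x) * \<rho> x)"
      by (intro Bochner_Integration.integral_cong) (auto simp: left_diff_distrib[symmetric] norm_mult \<rho>(2) less_imp_le)
    also have "\<dots> = Re (L2_inner M ?d (\<lambda>x. of_real (\<rho> x)))"
      unfolding L2_inner_def by (simp flip: of_real_mult)
    also have "\<dots> \<le> L2_norm M ?d * L2_norm M (\<lambda>x. of_real (\<rho> x))"
      using L2_Cauchy_Schwarz[OF d \<rho>2] complex_Re_le_cmod order_trans by blast
    finally show ?thesis by (simp add: L2_norm_def)
  qed
  have L1: "\<exists>N. \<forall>i\<ge>N. \<forall>j\<ge>N. (LINT x|M. norm (?s i x - ?s j x)) < e" if "e > 0" for e
  proof -
    let ?r = "L2_norm M (\<lambda>x. of_real (\<rho> x))"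
    have "e / (?r + 1) > 0" using that by (intro divide_pos_pos add_nonneg_pos) auto
    then obtain N where N: "\<forall>k\<ge>N. \<forall>l\<ge>N. L2_norm M (\<lambda>x. F k x - F l x) < e / (?r + 1)" using C by meson
    have "(LINT x|M. norm (?s i x - ?s j x)) < e" if "i \<ge> N" "j \<ge> N" for i j
    proof -
      have "(LINT x|M. norm (?s i x - ?s j x)) \<le> L2_norm M (\<lambda>x. F i x - F j x) * ?r" by (rule *)
      also have "\<dots> \<le> L2_norm M (\<lambda>x. F i x - F j x) * (?r + 1)" by (intro mult_left_mono) auto
      also have "\<dots> < e / (?r + 1) * (?r + 1)" using N that by (intro mult_strict_right_mono add_nonneg_pos) auto
      also have "\<dots> = e" using L2_norm_nonneg[of M "\<lambda>x. of_real (\<rho> x)"]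
        by (metis add.commute add_nonneg_pos less_irrefl nonzero_eq_divide_eq zero_less_one)
      finally show ?thesis .
    qed
    then show ?thesis by blast
  qed
  obtain r where r: "strict_mono r" "AE x in M. Cauchy (\<lambda>i. ?s (r i) x)"
    by (rule cauchy_L1_AE_cauchy_subseq[of M ?s, OF int L1])
  define u where "u x = lim (\<lambda>i. F (r i) x)" for x
  have [measurable]: "u \<in> borel_measurable M" unfolding u_def by measurable
  have lim: "AE x in M. (\<lambda>i. F (r i) x) \<longlonglongrightarrow> u x"
    using r(2) AE_space
  proof eventually_elim
    fix x assume c: "Cauchy (\<lambda>i. ?s (r i) x)" and x: "x \<in> space M"
    from c obtain l where "(\<lambda>i. ?s (r i) x) \<longlonglongrightarrow> l" using Cauchy_convergent convergent_def by blast
    then have "(\<lambda>i. ?s (r i) x / of_real (\<rho> x)) \<longlonglongrightarrow> l / of_real (\<rho> x)" by (intro tendsto_intros) (use \<rho>(2)[OF x] in auto)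
    then have "(\<lambda>i. F (r i) x) \<longlonglongrightarrow> l / of_real (\<rho> x)" using \<rho>(2)[OF x] by simp
    then show "(\<lambda>i. F (r i) x) \<longlonglongrightarrow> u x" unfolding u_def by (metis limI)
  qed
  have norm_sq: "(\<integral>\<^sup>+x. ennreal ((cmod (F k x - F l x))\<^sup>2) \<partial>M) = ennreal ((L2_norm M (\<lambda>x. F k x - F l x))\<^sup>2)" for k l
    unfolding L2_norm_sq using L2_integrable[OF L2.diff_T[OF F[of k] F[of l]]]
    by (intro nn_integral_eq_integral) auto
  \<comment> \<open>The Cauchy estimate with k fixed, passed to the limit in the second index along
    the subsequence r.\<close>
  have fatou: "(\<integral>\<^sup>+x. ennreal ((cmod (F k x - u x))\<^sup>2) \<partial>M) \<le> ennreal (e\<^sup>2)"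
    if e: "e > 0" "\<And>l. l \<ge> N \<Longrightarrow> L2_norm M (\<lambda>x. F k x - F l x) < e" for k N e
  proof -
    have "(\<integral>\<^sup>+x. ennreal ((cmod (F k x - u x))\<^sup>2) \<partial>M) =
      (\<integral>\<^sup>+x. liminf (\<lambda>i. ennreal ((cmod (F k x - F (r i) x))\<^sup>2)) \<partial>M)"
    proof (rule nn_integral_cong_AE)
      show "AE x in M. ennreal ((cmod (F k x - u x))\<^sup>2) = liminf (\<lambda>i. ennreal ((cmod (F k x - F (r i) x))\<^sup>2))"
        using lim
      proof eventually_elim
        fix x assume "(\<lambda>i. F (r i) x) \<longlonglongrightarrow> u x"
        then have "(\<lambda>i. ennreal ((cmod (F k x - F (r i) x))\<^sup>2)) \<longlonglongrightarrow> ennreal ((cmod (F k x - u x))\<^sup>2)"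
          by (intro tendsto_intros)
        then show "ennreal ((cmod (F k x - u x))\<^sup>2) = liminf (\<lambda>i. ennreal ((cmod (F k x - F (r i) x))\<^sup>2))"
          using lim_imp_Liminf[OF sequentially_bot] by metis
      qed
    qed
    also have "\<dots> \<le> liminf (\<lambda>i. \<integral>\<^sup>+x. ennreal ((cmod (F k x - F (r i) x))\<^sup>2) \<partial>M)"
      by (rule nn_integral_liminf) measurable
    also have "\<dots> \<le> liminf (\<lambda>i::nat. ennreal (e\<^sup>2))"
    proof (rule Liminf_mono, unfold norm_sq, rule eventually_sequentiallyI[of N])
      fix i assume "N \<le> i"
      then have "N \<le> r i" using seq_suble[OF r(1)] order_trans by blast
      then show "ennreal ((L2_norm M (\<lambda>x. F k x - F (r i) x))\<^sup>2) \<le> ennreal (e\<^sup>2)"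
        using e(2)[of "r i"] by (intro ennreal_leI power_mono) auto
    qed
    finally show ?thesis by (simp add: Liminf_const)
  qed
  have diff: "(\<lambda>x. F k x - u x) \<in> L2 M" if "e > 0" "\<And>l. l \<ge> N \<Longrightarrow> L2_norm M (\<lambda>x. F k x - F l x) < e" for k N e
    unfolding L2_def
  proof (intro CollectI conjI integrableI_bounded)
    show "(\<integral>\<^sup>+x. ennreal (norm ((cmod (F k x - u x))\<^sup>2)) \<partial>M) < \<infinity>"
      using order_le_less_trans[OF fatou[of e N k, OF that] ennreal_less_top] by simp
  qed measurable
  obtain N where N: "\<forall>k\<ge>N. \<forall>l\<ge>N. L2_norm M (\<lambda>x. F k x - F l x) < 1" using C zero_less_one by meson
  have "(\<lambda>x. F N x - u x) \<in> L2 M" by (rule diff[of 1 N N]) (use N in auto)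
  from L2.diff_T[OF F[of N] this] have u: "u \<in> L2 M" by simp
  show ?thesis
  proof (rule that[OF u], rule LIMSEQ_I)
    fix e :: real assume e: "e > 0"
    then have e2: "e / 2 > 0" by simp
    then obtain N where N: "\<forall>k\<ge>N. \<forall>l\<ge>N. L2_norm M (\<lambda>x. F k x - F l x) < e / 2" using C by meson
    have "L2_norm M (\<lambda>x. F k x - u x) < e" if k: "k \<ge> N" for k
    proof -
      have "ennreal ((L2_norm M (\<lambda>x. F k x - u x))\<^sup>2) = (\<integral>\<^sup>+x. ennreal ((cmod (F k x - u x))\<^sup>2) \<partial>M)"
        unfolding L2_norm_sq using L2_integrable[OF L2.diff_T[OF F[of k] u]]
        by (intro nn_integral_eq_integral[symmetric]) auto
      also have "\<dots> \<le> ennreal ((e / 2)\<^sup>2)" by (rule fatou[OF e2]) (use N k in auto)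
      finally have "(L2_norm M (\<lambda>x. F k x - u x))\<^sup>2 \<le> (e / 2)\<^sup>2" by (simp add: ennreal_le_iff)
      then have "L2_norm M (\<lambda>x. F k x - u x) \<le> e / 2" using e2 by (simp add: power2_le_iff_abs_le)
      then show ?thesis using e by simp
    qed
    then show "\<exists>N. \<forall>k\<ge>N. norm (L2_norm M (\<lambda>x. F k x - u x) - 0) < e" by auto
  qed
qed


subsection \<open>The Friedrichs extension of a form bounded below by one\<close>

text \<open>The bound \<open>form_ge\<close> makes energy Cauchy sequences converge in
  \<open>L2 M\<close> and places the numerical range in [1, infinity). In the application it is the
  Hardy inequality for the weight W.\<close>

locale form_operator = sigma_finite_measure M + semi_inner T "\<lambda>f g. L2_inner M (A f) g"
  for M :: "'a measure" and T and A +
  assumes T_L2: "f \<in> T \<Longrightarrow> f \<in> L2 M"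
    and A_L2: "f \<in> T \<Longrightarrow> A f \<in> L2 M"
    and form_ge: "f \<in> T \<Longrightarrow> (L2_norm M f)\<^sup>2 \<le> Re (L2_inner M (A f) f)"
begin

abbreviation "q f \<equiv> Re (L2_inner M (A f) f)"
abbreviation "F \<equiv> friedrichs M T A"

text \<open>The square root, absent from \<open>form_domain\<close>, makes the Cauchy condition one
  about a seminorm, to which the triangle inequality applies.\<close>

definition form_limit :: "('a \<Rightarrow> complex) \<Rightarrow> (nat \<Rightarrow> 'a \<Rightarrow> complex) \<Rightarrow> bool"
  where "form_limit u \<Phi> \<longleftrightarrow> (\<forall>k. \<Phi> k \<in> T) \<and> (\<lambda>k. L2_norm M (\<lambda>x. \<Phi> k x - u x)) \<longlonglongrightarrow> 0 \<and>
       (\<forall>\<epsilon>>0. \<exists>N. \<forall>k\<ge>N. \<forall>l\<ge>N. sqrt (q (\<lambda>x. \<Phi> k x - \<Phi> l x)) < \<epsilon>)"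

lemma form_domain_iff: "u \<in> form_domain M T A \<longleftrightarrow> u \<in> L2 M \<and> (\<exists>\<Phi>. form_limit u \<Phi>)"
proof -
  have "(\<forall>\<epsilon>>0. \<exists>N. \<forall>k\<ge>N. \<forall>l\<ge>N. q (\<lambda>x. \<Phi> k x - \<Phi> l x) < \<epsilon>) \<longleftrightarrow>
        (\<forall>\<epsilon>>0. \<exists>N. \<forall>k\<ge>N. \<forall>l\<ge>N. sqrt (q (\<lambda>x. \<Phi> k x - \<Phi> l x)) < \<epsilon>)" (is "?L = ?R") for \<Phi> :: "nat \<Rightarrow> 'a \<Rightarrow> complex"
  proof
    assume L: ?L
    show ?R
    proof (intro allI impI)
      fix \<epsilon> :: real assume "\<epsilon> > 0"
      then have "\<epsilon>\<^sup>2 > 0" by simp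
      then obtain N where "\<forall>k\<ge>N. \<forall>l\<ge>N. q (\<lambda>x. \<Phi> k x - \<Phi> l x) < \<epsilon>\<^sup>2" using L by meson
      then have "\<forall>k\<ge>N. \<forall>l\<ge>N. sqrt (q (\<lambda>x. \<Phi> k x - \<Phi> l x)) < \<epsilon>"
        using \<open>\<epsilon> > 0\<close> by (metis real_sqrt_less_iff real_sqrt_unique less_imp_le)
      then show "\<exists>N. \<forall>k\<ge>N. \<forall>l\<ge>N. sqrt (q (\<lambda>x. \<Phi> k x - \<Phi> l x)) < \<epsilon>" by blast
    qed
  next
    assume R: ?R
    show ?L
    proof (intro allI impI)
      fix \<epsilon> :: real assume "\<epsilon> > 0"
      then have "sqrt \<epsilon> > 0" by simp
      then obtain N where "\<forall>k\<ge>N. \<forall>l\<ge>N. sqrt (q (\<lambda>x. \<Phi> k x - \<Phi> l x)) < sqrt \<epsilon>" using R by meson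
      then show "\<exists>N. \<forall>k\<ge>N. \<forall>l\<ge>N. q (\<lambda>x. \<Phi> k x - \<Phi> l x) < \<epsilon>" by auto
    qed
  qed
  then show ?thesis unfolding form_domain_def form_limit_def by auto
qed

lemma friedrichs_iff:
  "(u, g) \<in> F \<longleftrightarrow> u \<in> L2 M \<and> g \<in> L2 M \<and> (\<exists>\<Phi>. form_limit u \<Phi>) \<and>
     (\<forall>\<phi>\<in>T. L2_inner M (A \<phi>) u = L2_inner M \<phi> g)"
  unfolding friedrichs_def by (auto simp: form_domain_iff)

text \<open>Needed to apply the resolvent estimate to the difference of two solutions, the
  contraction step in \<open>solvable_step\<close>.\<close>

lemma friedrichs_diff:
  assumes "(u, g) \<in> F" "(u', g') \<in> F"
  shows "((\<lambda>x. u x - u' x), (\<lambda>x. g x - g' x)) \<in> F"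
proof -
  obtain \<Phi> \<Psi> where \<Phi>: "form_limit u \<Phi>" and \<Psi>: "form_limit u' \<Psi>" using assms unfolding friedrichs_iff by auto
  have L: "u \<in> L2 M" "u' \<in> L2 M" "g \<in> L2 M" "g' \<in> L2 M" using assms unfolding friedrichs_iff by auto
  have T: "\<Phi> k \<in> T" "\<Psi> k \<in> T" for k using \<Phi> \<Psi> unfolding form_limit_def by auto
  have "form_limit (\<lambda>x. u x - u' x) (\<lambda>k x. \<Phi> k x - \<Psi> k x)"
    unfolding form_limit_def
  proof (intro conjI allI impI)
    show "(\<lambda>x. \<Phi> k x - \<Psi> k x) \<in> T" for k using T by (intro diff_T)
    show "(\<lambda>k. L2_norm M (\<lambda>x. \<Phi> k x - \<Psi> k x - (u x - u' x))) \<longlonglongrightarrow> 0"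
    proof (rule Lim_null_comparison)
      have "L2_norm M (\<lambda>x. (\<Phi> k x - u x) + (u' x - \<Psi> k x)) \<le>
          L2_norm M (\<lambda>x. \<Phi> k x - u x) + L2_norm M (\<lambda>x. u' x - \<Psi> k x)" for k
        using T L T_L2 by (intro L2_norm_triangle L2.diff_T) auto
      then show "\<forall>\<^sub>F k in sequentially. norm (L2_norm M (\<lambda>x. \<Phi> k x - \<Psi> k x - (u x - u' x))) \<le>
          L2_norm M (\<lambda>x. \<Phi> k x - u x) + L2_norm M (\<lambda>x. \<Psi> k x - u' x)"
        by (simp add: algebra_simps L2_norm_diff_commute[of M u'])
      show "(\<lambda>k. L2_norm M (\<lambda>x. \<Phi> k x - u x) + L2_norm M (\<lambda>x. \<Psi> k x - u' x)) \<longlonglongrightarrow> 0"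
        using tendsto_add[OF \<Phi>[unfolded form_limit_def, THEN conjunct2, THEN conjunct1]
          \<Psi>[unfolded form_limit_def, THEN conjunct2, THEN conjunct1]] by simp
    qed
    fix \<epsilon> :: real assume "\<epsilon> > 0"
    then have e: "\<epsilon> / 2 > 0" by simp
    obtain N where N: "\<forall>k\<ge>N. \<forall>l\<ge>N. sqrt (q (\<lambda>x. \<Phi> k x - \<Phi> l x)) < \<epsilon> / 2"
      using \<Phi> e unfolding form_limit_def by meson
    obtain N' where N': "\<forall>k\<ge>N'. \<forall>l\<ge>N'. sqrt (q (\<lambda>x. \<Psi> k x - \<Psi> l x)) < \<epsilon> / 2"
      using \<Psi> e unfolding form_limit_def by meson
    have "sqrt (q (\<lambda>x. \<Phi> k x - \<Psi> k x - (\<Phi> l x - \<Psi> l x))) < \<epsilon>" if "k \<ge> max N N'" "l \<ge> max N N'" for k l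
    proof -
      have "sqrt (q (\<lambda>x. (\<Phi> k x - \<Phi> l x) + (\<Psi> l x - \<Psi> k x))) \<le>
          sqrt (q (\<lambda>x. \<Phi> k x - \<Phi> l x)) + sqrt (q (\<lambda>x. \<Psi> l x - \<Psi> k x))"
        using T by (intro triangle diff_T)
      also have "\<dots> < \<epsilon>" using N[rule_format, of k l] N'[rule_format, of l k] that by simp
      finally show ?thesis by (simp add: algebra_simps)
    qed
    then show "\<exists>N. \<forall>k\<ge>N. \<forall>l\<ge>N. sqrt (q (\<lambda>x. \<Phi> k x - \<Psi> k x - (\<Phi> l x - \<Psi> l x))) < \<epsilon>" by blast
  qed
  moreover have "L2_inner M (A \<phi>) (\<lambda>x. u x - u' x) = L2_inner M \<phi> (\<lambda>x. g x - g' x)" if "\<phi> \<in> T" for \<phi>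
    using assms that L A_L2 T_L2 unfolding friedrichs_iff by (simp add: L2.diff_right)
  ultimately show ?thesis using L unfolding friedrichs_iff by (auto intro: L2.diff_T)
qed

text \<open>E is the limit of the energies of an approximating sequence. By the weak equation the
  inner product of the k-th member with g equals that of \<open>A (\<Phi> k)\<close> with u, and the
  latter differs from the energy of \<open>\<Phi> k\<close> by a null sequence. In particular the
  inner product of u and g is real.\<close>

lemma friedrichs_energy:
  assumes "(u, g) \<in> F"
  obtains E where "(L2_norm M u)\<^sup>2 \<le> E" "L2_inner M u g = of_real E"
proof -
  have L: "u \<in> L2 M" "g \<in> L2 M" using assms unfolding friedrichs_iff by auto
  obtain \<Phi> where \<Phi>: "form_limit u \<Phi>" using assms unfolding friedrichs_iff by auto
  have T: "\<Phi> k \<in> T" for k using \<Phi> unfolding form_limit_def by auto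
  have lim: "(\<lambda>k. L2_norm M (\<lambda>x. \<Phi> k x - u x)) \<longlonglongrightarrow> 0"
    and C: "\<forall>\<epsilon>>0. \<exists>N. \<forall>k\<ge>N. \<forall>l\<ge>N. sqrt (q (\<lambda>x. \<Phi> k x - \<Phi> l x)) < \<epsilon>"
    using \<Phi> unfolding form_limit_def by auto
  obtain E where E: "(\<lambda>k. q (\<Phi> k)) \<longlonglongrightarrow> E"
    using Cauchy_diag_convergent[OF T C] convergent_def by blast
  have le: "(L2_norm M u)\<^sup>2 \<le> E"
    by (rule LIMSEQ_le[OF tendsto_power[OF L2_norm_tendsto[OF T_L2[OF T] L(1) lim]] E])
       (use form_ge[OF T] in auto)
  have "Bseq (\<lambda>k. sqrt (q (\<Phi> k)))" using E tendsto_real_sqrt convergent_imp_Bseq convergentI by blast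
  then obtain K where K: "K > 0" "\<And>k. norm (sqrt (q (\<Phi> k))) \<le> K" unfolding Bseq_def by auto
  have lim_r: "(\<lambda>l. L2_inner M (A (\<Phi> k)) (\<Phi> l)) \<longlonglongrightarrow> L2_inner M (A (\<Phi> k)) u" for k
    by (rule L2_inner_tendsto_right[OF A_L2[OF T] T_L2[OF T] L(1) lim])
  have "(\<lambda>k. L2_inner M (A (\<Phi> k)) u - of_real (q (\<Phi> k))) \<longlonglongrightarrow> 0"
  proof (rule LIMSEQ_I)
    fix \<epsilon> :: real assume "\<epsilon> > 0"
    then have "\<epsilon> / (2 * K) > 0" using K by simp
    then obtain N where N: "\<forall>k\<ge>N. \<forall>l\<ge>N. sqrt (q (\<lambda>x. \<Phi> k x - \<Phi> l x)) < \<epsilon> / (2 * K)" using C by meson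
    \<comment> \<open>With k fixed let l tend to infinity. Cauchy-Schwarz for the form bounds the
      difference by K times the energy distance of the k-th and l-th members.\<close>
    have "norm (L2_inner M (A (\<Phi> k)) u - of_real (q (\<Phi> k))) \<le> \<epsilon> / 2" if k: "k \<ge> N" for k
    proof (rule Lim_norm_ubound)
      show "(\<lambda>l. L2_inner M (A (\<Phi> k)) (\<Phi> l) - of_real (q (\<Phi> k))) \<longlonglongrightarrow> L2_inner M (A (\<Phi> k)) u - of_real (q (\<Phi> k))"
        by (intro tendsto_intros lim_r)
      have "norm (L2_inner M (A (\<Phi> k)) (\<Phi> l) - of_real (q (\<Phi> k))) \<le> \<epsilon> / 2" if l: "l \<ge> N" for l
      proof -
        have "L2_inner M (A (\<Phi> k)) (\<Phi> l) - of_real (q (\<Phi> k)) = L2_inner M (A (\<Phi> k)) (\<lambda>x. \<Phi> l x - \<Phi> k x)"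
          using T by (subst diag_real[symmetric]) (auto simp: diff_right)
        also have "norm \<dots> \<le> sqrt (q (\<Phi> k)) * sqrt (q (\<lambda>x. \<Phi> l x - \<Phi> k x))"
          using T by (intro Cauchy_Schwarz diff_T)
        also have "\<dots> \<le> K * (\<epsilon> / (2 * K))"
          using N k l K(2)[of k] K(1) nonneg[OF T] nonneg[OF diff_T[OF T T]]
          by (intro mult_mono) (auto intro: less_imp_le)
        also have "\<dots> = \<epsilon> / 2" using K by simp
        finally show ?thesis .
      qed
      then show "\<forall>\<^sub>F l in sequentially. norm (L2_inner M (A (\<Phi> k)) (\<Phi> l) - of_real (q (\<Phi> k))) \<le> \<epsilon> / 2"
        by (rule eventually_sequentiallyI)
    qed simp
    then show "\<exists>N. \<forall>k\<ge>N. norm (L2_inner M (A (\<Phi> k)) u - of_real (q (\<Phi> k)) - 0) < \<epsilon>"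
      using \<open>\<epsilon> > 0\<close> by (intro exI[of _ N]) fastforce
  qed
  then have "(\<lambda>k. (L2_inner M (A (\<Phi> k)) u - of_real (q (\<Phi> k))) + of_real (q (\<Phi> k))) \<longlonglongrightarrow> 0 + of_real E"
    by (intro tendsto_intros E)
  then have "(\<lambda>k. L2_inner M (\<Phi> k) g) \<longlonglongrightarrow> of_real E"
    using assms T unfolding friedrichs_iff by simp
  moreover have "(\<lambda>k. L2_inner M (\<Phi> k) g) \<longlonglongrightarrow> L2_inner M u g"
    by (rule L2_inner_tendsto_left[OF L(2) T_L2[OF T] L(1) lim])
  ultimately have "L2_inner M u g = of_real E" using LIMSEQ_unique by blast
  with le show ?thesis using that by blast
qed

abbreviation "ray \<equiv> complex_of_real ` {1..}"

lemma closed_ray: "closed ray"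
proof -
  have "ray = {z. Im z = 0 \<and> Re z \<ge> 1}"
    by (auto simp: image_iff complex_eq_iff)
  also have "closed \<dots>"
    by (intro closed_Collect_conj closed_Collect_eq closed_Collect_le continuous_intros)
  finally show ?thesis .
qed

lemma ray_ne: "ray \<noteq> {}" by auto

lemma infdist_ray_pos: "z \<notin> ray \<Longrightarrow> infdist z ray > 0"
  using in_closed_iff_infdist_zero[OF closed_ray ray_ne] infdist_nonneg[of z ray] by (metis less_eq_real_def)

text \<open>The inner product of u and g divided by the squared norm of u is a point of
  \<open>ray\<close>. Hence the inner product of u with g - z u has modulus at least the squared
  norm of u times the distance from z to \<open>ray\<close>, and Cauchy-Schwarz removes one
  norm.\<close>

lemma friedrichs_bound:
  assumes "(u, g) \<in> F"
  shows "infdist z ray * L2_norm M u \<le> L2_norm M (\<lambda>x. g x - z * u x)"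
proof (cases "L2_norm M u = 0")
  case False
  then have pos: "L2_norm M u > 0" using L2_norm_nonneg[of M u] by linarith
  let ?s = "(L2_norm M u)\<^sup>2"
  have L: "u \<in> L2 M" "g \<in> L2 M" using assms unfolding friedrichs_iff by auto
  obtain E where E: "?s \<le> E" "L2_inner M u g = of_real E" using friedrichs_energy[OF assms] .
  have x: "complex_of_real (E / ?s) \<in> ray" using E(1) pos by (intro imageI) (auto simp: le_divide_eq)
  have "L2_inner M u (\<lambda>x. g x - z * u x) = of_real E - cnj z * of_real ?s"
    using L2.lin_right[OF L(2) L(1) L(1), of "- z"] E(2) L2_inner_self_norm[of M u] by simp
  also have "\<dots> = of_real ?s * cnj (of_real (E / ?s) - z)"
    using pos by (simp add: field_simps)
  finally have "cmod (L2_inner M u (\<lambda>x. g x - z * u x)) = ?s * dist z (of_real (E / ?s))"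
    by (simp only: norm_mult complex_mod_cnj norm_of_real dist_norm norm_minus_commute) simp
  moreover have "\<dots> \<ge> ?s * infdist z ray"
    by (intro mult_left_mono infdist_le x) simp
  moreover have "cmod (L2_inner M u (\<lambda>x. g x - z * u x)) \<le> L2_norm M u * L2_norm M (\<lambda>x. g x - z * u x)"
    using L2_Cauchy_Schwarz[OF L(1) L2_lin[OF L(2,1), of "- z"]] by simp
  ultimately have "L2_norm M u * (infdist z ray * L2_norm M u) \<le> L2_norm M u * L2_norm M (\<lambda>x. g x - z * u x)"
    by (simp add: power2_eq_square mult_ac)
  then show ?thesis using pos by simp
qed simp

definition solvable :: "complex \<Rightarrow> bool"
  where "solvable z \<longleftrightarrow> (\<forall>f\<in>L2 M. \<exists>(u, g)\<in>F. AE x in M. g x - z * u x = f x)"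

text \<open>The solution minimizes \<open>q \<phi> - 2 Re \<langle>\<phi>, f\<rangle>\<close>.\<close>

lemma solvable_0: "solvable 0"
  unfolding solvable_def
proof
  fix f assume f: "f \<in> L2 M"
  define J where "J \<phi> = q \<phi> - 2 * Re (L2_inner M \<phi> f)" for \<phi>
  have J_lin: "J (\<lambda>x. \<phi> x + c * \<psi> x) = J \<phi> + 2 * Re (c * (L2_inner M (A \<psi>) \<phi> - L2_inner M \<psi> f)) + (cmod c)\<^sup>2 * q \<psi>"
    if "\<phi> \<in> T" "\<psi> \<in> T" for \<phi> \<psi> c
    unfolding J_def using that expand[OF that, of c] L2.lin_left[OF T_L2[OF that(1)] T_L2[OF that(2)] f, of c]
    by (simp add: right_diff_distrib)
  have J_ge: "J \<phi> \<ge> - (L2_norm M f)\<^sup>2" if "\<phi> \<in> T" for \<phi>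
  proof -
    have "Re (L2_inner M \<phi> f) \<le> L2_norm M \<phi> * L2_norm M f"
      using L2_Cauchy_Schwarz[OF T_L2[OF that] f] complex_Re_le_cmod order_trans by blast
    moreover have "0 \<le> (L2_norm M \<phi> - L2_norm M f)\<^sup>2" by simp
    ultimately show ?thesis unfolding J_def using form_ge[OF that] by (simp add: power2_diff)
  qed
  define m where "m = Inf (J ` T)"
  have bdd: "bdd_below (J ` T)" using J_ge by (intro bdd_belowI2)
  have m_le: "m \<le> J \<phi>" if "\<phi> \<in> T" for \<phi> unfolding m_def using that bdd by (intro cINF_lower)
  have "\<exists>\<phi>\<in>T. J \<phi> < m + inverse (real (Suc k))" for k
    using cINF_less_iff[of T J] bdd zero_T unfolding m_def
    by (metis empty_iff inverse_positive_iff_positive less_add_same_cancel1 of_nat_0_less_iff zero_less_Suc)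
  then obtain \<Phi> where T: "\<And>k. \<Phi> k \<in> T" and \<Phi>: "\<And>k. J (\<Phi> k) < m + inverse (real (Suc k))" by metis
  \<comment> \<open>Comparison with the midpoint of the two functions, where J is at least m.
    Together with the parallelogram identity this shows that near-minimizers are close in energy, so
    that a minimizing sequence is Cauchy.\<close>
  have q_le: "q (\<lambda>x. \<phi> x - \<psi> x) \<le> 2 * (J \<phi> - m) + 2 * (J \<psi> - m)" if "\<phi> \<in> T" "\<psi> \<in> T" for \<phi> \<psi>
  proof -
    let ?d = "\<lambda>x. \<phi> x - \<psi> x"
    have d: "?d \<in> T" using that by (rule diff_T)
    define w where "w = L2_inner M (A ?d) \<phi> - L2_inner M ?d f"
    define p where "p = q ?d"
    have "m \<le> J (\<lambda>x. \<phi> x + (- 1 / 2) * ?d x)" by (intro m_le lin_T that d)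
    also have "\<dots> = J \<phi> + 2 * Re ((- 1 / 2) * w) + (cmod (- 1 / 2))\<^sup>2 * p"
      using J_lin[OF that(1) d, of "- 1 / 2"] unfolding w_def p_def .
    also have "\<dots> = J \<phi> - Re w + p / 4" by (simp add: power2_eq_square norm_divide)
    finally have "m \<le> J \<phi> - Re w + p / 4" .
    moreover have "J (\<lambda>x. \<phi> x + (- 1) * ?d x) = J \<phi> + 2 * Re ((- 1) * w) + (cmod (- 1))\<^sup>2 * p"
      using J_lin[OF that(1) d, of "- 1"] unfolding w_def p_def .
    then have "J \<psi> = J \<phi> - 2 * Re w + p" by simp
    ultimately have "p \<le> 2 * (J \<phi> - m) + 2 * (J \<psi> - m)" by argo
    then show ?thesis by (simp add: p_def)
  qed
  have Cq: "\<forall>\<epsilon>>0. \<exists>N. \<forall>k\<ge>N. \<forall>l\<ge>N. sqrt (q (\<lambda>x. \<Phi> k x - \<Phi> l x)) < \<epsilon>"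
  proof (intro allI impI)
    fix \<epsilon> :: real assume \<epsilon>: "\<epsilon> > 0"
    then have "\<epsilon>\<^sup>2 / 4 > 0" by simp
    then obtain N where N: "inverse (real (Suc N)) < \<epsilon>\<^sup>2 / 4" using reals_Archimedean by blast
    have "sqrt (q (\<lambda>x. \<Phi> k x - \<Phi> l x)) < \<epsilon>" if "k \<ge> N" "l \<ge> N" for k l
    proof -
      have "inverse (real (Suc j)) \<le> inverse (real (Suc N))" if "j \<ge> N" for j using that by (intro le_imp_inverse_le) auto
      then have "J (\<Phi> k) - m < \<epsilon>\<^sup>2 / 4" "J (\<Phi> l) - m < \<epsilon>\<^sup>2 / 4"
        using \<Phi>[of k] \<Phi>[of l] N that by (smt (verit))+
      then have "q (\<lambda>x. \<Phi> k x - \<Phi> l x) < \<epsilon>\<^sup>2" using q_le[OF T T, of k l] by simp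
      then show ?thesis using \<epsilon> by (metis real_sqrt_less_iff real_sqrt_unique less_imp_le)
    qed
    then show "\<exists>N. \<forall>k\<ge>N. \<forall>l\<ge>N. sqrt (q (\<lambda>x. \<Phi> k x - \<Phi> l x)) < \<epsilon>" by blast
  qed
  have "L2_norm M \<phi> \<le> sqrt (q \<phi>)" if "\<phi> \<in> T" for \<phi> using form_ge[OF that] by (simp add: real_le_rsqrt)
  then have "\<forall>\<epsilon>>0. \<exists>N. \<forall>k\<ge>N. \<forall>l\<ge>N. L2_norm M (\<lambda>x. \<Phi> k x - \<Phi> l x) < \<epsilon>"
    using Cq diff_T[OF T T] by (meson order_le_less_trans)
  then obtain u where u: "u \<in> L2 M" and lim: "(\<lambda>k. L2_norm M (\<lambda>x. \<Phi> k x - u x)) \<longlonglongrightarrow> 0"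
    using L2_complete[of \<Phi>, OF T_L2[OF T]] by blast
  have "form_limit u \<Phi>" unfolding form_limit_def using T lim Cq by blast
  moreover have "L2_inner M (A \<psi>) u = L2_inner M \<psi> f" if \<psi>: "\<psi> \<in> T" for \<psi>
  proof -
    define w where "w = L2_inner M (A \<psi>) u - L2_inner M \<psi> f"
    \<comment> \<open>Near-minimality of \<open>\<Phi> k\<close> against the perturbation
      \<open>c * \<psi>\<close>; the error 1 / (k + 1) disappears in the limit.\<close>
    have ge: "0 \<le> 2 * Re (c * w) + (cmod c)\<^sup>2 * q \<psi>" for c
    proof (rule LIMSEQ_le_const)
      have "(\<lambda>k. L2_inner M (A \<psi>) (\<Phi> k)) \<longlonglongrightarrow> L2_inner M (A \<psi>) u"
        by (rule L2_inner_tendsto_right[OF A_L2[OF \<psi>] T_L2[OF T] u lim])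
      then have "(\<lambda>k. inverse (real (Suc k)) + 2 * Re (c * (L2_inner M (A \<psi>) (\<Phi> k) - L2_inner M \<psi> f)) + (cmod c)\<^sup>2 * q \<psi>)
        \<longlonglongrightarrow> 0 + 2 * Re (c * w) + (cmod c)\<^sup>2 * q \<psi>"
        unfolding w_def by (intro tendsto_intros LIMSEQ_inverse_real_of_nat)
      then show "(\<lambda>k. inverse (real (Suc k)) + 2 * Re (c * (L2_inner M (A \<psi>) (\<Phi> k) - L2_inner M \<psi> f)) + (cmod c)\<^sup>2 * q \<psi>)
        \<longlonglongrightarrow> 2 * Re (c * w) + (cmod c)\<^sup>2 * q \<psi>" by simp
      have "0 \<le> inverse (real (Suc k)) + 2 * Re (c * (L2_inner M (A \<psi>) (\<Phi> k) - L2_inner M \<psi> f)) + (cmod c)\<^sup>2 * q \<psi>" for k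
        using m_le[OF lin_T[OF T \<psi>], of k c] J_lin[OF T \<psi>, of k c] \<Phi>[of k] by simp
      then show "\<exists>N. \<forall>k\<ge>N. 0 \<le> inverse (real (Suc k)) + 2 * Re (c * (L2_inner M (A \<psi>) (\<Phi> k) - L2_inner M \<psi> f)) + (cmod c)\<^sup>2 * q \<psi>"
        by blast
    qed
    have "w = 0"
    proof (rule ccontr)
      assume "w \<noteq> 0"
      \<comment> \<open>For the direction - s \<open>cnj w\<close> the first variation is -2 s
        |w|^2. This s is small enough for it to dominate the quadratic term, as s times the energy
        is below 2.\<close>
      let ?s = "1 / (q \<psi> + 1)"
      have nn: "0 \<le> q \<psi>" by (rule nonneg[OF \<psi>])
      have ge': "0 \<le> (cmod w)\<^sup>2 * (s * (- 2 + s * q \<psi>))" for s :: real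
      proof -
        have "Re (- of_real s * cnj w * w) = - s * (cmod w)\<^sup>2"
          by (simp add: cmod_power2) (simp add: power2_eq_square algebra_simps)
        then show ?thesis
          using ge[of "- of_real s * cnj w"] by (simp add: norm_mult power_mult_distrib power2_eq_square algebra_simps)
      qed
      have "0 \<le> (cmod w)\<^sup>2 * (?s * (- 2 + ?s * q \<psi>))" by (rule ge')
      moreover have "?s * q \<psi> < 2" "?s > 0" using nn by (auto simp: divide_less_eq)
      ultimately show False using \<open>w \<noteq> 0\<close> by (smt (verit) mult_pos_neg zero_less_power zero_less_norm_iff)
    qed
    then show ?thesis by (simp add: w_def)
  qed
  ultimately have "(u, f) \<in> F" using u f unfolding friedrichs_iff by blast
  then show "\<exists>(u, g)\<in>F. AE x in M. g x - 0 * u x = f x" by auto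
qed

text \<open>Banach's fixed point argument. The equation at z is the equation at z0 with right-hand
  side f + (z - z0) w and solution w; by \<open>friedrichs_bound\<close> the solution map contracts
  with ratio |z - z0| / \<open>infdist z0 ray\<close>.\<close>

lemma solvable_step:
  assumes "solvable z0" "cmod (z - z0) < infdist z0 ray"
  shows "solvable z"
  unfolding solvable_def
proof
  fix f assume f: "f \<in> L2 M"
  let ?d = "infdist z0 ray"
  have d: "?d > 0" using assms(2) norm_ge_zero order_le_less_trans by blast
  define r where "r = cmod (z - z0) / ?d"
  have r: "0 \<le> r" "r < 1" using d assms(2) by (auto simp: r_def)
  \<comment> \<open>Solutions are unique only up to null sets, so one representative is chosen for
    each w. The estimate \<open>contr\<close> holds for any such choice.\<close>
  define S where "S w = (SOME p. p \<in> F \<and> (AE x in M. snd p x - z0 * fst p x = f x + (z - z0) * w x))" for w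
  have S: "S w \<in> F" "AE x in M. snd (S w) x - z0 * fst (S w) x = f x + (z - z0) * w x" if "w \<in> L2 M" for w
  proof -
    have "\<exists>p. p \<in> F \<and> (AE x in M. snd p x - z0 * fst p x = f x + (z - z0) * w x)"
      using assms(1) L2_lin[OF f that, of "z - z0"] unfolding solvable_def by fastforce
    from someI_ex[OF this] show "S w \<in> F" "AE x in M. snd (S w) x - z0 * fst (S w) x = f x + (z - z0) * w x"
      unfolding S_def by auto
  qed
  have S': "(fst (S w), snd (S w)) \<in> F" if "w \<in> L2 M" for w using S(1)[OF that] by simp
  have SL: "fst (S w) \<in> L2 M" "snd (S w) \<in> L2 M" if "w \<in> L2 M" for w
    using S'[OF that] unfolding friedrichs_iff by auto
  have contr: "L2_norm M (\<lambda>x. fst (S v) x - fst (S w) x) \<le> r * L2_norm M (\<lambda>x. v x - w x)"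
    if v: "v \<in> L2 M" and w: "w \<in> L2 M" for v w
  proof -
    let ?u = "\<lambda>x. fst (S v) x - fst (S w) x" and ?g = "\<lambda>x. snd (S v) x - snd (S w) x"
    have "?d * L2_norm M ?u \<le> L2_norm M (\<lambda>x. ?g x - z0 * ?u x)"
      by (rule friedrichs_bound[OF friedrichs_diff[OF S'[OF v] S'[OF w]]])
    also have "\<dots> = L2_norm M (\<lambda>x. (z - z0) * (v x - w x))"
    proof (rule L2_norm_cong_AE)
      show "AE x in M. ?g x - z0 * ?u x = (z - z0) * (v x - w x)"
        using S(2)[OF v] S(2)[OF w]
      proof eventually_elim
        case (elim x)
        have "?g x - z0 * ?u x = (snd (S v) x - z0 * fst (S v) x) - (snd (S w) x - z0 * fst (S w) x)"
          by (simp add: algebra_simps)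
        then show ?case unfolding elim by (simp add: algebra_simps)
      qed
    qed (use SL[OF v] SL[OF w] v w in \<open>auto simp: L2_def\<close>)
    also have "\<dots> = cmod (z - z0) * L2_norm M (\<lambda>x. v x - w x)" by (rule L2_norm_cmult)
    finally show ?thesis using d by (simp add: r_def field_simps)
  qed
  define U where "U k = ((\<lambda>w. fst (S w)) ^^ k) (\<lambda>x. 0)" for k
  have U_Suc: "U (Suc k) = fst (S (U k))" for k by (simp add: U_def)
  have UL: "U k \<in> L2 M" for k
    by (induction k) (auto simp: U_Suc SL(1), simp add: U_def L2.zero_T)
  let ?c = "L2_norm M (\<lambda>x. U 1 x - U 0 x)"
  have step: "L2_norm M (\<lambda>x. U (Suc k) x - U k x) \<le> ?c * r ^ k" for k
  proof (induction k)
    case (Suc k)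
    have "L2_norm M (\<lambda>x. U (Suc (Suc k)) x - U (Suc k) x) \<le> r * L2_norm M (\<lambda>x. U (Suc k) x - U k x)"
      using contr[OF UL UL, of "Suc k" k] by (simp add: U_Suc)
    also have "\<dots> \<le> r * (?c * r ^ k)" by (intro mult_left_mono Suc r)
    finally show ?case by (simp add: mult_ac)
  qed simp
  have tail: "L2_norm M (\<lambda>x. U (k + m) x - U k x) \<le> ?c * r ^ k * (1 - r ^ m) / (1 - r)" for k m
  proof (induction m)
    case 0 then show ?case by (simp add: L2_norm_def)
  next
    case (Suc m)
    have "L2_norm M (\<lambda>x. U (k + Suc m) x - U k x) \<le>
        L2_norm M (\<lambda>x. U (Suc (k + m)) x - U (k + m) x) + L2_norm M (\<lambda>x. U (k + m) x - U k x)"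
      using L2_norm_triangle_diff[OF UL UL UL] by simp
    also have "\<dots> \<le> ?c * r ^ (k + m) + ?c * r ^ k * (1 - r ^ m) / (1 - r)"
      by (intro add_mono step Suc)
    also have "\<dots> = ?c * r ^ k * (1 - r ^ Suc m) / (1 - r)"
      using r by (simp add: field_simps power_add)
    finally show ?case .
  qed
  have "\<forall>\<epsilon>>0. \<exists>N. \<forall>k\<ge>N. \<forall>l\<ge>N. L2_norm M (\<lambda>x. U k x - U l x) < \<epsilon>"
  proof (intro allI impI)
    fix \<epsilon> :: real assume \<epsilon>: "\<epsilon> > 0"
    have "(\<lambda>k. ?c * r ^ k / (1 - r)) \<longlonglongrightarrow> ?c * 0 / (1 - r)"
      by (intro tendsto_intros LIMSEQ_power_zero) (use r in auto)
    then have "\<forall>\<^sub>F k in sequentially. ?c * r ^ k / (1 - r) < \<epsilon>"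
      by (rule order_tendstoD(2)) (use \<epsilon> in simp)
    then obtain N where N: "\<And>k. k \<ge> N \<Longrightarrow> ?c * r ^ k / (1 - r) < \<epsilon>" unfolding eventually_sequentially by auto
    have le: "L2_norm M (\<lambda>x. U (k + m) x - U k x) < \<epsilon>" if "k \<ge> N" for k m
    proof -
      have "?c * r ^ k * (1 - r ^ m) / (1 - r) \<le> ?c * r ^ k / (1 - r)"
        using r by (intro divide_right_mono mult_left_le) auto
      then show ?thesis using tail[of k m] N[OF that] by linarith
    qed
    have "L2_norm M (\<lambda>x. U k x - U l x) < \<epsilon>" if "k \<ge> N" "l \<ge> N" for k l
      using le[OF that(1), of "l - k"] le[OF that(2), of "k - l"] L2_norm_diff_commute[of M "U k" "U l"]
      by (cases "k \<le> l") auto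
    then show "\<exists>N. \<forall>k\<ge>N. \<forall>l\<ge>N. L2_norm M (\<lambda>x. U k x - U l x) < \<epsilon>" by blast
  qed
  then obtain u where u: "u \<in> L2 M" and lim: "(\<lambda>k. L2_norm M (\<lambda>x. U k x - u x)) \<longlonglongrightarrow> 0"
    using L2_complete[of U, OF UL] by blast
  \<comment> \<open>The limit u itself is not known to be in the domain, but its image under the
    solution map is. The two agree almost everywhere, since both are limits of the same
    iteration.\<close>
  let ?w = "fst (S u)"
  have "L2_norm M (\<lambda>x. ?w x - u x) \<le> r * L2_norm M (\<lambda>x. U k x - u x) + L2_norm M (\<lambda>x. U (Suc k) x - u x)" for k
  proof -
    have "L2_norm M (\<lambda>x. ?w x - u x) \<le> L2_norm M (\<lambda>x. ?w x - U (Suc k) x) + L2_norm M (\<lambda>x. U (Suc k) x - u x)"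
      by (rule L2_norm_triangle_diff[OF SL(1)[OF u] UL u])
    also have "L2_norm M (\<lambda>x. ?w x - U (Suc k) x) \<le> r * L2_norm M (\<lambda>x. u x - U k x)"
      unfolding U_Suc by (rule contr[OF u UL])
    finally show ?thesis using L2_norm_diff_commute[of M u] by simp
  qed
  moreover have "(\<lambda>k. r * L2_norm M (\<lambda>x. U k x - u x) + L2_norm M (\<lambda>x. U (Suc k) x - u x)) \<longlonglongrightarrow> r * 0 + 0"
    by (intro tendsto_intros lim LIMSEQ_Suc[OF lim])
  ultimately have "L2_norm M (\<lambda>x. ?w x - u x) \<le> 0"
    by (intro LIMSEQ_le_const[of _ 0]) auto
  then have "AE x in M. ?w x - u x = 0"
    by (intro L2_norm_eq_0_AE L2.diff_T SL(1) u antisym) auto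
  then have "AE x in M. snd (S u) x - z * ?w x = f x"
    using S(2)[OF u] by eventually_elim (simp add: algebra_simps)
  then show "\<exists>(u, g)\<in>F. AE x in M. g x - z * u x = f x" using S'[OF u] by fastforce
qed

text \<open>Continuity method along the segment from 0, where the variational solution is available,
  to z. The segment avoids \<open>ray\<close>: if t z lay on it with 0 <= t <= 1, then so would
  z.\<close>

lemma solvable_off_ray:
  assumes "z \<notin> ray"
  shows "solvable z"
proof -
  have nr: "of_real t * z \<notin> ray" if "0 \<le> t" "t \<le> 1" for t
  proof
    assume "of_real t * z \<in> ray"
    then obtain y where y: "y \<ge> 1" "of_real t * z = of_real y" by auto
    then have "t \<noteq> 0" by auto
    then have "z = of_real (y / t)" using y(2) by (simp add: field_simps)
    moreover have "y / t \<ge> 1" using y(1) that \<open>t \<noteq> 0\<close> by (simp add: le_divide_eq)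
    ultimately show False using assms by blast
  qed
  \<comment> \<open>By compactness the distance to \<open>ray\<close> has a positive minimum on the
    segment, which fixes a uniform step length.\<close>
  have "\<exists>t0\<in>{0..1}. \<forall>t\<in>{0..1}. infdist (of_real t0 * z) ray \<le> infdist (of_real t * z) ray"
    by (intro continuous_attains_inf continuous_intros) auto
  then obtain \<delta> where \<delta>: "\<delta> > 0" "\<And>t. 0 \<le> t \<Longrightarrow> t \<le> 1 \<Longrightarrow> \<delta> \<le> infdist (of_real t * z) ray"
    using infdist_ray_pos[OF nr] by (metis atLeastAtMost_iff)
  obtain N where "N > 0" and N: "cmod z / \<delta> < real N" using reals_Archimedean2[of "cmod z / \<delta>"] \<delta>(1)
    by (metis divide_nonneg_pos gr0I norm_ge_zero not_less of_nat_0)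
  have "solvable (of_real (real j / real N) * z)" if "j \<le> N" for j
    using that
  proof (induction j)
    case 0 then show ?case using solvable_0 by simp
  next
    case (Suc j)
    have "cmod (of_real (real (Suc j) / real N) * z - of_real (real j / real N) * z) = cmod z / real N"
    proof -
      have "of_real (real (Suc j) / real N) * z - of_real (real j / real N) * z = of_real (1 / real N) * z"
        by (simp add: add_divide_distrib algebra_simps)
      then show ?thesis by (simp only: norm_mult norm_of_real) simp
    qed
    also have "\<dots> < \<delta>" using N \<open>N > 0\<close> \<delta>(1) by (simp add: field_simps)
    also have "\<dots> \<le> infdist (of_real (real j / real N) * z) ray"
      using Suc.prems by (intro \<delta>(2)) auto
    finally show ?case using solvable_step[OF Suc.IH] Suc.prems by simp
  qed
  from this[of N] \<open>N > 0\<close> show ?thesis by simp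
qed

lemma off_ray_resolvent:
  assumes "z \<notin> ray"
  shows "z \<in> resolvent_set M F"
proof -
  have "L2_norm M u \<le> (1 / infdist z ray) * L2_norm M (\<lambda>x. g x - z * u x)" if "(u, g) \<in> F" for u g
    using friedrichs_bound[OF that, of z] infdist_ray_pos[OF assms] by (simp add: field_simps)
  then show ?thesis
    using solvable_off_ray[OF assms] unfolding resolvent_set_def solvable_def by blast
qed

text \<open>The hypothesis excludes a bounded inverse at every point of the half-line. No point of
  the half-line is isolated, so there is no discrete spectrum.\<close>

lemma spectrum_eq_ray:
  assumes "\<And>\<mu> C. \<mu> \<ge> 1 \<Longrightarrow> \<exists>(u, g)\<in>F. L2_norm M u > C * L2_norm M (\<lambda>x. g x - of_real \<mu> * u x)"
  shows "op_spectrum M F = ray" "essential_spectrum M F = ray"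
proof -
  have "of_real \<mu> \<notin> resolvent_set M F" if "\<mu> \<ge> 1" for \<mu>
  proof
    note \<mu> = that
    assume "of_real \<mu> \<in> resolvent_set M F"
    then obtain C where C: "\<forall>(u, g)\<in>F. L2_norm M u \<le> C * L2_norm M (\<lambda>x. g x - of_real \<mu> * u x)"
      unfolding resolvent_set_def by blast
    obtain u g where "(u, g) \<in> F" "L2_norm M u > C * L2_norm M (\<lambda>x. g x - of_real \<mu> * u x)"
      using assms[OF \<mu>, of C] by blast
    with C show False by fastforce
  qed
  then show *: "op_spectrum M F = ray" unfolding op_spectrum_def using off_ray_resolvent by blast
  have "\<not> z isolated_in ray" for z
  proof
    assume "z isolated_in ray"
    then obtain W where W: "z \<in> ray" "open W" "W \<inter> ray = {z}" unfolding isolated_in_def by blast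
    then obtain e where e: "e > 0" "ball z e \<subseteq> W" using openE by blast
    have "z + of_real (e / 2) \<in> ball z e" using e(1) by (simp add: dist_norm norm_divide)
    moreover have "z + of_real (e / 2) \<in> ray"
    proof -
      obtain y where "y \<ge> 1" "z = of_real y" using W(1) by auto
      then have "z + of_real (e / 2) = of_real (y + e / 2)" "y + e / 2 \<in> {1..}" using e(1) by auto
      then show ?thesis by blast
    qed
    ultimately have "z + of_real (e / 2) = z" using W(3) e(2) by blast
    then show False using e(1) by simp
  qed
  then show "essential_spectrum M F = ray"
    unfolding essential_spectrum_def discrete_spectrum_def * by blast
qed

end


subsection \<open>The ground state and its logarithmic gradient\<close>

text \<open>With X k the square of the k-th coordinate and R j the squared radius of the first j
  coordinates, the left side is the Euler operator applied to the logarithm of the ground state.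
  Exchanging the sums leaves a j times R j / R j.\<close>

lemma sum_tail_first_moment:
  fixes X R a :: "nat \<Rightarrow> real"
  assumes "\<And>j. R j = (\<Sum>k=1..j. X k)" "\<And>j. 1 \<le> j \<Longrightarrow> j \<le> N \<Longrightarrow> R j \<noteq> 0"
  shows "(\<Sum>k=1..N. X k * (\<Sum>j=k..N. a j / R j)) = (\<Sum>j=1..N. a j)"
  using assms(2)
proof (induction N)
  case (Suc N)
  let ?c = "a (Suc N) / R (Suc N)"
  have "(\<Sum>k=1..Suc N. X k * (\<Sum>j=k..Suc N. a j / R j)) =
      (\<Sum>k=1..N. X k * (\<Sum>j=k..N. a j / R j) + X k * ?c) + X (Suc N) * ?c"
    by (simp add: sum.cl_ivl_Suc algebra_simps)
  also have "\<dots> = (\<Sum>k=1..N. X k * (\<Sum>j=k..N. a j / R j)) + (\<Sum>k=1..N. X k) * ?c + X (Suc N) * ?c"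
    by (simp only: sum.distrib sum_distrib_right)
  also have "\<dots> = (\<Sum>j=1..N. a j) + (R N + X (Suc N)) * ?c"
    using Suc by (simp only: assms(1)[of N, symmetric] distrib_right) simp
  also have "R N + X (Suc N) = R (Suc N)" by (simp add: assms(1))
  finally show ?case using Suc.prems[of "Suc N"] by simp
qed simp

text \<open>In the same notation the left side is the squared gradient of the logarithm of the
  ground state. One more index adds a constant to every tail sum, so that the new cross term is a
  first moment.\<close>

lemma sum_tail_second_moment:
  fixes X R a :: "nat \<Rightarrow> real"
  assumes "\<And>j. R j = (\<Sum>k=1..j. X k)" "\<And>j. 1 \<le> j \<Longrightarrow> j \<le> N \<Longrightarrow> R j \<noteq> 0"
  shows "(\<Sum>k=1..N. X k * (\<Sum>j=k..N. a j / R j)\<^sup>2) = (\<Sum>j=1..N. a j * (a j + 2 * (\<Sum>i=1..j-1. a i)) / R j)"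
  using assms(2)
proof (induction N)
  case (Suc N)
  let ?c = "a (Suc N) / R (Suc N)"
  have "(\<Sum>k=1..Suc N. X k * (\<Sum>j=k..Suc N. a j / R j)\<^sup>2) =
      (\<Sum>k=1..N. X k * (\<Sum>j=k..N. a j / R j)\<^sup>2 + 2 * ?c * (X k * (\<Sum>j=k..N. a j / R j)) + X k * ?c\<^sup>2)
      + X (Suc N) * ?c\<^sup>2"
    by (simp add: sum.cl_ivl_Suc algebra_simps power2_sum)
  also have "\<dots> = (\<Sum>k=1..N. X k * (\<Sum>j=k..N. a j / R j)\<^sup>2)
      + 2 * ?c * (\<Sum>k=1..N. X k * (\<Sum>j=k..N. a j / R j)) + (R N + X (Suc N)) * ?c\<^sup>2"
    by (simp only: sum.distrib sum_distrib_left[symmetric] sum_distrib_right[symmetric] assms(1) distrib_right)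
  also have "\<dots> = (\<Sum>j=1..N. a j * (a j + 2 * (\<Sum>i=1..j-1. a i)) / R j)
      + 2 * ?c * (\<Sum>j=1..N. a j) + (R N + X (Suc N)) * ?c\<^sup>2"
    using Suc sum_tail_first_moment[OF assms(1), of N a] by simp
  also have "R N + X (Suc N) = R (Suc N)" by (simp add: assms(1))
  also have "R (Suc N) * ?c\<^sup>2 = a (Suc N) * ?c"
    using Suc.prems[of "Suc N"] by (simp add: power2_eq_square)
  finally show ?case by (simp add: algebra_simps add_divide_distrib)
qed simp

locale hardy_weights =
  fixes n :: nat and e :: "nat \<Rightarrow> 'n::finite" and \<alpha> \<beta> :: "nat \<Rightarrow> real"
  assumes n2: "n \<ge> 2"
    and bij: "bij_betw e {1..n} UNIV"
    and \<alpha>_nonpos: "\<And>i. i \<in> {1..n} \<Longrightarrow> \<alpha> i \<le> 0"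
    and \<beta>1: "\<beta> 1 = - (\<alpha> 1)\<^sup>2 + 1 / 4"
    and \<beta>i: "\<And>i. i \<in> {2..n} \<Longrightarrow> \<beta> i = - (\<alpha> i)\<^sup>2 + (\<alpha> (i - 1) - 1 / 2)\<^sup>2"
    and \<alpha>n: "\<alpha> n = 0"
    and inj_or_neg: "inj_on \<alpha> {1..n - 1} \<or> (\<forall>i\<in>{1..n - 1}. \<alpha> i < 0)"
begin

abbreviation "D \<equiv> half_space e"

definition rr :: "nat \<Rightarrow> real ^ 'n \<Rightarrow> real"
  where "rr j x = (\<Sum>k=1..j. (x $ e k)\<^sup>2)"

definition expo :: "nat \<Rightarrow> real"
  where "expo j = (if j = 1 then 1 / 2 - \<alpha> 1 else \<alpha> (j - 1) - \<alpha> j - 1 / 2)"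

text \<open>The logarithm of the ground state; \<open>rr j\<close> is the square of r_j, hence the
  factor one half. Keeping the logarithm avoids every division by u.\<close>

definition hlog :: "real ^ 'n \<Rightarrow> real"
  where "hlog x = (\<Sum>j=1..n. expo j / 2 * ln (rr j x))"

definition hgrad :: "'n \<Rightarrow> real ^ 'n \<Rightarrow> real"
  where "hgrad i x = (\<Sum>j=1..n. if i \<in> e ` {1..j} then expo j * (x $ i * inverse (rr j x)) else 0)"

lemma D_iff: "x \<in> D \<longleftrightarrow> x $ e 1 > 0"
  by (simp add: half_space_def)

lemma open_D [simp]: "open D"
proof -
  have "D = {x. 0 < x $ e 1}" by (auto simp: D_iff)
  then show ?thesis by (auto intro!: open_Collect_less continuous_intros)
qed

lemma e_mem: "k \<in> {1..n} \<Longrightarrow> j \<le> n \<Longrightarrow> e k \<in> e ` {1..j} \<longleftrightarrow> k \<le> j"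
  using inj_on_image_mem_iff[of e "{1..n}" k "{1..j}"] bij unfolding bij_betw_def by auto

lemma e_inj: "inj_on e {1..n}" using bij by (simp add: bij_betw_def)

lemma sum_UNIV: "(\<Sum>i\<in>UNIV. f i) = (\<Sum>k=1..n. f (e k))"
  using sum.reindex_bij_betw[OF bij, of f] by simp

lemma card_n: "CARD('n) = n"
  using bij_betw_same_card[OF bij] by simp

lemma rr_mono: "j \<le> k \<Longrightarrow> rr j x \<le> rr k x"
  unfolding rr_def by (intro sum_mono2) auto

lemma rr_1: "rr 1 x = (x $ e 1)\<^sup>2" by (simp add: rr_def)

lemma rr_pos: "x \<in> D \<Longrightarrow> 1 \<le> j \<Longrightarrow> 0 < rr j x"
  using rr_mono[of 1 j x] rr_1[of x] by (simp add: D_iff) (smt (verit) zero_less_power)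

lemma rr_n: "rr n x = (norm x)\<^sup>2"
  unfolding rr_def power2_norm_eq_inner inner_vec_def sum_UNIV by (simp add: power2_eq_square)

lemma rr_has_derivative: "(rr j has_derivative (\<lambda>v. \<Sum>k=1..j. 2 * (x $ e k) * v $ e k)) (at x)"
  unfolding rr_def[abs_def]
  by (auto intro!: derivative_eq_intros has_derivative_nth sum.cong)

lemma rr_differentiable: "rr j differentiable (at x)"
  using rr_has_derivative differentiableI by blast

lemma partial_rr: "j \<le> n \<Longrightarrow> partial i (rr j) x = (if i \<in> e ` {1..j} then 2 * x $ i else 0)"
proof -
  assume j: "j \<le> n"
  have inj: "inj_on e {1..j}" using j by (intro inj_on_subset[OF e_inj]) auto
  have "partial i (rr j) x = (\<Sum>k=1..j. 2 * (x $ e k) * axis i 1 $ e k)"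
    by (rule partial_eqI[OF rr_has_derivative])
  also have "\<dots> = (\<Sum>l\<in>e ` {1..j}. 2 * (x $ l) * axis i 1 $ l)"
    unfolding sum.reindex[OF inj] comp_def ..
  also have "\<dots> = (\<Sum>l\<in>e ` {1..j}. if l = i then 2 * x $ i else 0)"
    by (intro sum.cong) (auto simp: axis_def)
  also have "\<dots> = (if i \<in> e ` {1..j} then 2 * x $ i else 0)"
    by (subst sum.delta) auto
  finally show ?thesis .
qed

lemma Ck_on_rr: "open S \<Longrightarrow> Ck_on k S (rr j)"
  unfolding rr_def[abs_def] by (intro Ck_on_sum Ck_on_power Ck_on_nth)

lemma Ck_on_inverse_rr: "1 \<le> j \<Longrightarrow> Ck_on k D (\<lambda>x. inverse (rr j x))"
  by (rule Ck_on_compose[OF _ Dk_on_inverse Ck_on_rr]) (use rr_pos in \<open>fastforce+\<close>)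

lemma Ck_on_ln_rr: "1 \<le> j \<Longrightarrow> Ck_on k D (\<lambda>x. ln (rr j x))"
  by (rule Ck_on_compose[OF _ Dk_on_ln Ck_on_rr]) (use rr_pos in \<open>fastforce+\<close>)

lemma Ck_on_hlog: "Ck_on k D hlog"
  unfolding hlog_def[abs_def] by (intro Ck_on_sum Ck_on_mult Ck_on_const Ck_on_ln_rr) auto

lemma Ck_on_hgrad: "Ck_on k D (hgrad i)"
proof -
  have "Ck_on k D (\<lambda>x. if i \<in> e ` {1..j} then expo j * (x $ i * inverse (rr j x)) else 0)" if "1 \<le> j" for j
    using that by (cases "i \<in> e ` {1..j}") (auto intro!: Ck_on_mult Ck_on_inverse_rr)
  then show ?thesis unfolding hgrad_def[abs_def] by (intro Ck_on_sum) auto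
qed

lemma partial_hlog:
  assumes x: "x \<in> D"
  shows "partial i hlog x = hgrad i x"
proof -
  have d: "partial i (\<lambda>x. expo j / 2 * ln (rr j x)) x = (if i \<in> e ` {1..j} then expo j * (x $ i * inverse (rr j x)) else 0)"
    and d': "(\<lambda>x. expo j / 2 * ln (rr j x)) differentiable (at x)"
    if j: "j \<in> {1..n}" for j
  proof -
    have "(ln has_real_derivative inverse (rr j x)) (at (rr j x))"
      using rr_pos[OF x, of j] j by (auto intro!: derivative_eq_intros simp: divide_inverse)
    note c = partial_compose[OF this rr_differentiable]
    show "(\<lambda>x. expo j / 2 * ln (rr j x)) differentiable (at x)"
      by (intro differentiable_mult c) auto
    show "partial i (\<lambda>x. expo j / 2 * ln (rr j x)) x = (if i \<in> e ` {1..j} then expo j * (x $ i * inverse (rr j x)) else 0)"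
      using j by (subst partial_mult) (auto simp: c partial_rr)
  qed
  have "partial i hlog x = (\<Sum>j=1..n. partial i (\<lambda>x. expo j / 2 * ln (rr j x)) x)"
    unfolding hlog_def[abs_def] by (rule partial_sum) (rule d')
  also have "\<dots> = hgrad i x" unfolding hgrad_def by (intro sum.cong refl d)
  finally show ?thesis .
qed

lemma hgrad_e:
  assumes "k \<in> {1..n}"
  shows "hgrad (e k) x = x $ e k * (\<Sum>j=k..n. expo j / rr j x)"
proof -
  have "hgrad (e k) x = (\<Sum>j=1..n. if k \<le> j then expo j * (x $ e k * inverse (rr j x)) else 0)"
    unfolding hgrad_def by (intro sum.cong refl if_cong e_mem assms) auto
  also have "\<dots> = (\<Sum>j\<in>{1..n} \<inter> {j. k \<le> j}. expo j * (x $ e k * inverse (rr j x)))"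
    by (simp add: sum.If_cases)
  also have "{1..n} \<inter> {j. k \<le> j} = {k..n}" using assms by auto
  finally show ?thesis by (simp add: sum_distrib_left divide_inverse mult_ac)
qed

lemma partial_hgrad:
  assumes x: "x \<in> D" and k: "k \<in> {1..n}"
  shows "partial (e k) (hgrad (e k)) x = (\<Sum>j=k..n. expo j * (1 / rr j x - 2 * (x $ e k)\<^sup>2 / (rr j x)\<^sup>2))"
proof -
  let ?i = "e k"
  let ?f = "\<lambda>j x. if ?i \<in> e ` {1..j} then expo j * (x $ ?i * inverse (rr j x)) else 0"
  have d: "partial ?i (?f j) x = (if k \<le> j then expo j * (1 / rr j x - 2 * (x $ e k)\<^sup>2 / (rr j x)\<^sup>2) else 0)"
    and d': "?f j differentiable (at x)" if j: "j \<in> {1..n}" for j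
  proof -
    have "(inverse has_real_derivative - (inverse (rr j x))\<^sup>2) (at (rr j x))"
      using rr_pos[OF x, of j] j by (auto intro!: derivative_eq_intros simp: power2_eq_square)
    note c = partial_compose[OF this rr_differentiable]
    have n: "(\<lambda>x. x $ ?i) differentiable (at x)" using has_derivative_nth differentiableI by blast
    have m: "(\<lambda>x. x $ ?i * inverse (rr j x)) differentiable (at x)" by (intro differentiable_mult c n)
    then show "?f j differentiable (at x)" by (cases "?i \<in> e ` {1..j}") auto
    have "partial ?i (\<lambda>x. expo j * (x $ ?i * inverse (rr j x))) x = expo j * (1 / rr j x - 2 * (x $ e k)\<^sup>2 / (rr j x)\<^sup>2)"
      if "k \<le> j"
      using j that k e_mem[OF k, of j]
      by (simp add: partial_mult[OF differentiable_const m] partial_mult[OF n c(2)] c(1) partial_rr partial_nth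
           divide_inverse power2_eq_square algebra_simps)
    then show "partial ?i (?f j) x = (if k \<le> j then expo j * (1 / rr j x - 2 * (x $ e k)\<^sup>2 / (rr j x)\<^sup>2) else 0)"
      using e_mem[OF k, of j] j by auto
  qed
  have "partial ?i (hgrad ?i) x = (\<Sum>j=1..n. if k \<le> j then expo j * (1 / rr j x - 2 * (x $ e k)\<^sup>2 / (rr j x)\<^sup>2) else 0)"
  proof -
    have "partial ?i (hgrad ?i) x = (\<Sum>j=1..n. partial ?i (?f j) x)"
      unfolding hgrad_def[abs_def] by (rule partial_sum) (rule d')
    also have "\<dots> = (\<Sum>j=1..n. if k \<le> j then expo j * (1 / rr j x - 2 * (x $ e k)\<^sup>2 / (rr j x)\<^sup>2) else 0)"
      by (intro sum.cong refl d)
    finally show ?thesis .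
  qed
  also have "\<dots> = (\<Sum>j\<in>{1..n} \<inter> {j. k \<le> j}. expo j * (1 / rr j x - 2 * (x $ e k)\<^sup>2 / (rr j x)\<^sup>2))"
    by (simp add: sum.If_cases)
  also have "{1..n} \<inter> {j. k \<le> j} = {k..n}" using k by auto
  finally show ?thesis .
qed

text \<open>The differences of consecutive \<open>\<alpha>\<close> telescope. For j = n, with
  \<open>\<alpha> n\<close> zero, this is the degree of homogeneity of the ground state.\<close>

lemma sum_expo: "1 \<le> j \<Longrightarrow> (\<Sum>i=1..j. expo i) = - \<alpha> j - (real j - 2) / 2"
proof (induction j)
  case (Suc j)
  show ?case
  proof (cases "j = 0")
    case True then show ?thesis by (simp add: expo_def)
  next
    case False
    then show ?thesis using Suc by (simp add: expo_def[of "Suc j"] field_simps)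
  qed
qed simp

text \<open>The left side is the coefficient of 1 / \<open>rr j\<close> in the Laplacian of u
  divided by u. After insertion of \<open>sum_expo\<close> it is, for j > 1, minus the product of
  \<open>\<alpha> (j - 1)\<close> - 1/2 - \<open>\<alpha> j\<close> and
  \<open>\<alpha> (j - 1)\<close> - 1/2 + \<open>\<alpha> j\<close>, a difference of
  squares.\<close>

lemma expo_\<beta>:
  assumes "j \<in> {1..n}"
  shows "expo j * (real j - 2) + expo j * (expo j + 2 * (\<Sum>i=1..j-1. expo i)) = - \<beta> j"
proof (cases "j = 1")
  case True then show ?thesis by (simp add: expo_def \<beta>1[simplified] power2_eq_square algebra_simps)
next
  case False
  then have j: "j \<in> {2..n}" "1 \<le> j - 1" using assms by auto
  have "real (j - 1) = real j - 1" using j by simp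
  then show ?thesis using False
    unfolding sum_expo[OF j(2)] \<beta>i[OF j(1)] by (simp add: expo_def power2_eq_square field_simps)
qed

text \<open>\<open>exp hlog\<close> is a positive solution of \<open>- \<Delta>u = V u\<close> in the half-space.\<close>

lemma hlog_Riccati:
  assumes x: "x \<in> D"
  shows "(\<Sum>i\<in>UNIV. partial i (hgrad i) x + (hgrad i x)\<^sup>2) = - hardy_potential e \<beta> n x"
proof -
  define X where "X k = (x $ e k)\<^sup>2" for k
  have R: "rr j x = (\<Sum>k=1..j. X k)" for j by (simp add: rr_def X_def)
  have nz: "rr j x \<noteq> 0" if "1 \<le> j" for j using rr_pos[OF x that] by simp
  have "(\<Sum>i\<in>UNIV. partial i (hgrad i) x) = (\<Sum>k=1..n. \<Sum>j=k..n. expo j * (1 / rr j x - 2 * X k / (rr j x)\<^sup>2))"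
    unfolding sum_UNIV by (intro sum.cong refl) (simp add: partial_hgrad[OF x] X_def)
  also have "\<dots> = (\<Sum>j=1..n. \<Sum>k=1..j. expo j * (1 / rr j x - 2 * X k / (rr j x)\<^sup>2))"
  proof -
    let ?g = "\<lambda>k j. expo j * (1 / rr j x - 2 * X k / (rr j x)\<^sup>2)"
    have "(\<Sum>k\<in>{1..n}. sum (?g k) {j \<in> {1..n}. k \<le> j}) = (\<Sum>j\<in>{1..n}. \<Sum>k\<in>{k \<in> {1..n}. k \<le> j}. ?g k j)"
      by (rule sum.swap_restrict) auto
    moreover have "(\<Sum>k=1..n. sum (?g k) {j \<in> {1..n}. k \<le> j}) = (\<Sum>k=1..n. sum (?g k) {k..n})"
      by (intro sum.cong[OF refl] arg_cong2[where f=sum] refl) auto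
    moreover have "(\<Sum>j=1..n. \<Sum>k\<in>{k \<in> {1..n}. k \<le> j}. ?g k j) = (\<Sum>j=1..n. \<Sum>k=1..j. ?g k j)"
      by (intro sum.cong[OF refl] arg_cong2[where f=sum] refl) auto
    ultimately show ?thesis by (simp only:)
  qed
  \<comment> \<open>In its j variables the function ln r_j has Laplacian (j - 2) / r_j^2.\<close>
  also have "\<dots> = (\<Sum>j=1..n. expo j * (real j - 2) / rr j x)"
  proof (rule sum.cong[OF refl])
    fix j assume "j \<in> {1..n}"
    then have "rr j x \<noteq> 0" using nz by simp
    have "(\<Sum>k=1..j. expo j * (1 / rr j x - 2 * X k / (rr j x)\<^sup>2)) = expo j * (real j / rr j x - 2 * (\<Sum>k=1..j. X k) / (rr j x)\<^sup>2)"
      by (simp add: sum_distrib_left[symmetric] sum_subtractf sum_divide_distrib[symmetric])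
    also have "\<dots> = expo j * (real j - 2) / rr j x"
      unfolding R[symmetric] using \<open>rr j x \<noteq> 0\<close> by (simp add: power2_eq_square field_simps)
    finally show "(\<Sum>k=1..j. expo j * (1 / rr j x - 2 * X k / (rr j x)\<^sup>2)) = expo j * (real j - 2) / rr j x" .
  qed
  finally have 1: "(\<Sum>i\<in>UNIV. partial i (hgrad i) x) = (\<Sum>j=1..n. expo j * (real j - 2) / rr j x)" .
  have "(\<Sum>i\<in>UNIV. (hgrad i x)\<^sup>2) = (\<Sum>k=1..n. X k * (\<Sum>j=k..n. expo j / rr j x)\<^sup>2)"
    unfolding sum_UNIV by (intro sum.cong refl) (simp add: hgrad_e X_def power_mult_distrib)
  also have "\<dots> = (\<Sum>j=1..n. expo j * (expo j + 2 * (\<Sum>i=1..j-1. expo i)) / rr j x)"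
    by (rule sum_tail_second_moment) (use R nz in auto)
  finally have "(\<Sum>i\<in>UNIV. partial i (hgrad i) x + (hgrad i x)\<^sup>2) =
      (\<Sum>j=1..n. (expo j * (real j - 2) + expo j * (expo j + 2 * (\<Sum>i=1..j-1. expo i))) / rr j x)"
    by (simp add: sum.distrib 1 add_divide_distrib)
  also have "\<dots> = (\<Sum>j=1..n. - (\<beta> j / rr j x))"
    by (intro sum.cong refl) (simp only: expo_\<beta> minus_divide_left)
  finally show ?thesis by (simp add: hardy_potential_def rr_def sum_negf)
qed

text \<open>Euler's identity for the homogeneity of u. The condition that \<open>\<alpha> n\<close>
  vanishes gives the degree -(n - 2)/2, for which u^2 / |x|^2 dx is dilation invariant.\<close>

lemma hgrad_Euler:
  assumes x: "x \<in> D"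
  shows "(\<Sum>i\<in>UNIV. x $ i * hgrad i x) = - (real n - 2) / 2"
proof -
  define X where "X k = (x $ e k)\<^sup>2" for k
  have R: "rr j x = (\<Sum>k=1..j. X k)" for j by (simp add: rr_def X_def)
  have nz: "rr j x \<noteq> 0" if "1 \<le> j" for j using rr_pos[OF x that] by simp
  have "(\<Sum>i\<in>UNIV. x $ i * hgrad i x) = (\<Sum>k=1..n. X k * (\<Sum>j=k..n. expo j / rr j x))"
    unfolding sum_UNIV by (intro sum.cong refl) (simp add: hgrad_e X_def power2_eq_square)
  also have "\<dots> = (\<Sum>j=1..n. expo j)" by (rule sum_tail_first_moment) (use R nz in auto)
  also have "\<dots> = - (real n - 2) / 2" using sum_expo[of n] n2 \<alpha>n by (simp add: field_simps)
  finally show ?thesis .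
qed

text \<open>With \<open>\<alpha> n\<close> zero, \<open>\<beta> n\<close> is the square of a number
  that is at most -1/2.\<close>

lemma \<beta>n_pos: "\<beta> n > 0"
proof -
  have "\<alpha> (n - 1) \<le> 0" using n2 \<alpha>_nonpos[of "n - 1"] by auto
  then have "(\<alpha> (n - 1) - 1 / 2)\<^sup>2 > 0" by (intro zero_less_power2[THEN iffD2]) auto
  then show ?thesis using \<beta>i[of n] n2 \<alpha>n by simp
qed

lemma hardy_potential_Suc:
  "hardy_potential e \<beta> n x = hardy_potential e \<beta> (n - 1) x + \<beta> n / (norm x)\<^sup>2"
proof -
  obtain m where m: "n = Suc m" using n2 by (cases n) auto
  show ?thesis unfolding rr_n[symmetric] hardy_potential_def rr_def[symmetric] by (simp add: m)
qed

lemma Ck_on_hardy_potential: "Ck_on k D (hardy_potential e \<beta> j)"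
proof -
  have "Ck_on k D (\<lambda>x. \<Sum>i=1..j. \<beta> i * inverse (rr i x))"
    by (intro Ck_on_sum Ck_on_mult Ck_on_const Ck_on_inverse_rr) auto
  then show ?thesis by (simp add: hardy_potential_def[abs_def] rr_def divide_inverse)
qed

end


subsection \<open>Ground state representation of the quadratic forms\<close>

lemma test_functions_zero_partial:
  "\<phi> \<in> test_functions D \<Longrightarrow> x \<notin> D \<Longrightarrow> partial i \<phi> x = 0"
  using test_functions_zero test_functions_partial by blast

lemma set_integral_test:
  fixes f :: "real ^ 'n::finite \<Rightarrow> 'b::{banach, second_countable_topology}"
  assumes "\<And>x. x \<in> D \<Longrightarrow> f x = g x" "\<And>x. x \<notin> D \<Longrightarrow> g x = 0"
  shows "(LINT x:D|lborel. f x) = (\<integral>x. g x \<partial>lborel)"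
  unfolding set_lebesgue_integral_def
  by (rule Bochner_Integration.integral_cong) (use assms in \<open>auto simp: indicator_def\<close>)

lemma test_functions_of_real:
  "\<phi> \<in> test_functions D \<Longrightarrow> (\<lambda>x. complex_of_real (\<phi> x)) \<in> test_functions D"
  by (rule test_functions_bounded_linear[OF bounded_linear_of_real])

lemma test_functions_cnj: "\<phi> \<in> test_functions D \<Longrightarrow> (\<lambda>x. cnj (\<phi> x)) \<in> test_functions D"
  by (rule test_functions_bounded_linear[OF bounded_linear_cnj])

lemma test_functions_mult':
  fixes \<phi> \<psi> :: "real ^ 'n::finite \<Rightarrow> 'b::real_normed_algebra"
  assumes "open D" "\<phi> \<in> test_functions D" "\<psi> \<in> test_functions D"
  shows "(\<lambda>x. \<phi> x * \<psi> x) \<in> test_functions D"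
  by (rule test_functions_mult[OF assms(1) test_functions_Ck[OF assms(2)] assms(3)])

context hardy_weights
begin

abbreviation "W \<equiv> \<lambda>x. \<beta> n / (norm x)\<^sup>2"
abbreviation "V0 \<equiv> hardy_potential e \<beta> (n - 1)"
abbreviation "Vn \<equiv> hardy_potential e \<beta> n"
abbreviation "T \<equiv> test_functions D :: (real ^ 'n \<Rightarrow> complex) set"
abbreviation "M \<equiv> weighted_measure D W"
abbreviation "A \<equiv> \<lambda>\<phi> x. (1 / W x) *\<^sub>R schroedinger V0 \<phi> x"

text \<open>\<open>dh \<phi> = u \<nabla>(\<phi> / u)\<close> for the ground state \<open>u = exp hlog\<close>.\<close>

definition dh :: "'n \<Rightarrow> (real ^ 'n \<Rightarrow> 'b::real_normed_vector) \<Rightarrow> real ^ 'n \<Rightarrow> 'b"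
  where "dh i \<phi> x = partial i \<phi> x - hgrad i x *\<^sub>R \<phi> x"

definition En :: "(real ^ 'n \<Rightarrow> real) \<Rightarrow> real"
  where "En \<phi> = (\<integral>x. (\<Sum>i\<in>UNIV. (dh i \<phi> x)\<^sup>2) \<partial>lborel)"

lemma norm_pos: "x \<in> D \<Longrightarrow> norm x > 0"
  by (auto simp: D_iff)

lemma W_pos: "x \<in> D \<Longrightarrow> W x > 0"
  using \<beta>n_pos norm_pos by simp

lemma Ck_on_W: "Ck_on k D W"
proof -
  have "Ck_on k D (\<lambda>x. \<beta> n * inverse (rr n x))"
    using n2 by (intro Ck_on_mult Ck_on_const Ck_on_inverse_rr) auto
  then show ?thesis by (simp add: rr_n divide_inverse)
qed

lemma Ck_on_inverse_W: "Ck_on k D (\<lambda>x. 1 / W x)"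
proof -
  have "Ck_on k D (\<lambda>x. inverse (\<beta> n) * rr n x)"
    by (intro Ck_on_mult Ck_on_const Ck_on_rr) auto
  then show ?thesis by (simp add: rr_n divide_inverse mult.commute)
qed

lemma hgrad_differentiable: "x \<in> D \<Longrightarrow> hgrad i differentiable (at x)"
  using Ck_on_hgrad[of "Suc 0" i] by simp

lemma dh_test: "\<phi> \<in> test_functions D \<Longrightarrow> dh i \<phi> \<in> test_functions D"
  unfolding dh_def[abs_def]
  by (intro test_functions_diff test_functions_partial test_functions_scaleR Ck_on_hgrad open_D)

lemma dh_zero: "\<phi> \<in> test_functions D \<Longrightarrow> x \<notin> D \<Longrightarrow> dh i \<phi> x = 0"
  using dh_test test_functions_zero by blast

lemma En_integrable:
  fixes \<phi> :: "real ^ 'n \<Rightarrow> real"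
  shows "\<phi> \<in> test_functions D \<Longrightarrow> integrable lborel (\<lambda>x. \<Sum>i\<in>UNIV. (dh i \<phi> x)\<^sup>2)"
  unfolding power2_eq_square
  by (intro test_functions_integrable[where D=D] test_functions_sum test_functions_mult' dh_test open_D)

lemma En_nonneg: "0 \<le> En \<phi>"
  unfolding En_def by (intro integral_nonneg_AE AE_I2 sum_nonneg) auto

text \<open>The Riccati equation completes the square: |grad phi|^2 - V phi^2 is the squared length
  of dh phi plus the divergence of phi^2 times the gradient of \<open>hlog\<close>, and that
  divergence integrates to zero.\<close>

lemma quad_form_Vn:
  assumes \<phi>: "\<phi> \<in> test_functions D"
  shows "quad_form D Vn \<phi> = En \<phi>"
proof -
  let ?F = "\<lambda>i x. hgrad i x * (\<phi> x * \<phi> x)"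
  have F: "?F i \<in> test_functions D" for i
    by (intro test_functions_mult[OF open_D] test_functions_mult' \<phi> Ck_on_hgrad open_D)
  have "quad_form D Vn \<phi> = (\<integral>x. (\<Sum>i\<in>UNIV. (dh i \<phi> x)\<^sup>2) + (\<Sum>i\<in>UNIV. partial i (?F i) x) \<partial>lborel)"
    unfolding quad_form_def
  proof (rule set_integral_test)
    fix x assume x: "x \<in> D"
    note d = test_functions_differentiable[OF \<phi>, of x]
    have "partial i (?F i) x = partial i (hgrad i) x * (\<phi> x)\<^sup>2 + hgrad i x * (2 * \<phi> x * partial i \<phi> x)" for i
      using partial_mult[OF hgrad_differentiable[OF x] differentiable_mult[OF d d], of i i] partial_mult[OF d d, of i]
      by (simp add: power2_eq_square)
    then have "(\<Sum>i\<in>UNIV. (dh i \<phi> x)\<^sup>2) + (\<Sum>i\<in>UNIV. partial i (?F i) x) =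
        (\<Sum>i\<in>UNIV. (partial i \<phi> x)\<^sup>2 + (partial i (hgrad i) x + (hgrad i x)\<^sup>2) * (\<phi> x)\<^sup>2)"
      unfolding sum.distrib[symmetric] by (intro sum.cong refl) (simp add: dh_def power2_eq_square algebra_simps)
    also have "\<dots> = (\<Sum>i\<in>UNIV. (partial i \<phi> x)\<^sup>2) - Vn x * (\<phi> x)\<^sup>2"
      unfolding sum.distrib sum_distrib_right[symmetric] using hlog_Riccati[OF x] by (simp add: sum.distrib)
    finally show "(\<Sum>i\<in>UNIV. (partial i \<phi> x)\<^sup>2) - Vn x * (\<phi> x)\<^sup>2 =
        (\<Sum>i\<in>UNIV. (dh i \<phi> x)\<^sup>2) + (\<Sum>i\<in>UNIV. partial i (?F i) x)" by simp
  qed (simp add: dh_zero[OF \<phi>] test_functions_zero_partial[OF F])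
  also have "\<dots> = En \<phi>"
    using En_integrable[OF \<phi>] test_functions_integrable[OF test_functions_partial[OF F]] integral_partial_test_function[OF F]
    by (simp add: En_def)
  finally show ?thesis .
qed

lemma weighted_mass_eq:
  assumes \<phi>: "\<phi> \<in> test_functions D"
  shows "weighted_mass D W \<phi> = (\<integral>x. W x * (\<phi> x)\<^sup>2 \<partial>lborel)"
  unfolding weighted_mass_def by (rule set_integral_test) (use test_functions_zero[OF \<phi>] in auto)

lemma W_integrable:
  fixes \<phi> :: "real ^ 'n \<Rightarrow> real"
  assumes \<phi>: "\<phi> \<in> test_functions D"
  shows "integrable lborel (\<lambda>x. W x * (\<phi> x)\<^sup>2)"
  unfolding power2_eq_square[of "\<phi> _"]
  by (intro test_functions_integrable[where D=D] test_functions_mult Ck_on_W test_functions_Ck[OF \<phi>] \<phi> open_D)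

text \<open>Since \<open>Vn\<close> is the sum of \<open>V0\<close> and W, the slack in the Hardy
  inequality with weight W is exactly \<open>En\<close>.\<close>

lemma quad_form_V0:
  assumes \<phi>: "\<phi> \<in> test_functions D"
  shows "quad_form D V0 \<phi> = En \<phi> + weighted_mass D W \<phi>"
proof -
  have p: "(\<lambda>x. \<Sum>i\<in>UNIV. (partial i \<phi> x)\<^sup>2) \<in> test_functions D"
    unfolding power2_eq_square by (intro test_functions_sum test_functions_mult' test_functions_partial \<phi> open_D)
  have v: "(\<lambda>x. Vn x * (\<phi> x)\<^sup>2) \<in> test_functions D"
    unfolding power2_eq_square by (intro test_functions_mult test_functions_Ck[OF \<phi>] Ck_on_hardy_potential \<phi> open_D)
  have "quad_form D V0 \<phi> = (\<integral>x. ((\<Sum>i\<in>UNIV. (partial i \<phi> x)\<^sup>2) - Vn x * (\<phi> x)\<^sup>2) + W x * (\<phi> x)\<^sup>2 \<partial>lborel)"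
    unfolding quad_form_def
    by (rule set_integral_test) (simp_all add: hardy_potential_Suc left_diff_distrib distrib_right
        test_functions_zero[OF \<phi>] test_functions_zero_partial[OF \<phi>])
  also have "\<dots> = (\<integral>x. ((\<Sum>i\<in>UNIV. (partial i \<phi> x)\<^sup>2) - Vn x * (\<phi> x)\<^sup>2) \<partial>lborel) + weighted_mass D W \<phi>"
    unfolding weighted_mass_eq[OF \<phi>]
    by (intro Bochner_Integration.integral_add W_integrable \<phi> Bochner_Integration.integrable_diff
        test_functions_integrable[OF p] test_functions_integrable[OF v])
  also have "(\<integral>x. ((\<Sum>i\<in>UNIV. (partial i \<phi> x)\<^sup>2) - Vn x * (\<phi> x)\<^sup>2) \<partial>lborel) = quad_form D Vn \<phi>"
    unfolding quad_form_def
    by (rule set_integral_test[symmetric]) (simp_all add: test_functions_zero[OF \<phi>] test_functions_zero_partial[OF \<phi>])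
  finally show ?thesis by (simp add: quad_form_Vn[OF \<phi>])
qed

lemma M_density: "M = density lborel (\<lambda>x. ennreal (indicator D x * W x))"
  unfolding weighted_measure_def
  by (intro arg_cong[where f="density lborel"] ext) (auto simp: indicator_def)

lemma sets_M [simp]: "sets M = sets borel" and space_M [simp]: "space M = UNIV"
  by (simp_all add: weighted_measure_def)

lemma borel_D [measurable]: "D \<in> sets borel" by (simp add: borel_open)

lemma measurable_M: "borel_measurable M = borel_measurable borel"
  by (rule measurable_cong_sets) simp_all

lemma weight_nonneg: "0 \<le> indicator D x * W x"
  using \<beta>n_pos by (auto simp: indicator_def)

lemma weight_measurable [measurable]: "(\<lambda>x. indicator D x * W x) \<in> borel_measurable lborel"
  by measurable

lemma integral_M:
  fixes f :: "real ^ 'n \<Rightarrow> 'b::{banach, second_countable_topology}"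
  assumes "f \<in> borel_measurable borel"
  shows "(\<integral>x. f x \<partial>M) = (\<integral>x. (indicator D x * W x) *\<^sub>R f x \<partial>lborel)"
  unfolding M_density by (rule integral_density) (use assms weight_nonneg in auto)

lemma integrable_M:
  fixes f :: "real ^ 'n \<Rightarrow> 'b::{banach, second_countable_topology}"
  assumes "f \<in> borel_measurable borel"
  shows "integrable M f \<longleftrightarrow> integrable lborel (\<lambda>x. (indicator D x * W x) *\<^sub>R f x)"
  unfolding M_density by (rule integrable_density) (use assms weight_nonneg in auto)

lemma sigma_finite_M: "sigma_finite_measure M"
  unfolding M_density
  by (subst sigma_finite_measure.sigma_finite_iff_density_finite[OF sigma_finite_lborel]) auto

lemma T_L2: "\<phi> \<in> T \<Longrightarrow> \<phi> \<in> L2 M"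
proof -
  assume \<phi>: "\<phi> \<in> T"
  have b: "\<phi> \<in> borel_measurable borel" by (rule test_functions_measurable[OF \<phi>])
  have "(\<lambda>x. Re (\<phi> x * cnj (\<phi> x))) \<in> test_functions D"
    by (rule test_functions_bounded_linear[OF bounded_linear_Re]) (intro test_functions_mult' test_functions_cnj \<phi> open_D)
  then have "(\<lambda>x. (cmod (\<phi> x))\<^sup>2) \<in> test_functions D"
    by (simp add: complex_mult_cnj cmod_power2)
  then have t: "(\<lambda>x. W x *\<^sub>R (cmod (\<phi> x))\<^sup>2) \<in> test_functions D"
    by (intro test_functions_scaleR Ck_on_W open_D)
  have "integrable lborel (\<lambda>x. (indicator D x * W x) *\<^sub>R (cmod (\<phi> x))\<^sup>2)"
    by (rule Bochner_Integration.integrable_cong[THEN iffD1, OF refl _ test_functions_integrable[OF t]])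
       (use test_functions_zero[OF \<phi>] in \<open>auto simp: indicator_def\<close>)
  then show "\<phi> \<in> L2 M"
    unfolding L2_def measurable_M using b by (auto simp: integrable_M[of "\<lambda>x. (cmod (\<phi> x))\<^sup>2"])
qed

lemma schroedinger_test: "\<phi> \<in> test_functions D \<Longrightarrow> schroedinger (hardy_potential e \<beta> j) \<phi> \<in> test_functions D"
  unfolding schroedinger_def[abs_def]
  by (intro test_functions_diff test_functions_minus test_functions_laplacian test_functions_scaleR Ck_on_hardy_potential open_D)

lemma A_test: "\<phi> \<in> T \<Longrightarrow> A \<phi> \<in> T"
  by (intro test_functions_scaleR Ck_on_inverse_W schroedinger_test open_D)

lemma A_L2: "\<phi> \<in> T \<Longrightarrow> A \<phi> \<in> L2 M"
  by (intro T_L2 A_test)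

lemma L2_inner_M:
  assumes "\<phi> \<in> T" "\<psi> \<in> L2 M"
  shows "L2_inner M \<phi> \<psi> = (\<integral>x. W x *\<^sub>R (\<phi> x * cnj (\<psi> x)) \<partial>lborel)"
proof -
  have b: "(\<lambda>x. \<phi> x * cnj (\<psi> x)) \<in> borel_measurable borel"
    using L2_mult_integrable[OF T_L2[OF assms(1)] assms(2)] borel_measurable_integrable measurable_M by blast
  show ?thesis unfolding L2_inner_def integral_M[OF b]
    by (rule Bochner_Integration.integral_cong) (use test_functions_zero[OF assms(1)] in \<open>auto simp: indicator_def\<close>)
qed

lemma L2_inner_A:
  assumes "\<phi> \<in> T" "\<psi> \<in> L2 M"
  shows "L2_inner M (A \<phi>) \<psi> = (\<integral>x. schroedinger V0 \<phi> x * cnj (\<psi> x) \<partial>lborel)"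
  unfolding L2_inner_M[OF A_test[OF assms(1)] assms(2)]
proof (rule Bochner_Integration.integral_cong[OF refl])
  fix x
  show "W x *\<^sub>R (A \<phi> x * cnj (\<psi> x)) = schroedinger V0 \<phi> x * cnj (\<psi> x)"
  proof (cases "x \<in> D")
    case True
    then have "W x * (1 / W x) = 1" using W_pos[OF True] by (metis less_irrefl nonzero_eq_divide_eq mult.commute)
    then have "W x *\<^sub>R (A \<phi> x) = schroedinger V0 \<phi> x" by (simp only: scaleR_scaleR scaleR_one)
    then show ?thesis by (metis mult_scaleR_left)
  next
    case False
    then show ?thesis using test_functions_zero[OF schroedinger_test[OF assms(1)] False] by simp
  qed
qed

lemma partial_cnj:
  "\<phi> differentiable (at x) \<Longrightarrow> partial i (\<lambda>x. cnj (\<phi> x)) x = cnj (partial i \<phi> x)"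
  by (rule partial_bounded_linear[OF bounded_linear_cnj])

lemma dh_integrable:
  assumes "\<phi> \<in> T" "\<psi> \<in> T"
  shows "integrable lborel (\<lambda>x. \<Sum>i\<in>UNIV. dh i \<phi> x * cnj (dh i \<psi> x))"
  by (intro test_functions_integrable[where D=D] test_functions_sum test_functions_mult' test_functions_cnj dh_test assms open_D)

text \<open>Integration by parts against the field \<open>dh i \<phi> * cnj \<psi>\<close>: by the
  Riccati equation, subtracting its divergence from the product of the dh terms leaves the operator
  with potential \<open>Vn\<close>, and the last summand restores \<open>V0\<close>.\<close>

lemma form_representation:
  assumes \<phi>: "\<phi> \<in> T" and \<psi>: "\<psi> \<in> T"
  shows "L2_inner M (A \<phi>) \<psi> = (\<integral>x. (\<Sum>i\<in>UNIV. dh i \<phi> x * cnj (dh i \<psi> x)) \<partial>lborel) + L2_inner M \<phi> \<psi>"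
proof -
  let ?F = "\<lambda>i x. dh i \<phi> x * cnj (\<psi> x)"
  have F: "?F i \<in> T" for i
    by (intro test_functions_mult' test_functions_cnj dh_test \<phi> \<psi> open_D)
  have W: "(\<lambda>x. W x *\<^sub>R (\<phi> x * cnj (\<psi> x))) \<in> T"
    by (intro test_functions_scaleR Ck_on_W test_functions_mult' test_functions_cnj \<phi> \<psi> open_D)
  have "schroedinger V0 \<phi> x * cnj (\<psi> x) = ((\<Sum>i\<in>UNIV. dh i \<phi> x * cnj (dh i \<psi> x)) - (\<Sum>i\<in>UNIV. partial i (?F i) x))
      + W x *\<^sub>R (\<phi> x * cnj (\<psi> x))" for x
  proof (cases "x \<in> D")
    case x: True
    note d = test_functions_differentiable
    have "partial i (dh i \<phi>) x = partial i (partial i \<phi>) x - partial i (hgrad i) x *\<^sub>R \<phi> x - hgrad i x *\<^sub>R partial i \<phi> x" for i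
    proof -
      have "partial i (dh i \<phi>) x = partial i (partial i \<phi>) x - partial i (\<lambda>x. hgrad i x *\<^sub>R \<phi> x) x"
        unfolding dh_def[abs_def]
        by (rule partial_diff[OF d[OF test_functions_partial[OF \<phi>]]
              d[OF test_functions_scaleR[OF open_D Ck_on_hgrad \<phi>]]])
      then show ?thesis by (simp add: partial_scaleR[OF hgrad_differentiable[OF x] d[OF \<phi>]])
    qed
    then have p: "partial i (?F i) x = (partial i (partial i \<phi>) x - partial i (hgrad i) x *\<^sub>R \<phi> x - hgrad i x *\<^sub>R partial i \<phi> x) * cnj (\<psi> x)
        + dh i \<phi> x * cnj (partial i \<psi> x)" for i
      by (simp add: partial_mult[OF d[OF dh_test[OF \<phi>]] d[OF test_functions_cnj[OF \<psi>]]] partial_cnj[OF d[OF \<psi>]])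
    have "dh i \<phi> x * cnj (dh i \<psi> x) - partial i (?F i) x =
        - partial i (partial i \<phi>) x * cnj (\<psi> x) + (partial i (hgrad i) x + (hgrad i x)\<^sup>2) *\<^sub>R (\<phi> x * cnj (\<psi> x))" for i
      unfolding p unfolding dh_def by (simp add: scaleR_conv_of_real power2_eq_square algebra_simps)
    then have "(\<Sum>i\<in>UNIV. dh i \<phi> x * cnj (dh i \<psi> x)) - (\<Sum>i\<in>UNIV. partial i (?F i) x) =
        - laplacian \<phi> x * cnj (\<psi> x) + (- Vn x) *\<^sub>R (\<phi> x * cnj (\<psi> x))"
      unfolding sum_subtractf[symmetric] hlog_Riccati[OF x, symmetric]
      by (simp add: sum.distrib sum_subtractf sum_negf laplacian_def sum_distrib_right scaleR_sum_left scaleR_left_distrib)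
    then show ?thesis
      by (simp add: schroedinger_def hardy_potential_Suc algebra_simps)
  next
    case False
    then show ?thesis
      using test_functions_zero[OF schroedinger_test[OF \<phi>] False] test_functions_zero[OF \<phi> False]
        dh_zero[OF \<phi> False] test_functions_zero_partial[OF F False] by simp
  qed
  then show ?thesis
    unfolding L2_inner_A[OF \<phi> T_L2[OF \<psi>]] L2_inner_M[OF \<phi> T_L2[OF \<psi>]]
    using dh_integrable[OF \<phi> \<psi>] test_functions_integrable[OF W] test_functions_integrable[OF test_functions_partial[OF F]]
      integral_partial_test_function[OF F] by simp
qed

lemma A_lin:
  assumes "\<phi> \<in> T" "\<psi> \<in> T"
  shows "A (\<lambda>x. \<phi> x + c * \<psi> x) x = A \<phi> x + c * A \<psi> x"
proof -
  note d = test_functions_differentiable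
  have c: "(\<lambda>x. c * \<psi> x) \<in> T" by (rule test_functions_cmult[OF assms(2)])
  have p: "partial i (\<lambda>x. \<phi> x + c * \<psi> x) = (\<lambda>x. partial i \<phi> x + c * partial i \<psi> x)"
    if "\<phi> \<in> T" "\<psi> \<in> T" for \<phi> \<psi> i
    by (rule ext) (simp add: partial_add[OF d[OF that(1)] d[OF test_functions_cmult[OF that(2)]]]
        partial_bounded_linear[OF bounded_linear_mult_right d[OF that(2)]])
  have "laplacian (\<lambda>x. \<phi> x + c * \<psi> x) x = laplacian \<phi> x + c * laplacian \<psi> x"
    unfolding laplacian_def p[OF assms] p[OF test_functions_partial[OF assms(1)] test_functions_partial[OF assms(2)]]
    by (simp add: sum.distrib sum_distrib_left)
  then show ?thesis by (simp add: schroedinger_def algebra_simps)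
qed

text \<open>Symmetry and the lower bound by one are read off from
  \<open>form_representation\<close>: its right side is Hermitian, and on the diagonal the first
  summand is nonnegative.\<close>

lemma form_operator: "form_operator M T A"
proof -
  have herm: "L2_inner M (A g) f = cnj (L2_inner M (A f) g)" if "f \<in> T" "g \<in> T" for f g
    unfolding form_representation[OF that] form_representation[OF that(2,1)] complex_cnj_add
      Bochner_Integration.integral_cnj[symmetric] L2.herm[OF T_L2[OF that(1)] T_L2[OF that(2)]]
    by (simp add: mult.commute cnj_sum del: Bochner_Integration.integral_cnj)
  have ge: "(L2_norm M f)\<^sup>2 \<le> Re (L2_inner M (A f) f)" if "f \<in> T" for f
  proof -
    have "(\<integral>x. (\<Sum>i\<in>UNIV. dh i f x * cnj (dh i f x)) \<partial>lborel) = complex_of_real (\<integral>x. (\<Sum>i\<in>UNIV. (cmod (dh i f x))\<^sup>2) \<partial>lborel)"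
      by (simp add: complex_norm_square[symmetric] flip: integral_complex_of_real)
    moreover have "0 \<le> (\<integral>x. (\<Sum>i\<in>UNIV. (cmod (dh i f x))\<^sup>2) \<partial>lborel)"
      by (intro integral_nonneg_AE AE_I2 sum_nonneg) auto
    ultimately show ?thesis unfolding form_representation[OF that that] L2_inner_self_norm by simp
  qed
  show ?thesis
  proof (intro form_operator.intro sigma_finite_M semi_inner.intro form_operator_axioms.intro)
    fix f g k :: "real ^ 'n \<Rightarrow> complex" and c
    assume f: "f \<in> T" and g: "g \<in> T"
    show "(\<lambda>x. f x + c * g x) \<in> T" by (intro test_functions_add test_functions_cmult f g)
    show "L2_inner M (A g) f = cnj (L2_inner M (A f) g)" by (rule herm[OF f g])
    assume k: "k \<in> T"
    show "L2_inner M (A (\<lambda>x. f x + c * g x)) k = L2_inner M (A f) k + c * L2_inner M (A g) k"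
      unfolding A_lin[OF f g] by (rule L2.lin_left[OF A_L2[OF f] A_L2[OF g] T_L2[OF k]])
  next
    fix f assume f: "f \<in> T"
    show "0 \<le> Re (L2_inner M (A f) f)" using ge[OF f] zero_le_power2 order_trans by blast
  qed (use T_L2 A_L2 ge in auto)
qed

sublocale form_operator M T A by (rule form_operator)

lemma dh_of_real:
  fixes \<phi> :: "real ^ 'n \<Rightarrow> real"
  assumes "\<phi> \<in> test_functions D"
  shows "dh i (\<lambda>x. complex_of_real (\<phi> x)) x = of_real (dh i \<phi> x)"
  unfolding dh_def partial_bounded_linear[OF bounded_linear_of_real test_functions_differentiable[OF assms]]
  by (simp add: scaleR_conv_of_real)

lemma L2_norm_of_real:
  assumes \<phi>: "\<phi> \<in> test_functions D"
  shows "(L2_norm M (\<lambda>x. complex_of_real (\<phi> x)))\<^sup>2 = weighted_mass D W \<phi>"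
proof -
  have "complex_of_real ((L2_norm M (\<lambda>x. complex_of_real (\<phi> x)))\<^sup>2) = of_real (weighted_mass D W \<phi>)"
    unfolding L2_inner_self_norm[symmetric] weighted_mass_eq[OF \<phi>]
      L2_inner_M[OF test_functions_of_real[OF \<phi>] T_L2[OF test_functions_of_real[OF \<phi>]]]
    by (simp add: scaleR_conv_of_real power2_eq_square flip: integral_complex_of_real)
  then show ?thesis by (simp only: of_real_eq_iff)
qed

lemma form_of_real:
  assumes \<phi>: "\<phi> \<in> test_functions D"
  shows "Re (L2_inner M (A (\<lambda>x. complex_of_real (\<phi> x))) (\<lambda>x. complex_of_real (\<phi> x))) = quad_form D V0 \<phi>"
proof -
  have c: "(\<lambda>x. complex_of_real (\<phi> x)) \<in> T" by (rule test_functions_of_real[OF \<phi>])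
  have "(\<integral>x. (\<Sum>i\<in>UNIV. dh i (\<lambda>x. complex_of_real (\<phi> x)) x * cnj (dh i (\<lambda>x. complex_of_real (\<phi> x)) x)) \<partial>lborel) = complex_of_real (En \<phi>)"
    unfolding dh_of_real[OF \<phi>] En_def by (simp add: power2_eq_square flip: integral_complex_of_real)
  then show ?thesis
    unfolding form_representation[OF c c] L2_inner_self_norm L2_norm_of_real[OF \<phi>] quad_form_V0[OF \<phi>] by simp
qed

end


subsection \<open>Integration of products depending on the first coordinate\<close>

text \<open>Tonelli: with the coordinate i0 frozen at s, the integrand is a product of functions of
  one coordinate each, and the integral over the others factorizes. Extended nonnegative values
  permit kernels that are infinite on null sets.\<close>

lemma nn_integral_vec_prod:
  fixes i0 :: "'n::finite" and G :: "real \<Rightarrow> ennreal" and \<kappa> :: "'n \<Rightarrow> real \<Rightarrow> real \<Rightarrow> ennreal"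
  assumes [measurable]: "G \<in> borel_measurable borel"
    and \<kappa>[measurable]: "\<And>i. case_prod (\<kappa> i) \<in> borel_measurable (borel \<Otimes>\<^sub>M borel)"
  shows "(\<integral>\<^sup>+x. G (x $ i0) * (\<Prod>i\<in>UNIV - {i0}. \<kappa> i (x $ i0) (x $ i)) \<partial>(lborel :: (real ^ 'n) measure)) =
    (\<integral>\<^sup>+s. G s * (\<Prod>i\<in>UNIV - {i0}. \<integral>\<^sup>+y. \<kappa> i s y \<partial>lborel) \<partial>lborel)"
proof -
  let ?b = "\<lambda>i::'n. axis i (1::real)"
  let ?B = "Basis :: (real ^ 'n) set"
  let ?I = "?b ` (UNIV - {i0})"
  interpret product_sigma_finite "\<lambda>b::real^'n. lborel :: real measure"
    by standard
  have B: "?B = insert (?b i0) ?I" and nI: "?b i0 \<notin> ?I" and inj: "inj_on ?b A" for A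
    by (auto simp: Basis_vec_def axis_eq_axis inj_on_def)
  have comp: "(\<Sum>b\<in>?B. f b *\<^sub>R b) $ i = f (?b i)" for f i
  proof -
    have "(\<Sum>b\<in>?B. f b *\<^sub>R b) $ i = (\<Sum>b\<in>?B. f b *\<^sub>R b) \<bullet> ?b i" by (simp add: inner_axis)
    also have "\<dots> = f (?b i)" by (rule inner_sum_left_Basis) (auto simp: Basis_vec_def)
    finally show ?thesis .
  qed
  let ?H = "\<lambda>f. G (f (?b i0)) * (\<Prod>i\<in>UNIV - {i0}. \<kappa> i (f (?b i0)) (f (?b i)))"
  have mem: "?b i \<in> ?B" for i by (auto simp: Basis_vec_def)
  have [measurable]: "?H \<in> borel_measurable (Pi\<^sub>M ?B (\<lambda>b. lborel))"
    using mem by (intro borel_measurable_times_ennreal borel_measurable_prod_ennreal) measurable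
  have "(\<integral>\<^sup>+x. G (x $ i0) * (\<Prod>i\<in>UNIV - {i0}. \<kappa> i (x $ i0) (x $ i)) \<partial>(lborel :: (real ^ 'n) measure)) =
      (\<integral>\<^sup>+f. ?H f \<partial>Pi\<^sub>M ?B (\<lambda>b. lborel))"
  proof -
    have m1: "(\<lambda>f. \<Sum>b\<in>?B. f b *\<^sub>R b) \<in> borel_measurable (Pi\<^sub>M ?B (\<lambda>b. lborel))" by measurable
    have m2: "(\<lambda>x::real^'n. G (x $ i0) * (\<Prod>i\<in>UNIV - {i0}. \<kappa> i (x $ i0) (x $ i))) \<in> borel_measurable borel"
      by (intro borel_measurable_times_ennreal borel_measurable_prod_ennreal) measurable
    show ?thesis using m2
      by (subst lborel_eq[where 'a="real ^ 'n"], subst nn_integral_distr[OF m1]) (simp_all only: comp measurable_distr_eq1)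
  qed
  also have "\<dots> = (\<integral>\<^sup>+s. (\<integral>\<^sup>+f. ?H (f(?b i0 := s)) \<partial>Pi\<^sub>M ?I (\<lambda>b. lborel)) \<partial>lborel)"
    unfolding B by (rule product_nn_integral_insert_rev) (use nI in \<open>auto simp flip: B\<close>)
  also have "\<dots> = (\<integral>\<^sup>+s. G s * (\<Prod>i\<in>UNIV - {i0}. \<integral>\<^sup>+y. \<kappa> i s y \<partial>lborel) \<partial>lborel)"
  proof (rule nn_integral_cong)
    fix s
    let ?\<kappa> = "\<lambda>b. \<kappa> (the_inv ?b b) s"
    have inv: "the_inv ?b (?b i) = i" for i by (rule the_inv_f_f) (rule inj)
    have [measurable]: "\<kappa> i s \<in> borel_measurable borel" for i
    proof -
      have "(\<lambda>y. case_prod (\<kappa> i) (s, y)) \<in> borel_measurable borel" by measurable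
      then show ?thesis by simp
    qed
    have "(\<integral>\<^sup>+f. ?H (f(?b i0 := s)) \<partial>Pi\<^sub>M ?I (\<lambda>b. lborel)) =
        (\<integral>\<^sup>+f. G s * (\<Prod>b\<in>?I. ?\<kappa> b (f b)) \<partial>Pi\<^sub>M ?I (\<lambda>b. lborel))"
      by (rule nn_integral_cong) (auto simp: prod.reindex[OF inj] inv axis_eq_axis intro!: arg_cong[where f="\<lambda>p. G s * p"] prod.cong)
    also have "\<dots> = G s * (\<integral>\<^sup>+f. (\<Prod>b\<in>?I. ?\<kappa> b (f b)) \<partial>Pi\<^sub>M ?I (\<lambda>b. lborel))"
      by (rule nn_integral_cmult) measurable
    also have "(\<integral>\<^sup>+f. (\<Prod>b\<in>?I. ?\<kappa> b (f b)) \<partial>Pi\<^sub>M ?I (\<lambda>b. lborel)) = (\<Prod>b\<in>?I. integral\<^sup>N lborel (?\<kappa> b))"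
      by (rule product_nn_integral_prod) auto
    also have "\<dots> = (\<Prod>i\<in>UNIV - {i0}. \<integral>\<^sup>+y. \<kappa> i s y \<partial>lborel)"
      by (simp add: prod.reindex[OF inj] inv)
    finally show "(\<integral>\<^sup>+f. ?H (f(?b i0 := s)) \<partial>Pi\<^sub>M ?I (\<lambda>b. lborel)) = G s * (\<Prod>i\<in>UNIV - {i0}. \<integral>\<^sup>+y. \<kappa> i s y \<partial>lborel)" .
  qed
  finally show ?thesis .
qed

lemma prod_mono_ennreal:
  fixes f g :: "'i \<Rightarrow> ennreal"
  shows "(\<And>i. i \<in> I \<Longrightarrow> f i \<le> g i) \<Longrightarrow> prod f I \<le> prod g I"
  by (induction I rule: infinite_finite_induct) (auto intro: mult_mono)

lemma nn_integral_even_le: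
  fixes f :: "real \<Rightarrow> ennreal"
  assumes [measurable]: "f \<in> borel_measurable borel"
  shows "(\<integral>\<^sup>+y. f \<bar>y\<bar> \<partial>lborel) \<le> 2 * (\<integral>\<^sup>+y. f y * indicator {0..} y \<partial>lborel)"
proof -
  have "(\<integral>\<^sup>+y. f \<bar>y\<bar> \<partial>lborel) \<le> (\<integral>\<^sup>+y. f y * indicator {0..} y + f (- y) * indicator {0..} (- y) \<partial>lborel)"
    by (intro nn_integral_mono) (auto simp: indicator_def)
  also have "\<dots> = (\<integral>\<^sup>+y. f y * indicator {0..} y \<partial>lborel) + (\<integral>\<^sup>+y. f (- y) * indicator {0..} (- y) \<partial>lborel)"
    by (rule nn_integral_add) measurable
  also have "(\<integral>\<^sup>+y. f (- y) * indicator {0..} (- y) \<partial>lborel) = (\<integral>\<^sup>+y. f y * indicator {0..} y \<partial>lborel)"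
    using nn_integral_real_affine[of "\<lambda>y. f y * indicator {0..} y" "-1" 0] by simp
  finally show ?thesis by (simp add: mult_2)
qed

text \<open>Homogeneous of degree \<open>-1\<close> in \<open>(s, y)\<close>, so that its integral over \<open>y\<close> is bounded
  independently of \<open>s\<close>.\<close>

lemma nn_integral_hom_kernel_le:
  assumes "\<sigma> > 0" "s > 0"
  shows "(\<integral>\<^sup>+y. ennreal (s powr \<sigma> * (max s \<bar>y\<bar>) powr (- 1 - \<sigma>)) \<partial>lborel) \<le> ennreal (2 * (1 + 1 / \<sigma>))"
proof -
  let ?f = "\<lambda>y. ennreal (s powr \<sigma> * (max s y) powr (- 1 - \<sigma>))"
  have "(\<integral>\<^sup>+y. ?f \<bar>y\<bar> \<partial>lborel) \<le> 2 * (\<integral>\<^sup>+y. ?f y * indicator {0..} y \<partial>lborel)"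
    by (rule nn_integral_even_le) measurable
  \<comment> \<open>Split at y = s: the kernel equals 1/s below, which contributes 1, and the tail
    above contributes 1 / sigma.\<close>
  also have "(\<integral>\<^sup>+y. ?f y * indicator {0..} y \<partial>lborel) \<le>
     (\<integral>\<^sup>+y. ennreal (1 / s) * indicator {0..s} y + ennreal (s powr \<sigma>) * (ennreal (y powr (- 1 - \<sigma>)) * indicator {s..} y) \<partial>lborel)"
  proof (intro nn_integral_mono)
    fix y :: real
    have "s powr \<sigma> * s powr (- 1 - \<sigma>) = 1 / s"
      using assms by (simp add: powr_add[symmetric] powr_minus_divide)
    then show "?f y * indicator {0..} y \<le> ennreal (1 / s) * indicator {0..s} y + ennreal (s powr \<sigma>) * (ennreal (y powr (- 1 - \<sigma>)) * indicator {s..} y)"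
      using assms by (cases "s \<le> y") (auto simp: indicator_def max_def ennreal_mult'' intro: add_increasing)
  qed
  also have "\<dots> = ennreal (1 / s) * ennreal s + ennreal (s powr \<sigma>) * (\<integral>\<^sup>+y. ennreal (y powr (- 1 - \<sigma>)) * indicator {s..} y \<partial>lborel)"
    using assms by (simp add: nn_integral_add nn_integral_cmult)
  also have "(\<integral>\<^sup>+y. ennreal (y powr (- 1 - \<sigma>)) * indicator {s..} y \<partial>lborel) = ennreal (- (s powr ((- 1 - \<sigma>) + 1)) / ((- 1 - \<sigma>) + 1))"
    by (rule nn_integral_has_integral_lebesgue'[OF _ has_integral_powr_to_inf]) (use assms in auto)
  also have "- (s powr ((- 1 - \<sigma>) + 1)) / ((- 1 - \<sigma>) + 1) = s powr (- \<sigma>) / \<sigma>"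
    by simp
  also have "ennreal (1 / s) * ennreal s + ennreal (s powr \<sigma>) * ennreal (s powr (- \<sigma>) / \<sigma>) = ennreal 1 + ennreal (1 / \<sigma>)"
    using assms by (simp add: ennreal_mult'[symmetric] powr_add[symmetric])
  also have "\<dots> = ennreal (1 + 1 / \<sigma>)" using assms by (intro ennreal_plus[symmetric]) auto
  also have "2 * ennreal (1 + 1 / \<sigma>) = ennreal (2 * (1 + 1 / \<sigma>))"
    using assms by (subst ennreal_mult) auto
  finally show ?thesis by (simp add: mult_left_mono)
qed

text \<open>Here 0 \<open>powr\<close> a is 0, which would spoil a pointwise upper bound at y = 0.
  The value \<open>top\<close> there repairs it and does not change the integral.\<close>

lemma nn_integral_power_kernel_le:
  assumes "0 < \<sigma>" "0 \<le> b"
  shows "(\<integral>\<^sup>+y. (if y = 0 then top else ennreal (\<bar>y\<bar> powr (\<sigma> - 1))) * indicator {-b..b} y \<partial>lborel) \<le> ennreal (2 * (b powr \<sigma> / \<sigma>))"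
proof -
  let ?f = "\<lambda>y. ennreal (y powr (\<sigma> - 1)) * indicator {0..b} y"
  have "(\<integral>\<^sup>+y. (if y = 0 then top else ennreal (\<bar>y\<bar> powr (\<sigma> - 1))) * indicator {-b..b} y \<partial>lborel) = (\<integral>\<^sup>+y. ?f \<bar>y\<bar> \<partial>lborel)"
    by (rule nn_integral_cong_AE, rule AE_mp[OF AE_lborel_singleton[of 0]]) (auto simp: indicator_def abs_if)
  also have "\<dots> \<le> 2 * (\<integral>\<^sup>+y. ?f y * indicator {0..} y \<partial>lborel)"
    by (rule nn_integral_even_le) measurable
  also have "(\<integral>\<^sup>+y. ?f y * indicator {0..} y \<partial>lborel) = (\<integral>\<^sup>+y. ?f y \<partial>lborel)"
    by (rule nn_integral_cong) (auto simp: indicator_def)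
  also have "\<dots> = ennreal (b powr ((\<sigma> - 1) + 1) / ((\<sigma> - 1) + 1))"
    by (rule nn_integral_has_integral_lebesgue'[OF _ has_integral_powr_from_0]) (use assms in auto)
  also have "2 * ennreal (b powr ((\<sigma> - 1) + 1) / ((\<sigma> - 1) + 1)) = ennreal (2 * (b powr \<sigma> / \<sigma>))"
    using assms by (subst ennreal_mult) auto
  finally show ?thesis by (simp add: mult_left_mono)
qed

context hardy_weights
begin

subsection \<open>Integrability of the squared ground state on annuli\<close>

text \<open>Distinct numbers contain at most one zero, and negative ones none; in the second case
  any m will do. A uniform gap for the other indices is what the integral estimates consume.\<close>

lemma at_most_one_zero:
  obtains m \<tau> where "m \<in> {1..n-1}" "\<tau> > 0" "\<And>j. j \<in> {1..n-1} \<Longrightarrow> j \<noteq> m \<Longrightarrow> - \<alpha> j \<ge> \<tau>"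
proof -
  obtain m where m: "m \<in> {1..n-1}" "\<And>j. j \<in> {1..n-1} \<Longrightarrow> j \<noteq> m \<Longrightarrow> \<alpha> j < 0"
  proof (cases "\<exists>m\<in>{1..n-1}. \<alpha> m = 0")
    case True
    then obtain m where m: "m \<in> {1..n-1}" "\<alpha> m = 0" by auto
    then have inj: "inj_on \<alpha> {1..n-1}" using inj_or_neg by (metis less_irrefl)
    have "\<alpha> j < 0" if "j \<in> {1..n-1}" "j \<noteq> m" for j
    proof -
      have "\<alpha> j \<noteq> \<alpha> m" using inj_onD[OF inj, of j m] that m(1) by blast
      moreover have "\<alpha> j \<le> 0" using that(1) by (intro \<alpha>_nonpos) auto
      ultimately show ?thesis using m(2) by linarith
    qed
    then show ?thesis using m that by blast
  next
    case False
    then have "\<alpha> j < 0" if "j \<in> {1..n-1}" for j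
      using \<alpha>_nonpos[of j] that by (auto simp: order_less_le)
    moreover have "1 \<in> {1..n-1}" using n2 by auto
    ultimately show ?thesis using that by blast
  qed
  \<comment> \<open>The inserted 1 keeps the set nonempty when m is the only index, as for n =
    2.\<close>
  define \<tau> where "\<tau> = Min (insert 1 ((\<lambda>j. - \<alpha> j) ` ({1..n-1} - {m})))"
  show ?thesis
  proof (rule that[OF m(1)])
    show "\<tau> > 0" unfolding \<tau>_def using m(2) by (subst Min_gr_iff) auto
    show "\<tau> \<le> - \<alpha> j" if "j \<in> {1..n-1}" "j \<noteq> m" for j
      unfolding \<tau>_def using that by (intro Min_le) auto
  qed
qed

text \<open>Abel summation. It is the logarithm of the product formula for u^2 in terms of the
  ratios r_j / r_(j+1), before the last \<open>\<alpha>\<close> is set to zero.\<close>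

lemma expo_Abel:
  "1 \<le> N \<Longrightarrow> (\<Sum>j=1..N. expo j * (2 * l j)) =
     2 * l 1 - (\<Sum>j=1..N. l j) - 2 * \<alpha> N * l N + (\<Sum>j=1..<N. 2 * \<alpha> j * (l (Suc j) - l j))"
proof (induction N)
  case (Suc N)
  show ?case
  proof (cases "N = 0")
    case True then show ?thesis by (simp add: expo_def algebra_simps)
  next
    case False
    then show ?thesis using Suc
      by (simp add: expo_def[of "Suc N"] sum.atLeastLessThan_Suc algebra_simps)
  qed
qed simp

text \<open>The increments of l are nonnegative, and each one except the m-th carries a coefficient
  at most -2 tau, so they telescope over the blocks below and above m. The gain is shared out among
  the coordinates: j <= m receives sigma (l j - l 1) and j > m receives sigma (l n - l j). There are
  at most n shares, hence the condition n sigma <= 2 tau.\<close>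

lemma hlog_upper:
  assumes m: "m \<in> {1..n-1}" and \<tau>: "\<tau> > 0" "\<And>j. j \<in> {1..n-1} \<Longrightarrow> j \<noteq> m \<Longrightarrow> - \<alpha> j \<ge> \<tau>"
    and \<sigma>: "0 < \<sigma>" "real n * \<sigma> \<le> 2 * \<tau>" and x: "x \<in> D"
  defines "l \<equiv> \<lambda>j. ln (rr j x) / 2"
  shows "2 * hlog x \<le> l 1 + (\<Sum>j=2..n. if j \<le> m then \<sigma> * l 1 - (1 + \<sigma>) * l j else (\<sigma> - 1) * l j - \<sigma> * l n)"
proof -
  have mono: "l j \<le> l k" if "1 \<le> j" "j \<le> k" for j k
    unfolding l_def using rr_pos[OF x] rr_mono[OF that(2), of x] that by simp
  have mn: "1 \<le> m" "m < n" using m n2 by auto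
  have "2 * hlog x = (\<Sum>j=1..n. expo j * (2 * l j))"
    unfolding hlog_def l_def sum_distrib_left by (intro sum.cong) auto
  also have "\<dots> = 2 * l 1 - (\<Sum>j=1..n. l j) + (\<Sum>j=1..<n. 2 * \<alpha> j * (l (Suc j) - l j))"
    using expo_Abel[of n l] n2 \<alpha>n by simp
  finally have eq: "2 * hlog x = 2 * l 1 - (\<Sum>j=1..n. l j) + (\<Sum>j=1..<n. 2 * \<alpha> j * (l (Suc j) - l j))" .
  have "(\<Sum>j=1..<n. 2 * \<alpha> j * (l (Suc j) - l j)) \<le> (\<Sum>j=1..<n. if j = m then 0 else - (2 * \<tau>) * (l (Suc j) - l j))"
  proof (rule sum_mono)
    fix j assume j: "j \<in> {1..<n}"
    have d: "0 \<le> l (Suc j) - l j" using mono[of j "Suc j"] j by simp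
    have "j \<in> {1..n-1}" using j by auto
    then show "2 * \<alpha> j * (l (Suc j) - l j) \<le> (if j = m then 0 else - (2 * \<tau>) * (l (Suc j) - l j))"
      using mult_right_mono[OF _ d, of "2 * \<alpha> j" "- (2 * \<tau>)"] \<tau>(2)[of j] mult_nonpos_nonneg[OF _ d, of "2 * \<alpha> j"] \<alpha>_nonpos[of j] j
      by auto
  qed
  also have "\<dots> = - (2 * \<tau>) * (\<Sum>j=1..<m. l (Suc j) - l j) - (2 * \<tau>) * (\<Sum>j=Suc m..<n. l (Suc j) - l j)"
  proof -
    have "{1..<n} = {1..<m} \<union> ({m} \<union> {Suc m..<n})" using mn by auto
    then have "(\<Sum>j=1..<n. if j = m then 0 else - (2 * \<tau>) * (l (Suc j) - l j)) =
      (\<Sum>j\<in>{1..<m}. if j = m then 0 else - (2 * \<tau>) * (l (Suc j) - l j)) +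
      (\<Sum>j\<in>{Suc m..<n}. if j = m then 0 else - (2 * \<tau>) * (l (Suc j) - l j))"
      by (simp only:) (subst sum.union_disjoint, auto)
    also have "(\<Sum>j\<in>{1..<m}. if j = m then 0 else - (2 * \<tau>) * (l (Suc j) - l j)) = - (2 * \<tau>) * (\<Sum>j=1..<m. l (Suc j) - l j)"
      unfolding sum_distrib_left by (rule sum.cong) auto
    also have "(\<Sum>j\<in>{Suc m..<n}. if j = m then 0 else - (2 * \<tau>) * (l (Suc j) - l j)) = - (2 * \<tau>) * (\<Sum>j=Suc m..<n. l (Suc j) - l j)"
      unfolding sum_distrib_left by (rule sum.cong) auto
    finally show ?thesis by simp
  qed
  also have "(\<Sum>j=1..<m. l (Suc j) - l j) = l m - l 1" using mn by (intro sum_Suc_diff') auto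
  also have "(\<Sum>j=Suc m..<n. l (Suc j) - l j) = l n - l (Suc m)" using mn by (intro sum_Suc_diff') auto
  finally have "2 * hlog x \<le> 2 * l 1 - (\<Sum>j=1..n. l j) - 2 * \<tau> * (l m - l 1) - 2 * \<tau> * (l n - l (Suc m))"
    using eq by simp
  moreover have "(\<Sum>j=2..m. \<sigma> * (l j - l 1)) \<le> 2 * \<tau> * (l m - l 1)"
  proof -
    have "(\<Sum>j=2..m. \<sigma> * (l j - l 1)) \<le> (\<Sum>j=2..m. \<sigma> * (l m - l 1))"
      using mono \<sigma> by (intro sum_mono mult_left_mono) auto
    also have "\<dots> = real (m - 1) * \<sigma> * (l m - l 1)" by simp
    also have "\<dots> \<le> 2 * \<tau> * (l m - l 1)"
      using mono[of 1 m] mn \<sigma> by (intro mult_right_mono order_trans[OF mult_right_mono \<sigma>(2)]) auto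
    finally show ?thesis .
  qed
  moreover have "(\<Sum>j=Suc m..n. \<sigma> * (l n - l j)) \<le> 2 * \<tau> * (l n - l (Suc m))"
  proof -
    have "(\<Sum>j=Suc m..n. \<sigma> * (l n - l j)) \<le> (\<Sum>j=Suc m..n. \<sigma> * (l n - l (Suc m)))"
      using mono \<sigma> mn by (intro sum_mono mult_left_mono) auto
    also have "\<dots> = real (n - m) * \<sigma> * (l n - l (Suc m))" using mn by simp
    also have "\<dots> \<le> 2 * \<tau> * (l n - l (Suc m))"
      using mono[of "Suc m" n] mn \<sigma> by (intro mult_right_mono order_trans[OF mult_right_mono \<sigma>(2)]) auto
    finally show ?thesis .
  qed
  moreover have "(\<Sum>j=1..n. l j) = l 1 + (\<Sum>j=2..m. l j) + (\<Sum>j=Suc m..n. l j)"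
  proof -
    have "{1..n} = insert 1 ({2..m} \<union> {Suc m..n})" using mn by auto
    then have "(\<Sum>j=1..n. l j) = l 1 + sum l ({2..m} \<union> {Suc m..n})"
      by (simp only:) (rule sum.insert, use mn in auto)
    also have "sum l ({2..m} \<union> {Suc m..n}) = sum l {2..m} + sum l {Suc m..n}"
      by (rule sum.union_disjoint) auto
    finally show ?thesis by simp
  qed
  moreover have "(\<Sum>j=2..n. if j \<le> m then \<sigma> * l 1 - (1 + \<sigma>) * l j else (\<sigma> - 1) * l j - \<sigma> * l n) =
    - (\<Sum>j=2..m. l j) - (\<Sum>j=2..m. \<sigma> * (l j - l 1)) - (\<Sum>j=Suc m..n. l j) - (\<Sum>j=Suc m..n. \<sigma> * (l n - l j))"
  proof -
    have "{2..n} = {2..m} \<union> {Suc m..n}" using mn by auto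
    then have "(\<Sum>j=2..n. if j \<le> m then \<sigma> * l 1 - (1 + \<sigma>) * l j else (\<sigma> - 1) * l j - \<sigma> * l n) =
      (\<Sum>j=2..m. if j \<le> m then \<sigma> * l 1 - (1 + \<sigma>) * l j else (\<sigma> - 1) * l j - \<sigma> * l n) +
      (\<Sum>j=Suc m..n. if j \<le> m then \<sigma> * l 1 - (1 + \<sigma>) * l j else (\<sigma> - 1) * l j - \<sigma> * l n)"
      by (simp only:) (subst sum.union_disjoint, auto)
    also have "(\<Sum>j=2..m. if j \<le> m then \<sigma> * l 1 - (1 + \<sigma>) * l j else (\<sigma> - 1) * l j - \<sigma> * l n) = (\<Sum>j=2..m. - l j - \<sigma> * (l j - l 1))"
      by (intro sum.cong) (auto simp: algebra_simps)
    also have "(\<Sum>j=Suc m..n. if j \<le> m then \<sigma> * l 1 - (1 + \<sigma>) * l j else (\<sigma> - 1) * l j - \<sigma> * l n) = (\<Sum>j=Suc m..n. - l j - \<sigma> * (l n - l j))"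
      by (intro sum.cong) (auto simp: algebra_simps)
    finally show ?thesis by (simp add: sum_subtractf sum_negf)
  qed
  ultimately show ?thesis by argo
qed

lemma hlog_measurable [measurable]: "hlog \<in> borel_measurable borel"
  unfolding hlog_def[abs_def] rr_def[abs_def] by measurable

lemma bij_rest: "bij_betw e {2..n} (UNIV - {e 1})"
proof -
  have "{2..n} = {1..n} - {1}" using n2 by auto
  then show ?thesis using bij_betw_DiffI[OF bij, of "{1}" "{e 1}"] n2 by (auto simp: bij_betw_def)
qed

text \<open>The exponential of \<open>hlog_upper\<close> is x_1 times one factor per remaining
  coordinate. Each factor is dominated by a kernel in x_1 and that coordinate alone whose integral
  over the coordinate is at most K, whatever x_1 is. After integration only the density s ds is
  left.\<close>

lemma weight_integral_bound:
  assumes "0 < a" "a \<le> b"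
  obtains C where "C \<ge> 0" "\<And>g. g \<in> borel_measurable borel \<Longrightarrow>
    (\<integral>\<^sup>+x. indicator {x\<in>D. a \<le> norm x \<and> norm x \<le> b} x * (ennreal (exp (2 * hlog x)) * g (x $ e 1)) \<partial>lborel)
      \<le> ennreal C * (\<integral>\<^sup>+s. indicator {0<..b} s * (ennreal s * g s) \<partial>lborel)"
proof -
  obtain m \<tau> where m: "m \<in> {1..n-1}" and \<tau>: "\<tau> > 0" "\<And>j. j \<in> {1..n-1} \<Longrightarrow> j \<noteq> m \<Longrightarrow> - \<alpha> j \<ge> \<tau>"
    using at_most_one_zero by blast
  \<comment> \<open>Below 1, so that the exponent sigma - 1 is negative and r_j may be replaced by
    the smaller |x_j|; at most 2 tau / n, the share of each coordinate.\<close>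
  define \<sigma> where "\<sigma> = min (1 / 2) (2 * \<tau> / real n)"
  have \<sigma>: "0 < \<sigma>" "\<sigma> < 1" "real n * \<sigma> \<le> 2 * \<tau>"
  proof -
    show "0 < \<sigma>" "\<sigma> < 1" using \<tau>(1) n2 by (auto simp: \<sigma>_def)
    have "\<sigma> \<le> 2 * \<tau> / real n" by (simp add: \<sigma>_def)
    then show "real n * \<sigma> \<le> 2 * \<tau>" using n2 by (simp add: field_simps)
  qed
  \<comment> \<open>For j <= m the kernel comes from r_j >= max x_1 |x_j|, for j > m from r_j >=
    |x_j| and r_n >= a.\<close>
  define \<kappa> where "\<kappa> j s y = (if j \<le> m then ennreal (s powr \<sigma> * (max s \<bar>y\<bar>) powr (- 1 - \<sigma>)) * indicator {0<..} s
      else ennreal (a powr (- \<sigma>)) * ((if y = 0 then top else ennreal (\<bar>y\<bar> powr (\<sigma> - 1))) * indicator {-b..b} y))"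
    for j :: nat and s y :: real
  define inve where "inve = the_inv_into {1..n} e"
  have inve: "inve (e j) = j" if "j \<in> {1..n}" for j unfolding inve_def using the_inv_into_f_f[OF e_inj that] .
  have m1: "(\<lambda>(s::real, y::real). if y = 0 then top else ennreal (\<bar>y\<bar> powr (\<sigma> - 1))) \<in> borel_measurable (borel \<Otimes>\<^sub>M borel)"
    by measurable
  have \<kappa>_meas: "case_prod (\<kappa> j) \<in> borel_measurable (borel \<Otimes>\<^sub>M borel)" for j
    unfolding \<kappa>_def by (cases "j \<le> m"; simp; measurable)
  define K where "K = max (2 * (1 + 1 / \<sigma>)) (a powr (- \<sigma>) * (2 * (b powr \<sigma> / \<sigma>)))"
  have K: "K \<ge> 0" using \<sigma> by (auto simp: K_def le_max_iff_disj)
  have \<kappa>_int: "(\<integral>\<^sup>+y. \<kappa> j s y \<partial>lborel) \<le> ennreal K" for j s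
  proof (cases "j \<le> m")
    case True
    show ?thesis
    proof (cases "s > 0")
      case s: True
      then have "(\<integral>\<^sup>+y. \<kappa> j s y \<partial>lborel) = (\<integral>\<^sup>+y. ennreal (s powr \<sigma> * (max s \<bar>y\<bar>) powr (- 1 - \<sigma>)) \<partial>lborel)"
        using True by (simp add: \<kappa>_def)
      also have "\<dots> \<le> ennreal (2 * (1 + 1 / \<sigma>))" by (rule nn_integral_hom_kernel_le[OF \<sigma>(1) s])
      also have "\<dots> \<le> ennreal K" by (intro ennreal_leI) (simp add: K_def)
      finally show ?thesis .
    qed (use True in \<open>simp add: \<kappa>_def\<close>)
  next
    case False
    then have "(\<integral>\<^sup>+y. \<kappa> j s y \<partial>lborel) = ennreal (a powr (- \<sigma>)) *
        (\<integral>\<^sup>+y. (if y = 0 then top else ennreal (\<bar>y\<bar> powr (\<sigma> - 1))) * indicator {-b..b} y \<partial>lborel)"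
      by (simp add: \<kappa>_def nn_integral_cmult)
    also have "\<dots> \<le> ennreal (a powr (- \<sigma>)) * ennreal (2 * (b powr \<sigma> / \<sigma>))"
      using assms \<sigma> by (intro mult_left_mono nn_integral_power_kernel_le) auto
    also have "\<dots> \<le> ennreal K" using \<sigma> by (simp add: K_def ennreal_mult'[symmetric] ennreal_leI)
    finally show ?thesis .
  qed
  have pointwise: "indicator {x\<in>D. a \<le> norm x \<and> norm x \<le> b} x * ennreal (exp (2 * hlog x)) \<le>
     (indicator {0<..b} (x $ e 1) * ennreal (x $ e 1)) * (\<Prod>i\<in>UNIV - {e 1}. \<kappa> (inve i) (x $ e 1) (x $ i))" for x
  proof (cases "x \<in> D \<and> a \<le> norm x \<and> norm x \<le> b")
    case True
    then have x: "x \<in> D" "a \<le> norm x" "norm x \<le> b" by auto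
    let ?s = "x $ e 1"
    have s: "?s > 0" using x by (simp add: D_iff)
    have comp_b: "\<bar>x $ i\<bar> \<le> b" for i using component_le_norm_cart[of x i] x(3) by linarith
    define l where "l j = ln (rr j x) / 2" for j
    have l1: "l 1 = ln ?s" unfolding l_def rr_1 using s by (simp add: ln_realpow)
    have ln_le: "ln \<bar>x $ e j\<bar> \<le> l j" if "j \<in> {1..n}" "x $ e j \<noteq> 0" for j
    proof -
      have "(x $ e j)\<^sup>2 \<le> rr j x" unfolding rr_def using that by (intro member_le_sum) auto
      then have "ln ((x $ e j)\<^sup>2) \<le> ln (rr j x)" using that rr_pos[OF x(1)] by (subst ln_le_cancel_iff) auto
      moreover have "ln ((x $ e j)\<^sup>2) = 2 * ln \<bar>x $ e j\<bar>" using that by (subst power2_abs[symmetric], subst ln_realpow) auto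
      ultimately show ?thesis by (simp add: l_def)
    qed
    have mono: "l j \<le> l k" if "1 \<le> j" "j \<le> k" for j k
      unfolding l_def using rr_pos[OF x(1)] rr_mono[OF that(2), of x] that by simp
    have ln_a: "ln a \<le> l n"
    proof -
      have "ln (norm x) = l n" unfolding l_def rr_n using norm_pos[OF x(1)] by (simp add: ln_realpow)
      then show ?thesis using x(2) assms norm_pos[OF x(1)] by (metis ln_le_cancel_iff)
    qed
    let ?p = "\<lambda>j. if j \<le> m then \<sigma> * l 1 - (1 + \<sigma>) * l j else (\<sigma> - 1) * l j - \<sigma> * l n"
    have p_le: "ennreal (exp (?p j)) \<le> \<kappa> j ?s (x $ e j)" if j: "j \<in> {2..n}" for j
    proof (cases "j \<le> m")
      case True
      have "ln (max ?s \<bar>x $ e j\<bar>) \<le> l j"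
        using ln_le[of j] j mono[of 1 j] l1 s by (cases "x $ e j = 0") (auto simp: max_def)
      then have "\<sigma> * l 1 - (1 + \<sigma>) * l j \<le> \<sigma> * ln ?s + (- 1 - \<sigma>) * ln (max ?s \<bar>x $ e j\<bar>)"
        using mult_left_mono[of "ln (max ?s \<bar>x $ e j\<bar>)" "l j" "1 + \<sigma>"] \<sigma> l1 by (simp add: algebra_simps)
      then have "exp (\<sigma> * l 1 - (1 + \<sigma>) * l j) \<le> ?s powr \<sigma> * (max ?s \<bar>x $ e j\<bar>) powr (- 1 - \<sigma>)"
        using s by (simp add: powr_def exp_add[symmetric])
      then show ?thesis using True s by (simp add: \<kappa>_def ennreal_leI)
    next
      case False
      show ?thesis
      proof (cases "x $ e j = 0")
        case True
        then show ?thesis using False assms by (simp add: \<kappa>_def ennreal_mult_top comp_b)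
      next
        case nz: False
        have "(\<sigma> - 1) * l j \<le> (\<sigma> - 1) * ln \<bar>x $ e j\<bar>"
          using ln_le[of j] j nz \<sigma> by (intro mult_left_mono_neg) auto
        moreover have "\<sigma> * ln a \<le> \<sigma> * l n" using ln_a \<sigma> by (intro mult_left_mono) auto
        ultimately have "exp ((\<sigma> - 1) * l j - \<sigma> * l n) \<le> a powr (- \<sigma>) * \<bar>x $ e j\<bar> powr (\<sigma> - 1)"
          using nz assms by (simp add: powr_def exp_add[symmetric])
        then show ?thesis using False nz comp_b[of "e j"]
          by (simp add: \<kappa>_def ennreal_mult'[symmetric] ennreal_leI abs_le_iff)
      qed
    qed
    have "exp (2 * hlog x) \<le> exp (l 1 + (\<Sum>j=2..n. ?p j))"
      using hlog_upper[OF m \<tau> \<sigma>(1,3) x(1)] unfolding l_def by simp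
    also have "\<dots> = ?s * (\<Prod>j=2..n. exp (?p j))" using s by (simp add: exp_add exp_sum l1[unfolded One_nat_def])
    finally have "ennreal (exp (2 * hlog x)) \<le> ennreal ?s * (\<Prod>j=2..n. ennreal (exp (?p j)))"
      using s by (simp add: ennreal_leI prod_nonneg prod_ennreal ennreal_mult'[symmetric])
    also have "\<dots> \<le> ennreal ?s * (\<Prod>j=2..n. \<kappa> j ?s (x $ e j))"
      by (intro mult_left_mono prod_mono_ennreal p_le) auto
    also have "(\<Prod>j=2..n. \<kappa> j ?s (x $ e j)) = (\<Prod>j=2..n. \<kappa> (inve (e j)) ?s (x $ e j))"
      by (intro prod.cong) (auto simp: inve)
    also have "\<dots> = (\<Prod>i\<in>UNIV - {e 1}. \<kappa> (inve i) ?s (x $ i))"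
      by (rule prod.reindex_bij_betw[OF bij_rest])
    finally show ?thesis using True s comp_b[of "e 1"] by (simp add: indicator_def)
  qed (auto simp: indicator_def)
  let ?N = "card (UNIV - {e 1})"
  show ?thesis
  proof (rule that[of "K ^ ?N"])
    show "0 \<le> K ^ ?N" using K by simp
    fix g :: "real \<Rightarrow> ennreal" assume [measurable]: "g \<in> borel_measurable borel"
    have "(\<integral>\<^sup>+x. indicator {x\<in>D. a \<le> norm x \<and> norm x \<le> b} x * (ennreal (exp (2 * hlog x)) * g (x $ e 1)) \<partial>lborel) \<le>
      (\<integral>\<^sup>+x. (indicator {0<..b} (x $ e 1) * (ennreal (x $ e 1) * g (x $ e 1))) * (\<Prod>i\<in>UNIV - {e 1}. \<kappa> (inve i) (x $ e 1) (x $ i)) \<partial>lborel)"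
    proof (rule nn_integral_mono)
      fix x
      show "indicator {x\<in>D. a \<le> norm x \<and> norm x \<le> b} x * (ennreal (exp (2 * hlog x)) * g (x $ e 1)) \<le>
        (indicator {0<..b} (x $ e 1) * (ennreal (x $ e 1) * g (x $ e 1))) * (\<Prod>i\<in>UNIV - {e 1}. \<kappa> (inve i) (x $ e 1) (x $ i))"
        using mult_right_mono[OF pointwise[of x], of "g (x $ e 1)"] by (simp add: mult_ac)
    qed
    also have "\<dots> = (\<integral>\<^sup>+s. (indicator {0<..b} s * (ennreal s * g s)) * (\<Prod>i\<in>UNIV - {e 1}. \<integral>\<^sup>+y. \<kappa> (inve i) s y \<partial>lborel) \<partial>lborel)"
      by (rule nn_integral_vec_prod[where G="\<lambda>s. indicator {0<..b} s * (ennreal s * g s)" and \<kappa>="\<lambda>i. \<kappa> (inve i)", OF _ \<kappa>_meas])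
         measurable
    also have "\<dots> \<le> (\<integral>\<^sup>+s. (indicator {0<..b} s * (ennreal s * g s)) * ennreal (K ^ ?N) \<partial>lborel)"
    proof (intro nn_integral_mono mult_left_mono)
      fix s
      have "(\<Prod>i\<in>UNIV - {e 1}. \<integral>\<^sup>+y. \<kappa> (inve i) s y \<partial>lborel) \<le> (\<Prod>i\<in>UNIV - {e 1}. ennreal K)"
        by (intro prod_mono_ennreal \<kappa>_int)
      then show "(\<Prod>i\<in>UNIV - {e 1}. \<integral>\<^sup>+y. \<kappa> (inve i) s y \<partial>lborel) \<le> ennreal (K ^ ?N)"
        using K by (simp add: ennreal_power)
    qed simp
    also have "\<dots> = ennreal (K ^ ?N) * (\<integral>\<^sup>+s. indicator {0<..b} s * (ennreal s * g s) \<partial>lborel)"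
      by (subst nn_integral_multc) (auto simp: mult.commute)
    finally show "(\<integral>\<^sup>+x. indicator {x\<in>D. a \<le> norm x \<and> norm x \<le> b} x * (ennreal (exp (2 * hlog x)) * g (x $ e 1)) \<partial>lborel)
      \<le> ennreal (K ^ ?N) * (\<integral>\<^sup>+s. indicator {0<..b} s * (ennreal s * g s) \<partial>lborel)" .
  qed
qed

end


subsection \<open>Scaling\<close>

lemma nn_integral_scaleR:
  fixes f :: "'a::euclidean_space \<Rightarrow> ennreal"
  assumes [measurable]: "f \<in> borel_measurable borel" and c: "c > 0"
  shows "(\<integral>\<^sup>+x. f x \<partial>lborel) = ennreal (c ^ DIM('a)) * (\<integral>\<^sup>+x. f (c *\<^sub>R x) \<partial>lborel)"
  by (subst lborel_affine[of c 0])
     (use c in \<open>simp_all add: nn_integral_density nn_integral_distr nn_integral_cmult\<close>)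

lemma nn_integral_inverse_Icc:
  assumes "0 < a" "a \<le> b"
  shows "(\<integral>\<^sup>+s. ennreal (1 / s) * indicator {a..b} s \<partial>lborel) = ennreal (ln b - ln a)"
  by (rule nn_integral_FTC_Icc) (use assms in \<open>auto intro!: derivative_eq_intros simp: divide_inverse\<close>)

lemma positive_nn_integral_open:
  fixes f :: "'a::euclidean_space \<Rightarrow> ennreal"
  assumes "open S" "S \<noteq> {}" "\<And>x. x \<in> S \<Longrightarrow> f x > 0" "f \<in> borel_measurable borel"
  shows "(\<integral>\<^sup>+x. f x \<partial>lborel) > 0"
proof (rule ccontr)
  assume "\<not> (\<integral>\<^sup>+x. f x \<partial>lborel) > 0"
  then have "(\<integral>\<^sup>+x. f x \<partial>lborel) = 0" by simp
  then have "AE x in lborel. f x = 0" using nn_integral_0_iff_AE[of f lborel] assms(4) by simp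
  then have "AE x in lborel. x \<notin> S" by eventually_elim (use assms(3) in fastforce)
  then have "S \<in> null_sets lborel" using assms(1) by (subst (asm) AE_iff_null_sets[symmetric]) auto
  then have "negligible S" using negligible_iff_null_sets null_sets_completionI by blast
  then show False using open_not_negligible assms by blast
qed

section \<open>Logarithmic cutoffs in the first coordinate and in the radius\<close>

definition chi :: "real \<Rightarrow> real \<Rightarrow> real"
  where "chi L s = smooth_step (2 + ln s / L)"

text \<open>The transition of \<open>chi L\<close> takes place between exp (-2 L) and exp (-L) and
  is uniform in ln s. The derivative is of size 1 / (L s), and its square integrated against s ds is
  of order 1/L.\<close>

definition chi' :: "real \<Rightarrow> real \<Rightarrow> real"
  where "chi' L s = deriv smooth_step (2 + ln s / L) / (L * s)"

lemma smooth_step_deriv: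
  "(smooth_step has_real_derivative deriv smooth_step x) (at x)"
proof -
  obtain f' where "\<And>x. (smooth_step has_real_derivative f' x) (at x)"
    using Dk_on_derivs2[OF Dk_on_smooth_step] by metis
  then show ?thesis using DERIV_imp_deriv by metis
qed

lemma smooth_step_deriv_eq_0: "x < 0 \<or> x > 1 \<Longrightarrow> deriv smooth_step x = 0"
  using DERIV_eq_0_open[OF smooth_step_deriv, of "{..<0}" x 0] DERIV_eq_0_open[OF smooth_step_deriv, of "{1<..}" x 1]
  by auto

lemma smooth_step_deriv_bounded:
  obtains B where "B > 0" "\<And>x. \<bar>deriv smooth_step x\<bar> \<le> B"
proof -
  obtain f' where f': "\<And>x. (smooth_step has_real_derivative f' x) (at x)" "\<And>k. Dk_on k UNIV f'"
    using Dk_on_derivs2[OF Dk_on_smooth_step] by metis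
  have eq: "deriv smooth_step = f'" using DERIV_imp_deriv[OF f'(1)] by auto
  have "continuous_on UNIV (deriv smooth_step)" using f'(2)[of 0] eq by simp
  then show ?thesis
    by (rule bounded_of_eq_0_outside[where c=1]) (use smooth_step_deriv_eq_0 that in \<open>auto simp: abs_if split: if_splits\<close>)
qed

lemma chi_deriv: "s > 0 \<Longrightarrow> L > 0 \<Longrightarrow> (chi L has_real_derivative chi' L s) (at s)"
  unfolding chi_def[abs_def] chi'_def
  by (rule DERIV_cong, rule DERIV_chain2[OF smooth_step_deriv]) (auto intro!: derivative_eq_intros)

lemma Dk_on_chi: "L > 0 \<Longrightarrow> Dk_on k {0<..} (chi L)"
proof -
  have "Dk_on k {0<..} (\<lambda>s. smooth_step (2 + (1 / L) * ln s))"
    by (rule Dk_on_compose[OF Dk_on_smooth_step]) (intro Dk_on_add Dk_on_mult Dk_on_const Dk_on_ln, auto)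
  then show ?thesis by (simp add: chi_def[abs_def])
qed

lemma chi_bounds: "0 \<le> chi L s" "chi L s \<le> 1"
  by (simp_all add: chi_def smooth_step_bounds)

lemma chi_eq_0: "L > 0 \<Longrightarrow> 0 < s \<Longrightarrow> s \<le> exp (- 2 * L) \<Longrightarrow> chi L s = 0"
proof -
  assume L: "L > 0" "0 < s" "s \<le> exp (- 2 * L)"
  then have "ln s \<le> - 2 * L" by (metis ln_exp ln_le_cancel_iff exp_gt_zero)
  then show ?thesis using L by (simp add: chi_def field_simps)
qed

lemma chi_eq_1: "L > 0 \<Longrightarrow> exp (- L) \<le> s \<Longrightarrow> chi L s = 1"
proof -
  assume L: "L > 0" "exp (- L) \<le> s"
  then have "- L \<le> ln s" by (metis ln_exp ln_le_cancel_iff exp_gt_zero order_less_le_trans)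
  then show ?thesis using L by (simp add: chi_def field_simps)
qed

lemma chi'_nonzero:
  assumes "L > 0" "0 < s" "chi' L s \<noteq> 0"
  shows "exp (- 2 * L) \<le> s \<and> s \<le> exp (- L)"
proof -
  have "0 \<le> 2 + ln s / L" "2 + ln s / L \<le> 1"
    using assms smooth_step_deriv_eq_0[of "2 + ln s / L"] by (force simp: chi'_def)+
  then have "- 2 * L \<le> ln s" "ln s \<le> - L" using assms by (auto simp: field_simps)
  then show ?thesis using assms(2) by (metis exp_le_cancel_iff exp_ln)
qed

text \<open>The argument is meant to be ln |x|, which ranges over the whole line; the condition at
  |s| = R confines the support to an annulus.\<close>

definition radial_cutoff :: "(real \<Rightarrow> real) \<Rightarrow> real \<Rightarrow> bool"
  where "radial_cutoff v R \<longleftrightarrow> R > 0 \<and> (\<forall>k. Dk_on k UNIV v) \<and> (\<forall>s. \<bar>s\<bar> \<ge> R \<longrightarrow> v s = 0)"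

text \<open>The derivative is shown to vanish only on the open set |s| > R, while the definition
  asks for |s| >= R; the radius is therefore enlarged by one at each differentiation.\<close>

lemma radial_cutoff_deriv:
  assumes "radial_cutoff v R"
  shows "(v has_real_derivative deriv v s) (at s)" "\<And>s. \<bar>s\<bar> > R \<Longrightarrow> deriv v s = 0" "radial_cutoff (deriv v) (R + 1)"
proof -
  obtain f' where f': "\<And>x. (v has_real_derivative f' x) (at x)" "\<And>k. Dk_on k UNIV f'"
    using Dk_on_derivs2[of v] assms unfolding radial_cutoff_def by metis
  have eq: "deriv v = f'" using DERIV_imp_deriv[OF f'(1)] by auto
  show 1: "(v has_real_derivative deriv v s) (at s)" for s using f'(1) eq by simp
  show 2: "deriv v s = 0" if "\<bar>s\<bar> > R" for s
  proof -
    have "open {s. \<bar>s\<bar> > R}" by (intro open_Collect_less continuous_intros)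
    then show ?thesis using DERIV_eq_0_open[OF 1, of "{s. \<bar>s\<bar> > R}" s 0] that assms
      by (auto simp: radial_cutoff_def)
  qed
  show "radial_cutoff (deriv v) (R + 1)"
    unfolding radial_cutoff_def
  proof (intro conjI allI impI)
    show "R + 1 > 0" using assms by (simp add: radial_cutoff_def)
    show "Dk_on k UNIV (deriv v)" for k using f'(2) eq by simp
    show "deriv v s = 0" if "R + 1 \<le> \<bar>s\<bar>" for s using that by (intro 2) auto
  qed
qed

lemma radial_cutoff_bounded:
  assumes "radial_cutoff v R"
  obtains B where "B > 0" "\<And>s. \<bar>v s\<bar> \<le> B"
proof -
  have "continuous_on UNIV v" using assms Dk_on.simps(1) unfolding radial_cutoff_def by blast
  then show ?thesis by (rule bounded_of_eq_0_outside[where c=R]) (use assms that in \<open>auto simp: radial_cutoff_def\<close>)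
qed

context hardy_weights
begin

section \<open>Homogeneity of the ground state and the mass of spherical shells\<close>

lemma D_scale: "c > 0 \<Longrightarrow> c *\<^sub>R x \<in> D \<longleftrightarrow> x \<in> D"
  by (simp add: D_iff zero_less_mult_iff)

lemma rr_scale: "rr j (c *\<^sub>R x) = c\<^sup>2 * rr j x"
  by (simp add: rr_def power_mult_distrib sum_distrib_left)

lemma hlog_scale:
  assumes "x \<in> D" "c > 0"
  shows "hlog (c *\<^sub>R x) = hlog x - (real n - 2) / 2 * ln c"
proof -
  have "hlog (c *\<^sub>R x) = (\<Sum>j=1..n. expo j / 2 * ln (rr j x) + expo j * ln c)"
    unfolding hlog_def
  proof (intro sum.cong refl)
    fix j assume "j \<in> {1..n}"
    then have "rr j x > 0" using rr_pos[OF assms(1)] by simp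
    then have "ln (rr j (c *\<^sub>R x)) = 2 * ln c + ln (rr j x)"
      using assms(2) by (simp add: rr_scale ln_mult ln_realpow)
    then show "expo j / 2 * ln (rr j (c *\<^sub>R x)) = expo j / 2 * ln (rr j x) + expo j * ln c"
      by (simp add: algebra_simps)
  qed
  also have "\<dots> = hlog x + (\<Sum>j=1..n. expo j) * ln c"
    by (simp add: sum.distrib hlog_def sum_distrib_right)
  also have "(\<Sum>j=1..n. expo j) = - ((real n - 2) / 2)" using sum_expo[of n] n2 \<alpha>n by simp
  finally show ?thesis by simp
qed

text \<open>The density \<open>u\<^sup>2 / |x|\<^sup>2\<close> is homogeneous of degree \<open>- n\<close>: every shell \<open>e\<^sup>k \<le> |x| < e\<^sup>k\<^sup>+\<^sup>1\<close>
  carries the same mass.\<close>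

definition rdens :: "real ^ 'n \<Rightarrow> real"
  where "rdens x = (if x \<in> D then exp (2 * hlog x) / (norm x)\<^sup>2 else 0)"

lemma rdens_nonneg: "0 \<le> rdens x" by (simp add: rdens_def)

lemma rdens_measurable [measurable]: "rdens \<in> borel_measurable borel"
  unfolding rdens_def[abs_def] by measurable

lemma rdens_scale:
  assumes "c > 0"
  shows "c ^ n * rdens (c *\<^sub>R x) = rdens x"
proof (cases "x \<in> D")
  case True
  have "exp (2 * hlog (c *\<^sub>R x)) = exp (2 * hlog x) * c powr (- (real n - 2))"
  proof -
    have "2 * hlog (c *\<^sub>R x) = 2 * hlog x + (- (real n - 2)) * ln c"
      unfolding hlog_scale[OF True assms] by (simp add: field_simps)
    then show ?thesis using assms by (simp add: exp_add powr_def)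
  qed
  also have "c powr (- (real n - 2)) = c\<^sup>2 / c ^ n"
  proof -
    have "c powr (- (real n - 2)) = c powr (2 - real n)" by simp
    also have "\<dots> = c powr 2 / c powr real n" by (rule powr_diff)
    finally show ?thesis using assms by (simp add: powr_realpow)
  qed
  finally show ?thesis using assms True by (simp add: rdens_def D_scale power_mult_distrib field_simps)
next
  case False
  then show ?thesis using assms by (simp add: rdens_def D_scale)
qed

text \<open>The radii are given by their logarithms, so that dilation invariance becomes translation
  invariance in a and b.\<close>

definition shell :: "real \<Rightarrow> real \<Rightarrow> ennreal"
  where "shell a b = (\<integral>\<^sup>+x. indicator {x. exp a \<le> norm x \<and> norm x < exp b} x * ennreal (rdens x) \<partial>lborel)"

lemma shell_shift: "shell (a + t) (b + t) = shell a b"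
proof -
  let ?f = "\<lambda>x. indicator {x. exp (a + t) \<le> norm x \<and> norm x < exp (b + t)} x * ennreal (rdens x)"
  have "shell (a + t) (b + t) = ennreal (exp t ^ n) * (\<integral>\<^sup>+x. ?f (exp t *\<^sub>R x) \<partial>(lborel :: (real ^ 'n) measure))"
    unfolding shell_def by (subst nn_integral_scaleR[of _ "exp t"]) (auto simp: card_n)
  also have "\<dots> = (\<integral>\<^sup>+x. ennreal (exp t ^ n) * ?f (exp t *\<^sub>R x) \<partial>(lborel :: (real ^ 'n) measure))"
    by (subst nn_integral_cmult) auto
  also have "\<dots> = shell a b"
    unfolding shell_def
  proof (rule nn_integral_cong)
    fix x :: "real ^ 'n"
    have "ennreal (exp t ^ n) * ennreal (rdens (exp t *\<^sub>R x)) = ennreal (rdens x)"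
      using rdens_scale[of "exp t" x] by (simp add: ennreal_mult'[symmetric])
    then show "ennreal (exp t ^ n) * ?f (exp t *\<^sub>R x) = indicator {x. exp a \<le> norm x \<and> norm x < exp b} x * ennreal (rdens x)"
      by (simp add: indicator_def exp_add mult.commute[of "exp t"])
  qed
  finally show ?thesis .
qed

lemma shell_add:
  assumes "a \<le> b" "b \<le> c"
  shows "shell a c = shell a b + shell b c"
proof -
  have "shell a c = (\<integral>\<^sup>+x. indicator {x. exp a \<le> norm x \<and> norm x < exp b} x * ennreal (rdens x) +
      indicator {x. exp b \<le> norm x \<and> norm x < exp c} x * ennreal (rdens x) \<partial>lborel)"
    unfolding shell_def
  proof (rule nn_integral_cong)
    fix x :: "real ^ 'n"
    have "indicator {x. A \<le> norm x \<and> norm x < C} x * t =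
        indicator {x. A \<le> norm x \<and> norm x < B} x * t + indicator {x. B \<le> norm x \<and> norm x < C} x * t"
      if "A \<le> B" "B \<le> C" for A B C and t :: ennreal
      using that by (auto simp: indicator_def)
    then show "indicator {x. exp a \<le> norm x \<and> norm x < exp c} x * ennreal (rdens x) =
      indicator {x. exp a \<le> norm x \<and> norm x < exp b} x * ennreal (rdens x) +
      indicator {x. exp b \<le> norm x \<and> norm x < exp c} x * ennreal (rdens x)"
      using assms by simp
  qed
  also have "\<dots> = shell a b + shell b c" unfolding shell_def by (rule nn_integral_add) auto
  finally show ?thesis .
qed

lemma shell_nat: "shell a (a + real k) = of_nat k * shell 0 1"
proof (induction k)
  case 0
  have "{x :: real ^ 'n. exp a \<le> norm x \<and> norm x < exp a} = {}" by auto
  then show ?case unfolding shell_def by simp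
next
  case (Suc k)
  have "shell a (a + real (Suc k)) = shell a (a + real k) + shell (0 + (a + real k)) (1 + (a + real k))"
    using shell_add[of a "a + real k" "a + real (Suc k)"] by (simp add: add_ac)
  then show ?case unfolding shell_shift Suc by (simp add: distrib_right add.commute)
qed

text \<open>On an annulus 1 / |x|^2 is bounded, and \<open>weight_integral_bound\<close> with
  constant g leaves the integral of s over a bounded interval. The maximum b' supplies the ordering
  of the radii which that bound requires.\<close>

lemma shell_finite: "shell a b < \<infinity>"
proof -
  define b' where "b' = max a b"
  obtain C where C: "C \<ge> 0" "\<And>g. g \<in> borel_measurable borel \<Longrightarrow>
    (\<integral>\<^sup>+x. indicator {x\<in>D. exp a \<le> norm x \<and> norm x \<le> exp b'} x * (ennreal (exp (2 * hlog x)) * g (x $ e 1)) \<partial>lborel)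
      \<le> ennreal C * (\<integral>\<^sup>+s. indicator {0<..exp b'} s * (ennreal s * g s) \<partial>lborel)"
    using weight_integral_bound[of "exp a" "exp b'"] by (auto simp: b'_def)
  have "shell a b \<le> (\<integral>\<^sup>+x. indicator {x\<in>D. exp a \<le> norm x \<and> norm x \<le> exp b'} x * (ennreal (exp (2 * hlog x)) * ennreal (1 / (exp a)\<^sup>2)) \<partial>lborel)"
    unfolding shell_def
  proof (rule nn_integral_mono)
    fix x :: "real ^ 'n"
    show "indicator {x. exp a \<le> norm x \<and> norm x < exp b} x * ennreal (rdens x) \<le>
      indicator {x\<in>D. exp a \<le> norm x \<and> norm x \<le> exp b'} x * (ennreal (exp (2 * hlog x)) * ennreal (1 / (exp a)\<^sup>2))"
    proof (cases "x \<in> D \<and> exp a \<le> norm x \<and> norm x < exp b")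
      case True
      have "exp b \<le> exp b'" by (simp add: b'_def)
      with True have b: "norm x \<le> exp b'" by linarith
      have "rdens x \<le> exp (2 * hlog x) * (1 / (exp a)\<^sup>2)"
        using True by (simp add: rdens_def frac_le power_mono)
      then have "ennreal (rdens x) \<le> ennreal (exp (2 * hlog x) * (1 / (exp a)\<^sup>2))" by (rule ennreal_leI)
      then show ?thesis using True b by (simp add: ennreal_mult'[symmetric])
    next
      case False
      then have z: "indicator {x. exp a \<le> norm x \<and> norm x < exp b} x * ennreal (rdens x) = 0"
        by (cases "x \<in> D") (auto simp: rdens_def)
      show ?thesis unfolding z by (rule zero_le)
    qed
  qed
  also have "\<dots> \<le> ennreal C * (\<integral>\<^sup>+s. indicator {0<..exp b'} s * (ennreal s * ennreal (1 / (exp a)\<^sup>2)) \<partial>lborel)"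
    by (rule C(2)) simp
  also have "\<dots> \<le> ennreal C * (\<integral>\<^sup>+s. ennreal (exp b' * (1 / (exp a)\<^sup>2)) * indicator {0..exp b'} s \<partial>lborel)"
    by (intro mult_left_mono nn_integral_mono) (auto simp: indicator_def ennreal_mult'[symmetric] divide_right_mono intro!: ennreal_leI)
  also have "\<dots> = ennreal (C * (exp b' * (1 / (exp a)\<^sup>2) * exp b'))"
    using C(1) by (simp add: nn_integral_cmult ennreal_mult'[symmetric])
  finally show ?thesis using ennreal_less_top order_le_less_trans infinity_ennreal_def by metis
qed

lemma shell_pos: "shell 0 1 > 0"
  unfolding shell_def
proof (rule positive_nn_integral_open[where S="{x\<in>D. exp 0 < norm x \<and> norm x < exp 1}"])
  have "{x\<in>D. exp 0 < norm x \<and> norm x < exp 1} = D \<inter> ({x. exp 0 < norm x} \<inter> {x. norm x < exp 1})" by auto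
  also have "open \<dots>" by (intro open_Int open_D open_Collect_less continuous_intros)
  finally show "open {x\<in>D. exp 0 < norm x \<and> norm x < exp 1}" .
  have "(3/2::real) *\<^sub>R axis (e 1) 1 \<in> {x\<in>D. exp 0 < norm x \<and> norm x < exp 1}"
    using exp_ge_add_one_self[of 1] by (simp add: D_iff)
  then show "{x\<in>D. exp 0 < norm x \<and> norm x < exp 1} \<noteq> {}" by blast
qed (auto simp: rdens_def indicator_def dest: norm_pos intro!: divide_pos_pos zero_less_power)

definition smass :: real where "smass = enn2real (shell 0 1)"

lemma shell_eq: "shell a (a + real k) = ennreal (real k * smass)"
proof -
  have "shell 0 1 = ennreal smass" unfolding smass_def using shell_finite[of 0 1] by simp
  then show ?thesis unfolding shell_nat by (simp add: smass_def ennreal_mult' ennreal_of_nat_eq_real_of_nat)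
qed

lemma smass_pos: "smass > 0"
  unfolding smass_def using shell_pos shell_finite[of 0 1] by (simp add: enn2real_positive_iff)


subsection \<open>Truncated ground states\<close>

definition lr :: "real ^ 'n \<Rightarrow> real" where "lr x = ln (rr n x) / 2"

definition gs :: "(real \<Rightarrow> real) \<Rightarrow> real ^ 'n \<Rightarrow> real"
  where "gs v x = (if x \<in> D then exp (hlog x) * v (lr x) else 0)"

text \<open>\<open>gs v\<close> is cut off only in |x| and reaches the boundary of the half-space; a
  factor c vanishing for small x_1 turns it into a test function.\<close>

definition tgs :: "(real \<Rightarrow> real) \<Rightarrow> (real \<Rightarrow> real) \<Rightarrow> real ^ 'n \<Rightarrow> real"
  where "tgs v c x = (if x \<in> D then exp (hlog x) * (v (lr x) * c (x $ e 1)) else 0)"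

lemma lr_eq: "x \<in> D \<Longrightarrow> lr x = ln (norm x)"
  using norm_pos by (simp add: lr_def rr_n ln_realpow)

lemma lr_lt: "x \<in> D \<Longrightarrow> \<bar>lr x\<bar> < R \<Longrightarrow> exp (- R) \<le> norm x \<and> norm x < exp R"
proof -
  assume x: "x \<in> D" and "\<bar>lr x\<bar> < R"
  then have "- R < ln (norm x)" "ln (norm x) < R" using lr_eq[OF x] by auto
  then have "exp (- R) < exp (ln (norm x))" "exp (ln (norm x)) < exp R" by (simp_all only: exp_less_cancel_iff)
  then show ?thesis unfolding exp_ln[OF norm_pos[OF x]] by simp
qed

lemma lr_differentiable: "x \<in> D \<Longrightarrow> lr differentiable (at x)"
  and partial_lr: "x \<in> D \<Longrightarrow> partial i lr x = x $ i / rr n x"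
proof -
  assume x: "x \<in> D"
  have "((\<lambda>y. ln y / 2) has_real_derivative 1 / (2 * rr n x)) (at (rr n x))"
    using DERIV_cdivide[OF DERIV_ln[of "rr n x"], of 2] rr_pos[OF x, of n] n2 by (simp add: field_simps)
  note c = partial_compose[OF this rr_differentiable]
  have "i \<in> e ` {1..n}" using bij by (auto simp: bij_betw_def)
  then show "lr differentiable (at x)" "partial i lr x = x $ i / rr n x"
    unfolding lr_def[abs_def] using c rr_pos[OF x, of n] n2 by (auto simp: partial_rr)
qed

lemma Ck_on_lr: "Ck_on k D lr"
proof -
  have "Ck_on k D (\<lambda>x. (1 / 2) * ln (rr n x))" using n2 by (intro Ck_on_mult Ck_on_const Ck_on_ln_rr) auto
  then show ?thesis by (simp add: lr_def[abs_def])
qed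

lemma tgs_test:
  assumes v: "radial_cutoff v R" and c: "\<And>k. Dk_on k {0<..} c" and \<delta>: "\<delta> > 0" "\<And>s. 0 < s \<Longrightarrow> s < \<delta> \<Longrightarrow> c s = 0"
  shows "tgs v c \<in> test_functions D"
proof (rule test_functionsI[OF open_D])
  let ?K = "{x. \<delta> \<le> x $ e 1} \<inter> cball 0 (exp R)"
  show "Ck_on k D (tgs v c)" for k
  proof (rule Ck_on_cong_imp[OF open_D])
    show "Ck_on k D (\<lambda>x. exp (hlog x) * (v (lr x) * c (x $ e 1)))"
    proof (intro Ck_on_mult open_D)
      show "Ck_on k D (\<lambda>x. exp (hlog x))" by (rule Ck_on_compose[OF open_D Dk_on_exp[of k UNIV] Ck_on_hlog]) auto
      show "Ck_on k D (\<lambda>x. v (lr x))"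
        by (rule Ck_on_compose[OF open_D, of k UNIV]) (use v Ck_on_lr in \<open>auto simp: radial_cutoff_def\<close>)
      show "Ck_on k D (\<lambda>x. c (x $ e 1))"
        by (rule Ck_on_compose[OF open_D c]) (auto simp: D_iff)
    qed
  qed (simp add: tgs_def)
  show "compact ?K" by (intro closed_Int_compact closed_Collect_le continuous_intros) auto
  show "?K \<subseteq> D" using \<delta> by (auto simp: D_iff)
  show "tgs v c x = 0" if "x \<notin> ?K" for x
  proof (cases "x \<in> D")
    case True
    then have "v (lr x) = 0 \<or> c (x $ e 1) = 0"
    proof (cases "x $ e 1 < \<delta>")
      case True then show ?thesis using \<delta> \<open>x \<in> D\<close> by (simp add: D_iff)
    next
      case False
      then have "norm x > exp R" using that by auto
      then have "ln (norm x) > R" using norm_pos[OF True] by (metis exp_less_cancel_iff exp_ln)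
      then have "\<bar>lr x\<bar> \<ge> R" using lr_eq[OF True] by auto
      then show ?thesis using v by (simp add: radial_cutoff_def)
    qed
    then show ?thesis by (auto simp: tgs_def)
  qed (simp add: tgs_def)
qed

text \<open>This is u grad (g / u) for g = u f: the derivative of u cancels, so that only
  derivatives of cutoffs ever enter the energy.\<close>

lemma dh_exp_hlog:
  assumes x: "x \<in> D" and f: "f differentiable (at x)" and eq: "\<And>y. y \<in> D \<Longrightarrow> g y = exp (hlog y) * f y"
  shows "dh i g x = exp (hlog x) * partial i f x"
proof -
  have h: "hlog differentiable (at x)" using Ck_on_hlog[of "Suc 0"] x by simp
  note c = partial_compose[OF DERIV_exp h]
  have "partial i g x = partial i (\<lambda>y. exp (hlog y) * f y) x"
    by (rule partial_cong[OF open_D x eq])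
  also have "\<dots> = exp (hlog x) * hgrad i x * f x + exp (hlog x) * partial i f x"
    by (simp add: partial_mult[OF c(2) f] c(1) partial_hlog[OF x])
  finally show ?thesis by (simp add: dh_def eq[OF x])
qed

lemma dh_tgs:
  assumes x: "x \<in> D" and v: "(v has_real_derivative v') (at (lr x))" and c: "(c has_real_derivative c') (at (x $ e 1))"
  shows "dh i (tgs v c) x = exp (hlog x) * (v' * (x $ i / rr n x) * c (x $ e 1) + v (lr x) * (if i = e 1 then c' else 0))"
proof -
  note p = partial_compose[OF v lr_differentiable[OF x]]
  have d: "(\<lambda>x::real^'n. x $ e 1) differentiable (at x)" using has_derivative_nth differentiableI by blast
  note q = partial_compose[OF c d]
  have "dh i (tgs v c) x = exp (hlog x) * partial i (\<lambda>x. v (lr x) * c (x $ e 1)) x"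
    by (rule dh_exp_hlog[OF x differentiable_mult[OF p(2) q(2)]]) (simp add: tgs_def)
  then show ?thesis
    unfolding partial_mult[OF p(2) q(2)] p(1) q(1) partial_lr[OF x] partial_nth by simp
qed

text \<open>The gradient of ln |x| has length 1 / |x|, which produces the density
  \<open>rdens\<close>; the derivative of c only acts in the first coordinate direction.\<close>

lemma dh_tgs_sum_le:
  assumes x: "x \<in> D" and v: "(v has_real_derivative v') (at (lr x))" and c: "(c has_real_derivative c') (at (x $ e 1))"
  shows "(\<Sum>i\<in>UNIV. (dh i (tgs v c) x)\<^sup>2) \<le> 2 * (v' * c (x $ e 1))\<^sup>2 * rdens x + 2 * exp (2 * hlog x) * (v (lr x) * c')\<^sup>2"
proof -
  let ?u = "exp (hlog x)"
  have sq: "(a + b)\<^sup>2 \<le> 2 * a\<^sup>2 + 2 * b\<^sup>2" for a b :: real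
    using sum_squares_bound[of a b] by (simp add: power2_sum)
  have "(\<Sum>i\<in>UNIV. (dh i (tgs v c) x)\<^sup>2) \<le>
    (\<Sum>i\<in>UNIV. 2 * (?u * (v' * (x $ i / rr n x) * c (x $ e 1)))\<^sup>2 + 2 * (?u * (v (lr x) * (if i = e 1 then c' else 0)))\<^sup>2)"
    unfolding dh_tgs[OF assms] distrib_left by (intro sum_mono sq)
  also have "\<dots> = 2 * ?u\<^sup>2 * (v' * c (x $ e 1))\<^sup>2 / (rr n x)\<^sup>2 * (\<Sum>i\<in>UNIV. (x $ i)\<^sup>2) + (\<Sum>i\<in>UNIV. if i = e 1 then 2 * ?u\<^sup>2 * (v (lr x) * c')\<^sup>2 else 0)"
    unfolding sum.distrib sum_distrib_left
    by (intro arg_cong2[where f="(+)"] sum.cong refl) (auto simp: power_mult_distrib power_divide)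
  also have "(\<Sum>i\<in>UNIV. (x $ i)\<^sup>2) = rr n x" unfolding sum_UNIV rr_def ..
  also have "2 * ?u\<^sup>2 * (v' * c (x $ e 1))\<^sup>2 / (rr n x)\<^sup>2 * rr n x = 2 * (v' * c (x $ e 1))\<^sup>2 * rdens x"
    using x norm_pos[OF x] by (simp add: rdens_def rr_n exp_double power2_eq_square)
  finally show ?thesis by (simp add: exp_double)
qed

end


lemma measurable_deriv_smooth_step [measurable]: "deriv smooth_step \<in> borel_measurable borel"
proof -
  obtain f' where f': "\<And>x. (smooth_step has_real_derivative f' x) (at x)" "\<And>k. Dk_on k UNIV f'"
    using Dk_on_derivs2[OF Dk_on_smooth_step] by metis
  have eq: "deriv smooth_step = f'" using DERIV_imp_deriv[OF f'(1)] by auto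
  have "continuous_on UNIV (deriv smooth_step)" using f'(2)[of 0] eq by simp
  then show ?thesis by (rule borel_measurable_continuous_onI)
qed

lemma measurable_smooth_step [measurable]: "smooth_step \<in> borel_measurable borel"
  using Dk_on_smooth_step[of 0] by (simp add: borel_measurable_continuous_onI)

lemma measurable_chi [measurable]: "chi L \<in> borel_measurable borel" "chi' L \<in> borel_measurable borel"
  unfolding chi_def[abs_def] chi'_def[abs_def] by measurable

lemma measurable_radial_cutoff: "radial_cutoff v R \<Longrightarrow> v \<in> borel_measurable borel"
  unfolding radial_cutoff_def using Dk_on.simps(1) by (metis borel_measurable_continuous_onI)

context hardy_weights
begin

definition ann :: "real \<Rightarrow> (real ^ 'n) set"
  where "ann R = {x\<in>D. exp (- R) \<le> norm x \<and> norm x \<le> exp R}"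

lemma ann_measurable [measurable]: "ann R \<in> sets borel"
  unfolding ann_def by measurable

lemma lr_measurable [measurable]: "lr \<in> borel_measurable borel"
  unfolding lr_def[abs_def] rr_def[abs_def] by measurable

text \<open>Both integrals reduce to one variable with density s. In the first, s times the squared
  derivative is at most a constant times 1 / (L^2 s) on an interval of logarithmic length L. The
  second is at most a constant times exp (-2 L), and the weaker 1/L is kept for uniformity.\<close>

lemma strip_bounds:
  assumes "R > 0"
  obtains C where "C \<ge> 0"
    "\<And>L. L \<ge> 1 \<Longrightarrow> (\<integral>\<^sup>+x. indicator (ann R) x * (ennreal (exp (2 * hlog x)) * ennreal ((chi' L (x $ e 1))\<^sup>2)) \<partial>lborel) \<le> ennreal (C / L)"
    "\<And>L. L \<ge> 1 \<Longrightarrow> (\<integral>\<^sup>+x. indicator (ann R) x * (ennreal (exp (2 * hlog x)) * indicator {..<exp (- L)} (x $ e 1)) \<partial>lborel) \<le> ennreal (C / L)"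
proof -
  obtain C0 where C0: "C0 \<ge> 0" "\<And>g. g \<in> borel_measurable borel \<Longrightarrow>
    (\<integral>\<^sup>+x. indicator (ann R) x * (ennreal (exp (2 * hlog x)) * g (x $ e 1)) \<partial>lborel)
      \<le> ennreal C0 * (\<integral>\<^sup>+s. indicator {0<..exp R} s * (ennreal s * g s) \<partial>lborel)"
    using weight_integral_bound[of "exp (- R)" "exp R"] assms unfolding ann_def by auto
  obtain B where B: "B > 0" "\<And>x. \<bar>deriv smooth_step x\<bar> \<le> B" using smooth_step_deriv_bounded by blast
  show ?thesis
  proof (rule that[of "C0 * (B\<^sup>2 + 1)"])
    show "C0 * (B\<^sup>2 + 1) \<ge> 0" using C0 by simp
    fix L :: real assume L: "L \<ge> 1"
    have "(\<integral>\<^sup>+s. indicator {0<..exp R} s * (ennreal s * ennreal ((chi' L s)\<^sup>2)) \<partial>lborel) \<le>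
        (\<integral>\<^sup>+s. ennreal (B\<^sup>2 / L\<^sup>2) * (ennreal (1 / s) * indicator {exp (- 2 * L)..exp (- L)} s) \<partial>lborel)"
    proof (rule nn_integral_mono)
      fix s :: real
      show "indicator {0<..exp R} s * (ennreal s * ennreal ((chi' L s)\<^sup>2)) \<le>
          ennreal (B\<^sup>2 / L\<^sup>2) * (ennreal (1 / s) * indicator {exp (- 2 * L)..exp (- L)} s)"
      proof (cases "0 < s \<and> s \<le> exp R \<and> chi' L s \<noteq> 0")
        case True
        then have s: "s > 0" "exp (- 2 * L) \<le> s" "s \<le> exp (- L)" using chi'_nonzero[of L s] L by auto
        have "(deriv smooth_step (2 + ln s / L))\<^sup>2 \<le> B\<^sup>2"
          using B power_mono[OF B(2), of "2 + ln s / L" 2] by simp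
        then have "s * (chi' L s)\<^sup>2 \<le> B\<^sup>2 / L\<^sup>2 * (1 / s)"
          using s(1) L by (simp add: chi'_def power_divide power_mult_distrib power2_eq_square field_simps)
        then have "ennreal (s * (chi' L s)\<^sup>2) \<le> ennreal (B\<^sup>2 / L\<^sup>2 * (1 / s))" by (rule ennreal_leI)
        then show ?thesis using s True by (simp add: ennreal_mult'[symmetric])
      next
        case False
        then have z: "indicator {0<..exp R} s * (ennreal s * ennreal ((chi' L s)\<^sup>2)) = 0" by (auto simp: indicator_def)
        show ?thesis unfolding z by (rule zero_le)
      qed
    qed
    also have "\<dots> = ennreal (B\<^sup>2 / L\<^sup>2) * ennreal (ln (exp (- L)) - ln (exp (- 2 * L)))"
      using L by (subst nn_integral_cmult, simp, subst nn_integral_inverse_Icc) auto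
    also have "\<dots> = ennreal (B\<^sup>2 / L)" using L by (simp add: ennreal_mult'[symmetric] power2_eq_square)
    finally have 1: "(\<integral>\<^sup>+s. indicator {0<..exp R} s * (ennreal s * ennreal ((chi' L s)\<^sup>2)) \<partial>lborel) \<le> ennreal (B\<^sup>2 / L)" .
    have "(\<integral>\<^sup>+x. indicator (ann R) x * (ennreal (exp (2 * hlog x)) * ennreal ((chi' L (x $ e 1))\<^sup>2)) \<partial>lborel) \<le>
        ennreal C0 * (\<integral>\<^sup>+s. indicator {0<..exp R} s * (ennreal s * ennreal ((chi' L s)\<^sup>2)) \<partial>lborel)"
      by (rule C0(2)) simp
    also have "\<dots> \<le> ennreal C0 * ennreal (B\<^sup>2 / L)" by (intro mult_left_mono 1) simp
    also have "\<dots> \<le> ennreal (C0 * (B\<^sup>2 + 1) / L)"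
      using C0 L by (simp add: ennreal_mult'[symmetric] divide_right_mono mult_left_mono ennreal_leI)
    finally show "(\<integral>\<^sup>+x. indicator (ann R) x * (ennreal (exp (2 * hlog x)) * ennreal ((chi' L (x $ e 1))\<^sup>2)) \<partial>lborel) \<le> ennreal (C0 * (B\<^sup>2 + 1) / L)" .
    have "(\<integral>\<^sup>+s. indicator {0<..exp R} s * (ennreal s * indicator {..<exp (- L)} s) \<partial>lborel) \<le>
        (\<integral>\<^sup>+s. ennreal (exp (- L)) * indicator {0..exp (- L)} s \<partial>lborel)"
      by (intro nn_integral_mono) (auto simp: indicator_def intro!: ennreal_leI)
    also have "\<dots> = ennreal (exp (- L)) * ennreal (exp (- L))" by (simp add: nn_integral_cmult)
    also have "\<dots> \<le> ennreal (1 / L)"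
    proof -
      have "L \<le> exp L" using exp_ge_add_one_self[of L] by linarith
      then have 1: "exp (- L) \<le> 1 / L" using L by (simp add: exp_minus field_simps)
      have "exp (- L) * exp (- L) \<le> exp (- L) * 1" using L by (intro mult_left_mono) auto
      then have "exp (- L) * exp (- L) \<le> 1 / L" unfolding mult_1_right using 1 by (rule order_trans)
      then show ?thesis by (simp add: ennreal_mult'[symmetric] ennreal_leI)
    qed
    finally have 2: "(\<integral>\<^sup>+s. indicator {0<..exp R} s * (ennreal s * indicator {..<exp (- L)} s) \<partial>lborel) \<le> ennreal (1 / L)" .
    have "(\<integral>\<^sup>+x. indicator (ann R) x * (ennreal (exp (2 * hlog x)) * indicator {..<exp (- L)} (x $ e 1)) \<partial>lborel) \<le>
        ennreal C0 * (\<integral>\<^sup>+s. indicator {0<..exp R} s * (ennreal s * indicator {..<exp (- L)} s) \<partial>lborel)"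
      by (rule C0(2)) simp
    also have "\<dots> \<le> ennreal C0 * ennreal (1 / L)" by (intro mult_left_mono 2) simp
    also have "\<dots> \<le> ennreal (C0 * (B\<^sup>2 + 1) / L)"
    proof -
      have "C0 \<le> C0 * (B\<^sup>2 + 1)" using C0(1) by (simp add: distrib_left)
      then have "C0 / L \<le> C0 * (B\<^sup>2 + 1) / L" using L by (intro divide_right_mono) auto
      then show ?thesis using C0(1) by (simp add: ennreal_mult'[symmetric] ennreal_leI)
    qed
    finally show "(\<integral>\<^sup>+x. indicator (ann R) x * (ennreal (exp (2 * hlog x)) * indicator {..<exp (- L)} (x $ e 1)) \<partial>lborel) \<le> ennreal (C0 * (B\<^sup>2 + 1) / L)" .
  qed
qed

lemma tgs_chi_test:
  assumes "radial_cutoff v R" "L > 0"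
  shows "tgs v (chi L) \<in> test_functions D"
  by (rule tgs_test[OF assms(1) Dk_on_chi[OF assms(2)], of "exp (- 2 * L)"]) (use assms chi_eq_0 in auto)

lemma ennreal_En:
  assumes "\<phi> \<in> test_functions D"
  shows "ennreal (En \<phi>) = (\<integral>\<^sup>+x. ennreal (\<Sum>i\<in>UNIV. (dh i \<phi> x)\<^sup>2) \<partial>lborel)"
  unfolding En_def by (rule nn_integral_eq_integral[OF En_integrable[OF assms], symmetric], rule AE_I2, rule sum_nonneg, simp)

lemma in_annI: "x \<in> D \<Longrightarrow> \<bar>lr x\<bar> < R \<Longrightarrow> x \<in> ann R"
  using lr_lt[of x R] by (simp add: ann_def)

lemma rdens_le_ann:
  assumes "x \<in> ann R"
  shows "rdens x \<le> exp (2 * R) * exp (2 * hlog x)"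
proof -
  have x: "x \<in> D" "exp (- R) \<le> norm x" using assms by (auto simp: ann_def)
  have "exp (- R) * exp (- R) \<le> norm x * norm x" using x by (intro mult_mono) auto
  then have "exp (2 * R) * (exp (- R) * exp (- R)) \<le> exp (2 * R) * (norm x * norm x)" by (intro mult_left_mono) auto
  then have "1 \<le> exp (2 * R) * (norm x)\<^sup>2"
    by (simp add: exp_add[symmetric] power2_eq_square)
  then have "exp (2 * hlog x) * 1 \<le> exp (2 * hlog x) * (exp (2 * R) * (norm x)\<^sup>2)" by (intro mult_left_mono) auto
  then show ?thesis using x norm_pos[OF x(1)] by (simp add: rdens_def divide_le_eq mult_ac)
qed

text \<open>The two cases for c serve the energy of one truncation and the energy distance of two
  truncations.\<close>

lemma En_tgs_le:
  assumes v: "radial_cutoff v R" and L: "L > 0" "L' > 0"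
    and c: "c = chi L \<or> c = (\<lambda>s. chi L s - chi L' s)" and c': "c' = (if c = chi L then chi' L else (\<lambda>s. chi' L s - chi' L' s))"
  shows "ennreal (En (tgs v c)) \<le> (\<integral>\<^sup>+x. indicator D x * ennreal (2 * (deriv v (lr x) * c (x $ e 1))\<^sup>2 * rdens x
    + 2 * exp (2 * hlog x) * (v (lr x) * c' (x $ e 1))\<^sup>2) \<partial>lborel)"
proof -
  define m where "m = min (exp (- 2 * L)) (exp (- 2 * L'))"
  have d: "(c has_real_derivative c' s) (at s)" if "s > 0" for s
    using c c' chi_deriv[OF that] L by (auto intro!: DERIV_diff)
  have "tgs v c \<in> test_functions D"
  proof (rule tgs_test[OF v, of _ m])
    show "Dk_on k {0<..} c" for k
    proof -
      have "Dk_on k {0<..} (\<lambda>s. chi L s + (- 1) * chi L' s)"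
        by (intro Dk_on_add Dk_on_mult Dk_on_const Dk_on_chi L)
      then show ?thesis using c Dk_on_chi[OF L(1)] by auto
    qed
    show "m > 0" by (simp add: m_def)
    show "c s = 0" if "0 < s" "s < m" for s
      using c chi_eq_0[OF L(1) that(1)] chi_eq_0[OF L(2) that(1)] that by (auto simp: m_def)
  qed
  then show ?thesis
    unfolding ennreal_En[OF \<open>tgs v c \<in> test_functions D\<close>]
  proof (intro nn_integral_mono)
    fix x assume t: "tgs v c \<in> test_functions D"
    show "ennreal (\<Sum>i\<in>UNIV. (dh i (tgs v c) x)\<^sup>2) \<le> indicator D x * ennreal (2 * (deriv v (lr x) * c (x $ e 1))\<^sup>2 * rdens x
    + 2 * exp (2 * hlog x) * (v (lr x) * c' (x $ e 1))\<^sup>2)"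
    proof (cases "x \<in> D")
      case True
      then show ?thesis
        using dh_tgs_sum_le[OF True radial_cutoff_deriv(1)[OF v] d] by (simp add: D_iff ennreal_leI)
    next
      case False
      then show ?thesis using dh_zero[OF t False] by simp
    qed
  qed
qed

lemma chi_diff_sq_le:
  assumes "0 < L" "L \<le> L'"
  shows "(chi L s - chi L' s)\<^sup>2 \<le> indicator {..<exp (- L)} s"
proof (cases "s < exp (- L)")
  case True
  have "\<bar>chi L s - chi L' s\<bar> \<le> 1" using chi_bounds[of L s] chi_bounds[of L' s] by linarith
  then show ?thesis using True by (simp add: abs_square_le_1)
next
  case False
  then have 1: "exp (- L) \<le> s" by simp
  have "exp (- L') \<le> exp (- L)" using assms by simp
  then have "exp (- L') \<le> s" using 1 by linarith
  with 1 have "chi L s = 1" "chi L' s = 1" using assms by (auto intro!: chi_eq_1)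
  then show ?thesis by simp
qed

lemma sq_diff_le: "(a - b)\<^sup>2 \<le> 2 * a\<^sup>2 + 2 * (b::real)\<^sup>2"
  using sum_squares_bound[of a "- b"] by (simp add: power2_diff)

text \<open>Everything the cutoff in x_1 alters lies in the strip x_1 <= exp (-L) and is of order
  1/L by \<open>strip_bounds\<close>. What survives for large L is twice the energy of v as a
  function of ln |x|.\<close>

lemma tgs_energy_bounds:
  assumes v: "radial_cutoff v R"
  obtains K where "K \<ge> 0"
    "\<forall>L L'. 1 \<le> L \<longrightarrow> L \<le> L' \<longrightarrow> En (tgs v (\<lambda>s. chi L s - chi L' s)) \<le> K / L"
    "\<forall>L\<ge>1. ennreal (En (tgs v (chi L))) \<le> (\<integral>\<^sup>+x. ennreal (2 * (deriv v (lr x))\<^sup>2 * rdens x) \<partial>lborel) + ennreal (K / L)"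
    "\<forall>L\<ge>1. (\<integral>\<^sup>+x. ennreal (rdens x * (v (lr x) * (1 - chi L (x $ e 1)))\<^sup>2) \<partial>lborel) \<le> ennreal (K / L)"
proof -
  obtain B0 where B0: "B0 > 0" "\<And>s. \<bar>v s\<bar> \<le> B0" using radial_cutoff_bounded[OF v] by blast
  obtain B1 where B1: "B1 > 0" "\<And>s. \<bar>deriv v s\<bar> \<le> B1" using radial_cutoff_bounded[OF radial_cutoff_deriv(3)[OF v]] by blast
  have R: "R > 0" using v by (simp add: radial_cutoff_def)
  have [measurable]: "v \<in> borel_measurable borel" "deriv v \<in> borel_measurable borel"
    using measurable_radial_cutoff v radial_cutoff_deriv(3)[OF v] by blast+
  \<comment> \<open>Off this larger annulus both v and its derivative vanish at ln |x|.\<close>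
  let ?R = "R + 1"
  obtain C where C: "C \<ge> 0"
    "\<And>L. L \<ge> 1 \<Longrightarrow> (\<integral>\<^sup>+x. indicator (ann ?R) x * (ennreal (exp (2 * hlog x)) * ennreal ((chi' L (x $ e 1))\<^sup>2)) \<partial>lborel) \<le> ennreal (C / L)"
    "\<And>L. L \<ge> 1 \<Longrightarrow> (\<integral>\<^sup>+x. indicator (ann ?R) x * (ennreal (exp (2 * hlog x)) * indicator {..<exp (- L)} (x $ e 1)) \<partial>lborel) \<le> ennreal (C / L)"
    using strip_bounds[of ?R] R by auto
  let ?E = "exp (2 * ?R)"
  let ?i1 = "\<lambda>L. \<integral>\<^sup>+x. indicator (ann ?R) x * (ennreal (exp (2 * hlog x)) * ennreal ((chi' L (x $ e 1))\<^sup>2)) \<partial>lborel"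
  let ?i2 = "\<lambda>L. \<integral>\<^sup>+x. indicator (ann ?R) x * (ennreal (exp (2 * hlog x)) * indicator {..<exp (- L)} (x $ e 1)) \<partial>lborel"
  \<comment> \<open>The sum of the constants from the two energy estimates and the mass estimate, so
    that one K serves all three conclusions.\<close>
  define K where "K = 2 * B1\<^sup>2 * ?E * C + 8 * B0\<^sup>2 * C + B0\<^sup>2 * ?E * C"
  have K: "2 * B1\<^sup>2 * ?E * C + 8 * B0\<^sup>2 * C \<le> K" "2 * B0\<^sup>2 * C \<le> K" "B0\<^sup>2 * ?E * C \<le> K" "0 \<le> K"
  proof -
    have "0 \<le> 2 * B1\<^sup>2 * ?E * C" "0 \<le> 2 * B0\<^sup>2 * C" "0 \<le> B0\<^sup>2 * ?E * C" using C(1) by auto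
    then show "2 * B1\<^sup>2 * ?E * C + 8 * B0\<^sup>2 * C \<le> K" "2 * B0\<^sup>2 * C \<le> K" "B0\<^sup>2 * ?E * C \<le> K" "0 \<le> K"
      unfolding K_def by linarith+
  qed
  have v2: "(v s)\<^sup>2 \<le> B0\<^sup>2" "(deriv v s)\<^sup>2 \<le> B1\<^sup>2" for s
    using B0 B1 abs_le_square_iff[of "v s" B0] abs_le_square_iff[of "deriv v s" B1] by auto
  have v0: "v (lr x) = 0" "deriv v (lr x) = 0" if "x \<in> D" "x \<notin> ann ?R" for x
  proof -
    have "\<bar>lr x\<bar> \<ge> ?R" using in_annI[OF that(1), of ?R] that(2) by force
    then show "v (lr x) = 0" "deriv v (lr x) = 0"
      using v radial_cutoff_deriv(2)[OF v, of "lr x"] by (auto simp: radial_cutoff_def)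
  qed
  have rd: "(\<integral>\<^sup>+x. ennreal (a * exp (2 * hlog x) * (chi' L (x $ e 1))\<^sup>2) * indicator (ann ?R) x \<partial>lborel) \<le> ennreal (a * C / L)"
    if "a \<ge> 0" "L \<ge> 1" for a L
  proof -
    have "(\<integral>\<^sup>+x. ennreal (a * exp (2 * hlog x) * (chi' L (x $ e 1))\<^sup>2) * indicator (ann ?R) x \<partial>lborel) = ennreal a * ?i1 L"
      by (subst nn_integral_cmult[symmetric], simp, intro nn_integral_cong)
         (use that in \<open>simp add: ennreal_mult' mult_ac\<close>)
    also have "\<dots> \<le> ennreal a * ennreal (C / L)" by (intro mult_left_mono C that) simp
    finally show ?thesis using that by (simp add: ennreal_mult'[symmetric])
  qed
  have rd': "(\<integral>\<^sup>+x. ennreal (a * exp (2 * hlog x) * indicator {..<exp (- L)} (x $ e 1)) * indicator (ann ?R) x \<partial>lborel) \<le> ennreal (a * C / L)"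
    if "a \<ge> 0" "L \<ge> 1" for a L
  proof -
    have "(\<integral>\<^sup>+x. ennreal (a * exp (2 * hlog x) * indicator {..<exp (- L)} (x $ e 1)) * indicator (ann ?R) x \<partial>lborel) = ennreal a * ?i2 L"
      by (subst nn_integral_cmult[symmetric], simp, intro nn_integral_cong)
         (use that in \<open>auto simp: ennreal_mult' mult_ac indicator_def\<close>)
    also have "\<dots> \<le> ennreal a * ennreal (C / L)" by (intro mult_left_mono C that) simp
    finally show ?thesis using that by (simp add: ennreal_mult'[symmetric])
  qed
  show ?thesis
  proof (rule that[OF K(4)]; intro allI impI)
    fix L L' :: real assume L: "1 \<le> L" "L \<le> L'"
    let ?c = "\<lambda>s. chi L s - chi L' s"
    let ?f1 = "\<lambda>x. ennreal (2 * B1\<^sup>2 * ?E * exp (2 * hlog x) * indicator {..<exp (- L)} (x $ e 1)) * indicator (ann ?R) x"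
    let ?f2 = "\<lambda>L x. ennreal (4 * B0\<^sup>2 * exp (2 * hlog x) * (chi' L (x $ e 1))\<^sup>2) * indicator (ann ?R) x"
    \<comment> \<open>At s = 1 the cutoff \<open>chi L'\<close> equals one, so the difference is not
      \<open>chi L\<close>. This decides the conditional in \<open>En_tgs_le\<close>.\<close>
    have "chi L \<noteq> ?c \<or> (\<lambda>s. chi' L s - chi' L' s) = chi' L"
    proof (rule disjI1, rule notI)
      assume "chi L = ?c"
      then have "chi L 1 = chi L 1 - chi L' 1" by metis
      then show False using L chi_eq_1[of L' 1] by simp
    qed
    then have c': "(\<lambda>s. chi' L s - chi' L' s) = (if ?c = chi L then chi' L else (\<lambda>s. chi' L s - chi' L' s))"
      by (cases "?c = chi L") auto
    have "ennreal (En (tgs v ?c)) \<le> (\<integral>\<^sup>+x. indicator D x * ennreal (2 * (deriv v (lr x) * ?c (x $ e 1))\<^sup>2 * rdens x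
      + 2 * exp (2 * hlog x) * (v (lr x) * (chi' L (x $ e 1) - chi' L' (x $ e 1)))\<^sup>2) \<partial>lborel)"
      by (rule En_tgs_le[OF v _ _ _ c']) (use L in auto)
    also have "\<dots> \<le> (\<integral>\<^sup>+x. ?f1 x + (?f2 L x + ?f2 L' x) \<partial>lborel)"
    proof (rule nn_integral_mono)
      fix x
      show "indicator D x * ennreal (2 * (deriv v (lr x) * ?c (x $ e 1))\<^sup>2 * rdens x
        + 2 * exp (2 * hlog x) * (v (lr x) * (chi' L (x $ e 1) - chi' L' (x $ e 1)))\<^sup>2) \<le> ?f1 x + (?f2 L x + ?f2 L' x)"
      proof (cases "x \<in> D \<and> x \<in> ann ?R")
        case True
        let ?s = "x $ e 1"
        have "(deriv v (lr x) * ?c ?s)\<^sup>2 * rdens x \<le> (B1\<^sup>2 * indicator {..<exp (- L)} ?s) * (?E * exp (2 * hlog x))"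
          unfolding power_mult_distrib
          using True L by (intro mult_mono v2 chi_diff_sq_le rdens_le_ann rdens_nonneg) auto
        moreover have "(v (lr x) * (chi' L ?s - chi' L' ?s))\<^sup>2 \<le> B0\<^sup>2 * (2 * (chi' L ?s)\<^sup>2 + 2 * (chi' L' ?s)\<^sup>2)"
          unfolding power_mult_distrib by (intro mult_mono v2 sq_diff_le) auto
        then have "exp (2 * hlog x) * (v (lr x) * (chi' L ?s - chi' L' ?s))\<^sup>2 \<le> exp (2 * hlog x) * (B0\<^sup>2 * (2 * (chi' L ?s)\<^sup>2 + 2 * (chi' L' ?s)\<^sup>2))"
          by (intro mult_left_mono) auto
        ultimately have "2 * (deriv v (lr x) * ?c ?s)\<^sup>2 * rdens x + 2 * exp (2 * hlog x) * (v (lr x) * (chi' L ?s - chi' L' ?s))\<^sup>2 \<le>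
          2 * B1\<^sup>2 * ?E * exp (2 * hlog x) * indicator {..<exp (- L)} ?s +
          (4 * B0\<^sup>2 * exp (2 * hlog x) * (chi' L ?s)\<^sup>2 + 4 * B0\<^sup>2 * exp (2 * hlog x) * (chi' L' ?s)\<^sup>2)"
          by (simp add: algebra_simps)
        from ennreal_leI[OF this] show ?thesis using True by (simp add: ennreal_plus[symmetric] del: ennreal_plus)
      next
        case False
        then have z: "indicator D x * ennreal (2 * (deriv v (lr x) * ?c (x $ e 1))\<^sup>2 * rdens x
          + 2 * exp (2 * hlog x) * (v (lr x) * (chi' L (x $ e 1) - chi' L' (x $ e 1)))\<^sup>2) = 0"
          using v0[of x] by (cases "x \<in> D") auto
        show ?thesis unfolding z by (rule zero_le)
      qed
    qed
    also have "\<dots> = (\<integral>\<^sup>+x. ?f1 x \<partial>lborel) + ((\<integral>\<^sup>+x. ?f2 L x \<partial>lborel) + (\<integral>\<^sup>+x. ?f2 L' x \<partial>lborel))"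
      by (subst nn_integral_add, measurable, subst nn_integral_add, measurable)
    also have "\<dots> \<le> ennreal (2 * B1\<^sup>2 * ?E * C / L) + (ennreal (4 * B0\<^sup>2 * C / L) + ennreal (4 * B0\<^sup>2 * C / L'))"
      using L by (intro add_mono rd rd') auto
    also have "\<dots> = ennreal (2 * B1\<^sup>2 * ?E * C / L + (4 * B0\<^sup>2 * C / L + 4 * B0\<^sup>2 * C / L'))"
      using L C(1) by (simp add: ennreal_plus)
    also have "\<dots> \<le> ennreal (K / L)"
    proof (rule ennreal_leI)
      have "4 * B0\<^sup>2 * C / L' \<le> 4 * B0\<^sup>2 * C / L" using L C(1) by (intro divide_left_mono) auto
      then have "2 * B1\<^sup>2 * ?E * C / L + (4 * B0\<^sup>2 * C / L + 4 * B0\<^sup>2 * C / L') \<le> (2 * B1\<^sup>2 * ?E * C + 8 * B0\<^sup>2 * C) / L"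
      proof -
        have "8 * B0\<^sup>2 * C / L = 2 * (4 * B0\<^sup>2 * C / L)" by simp
        then show ?thesis using \<open>4 * B0\<^sup>2 * C / L' \<le> 4 * B0\<^sup>2 * C / L\<close> unfolding add_divide_distrib by argo
      qed
      also have "\<dots> \<le> K / L" using K L by (intro divide_right_mono) auto
      finally show "2 * B1\<^sup>2 * ?E * C / L + (4 * B0\<^sup>2 * C / L + 4 * B0\<^sup>2 * C / L') \<le> K / L" .
    qed
    finally show "En (tgs v ?c) \<le> K / L" using K L by (simp add: ennreal_le_iff)
  next
    fix L :: real assume L: "1 \<le> L"
    let ?f1 = "\<lambda>x. ennreal (2 * (deriv v (lr x))\<^sup>2 * rdens x)"
    let ?f2 = "\<lambda>x. ennreal (2 * B0\<^sup>2 * exp (2 * hlog x) * (chi' L (x $ e 1))\<^sup>2) * indicator (ann ?R) x"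
    have "ennreal (En (tgs v (chi L))) \<le> (\<integral>\<^sup>+x. indicator D x * ennreal (2 * (deriv v (lr x) * chi L (x $ e 1))\<^sup>2 * rdens x
      + 2 * exp (2 * hlog x) * (v (lr x) * chi' L (x $ e 1))\<^sup>2) \<partial>lborel)"
      by (rule En_tgs_le[OF v, of L 1]) (use L in auto)
    also have "\<dots> \<le> (\<integral>\<^sup>+x. ?f1 x + ?f2 x \<partial>lborel)"
    proof (rule nn_integral_mono)
      fix x
      show "indicator D x * ennreal (2 * (deriv v (lr x) * chi L (x $ e 1))\<^sup>2 * rdens x
        + 2 * exp (2 * hlog x) * (v (lr x) * chi' L (x $ e 1))\<^sup>2) \<le> ?f1 x + ?f2 x"
      proof (cases "x \<in> D \<and> x \<in> ann ?R")
        case True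
        let ?s = "x $ e 1"
        have "(chi L ?s)\<^sup>2 \<le> 1" using chi_bounds[of L ?s] by (simp add: power_le_one)
        then have "(deriv v (lr x) * chi L ?s)\<^sup>2 * rdens x \<le> ((deriv v (lr x))\<^sup>2 * 1) * rdens x"
          unfolding power_mult_distrib by (intro mult_right_mono mult_left_mono rdens_nonneg) auto
        then have "2 * (deriv v (lr x) * chi L ?s)\<^sup>2 * rdens x \<le> 2 * (deriv v (lr x))\<^sup>2 * rdens x" by simp
        moreover have "exp (2 * hlog x) * (v (lr x) * chi' L ?s)\<^sup>2 \<le> exp (2 * hlog x) * (B0\<^sup>2 * (chi' L ?s)\<^sup>2)"
          unfolding power_mult_distrib by (intro mult_left_mono mult_right_mono v2) auto
        then have "2 * exp (2 * hlog x) * (v (lr x) * chi' L ?s)\<^sup>2 \<le> 2 * B0\<^sup>2 * exp (2 * hlog x) * (chi' L ?s)\<^sup>2" by simp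
        ultimately have "2 * (deriv v (lr x) * chi L ?s)\<^sup>2 * rdens x + 2 * exp (2 * hlog x) * (v (lr x) * chi' L ?s)\<^sup>2 \<le>
          2 * (deriv v (lr x))\<^sup>2 * rdens x + 2 * B0\<^sup>2 * exp (2 * hlog x) * (chi' L ?s)\<^sup>2"
          by (rule add_mono)
        from ennreal_leI[OF this] show ?thesis using True rdens_nonneg[of x] by (simp add: ennreal_plus[symmetric] del: ennreal_plus)
      next
        case False
        then have z: "indicator D x * ennreal (2 * (deriv v (lr x) * chi L (x $ e 1))\<^sup>2 * rdens x
          + 2 * exp (2 * hlog x) * (v (lr x) * chi' L (x $ e 1))\<^sup>2) = 0"
          using v0[of x] by (cases "x \<in> D") auto
        show ?thesis unfolding z by (rule zero_le)
      qed
    qed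
    also have "\<dots> = (\<integral>\<^sup>+x. ?f1 x \<partial>lborel) + (\<integral>\<^sup>+x. ?f2 x \<partial>lborel)"
      by (subst nn_integral_add, measurable)
    also have "\<dots> \<le> (\<integral>\<^sup>+x. ?f1 x \<partial>lborel) + ennreal (2 * B0\<^sup>2 * C / L)"
      using L by (intro add_mono rd) auto
    also have "\<dots> \<le> (\<integral>\<^sup>+x. ?f1 x \<partial>lborel) + ennreal (K / L)"
      using K L by (intro add_left_mono ennreal_leI divide_right_mono) auto
    finally show "ennreal (En (tgs v (chi L))) \<le> (\<integral>\<^sup>+x. ?f1 x \<partial>lborel) + ennreal (K / L)" .
    have "(\<integral>\<^sup>+x. ennreal (rdens x * (v (lr x) * (1 - chi L (x $ e 1)))\<^sup>2) \<partial>lborel) \<le>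
      (\<integral>\<^sup>+x. ennreal (B0\<^sup>2 * ?E * exp (2 * hlog x) * indicator {..<exp (- L)} (x $ e 1)) * indicator (ann ?R) x \<partial>lborel)"
    proof (rule nn_integral_mono)
      fix x
      show "ennreal (rdens x * (v (lr x) * (1 - chi L (x $ e 1)))\<^sup>2) \<le>
        ennreal (B0\<^sup>2 * ?E * exp (2 * hlog x) * indicator {..<exp (- L)} (x $ e 1)) * indicator (ann ?R) x"
      proof (cases "x \<in> D \<and> x \<in> ann ?R")
        case True
        let ?s = "x $ e 1"
        have "(1 - chi L ?s)\<^sup>2 \<le> indicator {..<exp (- L)} ?s"
        proof (cases "?s < exp (- L)")
          case True then show ?thesis using chi_bounds[of L ?s] by (simp add: power_le_one)
        next
          case False then show ?thesis using chi_eq_1[of L ?s] L by simp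
        qed
        then have "rdens x * (v (lr x) * (1 - chi L ?s))\<^sup>2 \<le> (?E * exp (2 * hlog x)) * (B0\<^sup>2 * indicator {..<exp (- L)} ?s)"
          unfolding power_mult_distrib using True by (intro mult_mono v2 rdens_le_ann) auto
        from ennreal_leI[OF this] show ?thesis using True by (simp add: mult_ac)
      next
        case False
        then have z: "rdens x * (v (lr x) * (1 - chi L (x $ e 1)))\<^sup>2 = 0"
          using v0[of x] by (cases "x \<in> D") (auto simp: rdens_def)
        show ?thesis unfolding z by simp
      qed
    qed
    also have "\<dots> \<le> ennreal (B0\<^sup>2 * ?E * C / L)" using L by (intro rd') auto
    also have "\<dots> \<le> ennreal (K / L)" using K L by (intro ennreal_leI divide_right_mono) auto
    finally show "(\<integral>\<^sup>+x. ennreal (rdens x * (v (lr x) * (1 - chi L (x $ e 1)))\<^sup>2) \<partial>lborel) \<le> ennreal (K / L)" .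
  qed
qed

end


context hardy_weights
begin

subsection \<open>Ground states cut off in the radial direction\<close>

abbreviation cr :: "(real ^ 'n \<Rightarrow> real) \<Rightarrow> real ^ 'n \<Rightarrow> complex"
  where "cr f \<equiv> \<lambda>x. complex_of_real (f x)"

lemma nn_integral_M:
  assumes "g \<in> borel_measurable borel"
  shows "(\<integral>\<^sup>+x. g x \<partial>M) = (\<integral>\<^sup>+x. ennreal (indicator D x * W x) * g x \<partial>lborel)"
  unfolding M_density by (rule nn_integral_density) (use assms in auto)

lemma nn_integral_M_sq:
  assumes [measurable]: "f \<in> borel_measurable borel"
  shows "(\<integral>\<^sup>+x. ennreal ((cmod (cr f x))\<^sup>2) \<partial>M) = (\<integral>\<^sup>+x. ennreal (indicator D x * W x * (f x)\<^sup>2) \<partial>lborel)"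
proof -
  have [measurable]: "(\<lambda>x. ennreal ((f x)\<^sup>2)) \<in> borel_measurable borel" by measurable
  have "(\<integral>\<^sup>+x. ennreal ((cmod (cr f x))\<^sup>2) \<partial>M) = (\<integral>\<^sup>+x. ennreal ((f x)\<^sup>2) \<partial>M)" by simp
  also have "\<dots> = (\<integral>\<^sup>+x. ennreal (indicator D x * W x) * ennreal ((f x)\<^sup>2) \<partial>lborel)" by (rule nn_integral_M) simp
  also have "\<dots> = (\<integral>\<^sup>+x. ennreal (indicator D x * W x * (f x)\<^sup>2) \<partial>lborel)"
    by (intro nn_integral_cong ennreal_mult'[symmetric] weight_nonneg)
  finally show ?thesis .
qed

lemma L2_cr:
  assumes [measurable]: "f \<in> borel_measurable borel"
    and fin: "(\<integral>\<^sup>+x. ennreal (indicator D x * W x * (f x)\<^sup>2) \<partial>lborel) < \<infinity>"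
  shows "cr f \<in> L2 M" "ennreal ((L2_norm M (cr f))\<^sup>2) = (\<integral>\<^sup>+x. ennreal (indicator D x * W x * (f x)\<^sup>2) \<partial>lborel)"
proof -
  have m: "cr f \<in> borel_measurable M" unfolding measurable_M by measurable
  have i: "integrable M (\<lambda>x. (cmod (cr f x))\<^sup>2)"
  proof (rule integrableI_bounded)
    show "(\<lambda>x. (cmod (cr f x))\<^sup>2) \<in> borel_measurable M" using m by measurable
    show "(\<integral>\<^sup>+x. ennreal (norm ((cmod (cr f x))\<^sup>2)) \<partial>M) < \<infinity>"
      using fin nn_integral_M_sq[OF assms(1)] by simp
  qed
  show "cr f \<in> L2 M" unfolding L2_def using m i by simp
  show "ennreal ((L2_norm M (cr f))\<^sup>2) = (\<integral>\<^sup>+x. ennreal (indicator D x * W x * (f x)\<^sup>2) \<partial>lborel)"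
    unfolding L2_norm_sq nn_integral_M_sq[OF assms(1), symmetric]
    by (rule nn_integral_eq_integral[symmetric, OF i]) simp
qed

lemma gs_measurable:
  assumes "radial_cutoff v R"
  shows "gs v \<in> borel_measurable borel"
proof -
  have [measurable]: "v \<in> borel_measurable borel" by (rule measurable_radial_cutoff[OF assms])
  show ?thesis unfolding gs_def[abs_def] by measurable
qed

lemma weight_ground: "indicator D x * W x * (exp (hlog x) * t)\<^sup>2 = \<beta> n * (rdens x * t\<^sup>2)"
  by (simp add: rdens_def indicator_def power_mult_distrib exp_double)

lemma weight_gs: "indicator D x * W x * (gs v x)\<^sup>2 = \<beta> n * (rdens x * (v (lr x))\<^sup>2)"
proof (cases "x \<in> D")
  case True
  then have "gs v x = exp (hlog x) * v (lr x)" by (simp add: gs_def)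
  then show ?thesis by (simp only: weight_ground)
qed (simp add: rdens_def)

lemma shell_bound:
  assumes v: "radial_cutoff v R" and B: "\<And>s. \<bar>v s\<bar> \<le> B"
  shows "(\<integral>\<^sup>+x. ennreal (rdens x * (v (lr x))\<^sup>2) \<partial>lborel) \<le> ennreal (B\<^sup>2) * shell (- R) R"
proof -
  have [measurable]: "v \<in> borel_measurable borel" by (rule measurable_radial_cutoff[OF v])
  have "(\<integral>\<^sup>+x. ennreal (rdens x * (v (lr x))\<^sup>2) \<partial>lborel) \<le>
      (\<integral>\<^sup>+x. ennreal (B\<^sup>2) * (indicator {x. exp (- R) \<le> norm x \<and> norm x < exp R} x * ennreal (rdens x)) \<partial>lborel)"
  proof (rule nn_integral_mono)
    fix x :: "real ^ 'n"
    show "ennreal (rdens x * (v (lr x))\<^sup>2) \<le> ennreal (B\<^sup>2) * (indicator {x. exp (- R) \<le> norm x \<and> norm x < exp R} x * ennreal (rdens x))"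
    proof (cases "x \<in> D \<and> \<bar>lr x\<bar> < R")
      case True
      have "(v (lr x))\<^sup>2 \<le> B\<^sup>2" using B[of "lr x"] abs_le_square_iff[of "v (lr x)" B] by linarith
      then have "rdens x * (v (lr x))\<^sup>2 \<le> B\<^sup>2 * rdens x"
        using mult_right_mono[OF _ rdens_nonneg[of x]] by (simp add: mult.commute[of "rdens x"])
      from ennreal_leI[OF this] show ?thesis using lr_lt[of x R] True by (simp add: ennreal_mult')
    next
      case False
      then have "rdens x * (v (lr x))\<^sup>2 = 0" using v by (cases "x \<in> D") (auto simp: rdens_def radial_cutoff_def)
      then show ?thesis by (simp only: ennreal_0 zero_le)
    qed
  qed
  also have "\<dots> = ennreal (B\<^sup>2) * shell (- R) R" unfolding shell_def by (rule nn_integral_cmult) measurable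
  finally show ?thesis .
qed

lemma gs_L2:
  assumes v: "radial_cutoff v R"
  shows "cr (gs v) \<in> L2 M" "ennreal ((L2_norm M (cr (gs v)))\<^sup>2) = ennreal (\<beta> n) * (\<integral>\<^sup>+x. ennreal (rdens x * (v (lr x))\<^sup>2) \<partial>lborel)"
proof -
  have [measurable]: "v \<in> borel_measurable borel" by (rule measurable_radial_cutoff[OF v])
  obtain B where B: "\<And>s. \<bar>v s\<bar> \<le> B" using radial_cutoff_bounded[OF v] by blast
  have eq: "(\<integral>\<^sup>+x. ennreal (indicator D x * W x * (gs v x)\<^sup>2) \<partial>lborel) = ennreal (\<beta> n) * (\<integral>\<^sup>+x. ennreal (rdens x * (v (lr x))\<^sup>2) \<partial>lborel)"
    unfolding weight_gs using \<beta>n_pos by (subst nn_integral_cmult[symmetric]) (auto simp: ennreal_mult')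
  have "\<dots> \<le> ennreal (\<beta> n) * (ennreal (B\<^sup>2) * shell (- R) R)" by (intro mult_left_mono shell_bound[OF v B]) simp
  also have "\<dots> < \<infinity>" using shell_finite[of "- R" R] by (simp add: ennreal_mult_less_top)
  finally have fin: "(\<integral>\<^sup>+x. ennreal (indicator D x * W x * (gs v x)\<^sup>2) \<partial>lborel) < \<infinity>" unfolding eq .
  show "cr (gs v) \<in> L2 M" "ennreal ((L2_norm M (cr (gs v)))\<^sup>2) = ennreal (\<beta> n) * (\<integral>\<^sup>+x. ennreal (rdens x * (v (lr x))\<^sup>2) \<partial>lborel)"
    using L2_cr[OF gs_measurable[OF v] fin] eq by auto
qed

lemma q_real_diff:
  assumes "f \<in> test_functions D" "g \<in> test_functions D"
  shows "q (\<lambda>x. cr f x - cr g x) = En (\<lambda>x. f x - g x) + (L2_norm M (\<lambda>x. cr f x - cr g x))\<^sup>2"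
proof -
  have d: "(\<lambda>x. f x - g x) \<in> test_functions D" by (rule test_functions_diff[OF assms])
  show ?thesis using form_of_real[OF d] quad_form_V0[OF d] L2_norm_of_real[OF d] by simp
qed

text \<open>The truncations in x_1 converge in mass and are Cauchy in energy. This puts
  \<open>gs v\<close> into the form domain although in general its support reaches the
  boundary.\<close>

lemma form_limit_gs:
  assumes v: "radial_cutoff v R"
  shows "form_limit (cr (gs v)) (\<lambda>k. cr (tgs v (chi (real (Suc k)))))"
proof -
  obtain K where K': "K \<ge> 0"
    "\<forall>L L'. 1 \<le> L \<longrightarrow> L \<le> L' \<longrightarrow> En (tgs v (\<lambda>s. chi L s - chi L' s)) \<le> K / L"
    "\<forall>L\<ge>1. (\<integral>\<^sup>+x. ennreal (rdens x * (v (lr x) * (1 - chi L (x $ e 1)))\<^sup>2) \<partial>lborel) \<le> ennreal (K / L)"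
    by (rule tgs_energy_bounds[OF v])
  note K = K'(1) K'(2,3)[rule_format]
  have [measurable]: "v \<in> borel_measurable borel" by (rule measurable_radial_cutoff[OF v])
  let ?\<psi> = "\<lambda>k. tgs v (chi (real (Suc k)))"
  have t: "?\<psi> k \<in> test_functions D" for k by (rule tgs_chi_test[OF v]) simp
  have T: "cr (?\<psi> k) \<in> T" for k by (rule test_functions_of_real[OF t])
  define s where "s k = L2_norm M (\<lambda>x. cr (?\<psi> k) x - cr (gs v) x)" for k
  have s_le: "s k \<le> sqrt (\<beta> n * (K / real (Suc k)))" for k
  proof -
    let ?f = "\<lambda>x. ?\<psi> k x - gs v x"
    have m: "?f \<in> borel_measurable borel" using test_functions_measurable[OF t[of k]] gs_measurable[OF v] by measurable
    have "indicator D x * W x * (?f x)\<^sup>2 = \<beta> n * (rdens x * (v (lr x) * (1 - chi (real (Suc k)) (x $ e 1)))\<^sup>2)" for x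
    proof (cases "x \<in> D")
      case True
      have "?f x = exp (hlog x) * (- (v (lr x) * (1 - chi (real (Suc k)) (x $ e 1))))"
        using True by (simp add: tgs_def gs_def algebra_simps)
      then show ?thesis using weight_ground[of x "- (v (lr x) * (1 - chi (real (Suc k)) (x $ e 1)))"] by simp
    qed (simp add: rdens_def)
    then have "(\<integral>\<^sup>+x. ennreal (indicator D x * W x * (?f x)\<^sup>2) \<partial>lborel) =
        ennreal (\<beta> n) * (\<integral>\<^sup>+x. ennreal (rdens x * (v (lr x) * (1 - chi (real (Suc k)) (x $ e 1)))\<^sup>2) \<partial>lborel)"
      using \<beta>n_pos by (subst nn_integral_cmult[symmetric]) (auto simp: ennreal_mult')
    also have "\<dots> \<le> ennreal (\<beta> n) * ennreal (K / real (Suc k))" by (intro mult_left_mono K) auto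
    also have "\<dots> = ennreal (\<beta> n * (K / real (Suc k)))" using \<beta>n_pos K(1) by (simp add: ennreal_mult'[symmetric])
    finally have le: "(\<integral>\<^sup>+x. ennreal (indicator D x * W x * (?f x)\<^sup>2) \<partial>lborel) \<le> ennreal (\<beta> n * (K / real (Suc k)))" .
    then have "ennreal ((L2_norm M (cr ?f))\<^sup>2) \<le> ennreal (\<beta> n * (K / real (Suc k)))"
      using L2_cr(2)[OF m] order_le_less_trans[OF le ennreal_less_top] by simp
    then have "(s k)\<^sup>2 \<le> \<beta> n * (K / real (Suc k))" using \<beta>n_pos K(1) by (simp add: s_def ennreal_le_iff)
    then show ?thesis by (rule real_le_rsqrt)
  qed
  have lim: "(\<lambda>k. K / real (Suc k)) \<longlonglongrightarrow> 0"
    using tendsto_mult_right_zero[OF LIMSEQ_inverse_real_of_nat, of K] by (simp add: divide_inverse)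
  have s0: "s \<longlonglongrightarrow> 0"
  proof (rule Lim_null_comparison)
    show "\<forall>\<^sub>F k in sequentially. norm (s k) \<le> sqrt (\<beta> n * (K / real (Suc k)))"
      using s_le by (simp add: s_def)
    show "(\<lambda>k. sqrt (\<beta> n * (K / real (Suc k)))) \<longlonglongrightarrow> 0"
      using tendsto_real_sqrt[OF tendsto_mult_right_zero[OF lim, of "\<beta> n"]] by simp
  qed
  show ?thesis
    unfolding form_limit_def
  proof (intro conjI allI impI)
    show "cr (?\<psi> k) \<in> T" for k by (rule T)
    show "(\<lambda>k. L2_norm M (\<lambda>x. cr (?\<psi> k) x - cr (gs v) x)) \<longlonglongrightarrow> 0" using s0 unfolding s_def .
    fix \<epsilon> :: real assume \<epsilon>: "\<epsilon> > 0"
    \<comment> \<open>The form is energy plus squared norm. The first bound keeps the energy part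
      below half of epsilon^2; the second keeps the distance of two truncations below epsilon / 2,
      so the squared norm contributes at most a quarter.\<close>
    have "\<forall>\<^sub>F k in sequentially. K / real (Suc k) < \<epsilon>\<^sup>2 / 2"
      by (rule order_tendstoD(2)[OF lim]) (use \<epsilon> in simp)
    moreover have "\<forall>\<^sub>F k in sequentially. s k < \<epsilon> / 4"
      by (rule order_tendstoD(2)[OF s0]) (use \<epsilon> in simp)
    ultimately have "\<forall>\<^sub>F k in sequentially. K / real (Suc k) < \<epsilon>\<^sup>2 / 2 \<and> s k < \<epsilon> / 4"
      by (rule eventually_conj)
    then obtain N where N: "\<And>k. k \<ge> N \<Longrightarrow> K / real (Suc k) < \<epsilon>\<^sup>2 / 2 \<and> s k < \<epsilon> / 4"
      unfolding eventually_sequentially by auto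
    have main: "sqrt (q (\<lambda>x. cr (?\<psi> k) x - cr (?\<psi> l) x)) < \<epsilon>" if "k \<ge> N" "l \<ge> N" "k \<le> l" for k l
    proof -
      have d: "(\<lambda>x. ?\<psi> k x - ?\<psi> l x) = tgs v (\<lambda>s. chi (real (Suc k)) s - chi (real (Suc l)) s)"
        by (rule ext) (simp add: tgs_def algebra_simps)
      have "En (\<lambda>x. ?\<psi> k x - ?\<psi> l x) \<le> K / real (Suc k)"
        unfolding d by (rule K(2)) (use that in auto)
      moreover have "L2_norm M (\<lambda>x. cr (?\<psi> k) x - cr (?\<psi> l) x) \<le> s k + s l"
        using L2_norm_triangle_diff[OF T_L2[OF T[of k]] gs_L2(1)[OF v] T_L2[OF T[of l]]]
        by (simp add: s_def L2_norm_diff_commute[of M "cr (gs v)"])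
      then have "(L2_norm M (\<lambda>x. cr (?\<psi> k) x - cr (?\<psi> l) x))\<^sup>2 \<le> (\<epsilon> / 2)\<^sup>2"
        using N[OF that(1)] N[OF that(2)] by (intro power_mono) auto
      moreover have "(\<epsilon> / 2)\<^sup>2 < \<epsilon>\<^sup>2 / 2" using \<epsilon> by (simp add: power_divide)
      ultimately have lt: "q (\<lambda>x. cr (?\<psi> k) x - cr (?\<psi> l) x) < \<epsilon>\<^sup>2"
        unfolding q_real_diff[OF t t] using N[OF that(1)] by linarith
      have "sqrt (\<epsilon>\<^sup>2) = \<epsilon>" using \<epsilon> by simp
      with real_sqrt_less_mono[OF lt] show ?thesis by (rule ord_less_eq_trans)
    qed
    have "sqrt (q (\<lambda>x. cr (?\<psi> k) x - cr (?\<psi> l) x)) < \<epsilon>" if "k \<ge> N" "l \<ge> N" for k l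
      using main[OF that] main[OF that(2,1)] diff_commute[OF T[of k] T[of l]] by (cases "k \<le> l") auto
    then show "\<exists>N. \<forall>k\<ge>N. \<forall>l\<ge>N. sqrt (q (\<lambda>x. cr (?\<psi> k) x - cr (?\<psi> l) x)) < \<epsilon>" by blast
  qed
qed

lemma dh_exp_hlog_open:
  assumes S: "open S" "S \<subseteq> D" and x: "x \<in> S" and f: "f differentiable (at x)" and eq: "\<And>y. y \<in> S \<Longrightarrow> g y = exp (hlog y) * f y"
  shows "dh i g x = exp (hlog x) * partial i f x"
proof -
  have "partial i g x = partial i (\<lambda>y. exp (hlog y) * f y) x" by (rule partial_cong[OF S(1) x eq])
  then have "dh i g x = dh i (\<lambda>y. exp (hlog y) * f y) x" by (simp add: dh_def eq[OF x])
  also have "\<dots> = exp (hlog x) * partial i f x" by (rule dh_exp_hlog[OF _ f]) (use x S in auto)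
  finally show ?thesis .
qed

lemma partial_cr:
  "\<psi> \<in> test_functions D \<Longrightarrow> partial i (cr \<psi>) = cr (partial i \<psi>)"
  by (rule ext) (rule partial_bounded_linear[OF bounded_linear_of_real test_functions_differentiable])

lemma schroedinger_cr:
  "\<psi> \<in> test_functions D \<Longrightarrow> schroedinger V (cr \<psi>) x = of_real (schroedinger V \<psi> x)"
  by (simp add: schroedinger_def laplacian_def partial_cr test_functions_partial scaleR_conv_of_real)

text \<open>The first-order terms cancel: the divergence of x / |x|^2 contributes (n - 2) v' /
  |x|^2, and the cross term with grad u contributes its negative by Euler's identity. The statement
  is local because a truncated function has the required form only where the cutoff in x_1 equals
  one.\<close>

lemma laplacian_ground:
  assumes v: "radial_cutoff v R" and \<psi>: "\<psi> \<in> test_functions D" and S: "open S" "S \<subseteq> D" "x \<in> S"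
    and eq: "\<And>y. y \<in> S \<Longrightarrow> \<psi> y = exp (hlog y) * v (lr y)"
  shows "laplacian \<psi> x + Vn x * \<psi> x = exp (hlog x) * (deriv (deriv v) (lr x) / rr n x)"
proof -
  have x: "x \<in> D" using S by auto
  let ?f = "\<lambda>i y. deriv v (lr y) * (y $ i * inverse (rr n y))"
  note v1 = radial_cutoff_deriv(1)[OF v]
  note v2 = radial_cutoff_deriv(1)[OF radial_cutoff_deriv(3)[OF v]]
  have dhy: "dh i \<psi> y = exp (hlog y) * ?f i y" if "y \<in> S" for i y
  proof -
    have y: "y \<in> D" using that S by auto
    note p = partial_compose[OF v1 lr_differentiable[OF y]]
    have "dh i \<psi> y = exp (hlog y) * partial i (\<lambda>y. v (lr y)) y"
      by (rule dh_exp_hlog_open[OF S(1,2) that p(2) eq])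
    then show ?thesis by (simp add: p(1) partial_lr[OF y] divide_inverse)
  qed
  have rn: "rr n x > 0" using rr_pos[OF x] n2 by simp
  have "(inverse has_real_derivative - (inverse (rr n x))\<^sup>2) (at (rr n x))"
    using rn by (auto intro!: derivative_eq_intros simp: power2_eq_square)
  note inv = partial_compose[OF this rr_differentiable]
  note dv = partial_compose[OF v2 lr_differentiable[OF x]]
  have n: "(\<lambda>x::real^'n. x $ i) differentiable (at x)" for i using has_derivative_nth differentiableI by blast
  have m: "(\<lambda>y. y $ i * inverse (rr n y)) differentiable (at x)" for i by (intro differentiable_mult inv n)
  have f: "?f i differentiable (at x)" for i by (intro differentiable_mult m dv)
  have mem: "i \<in> e ` {1..n}" for i using bij by (auto simp: bij_betw_def)
  have pf: "partial i (?f i) x = deriv (deriv v) (lr x) * (x $ i)\<^sup>2 / (rr n x)\<^sup>2 + deriv v (lr x) * (1 / rr n x - 2 * (x $ i)\<^sup>2 / (rr n x)\<^sup>2)" for i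
    using mem[of i]
    unfolding partial_mult[OF dv(2) m] partial_mult[OF n inv(2)] dv(1) inv(1) partial_lr[OF x] partial_nth partial_rr[OF order_refl]
    by (simp add: divide_inverse power2_eq_square algebra_simps)
  have dd: "dh i (dh i \<psi>) x = exp (hlog x) * partial i (?f i) x" for i
    by (rule dh_exp_hlog_open[OF S f dhy])
  note d = test_functions_differentiable
  \<comment> \<open>The square of the identity that the i-th partial derivative is
    \<open>dh i\<close> plus multiplication by \<open>hgrad i\<close>; the terms of order zero are
    summed by the Riccati equation.\<close>
  have expand: "partial i (partial i \<psi>) x = dh i (dh i \<psi>) x + 2 * hgrad i x * dh i \<psi> x + (partial i (hgrad i) x + (hgrad i x)\<^sup>2) * \<psi> x" for i
  proof -
    have "partial i (dh i \<psi>) x = partial i (partial i \<psi>) x - partial i (\<lambda>x. hgrad i x *\<^sub>R \<psi> x) x"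
      unfolding dh_def[abs_def]
      by (rule partial_diff[OF d[OF test_functions_partial[OF \<psi>]] d[OF test_functions_scaleR[OF open_D Ck_on_hgrad \<psi>]]])
    also have "partial i (\<lambda>x. hgrad i x *\<^sub>R \<psi> x) x = partial i (hgrad i) x * \<psi> x + hgrad i x * partial i \<psi> x"
      by (simp add: partial_mult[OF hgrad_differentiable[OF x] d[OF \<psi>]])
    finally have "partial i (partial i \<psi>) x = partial i (dh i \<psi>) x + partial i (hgrad i) x * \<psi> x + hgrad i x * partial i \<psi> x" by simp
    moreover have "partial i (dh i \<psi>) x = dh i (dh i \<psi>) x + hgrad i x * dh i \<psi> x"
      by (simp add: dh_def[of i "dh i \<psi>"])
    ultimately show ?thesis by (simp add: dh_def[of i \<psi>] power2_eq_square algebra_simps)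
  qed
  let ?u = "exp (hlog x)" and ?v1 = "deriv v (lr x)" and ?v2 = "deriv (deriv v) (lr x)"
  have "laplacian \<psi> x = (\<Sum>i\<in>UNIV. ?u * partial i (?f i) x + 2 * hgrad i x * (?u * ?f i x)) + (\<Sum>i\<in>UNIV. partial i (hgrad i) x + (hgrad i x)\<^sup>2) * \<psi> x"
    unfolding laplacian_def expand dd dhy[OF S(3)] by (simp add: sum.distrib sum_distrib_right distrib_right)
  then have "laplacian \<psi> x + Vn x * \<psi> x = (\<Sum>i\<in>UNIV. ?u * partial i (?f i) x + 2 * hgrad i x * (?u * ?f i x))"
    by (simp add: hlog_Riccati[OF x])
  also have "\<dots> = (\<Sum>i\<in>UNIV. (?u * (?v2 - 2 * ?v1) / (rr n x)\<^sup>2) * (x $ i)\<^sup>2 + ?u * ?v1 / rr n x + (2 * ?u * ?v1 / rr n x) * (x $ i * hgrad i x))"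
    unfolding pf by (intro sum.cong refl) (simp add: divide_inverse algebra_simps)
  also have "\<dots> = (?u * (?v2 - 2 * ?v1) / (rr n x)\<^sup>2) * (\<Sum>i\<in>UNIV. (x $ i)\<^sup>2) + real n * (?u * ?v1 / rr n x) + (2 * ?u * ?v1 / rr n x) * (\<Sum>i\<in>UNIV. x $ i * hgrad i x)"
    unfolding sum.distrib sum_distrib_left[symmetric] by (simp add: card_n)
  also have "(\<Sum>i\<in>UNIV. (x $ i)\<^sup>2) = rr n x" unfolding sum_UNIV rr_def ..
  also have "(\<Sum>i\<in>UNIV. x $ i * hgrad i x) = - (real n - 2) / 2" by (rule hgrad_Euler[OF x])
  finally show ?thesis using rn by (simp add: power2_eq_square field_simps)
qed

text \<open>W is \<open>\<beta> n\<close> / |x|^2, so the factor 1 / |x|^2 in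
  \<open>laplacian_ground\<close> cancels and a one-dimensional operator in ln |x| with constant
  coefficients remains.\<close>

lemma A_ground:
  assumes v: "radial_cutoff v R" and \<psi>: "\<psi> \<in> test_functions D" and S: "open S" "S \<subseteq> D" "x \<in> S"
    and eq: "\<And>y. y \<in> S \<Longrightarrow> \<psi> y = exp (hlog y) * v (lr y)"
  shows "A (cr \<psi>) x = cr (gs (\<lambda>s. v s - deriv (deriv v) s / \<beta> n)) x"
proof -
  have x: "x \<in> D" using S by auto
  have rn: "rr n x > 0" using rr_pos[OF x] n2 by simp
  have "schroedinger V0 \<psi> x = W x * \<psi> x - (laplacian \<psi> x + Vn x * \<psi> x)"
    unfolding schroedinger_def hardy_potential_Suc[of x] by (simp add: algebra_simps)
  also have "\<dots> = W x * \<psi> x - exp (hlog x) * (deriv (deriv v) (lr x) / rr n x)"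
  proof -
    have "laplacian \<psi> x + Vn x * \<psi> x = exp (hlog x) * (deriv (deriv v) (lr x) / rr n x)"
      by (rule laplacian_ground[OF v \<psi> S eq])
    then show ?thesis by (simp only:)
  qed
  also have "\<dots> = W x * (exp (hlog x) * (v (lr x) - deriv (deriv v) (lr x) / \<beta> n))"
    using \<beta>n_pos rn by (simp add: eq[OF S(3)] rr_n[symmetric] field_simps)
  also have "exp (hlog x) * (v (lr x) - deriv (deriv v) (lr x) / \<beta> n) = gs (\<lambda>s. v s - deriv (deriv v) s / \<beta> n) x"
    using x by (simp add: gs_def)
  finally have sch: "schroedinger V0 \<psi> x = W x * gs (\<lambda>s. v s - deriv (deriv v) s / \<beta> n) x" .
  have W: "(1 / W x) * W x = 1" using W_pos[OF x] by (metis less_irrefl nonzero_eq_divide_eq)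
  have "A (cr \<psi>) x = of_real ((1 / W x) * schroedinger V0 \<psi> x)"
    unfolding schroedinger_cr[OF \<psi>] by (simp only: scaleR_conv_of_real of_real_mult)
  also have "(1 / W x) * schroedinger V0 \<psi> x = gs (\<lambda>s. v s - deriv (deriv v) s / \<beta> n) x"
    unfolding sch mult.assoc[symmetric] W by simp
  finally show ?thesis .
qed

text \<open>In the weak equation only values on the support of the test function matter. There
  \<open>gs v\<close> agrees with a truncation that is itself a test function, so symmetry moves
  \<open>A\<close> across and \<open>A_ground\<close> evaluates it.\<close>

lemma friedrichs_gs:
  assumes v: "radial_cutoff v R"
  shows "(cr (gs v), cr (gs (\<lambda>s. v s - deriv (deriv v) s / \<beta> n))) \<in> F" "radial_cutoff (\<lambda>s. v s - deriv (deriv v) s / \<beta> n) (R + 2)"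
proof -
  let ?w = "\<lambda>s. v s - deriv (deriv v) s / \<beta> n"
  have v2: "radial_cutoff (deriv (deriv v)) (R + 1 + 1)" by (intro radial_cutoff_deriv(3) v)
  show w: "radial_cutoff ?w (R + 2)"
    unfolding radial_cutoff_def
  proof (intro conjI allI impI)
    show "R + 2 > 0" using v by (simp add: radial_cutoff_def)
    have "Dk_on k UNIV (\<lambda>s. v s + (- 1 / \<beta> n) * deriv (deriv v) s)" for k
      using v v2 unfolding radial_cutoff_def by (intro Dk_on_add Dk_on_mult Dk_on_const) auto
    then show "Dk_on k UNIV ?w" for k by simp
    show "?w s = 0" if "R + 2 \<le> \<bar>s\<bar>" for s using v v2 that unfolding radial_cutoff_def by auto
  qed
  have weak: "L2_inner M (A \<phi>) (cr (gs v)) = L2_inner M \<phi> (cr (gs ?w))" if \<phi>: "\<phi> \<in> T" for \<phi>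
  proof -
    obtain K where K: "compact K" "K \<subseteq> D" "\<And>x. x \<notin> K \<Longrightarrow> \<phi> x = 0" "\<And>k. Ck_on k UNIV \<phi>"
      using test_functionsE[OF \<phi>] by metis
    obtain m where m: "m > 0" "\<And>x. x \<in> K \<Longrightarrow> m \<le> x $ e 1"
    proof (cases "K = {}")
      case False
      have "\<exists>x\<in>K. \<forall>y\<in>K. x $ e 1 \<le> y $ e 1"
        by (intro continuous_attains_inf K False continuous_intros)
      then obtain x where "x \<in> K" "\<forall>y\<in>K. x $ e 1 \<le> y $ e 1" by blast
      then show ?thesis using K(2) that[of "x $ e 1"] by (auto simp: D_iff)
    qed (use that[of 1] in auto)
    \<comment> \<open>Large enough that \<open>chi L\<close> is one on K: m is a lower bound of the
      first coordinate there, and the summand 1 makes exp (-L) < m strict.\<close>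
    define L where "L = max 1 (1 - ln m)"
    have L: "L \<ge> 1" "exp (- L) < m"
    proof -
      have "- L < ln m" by (simp add: L_def)
      then show "exp (- L) < m" using m(1) by (metis exp_less_cancel_iff exp_ln)
    qed (simp add: L_def)
    define S where "S = {x :: real ^ 'n. x $ e 1 > exp (- L)}"
    have S: "open S" unfolding S_def by (intro open_Collect_less continuous_intros)
    have SD: "S \<subseteq> D"
    proof
      fix x assume "x \<in> S"
      then have "exp (- L) < x $ e 1" by (simp add: S_def)
      then show "x \<in> D" unfolding D_iff using exp_gt_zero[of "- L"] by linarith
    qed
    have "K \<subseteq> S" using m(2) L(2) by (force simp: S_def)
    then have \<phi>S: "\<phi> \<in> test_functions S" using K unfolding test_functions_iff by blast
    have A_S: "A \<phi> \<in> test_functions S"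
      unfolding schroedinger_def[abs_def]
      by (intro test_functions_scaleR test_functions_diff test_functions_minus test_functions_laplacian S \<phi>S
          Ck_on_subset[OF Ck_on_inverse_W SD] Ck_on_subset[OF Ck_on_hardy_potential SD])
    let ?\<psi> = "tgs v (chi L)"
    have \<psi>: "?\<psi> \<in> test_functions D" using L by (intro tgs_chi_test[OF v]) auto
    have \<psi>c: "cr ?\<psi> \<in> T" by (rule test_functions_of_real[OF \<psi>])
    have eq: "?\<psi> y = exp (hlog y) * v (lr y)" if "y \<in> S" for y
    proof -
      have "chi L (y $ e 1) = 1" using that L by (intro chi_eq_1) (auto simp: S_def)
      then show ?thesis using that SD by (auto simp: tgs_def)
    qed
    have "L2_inner M (A \<phi>) (cr (gs v)) = L2_inner M (A \<phi>) (cr ?\<psi>)"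
      unfolding L2_inner_def
    proof (rule Bochner_Integration.integral_cong[OF refl])
      fix x
      show "A \<phi> x * cnj (cr (gs v) x) = A \<phi> x * cnj (cr ?\<psi> x)"
      proof (cases "x \<in> S")
        case True then show ?thesis using eq[OF True] SD by (auto simp: gs_def)
      next
        case False then show ?thesis using test_functions_zero[OF A_S False] by (simp only: mult_zero_left)
      qed
    qed
    also have "\<dots> = cnj (L2_inner M (A (cr ?\<psi>)) \<phi>)" by (rule herm[OF \<psi>c \<phi>])
    also have "\<dots> = L2_inner M \<phi> (A (cr ?\<psi>))"
      by (rule L2.herm[symmetric]) (intro A_L2 \<psi>c T_L2 \<phi>)+
    also have "\<dots> = L2_inner M \<phi> (cr (gs ?w))"
      unfolding L2_inner_def
    proof (rule Bochner_Integration.integral_cong[OF refl])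
      fix x
      show "\<phi> x * cnj (A (cr ?\<psi>) x) = \<phi> x * cnj (cr (gs ?w) x)"
      proof (cases "x \<in> S")
        case True then show ?thesis using A_ground[OF v \<psi> S SD True eq] by simp
      next
        case False then show ?thesis using test_functions_zero[OF \<phi>S False] by simp
      qed
    qed
    finally show ?thesis .
  qed
  show "(cr (gs v), cr (gs ?w)) \<in> F"
    unfolding friedrichs_iff using gs_L2(1)[OF v] gs_L2(1)[OF w] form_limit_gs[OF v] weak by blast
qed

end


subsection \<open>Dilations of test functions\<close>

lemma partial_scale:
  assumes "\<phi> \<in> test_functions D"
  shows "partial i (\<lambda>x. \<phi> (c *\<^sub>R x)) = (\<lambda>x. c *\<^sub>R partial i \<phi> (c *\<^sub>R x))"
    and "(\<lambda>x. \<phi> (c *\<^sub>R x)) differentiable (at x)"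
proof -
  have der: "((\<lambda>x. \<phi> (c *\<^sub>R x)) has_derivative (\<lambda>v. frechet_derivative \<phi> (at (c *\<^sub>R x)) (c *\<^sub>R v))) (at x)" for x
  proof -
    have F: "(\<phi> has_derivative frechet_derivative \<phi> (at (c *\<^sub>R x))) (at (c *\<^sub>R x))"
      using test_functions_differentiable[OF assms] frechet_derivative_works by blast
    show ?thesis
      by (rule has_derivative_compose[where f="\<lambda>x. c *\<^sub>R x" and g=\<phi>, OF _ F]) (auto intro!: derivative_eq_intros)
  qed
  have lin: "linear (frechet_derivative \<phi> (at (c *\<^sub>R x)))" for x
    using test_functions_differentiable[OF assms] by (rule linear_frechet_derivative)
  show "partial i (\<lambda>x. \<phi> (c *\<^sub>R x)) = (\<lambda>x. c *\<^sub>R partial i \<phi> (c *\<^sub>R x))"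
    by (rule ext) (simp add: partial_eqI[OF der] partial_def linear_scale[OF lin])
  show "(\<lambda>x. \<phi> (c *\<^sub>R x)) differentiable (at x)" using der differentiableI by blast
qed

lemma Ck_on_scale:
  "\<phi> \<in> test_functions D \<Longrightarrow> Ck_on k UNIV (\<lambda>x. \<phi> (c *\<^sub>R x))"
proof (induction k arbitrary: \<phi>)
  case 0
  have "continuous_on UNIV \<phi>" by (rule test_functions_continuous[OF 0])
  then show ?case by (auto intro!: continuous_intros continuous_on_compose2[of UNIV \<phi>])
next
  case (Suc k)
  have "Ck_on k UNIV (\<lambda>x. c *\<^sub>R partial i \<phi> (c *\<^sub>R x))" for i
    by (rule Ck_on_bounded_linear[OF open_UNIV bounded_linear_scaleR_right])
       (intro Suc.IH test_functions_partial Suc.prems)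
  then show ?case using partial_scale[OF Suc.prems] by simp
qed

lemma test_functions_scale:
  assumes \<phi>: "\<phi> \<in> test_functions D" and K: "compact K" "\<And>x. x \<notin> K \<Longrightarrow> \<phi> x = 0"
    and c: "c > 0" "\<And>x. x \<in> K \<Longrightarrow> (1 / c) *\<^sub>R x \<in> D'"
  shows "(\<lambda>x. \<phi> (c *\<^sub>R x)) \<in> test_functions D'"
  unfolding test_functions_iff
proof (intro conjI allI exI[of _ "(\<lambda>x. (1 / c) *\<^sub>R x) ` K"])
  show "Ck_on k UNIV (\<lambda>x. \<phi> (c *\<^sub>R x))" for k by (rule Ck_on_scale[OF \<phi>])
  show "compact ((\<lambda>x. (1 / c) *\<^sub>R x) ` K)" by (rule compact_scaling[OF K(1)])
  show "(\<lambda>x. (1 / c) *\<^sub>R x) ` K \<subseteq> D'" using c by auto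
  show "x \<notin> (\<lambda>x. (1 / c) *\<^sub>R x) ` K \<longrightarrow> \<phi> (c *\<^sub>R x) = 0" for x
  proof
    assume "x \<notin> (\<lambda>x. (1 / c) *\<^sub>R x) ` K"
    moreover have "x = (1 / c) *\<^sub>R (c *\<^sub>R x)" using c by simp
    ultimately have "c *\<^sub>R x \<notin> K" by blast
    then show "\<phi> (c *\<^sub>R x) = 0" by (rule K(2))
  qed
qed

lemma radial_cutoff_bump:
  assumes "N > 0"
  shows "radial_cutoff (\<lambda>s. smooth_bump (s / N)) (2 * N)"
  unfolding radial_cutoff_def
proof (intro conjI allI impI)
  show "0 < 2 * N" using assms by simp
  show "Dk_on k UNIV (\<lambda>s. smooth_bump (s / N))" for k
    using Dk_on_compose[OF Dk_on_smooth_bump Dk_on_affine[of k UNIV 0 "1 / N"]] by simp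
  show "smooth_bump (s / N) = 0" if "2 * N \<le> \<bar>s\<bar>" for s
    using that assms by (intro smooth_bump_eq_0) (simp add: le_divide_eq)
qed

lemma smooth_bump_derivs:
  obtains b1 b2 B where "\<And>s. (smooth_bump has_real_derivative b1 s) (at s)" "\<And>s. (b1 has_real_derivative b2 s) (at s)"
    "B > 0" "\<And>s. \<bar>b1 s\<bar> \<le> B" "\<And>s. \<bar>b2 s\<bar> \<le> B"
proof -
  have r: "radial_cutoff smooth_bump 2" using radial_cutoff_bump[of 1] by simp
  note r1 = radial_cutoff_deriv[OF r]
  note r2 = radial_cutoff_deriv[OF r1(3)]
  obtain B1 where B1: "B1 > 0" "\<And>s. \<bar>deriv smooth_bump s\<bar> \<le> B1" using radial_cutoff_bounded[OF r1(3)] by blast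
  obtain B2 where B2: "B2 > 0" "\<And>s. \<bar>deriv (deriv smooth_bump) s\<bar> \<le> B2" using radial_cutoff_bounded[OF r2(3)] by blast
  show ?thesis
  proof (rule that[OF r1(1) r2(1), of "max B1 B2"])
    show "max B1 B2 > 0" using B1 by auto
    show "\<bar>deriv smooth_bump s\<bar> \<le> max B1 B2" "\<bar>deriv (deriv smooth_bump) s\<bar> \<le> max B1 B2" for s
      using B1(2)[of s] B2(2)[of s] by auto
  qed
qed

context hardy_weights
begin

lemma hgrad_scale: "c > 0 \<Longrightarrow> hgrad i (c *\<^sub>R x) = (1 / c) * hgrad i x"
  unfolding hgrad_def sum_distrib_left
  by (intro sum.cong refl) (simp add: rr_scale power2_eq_square divide_inverse)

lemma dh_scale:
  assumes "\<phi> \<in> test_functions D" "c > 0"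
  shows "dh i (\<lambda>x. \<phi> (c *\<^sub>R x)) x = c *\<^sub>R dh i \<phi> (c *\<^sub>R x)"
  using assms(2) by (simp add: dh_def partial_scale[OF assms(1)] hgrad_scale scaleR_diff_right)

text \<open>Energy and mass are multiplied by the same power of c under a dilation, so that their
  ratio is invariant; this transfers constants between regions of the half-space.\<close>

lemma En_scale:
  fixes \<phi> :: "real ^ 'n \<Rightarrow> real"
  assumes \<phi>: "\<phi> \<in> test_functions D" and c: "c > 0" and \<phi>c: "(\<lambda>x. \<phi> (c *\<^sub>R x)) \<in> test_functions D"
  shows "c ^ n * En (\<lambda>x. \<phi> (c *\<^sub>R x)) = c\<^sup>2 * En \<phi>"
proof -
  let ?S = "\<lambda>x. \<Sum>i\<in>UNIV. (dh i \<phi> x)\<^sup>2"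
  have S0: "0 \<le> ?S x" for x by (intro sum_nonneg) simp
  have [measurable]: "?S \<in> borel_measurable borel"
    using borel_measurable_integrable[OF En_integrable[OF \<phi>]] by simp
  have "ennreal (En \<phi>) = ennreal (c ^ n) * (\<integral>\<^sup>+x. ennreal (?S (c *\<^sub>R x)) \<partial>lborel)"
    unfolding ennreal_En[OF \<phi>] by (subst nn_integral_scaleR[OF _ c]) (auto simp: card_n)
  moreover have "ennreal (En (\<lambda>x. \<phi> (c *\<^sub>R x))) = ennreal (c\<^sup>2) * (\<integral>\<^sup>+x. ennreal (?S (c *\<^sub>R x)) \<partial>lborel)"
    unfolding ennreal_En[OF \<phi>c] dh_scale[OF \<phi> c]
    by (subst nn_integral_cmult[symmetric]) (auto simp: ennreal_mult'[symmetric] S0 sum_distrib_left power_mult_distrib)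
  ultimately have "ennreal (c ^ n) * ennreal (En (\<lambda>x. \<phi> (c *\<^sub>R x))) = ennreal (c\<^sup>2) * ennreal (En \<phi>)"
    by (simp add: mult_ac)
  then have "ennreal (c ^ n * En (\<lambda>x. \<phi> (c *\<^sub>R x))) = ennreal (c\<^sup>2 * En \<phi>)"
    using c by (simp add: ennreal_mult')
  then show ?thesis using c En_nonneg by (subst (asm) ennreal_inj) auto
qed

lemma mass_nonneg: "\<phi> \<in> test_functions D \<Longrightarrow> 0 \<le> weighted_mass D W \<phi>"
  using L2_norm_of_real[of \<phi>] zero_le_power2 by metis

lemma ennreal_mass:
  assumes \<phi>: "\<phi> \<in> test_functions D"
  shows "ennreal (weighted_mass D W \<phi>) = (\<integral>\<^sup>+x. ennreal (W x * (\<phi> x)\<^sup>2) \<partial>lborel)"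
  unfolding weighted_mass_eq[OF \<phi>] using \<beta>n_pos
  by (intro nn_integral_eq_integral[symmetric] W_integrable \<phi>) auto

lemma mass_scale:
  assumes \<phi>: "\<phi> \<in> test_functions D" and c: "c > 0" and \<phi>c: "(\<lambda>x. \<phi> (c *\<^sub>R x)) \<in> test_functions D"
  shows "c ^ n * weighted_mass D W (\<lambda>x. \<phi> (c *\<^sub>R x)) = c\<^sup>2 * weighted_mass D W \<phi>"
proof -
  let ?S = "\<lambda>x. W x * (\<phi> x)\<^sup>2"
  have S0: "0 \<le> ?S x" for x using \<beta>n_pos by simp
  have [measurable]: "\<phi> \<in> borel_measurable borel" by (rule test_functions_measurable[OF \<phi>])
  have "ennreal (weighted_mass D W \<phi>) = ennreal (c ^ n) * (\<integral>\<^sup>+x. ennreal (?S (c *\<^sub>R x)) \<partial>lborel)"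
    unfolding ennreal_mass[OF \<phi>] by (subst nn_integral_scaleR[OF _ c]) (auto simp: card_n)
  moreover have "W x * (\<phi> (c *\<^sub>R x))\<^sup>2 = c\<^sup>2 * ?S (c *\<^sub>R x)" for x
    using c by (simp add: power_mult_distrib)
  then have "ennreal (weighted_mass D W (\<lambda>x. \<phi> (c *\<^sub>R x))) = ennreal (c\<^sup>2) * (\<integral>\<^sup>+x. ennreal (?S (c *\<^sub>R x)) \<partial>lborel)"
    unfolding ennreal_mass[OF \<phi>c] by (subst nn_integral_cmult[symmetric]) (auto simp: ennreal_mult'[symmetric])
  ultimately have "ennreal (c ^ n) * ennreal (weighted_mass D W (\<lambda>x. \<phi> (c *\<^sub>R x))) = ennreal (c\<^sup>2) * ennreal (weighted_mass D W \<phi>)"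
    by (simp add: mult_ac)
  then have "ennreal (c ^ n * weighted_mass D W (\<lambda>x. \<phi> (c *\<^sub>R x))) = ennreal (c\<^sup>2 * weighted_mass D W \<phi>)"
    using c by (simp add: ennreal_mult')
  then show ?thesis using c mass_nonneg[OF \<phi>] mass_nonneg[OF \<phi>c] by (subst (asm) ennreal_inj) auto
qed


subsection \<open>Criticality\<close>

lemma shell_sym: "shell (- real N) (real N) = ennreal (real (2 * N) * smass)"
  using shell_eq[of "- real N" "2 * N"] by simp

text \<open>A bump of width N in ln |x| has slope of order 1/N on shells of total mass of order N.
  The constant K of the boundary strip depends on N, so L has to be chosen after N.\<close>

lemma null_sequence:
  obtains C where "C \<ge> 0" "\<And>N. N \<ge> 1 \<Longrightarrow> \<exists>K\<ge>0. \<forall>L\<ge>1. En (tgs (\<lambda>s. smooth_bump (s / real N)) (chi L)) \<le> C / real N + K / L"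
proof -
  obtain b1 b2 B where b: "\<And>s. (smooth_bump has_real_derivative b1 s) (at s)" "B > 0" "\<And>s. \<bar>b1 s\<bar> \<le> B"
    using smooth_bump_derivs by metis
  show ?thesis
  \<comment> \<open>The factor 12 is 2 from \<open>dh_tgs_sum_le\<close> times 6, since 2 (2 N + 1)
    <= 6 N.\<close>
  proof (rule that[of "12 * B\<^sup>2 * smass"])
    show "0 \<le> 12 * B\<^sup>2 * smass" using smass_pos by simp
    fix N :: nat assume N: "N \<ge> 1"
    let ?v = "\<lambda>s. smooth_bump (s / real N)"
    have v: "radial_cutoff ?v (2 * real N)" using N by (intro radial_cutoff_bump) auto
    have dv: "deriv ?v s = b1 (s / real N) / real N" for s
    proof -
      have "(?v has_real_derivative b1 (s / real N) * (1 / real N)) (at s)"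
        by (rule DERIV_chain2[OF b(1)]) (use N in \<open>auto intro!: derivative_eq_intros\<close>)
      then have "deriv ?v s = b1 (s / real N) * (1 / real N)" by (rule DERIV_imp_deriv)
      then show ?thesis by simp
    qed
    have v': "radial_cutoff (deriv ?v) (real (2 * N + 1))" using radial_cutoff_deriv(3)[OF v] by (simp add: add.commute)
    have bd: "\<bar>deriv ?v s\<bar> \<le> B / real N" for s using b(3)[of "s / real N"] N by (simp add: dv divide_right_mono)
    have [measurable]: "deriv ?v \<in> borel_measurable borel" by (rule measurable_radial_cutoff[OF v'])
    have "(\<integral>\<^sup>+x. ennreal (2 * (deriv ?v (lr x))\<^sup>2 * rdens x) \<partial>lborel) = 2 * (\<integral>\<^sup>+x. ennreal (rdens x * (deriv ?v (lr x))\<^sup>2) \<partial>lborel)"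
      by (subst nn_integral_cmult[symmetric]) (auto simp: ennreal_mult' mult_ac rdens_nonneg intro!: nn_integral_cong)
    also have "\<dots> \<le> 2 * (ennreal ((B / real N)\<^sup>2) * ennreal (real (2 * (2 * N + 1)) * smass))"
      using shell_bound[OF v' bd] unfolding shell_sym by (intro mult_left_mono) auto
    also have "\<dots> = ennreal (2 * ((B / real N)\<^sup>2 * (real (2 * (2 * N + 1)) * smass)))"
      using smass_pos by (simp add: ennreal_mult')
    also have "\<dots> \<le> ennreal (12 * B\<^sup>2 * smass / real N)"
    proof (rule ennreal_leI)
      have "real (2 * (2 * N + 1)) \<le> 6 * real N" using N by simp
      then have "2 * ((B / real N)\<^sup>2 * (real (2 * (2 * N + 1)) * smass)) \<le> 2 * ((B / real N)\<^sup>2 * (6 * real N * smass))"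
        using smass_pos by (intro mult_left_mono mult_right_mono) auto
      also have "\<dots> = 12 * B\<^sup>2 * smass / real N" using N by (simp add: power2_eq_square)
      finally show "2 * ((B / real N)\<^sup>2 * (real (2 * (2 * N + 1)) * smass)) \<le> 12 * B\<^sup>2 * smass / real N" .
    qed
    finally have e: "(\<integral>\<^sup>+x. ennreal (2 * (deriv ?v (lr x))\<^sup>2 * rdens x) \<partial>lborel) \<le> ennreal (12 * B\<^sup>2 * smass / real N)" .
    obtain K where K: "K \<ge> 0"
      "\<forall>L L'. 1 \<le> L \<longrightarrow> L \<le> L' \<longrightarrow> En (tgs ?v (\<lambda>s. chi L s - chi L' s)) \<le> K / L"
      "\<forall>L\<ge>1. ennreal (En (tgs ?v (chi L))) \<le> (\<integral>\<^sup>+x. ennreal (2 * (deriv ?v (lr x))\<^sup>2 * rdens x) \<partial>lborel) + ennreal (K / L)"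
      "\<forall>L\<ge>1. (\<integral>\<^sup>+x. ennreal (rdens x * (?v (lr x) * (1 - chi L (x $ e 1)))\<^sup>2) \<partial>lborel) \<le> ennreal (K / L)"
      by (rule tgs_energy_bounds[OF v])
    have "En (tgs ?v (chi L)) \<le> 12 * B\<^sup>2 * smass / real N + K / L" if L: "L \<ge> 1" for L
    proof -
      have "ennreal (En (tgs ?v (chi L))) \<le> ennreal (12 * B\<^sup>2 * smass / real N) + ennreal (K / L)"
        using K(3)[rule_format, OF L] add_right_mono[OF e, of "ennreal (K / L)"] by (rule order_trans)
      also have "\<dots> = ennreal (12 * B\<^sup>2 * smass / real N + K / L)"
        using K(1) L smass_pos by (intro ennreal_plus[symmetric]) auto
      finally show ?thesis using K(1) L smass_pos by (subst (asm) ennreal_le_iff) auto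
    qed
    then show "\<exists>K\<ge>0. \<forall>L\<ge>1. En (tgs ?v (chi L)) \<le> 12 * B\<^sup>2 * smass / real N + K / L" using K(1) by blast
  qed
qed

text \<open>A weight that improves the inequality would have zero mass against the square of the ground state
  on every compact subset of the half-space.\<close>

lemma critical_Vn: "critical D (quad_form D Vn)"
  unfolding critical_def
proof
  show "nonneg_form D (quad_form D Vn)" unfolding nonneg_form_def using quad_form_Vn En_nonneg by auto
  show "\<not> subcritical D (quad_form D Vn)"
  proof
    assume "subcritical D (quad_form D Vn)"
    then obtain P where P: "P \<in> borel_measurable lborel" "\<forall>x\<in>D. 0 \<le> P x" "\<not> (AE x in lborel. x \<in> D \<longrightarrow> P x = 0)"
      "\<forall>\<phi>\<in>test_functions D. (\<integral>\<^sup>+x\<in>D. ennreal (P x * (\<phi> x)\<^sup>2) \<partial>lborel) \<le> ennreal (quad_form D Vn \<phi>)"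
      unfolding subcritical_def by auto
    have [measurable]: "P \<in> borel_measurable borel" using P(1) by simp
    obtain C where C: "C \<ge> 0" "\<And>N. N \<ge> 1 \<Longrightarrow> \<exists>K\<ge>0. \<forall>L\<ge>1. En (tgs (\<lambda>s. smooth_bump (s / real N)) (chi L)) \<le> C / real N + K / L"
      using null_sequence by blast
    \<comment> \<open>An exhaustion of the half-space; on the j-th set the truncated ground state
      equals the ground state as soon as N and L are at least j and 1.\<close>
    define Q where "Q j = {x\<in>D. exp (- real j) \<le> x $ e 1 \<and> \<bar>lr x\<bar> \<le> real j}" for j
    have Q_meas [measurable]: "Q j \<in> sets borel" for j unfolding Q_def by measurable
    have zero: "(\<integral>\<^sup>+x. ennreal (P x * exp (2 * hlog x)) * indicator (Q j) x \<partial>lborel) = 0" for j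
    proof -
      let ?I = "\<integral>\<^sup>+x. ennreal (P x * exp (2 * hlog x)) * indicator (Q j) x \<partial>lborel"
      have le: "?I \<le> ennreal (En (tgs (\<lambda>s. smooth_bump (s / real N)) (chi L)))"
        if N: "N \<ge> max 1 j" and L: "L \<ge> max 1 (real j)" for N L
      proof -
        let ?\<phi> = "tgs (\<lambda>s. smooth_bump (s / real N)) (chi L)"
        have \<phi>: "?\<phi> \<in> test_functions D" by (rule tgs_chi_test[OF radial_cutoff_bump]) (use N L in auto)
        have "?I \<le> (\<integral>\<^sup>+x\<in>D. ennreal (P x * (?\<phi> x)\<^sup>2) \<partial>lborel)"
        proof (rule nn_integral_mono)
          fix x
          show "ennreal (P x * exp (2 * hlog x)) * indicator (Q j) x \<le> ennreal (P x * (?\<phi> x)\<^sup>2) * indicator D x"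
          proof (cases "x \<in> Q j")
            case True
            then have x: "x \<in> D" "exp (- real j) \<le> x $ e 1" "\<bar>lr x\<bar> \<le> real j" by (auto simp: Q_def)
            have "exp (- L) \<le> exp (- real j)" using L by simp
            then have "chi L (x $ e 1) = 1" using x(2) L by (intro chi_eq_1) linarith+
            moreover have "smooth_bump (lr x / real N) = 1" using x(3) N by (intro smooth_bump_eq_1) (simp add: divide_le_eq)
            ultimately have "(?\<phi> x)\<^sup>2 = exp (2 * hlog x)" using x(1) by (simp add: tgs_def exp_double)
            then show ?thesis using x(1) True by simp
          qed simp
        qed
        also have "\<dots> \<le> ennreal (quad_form D Vn ?\<phi>)" using P(4) \<phi> by blast
        finally show ?thesis unfolding quad_form_Vn[OF \<phi>] .
      qed
      have eps: "?I \<le> ennreal \<epsilon>" if \<epsilon>: "\<epsilon> > 0" for \<epsilon>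
      proof -
        obtain N0 :: nat where N0: "2 * C / \<epsilon> < real N0" using reals_Archimedean2 by blast
        define N where "N = max N0 (max 1 j)"
        have N: "N \<ge> max 1 j" "N \<ge> 1" "2 * C / \<epsilon> < real N" using N0 by (auto simp: N_def max_def)
        have CN: "C / real N \<le> \<epsilon> / 2" using N \<epsilon> by (simp add: field_simps)
        obtain K where K: "K \<ge> 0" "\<forall>L\<ge>1. En (tgs (\<lambda>s. smooth_bump (s / real N)) (chi L)) \<le> C / real N + K / L"
          using C(2)[OF N(2)] by blast
        define L where "L = max (2 * K / \<epsilon>) (max 1 (real j))"
        have L: "L \<ge> max 1 (real j)" "L \<ge> 1" "2 * K / \<epsilon> \<le> L" by (auto simp: L_def)
        have "2 * K \<le> L * \<epsilon>" using L(3) \<epsilon> by (simp add: divide_le_eq)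
        then have KL: "K / L \<le> \<epsilon> / 2" using L(2) by (simp add: field_simps)
        have "En (tgs (\<lambda>s. smooth_bump (s / real N)) (chi L)) \<le> C / real N + K / L" using K(2) L(2) by blast
        also have "\<dots> \<le> \<epsilon> / 2 + \<epsilon> / 2" by (intro add_mono CN KL)
        also have "\<dots> = \<epsilon>" by simp
        finally show ?thesis by (rule order_trans[OF le[OF N(1) L(1)] ennreal_leI])
      qed
      have fin: "?I < \<infinity>" using eps[of 1] order_le_less_trans[OF _ ennreal_less_top] by fastforce
      then obtain i where i: "i \<ge> 0" "?I = ennreal i" using less_top_ennreal by auto
      have "i \<le> 0 + \<epsilon>" if "\<epsilon> > 0" for \<epsilon> using eps[OF that] i that by (simp add: ennreal_le_iff)
      then have "i \<le> 0" by (rule field_le_epsilon)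
      with i show ?thesis by simp
    qed
    have "AE x in lborel. ennreal (P x * exp (2 * hlog x)) * indicator (Q j) x = 0" for j
      using zero[of j] by (subst (asm) nn_integral_0_iff_AE) auto
    then have "AE x in lborel. \<forall>j. ennreal (P x * exp (2 * hlog x)) * indicator (Q j) x = 0"
      by (subst AE_all_countable) auto
    then have "AE x in lborel. x \<in> D \<longrightarrow> P x = 0"
    proof eventually_elim
      case (elim x)
      show ?case
      proof
        assume x: "x \<in> D"
        obtain j :: nat where j: "max (- ln (x $ e 1)) \<bar>lr x\<bar> < real j" using reals_Archimedean2 by blast
        have x1: "x $ e 1 > 0" using x by (simp add: D_iff)
        have "- real j < ln (x $ e 1)" using j by simp
        then have "exp (- real j) < x $ e 1" using x1 by (metis exp_less_cancel_iff exp_ln)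
        then have "x \<in> Q j" using x j by (simp add: Q_def)
        then have "ennreal (P x * exp (2 * hlog x)) = 0" using elim[rule_format, of j] by simp
        then have "P x * exp (2 * hlog x) \<le> 0" by (simp add: ennreal_eq_0_iff)
        then have "P x \<le> 0" by (simp add: mult_le_0_iff)
        then show "P x = 0" using P(2) x by force
      qed
    qed
    then show False using P(3) by blast
  qed
qed

section \<open>Subcriticality and best constants\<close>

lemma W_not_AE_zero: "\<not> (AE x in lborel. x \<in> D \<longrightarrow> t * W x = 0)" if "t > 0"
proof
  assume "AE x in lborel. x \<in> D \<longrightarrow> t * W x = 0"
  then have ae: "AE x in lborel. ennreal (indicator D x) = 0"
  proof eventually_elim
    case (elim x)
    then show ?case using W_pos[of x] that by (cases "x \<in> D") auto
  qed
  have "(\<integral>\<^sup>+x. ennreal (indicator D x) \<partial>(lborel :: (real ^ 'n) measure)) > 0"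
  proof (rule positive_nn_integral_open[OF open_D])
    have "axis (e 1) 1 \<in> D" by (simp add: D_iff)
    then show "D \<noteq> {}" by blast
  qed auto
  moreover have "(\<integral>\<^sup>+x. ennreal (indicator D x) \<partial>(lborel :: (real ^ 'n) measure)) = 0"
    by (subst nn_integral_0_iff_AE) (use ae in auto)
  ultimately show False by simp
qed

lemma set_nn_integral_mass:
  assumes \<phi>: "\<phi> \<in> test_functions D" and t: "t > 0"
  shows "(\<integral>\<^sup>+x\<in>D. ennreal (t * W x * (\<phi> x)\<^sup>2) \<partial>lborel) = ennreal (t * weighted_mass D W \<phi>)"
proof -
  have "(\<integral>\<^sup>+x\<in>D. ennreal (t * W x * (\<phi> x)\<^sup>2) \<partial>lborel) = (\<integral>\<^sup>+x. ennreal t * ennreal (W x * (\<phi> x)\<^sup>2) \<partial>lborel)"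
  proof (rule nn_integral_cong)
    fix x
    show "ennreal (t * W x * (\<phi> x)\<^sup>2) * indicator D x = ennreal t * ennreal (W x * (\<phi> x)\<^sup>2)"
    proof (cases "x \<in> D")
      case True
      have "ennreal (t * (W x * (\<phi> x)\<^sup>2)) = ennreal t * ennreal (W x * (\<phi> x)\<^sup>2)" using t by (intro ennreal_mult') simp
      then show ?thesis using True by (simp only: mult.assoc indicator_simps) simp
    next
      case False then show ?thesis using test_functions_zero[OF \<phi> False] by simp
    qed
  qed
  also have "\<dots> = ennreal t * ennreal (weighted_mass D W \<phi>)"
    unfolding ennreal_mass[OF \<phi>] by (rule nn_integral_cmult) (use borel_measurable_integrable[OF W_integrable[OF \<phi>]] in measurable)
  finally show ?thesis using t by (simp add: ennreal_mult')
qed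

lemma subcritical_V0: "subcritical D (quad_form D V0)"
  unfolding subcritical_def nonneg_form_def
\<comment> \<open>W itself is the improving weight, written as \<open>1 * W x\<close> to match
  \<open>set_nn_integral_mass\<close> with t = 1.\<close>
proof (intro conjI ballI bexI[of _ "\<lambda>x. 1 * W x"])
  fix \<phi> :: "real ^ 'n \<Rightarrow> real" assume \<phi>: "\<phi> \<in> test_functions D"
  show "0 \<le> quad_form D V0 \<phi>" using quad_form_V0[OF \<phi>] En_nonneg[of \<phi>] mass_nonneg[OF \<phi>] by simp
  show "(\<integral>\<^sup>+x\<in>D. ennreal (1 * W x * (\<phi> x)\<^sup>2) \<partial>lborel) \<le> ennreal (quad_form D V0 \<phi>)"
    unfolding set_nn_integral_mass[OF \<phi> zero_less_one] quad_form_V0[OF \<phi>] using En_nonneg[of \<phi>] by (intro ennreal_leI) simp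
next
  show "0 \<le> 1 * W x" if "x \<in> D" for x using W_pos[OF that] by simp
  show "\<not> (AE x in lborel. x \<in> D \<longrightarrow> 1 * W x = 0)" by (rule W_not_AE_zero) simp
  show "(\<lambda>x. 1 * W x) \<in> borel_measurable lborel" by measurable
qed

text \<open>If c > 1 were admissible, then (c - 1) W would improve the critical inequality.\<close>

lemma constant_le_1:
  assumes "\<And>\<phi>. \<phi> \<in> test_functions D \<Longrightarrow> c * weighted_mass D W \<phi> \<le> quad_form D V0 \<phi>"
  shows "c \<le> 1"
proof (rule ccontr)
  assume "\<not> c \<le> 1"
  then have c: "c - 1 > 0" by simp
  have "subcritical D (quad_form D Vn)"
    unfolding subcritical_def
  proof (intro conjI ballI bexI[of _ "\<lambda>x. (c - 1) * W x"])
    show "nonneg_form D (quad_form D Vn)" unfolding nonneg_form_def using quad_form_Vn En_nonneg by auto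
    show "0 \<le> (c - 1) * W x" if "x \<in> D" for x using W_pos[OF that] c by (intro mult_nonneg_nonneg) auto
    show "\<not> (AE x in lborel. x \<in> D \<longrightarrow> (c - 1) * W x = 0)" by (rule W_not_AE_zero[OF c])
    show "(\<lambda>x. (c - 1) * W x) \<in> borel_measurable lborel" by measurable
    fix \<phi> :: "real ^ 'n \<Rightarrow> real" assume \<phi>: "\<phi> \<in> test_functions D"
    have "(c - 1) * weighted_mass D W \<phi> \<le> En \<phi>"
      using assms[OF \<phi>] quad_form_V0[OF \<phi>] by (simp add: left_diff_distrib)
    then show "(\<integral>\<^sup>+x\<in>D. ennreal ((c - 1) * W x * (\<phi> x)\<^sup>2) \<partial>lborel) \<le> ennreal (quad_form D Vn \<phi>)"
      unfolding set_nn_integral_mass[OF \<phi> c] quad_form_Vn[OF \<phi>] by (rule ennreal_leI)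
  qed
  then show False using critical_Vn unfolding critical_def by blast
qed

text \<open>Every compact subset of D fits into D' after a dilation, so a constant valid on D' is
  valid on D, where \<open>constant_le_1\<close> applies.\<close>

lemma best_constant_subset:
  assumes sub: "D' \<subseteq> D"
    and scale: "\<And>K. compact K \<Longrightarrow> K \<subseteq> D \<Longrightarrow> \<exists>c>0. \<forall>x\<in>K. (1 / c) *\<^sub>R x \<in> D'"
  shows "best_constant (test_functions D') (quad_form D V0) (weighted_mass D W) 1"
  unfolding best_constant_def
proof (intro conjI ballI allI impI)
  fix \<phi> :: "real ^ 'n \<Rightarrow> real" assume "\<phi> \<in> test_functions D'"
  then have \<phi>: "\<phi> \<in> test_functions D" by (rule test_functions_mono[OF sub])
  show "1 * weighted_mass D W \<phi> \<le> quad_form D V0 \<phi>" using quad_form_V0[OF \<phi>] En_nonneg[of \<phi>] by simp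
next
  fix c' assume c': "\<forall>\<phi>\<in>test_functions D'. c' * weighted_mass D W \<phi> \<le> quad_form D V0 \<phi>"
  show "c' \<le> 1"
  proof (rule constant_le_1)
    fix \<phi> :: "real ^ 'n \<Rightarrow> real" assume \<phi>: "\<phi> \<in> test_functions D"
    obtain K where K: "compact K" "K \<subseteq> D" "\<And>x. x \<notin> K \<Longrightarrow> \<phi> x = 0" using test_functionsE[OF \<phi>] by metis
    obtain c where c: "c > 0" "\<And>x. x \<in> K \<Longrightarrow> (1 / c) *\<^sub>R x \<in> D'" using scale[OF K(1,2)] by blast
    have \<phi>': "(\<lambda>x. \<phi> (c *\<^sub>R x)) \<in> test_functions D'" by (rule test_functions_scale[OF \<phi> K(1,3) c])
    then have \<phi>c: "(\<lambda>x. \<phi> (c *\<^sub>R x)) \<in> test_functions D" by (rule test_functions_mono[OF sub])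
    let ?m = "weighted_mass D W (\<lambda>x. \<phi> (c *\<^sub>R x))" and ?E = "En (\<lambda>x. \<phi> (c *\<^sub>R x))"
    have "c' * ?m \<le> ?E + ?m" using c' \<phi>' quad_form_V0[OF \<phi>c] by auto
    then have "c ^ n * (c' * ?m) \<le> c ^ n * (?E + ?m)" using c by (intro mult_left_mono) auto
    then have "c' * (c ^ n * ?m) \<le> c ^ n * ?E + c ^ n * ?m" by (simp add: algebra_simps)
    then have "c' * (c\<^sup>2 * weighted_mass D W \<phi>) \<le> c\<^sup>2 * En \<phi> + c\<^sup>2 * weighted_mass D W \<phi>"
      unfolding mass_scale[OF \<phi> c(1) \<phi>c] En_scale[OF \<phi> c(1) \<phi>c] .
    then have "c\<^sup>2 * (c' * weighted_mass D W \<phi>) \<le> c\<^sup>2 * (En \<phi> + weighted_mass D W \<phi>)" by (simp add: algebra_simps)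
    then show "c' * weighted_mass D W \<phi> \<le> quad_form D V0 \<phi>"
      unfolding quad_form_V0[OF \<phi>] using c(1) by (simp add: mult_le_cancel_left_pos)
  qed
qed

lemma best_constants:
  assumes R: "R > 0"
  shows "best_constant (test_functions (D \<inter> {x. norm x < R})) (quad_form D V0) (weighted_mass D W) 1"
    and "best_constant (test_functions (D \<inter> {x. norm x > R})) (quad_form D V0) (weighted_mass D W) 1"
proof -
  have D': "(1 / c) *\<^sub>R x \<in> D" if "c > 0" "x \<in> D" for c :: real and x using D_scale[of "1 / c" x] that by simp
  show "best_constant (test_functions (D \<inter> {x. norm x < R})) (quad_form D V0) (weighted_mass D W) 1"
  proof (rule best_constant_subset)
    fix K :: "(real ^ 'n) set" assume K: "compact K" "K \<subseteq> D"
    obtain b where b: "b > 0" "\<And>x. x \<in> K \<Longrightarrow> norm x \<le> b" using compact_imp_bounded[OF K(1)] unfolding bounded_pos by auto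
    have "norm ((1 / (2 * b / R)) *\<^sub>R x) < R" if "x \<in> K" for x
      using b(2)[OF that] b(1) R by (simp add: field_simps)
    then show "\<exists>c>0. \<forall>x\<in>K. (1 / c) *\<^sub>R x \<in> D \<inter> {x. norm x < R}"
      using b R K(2) by (intro exI[of _ "2 * b / R"] conjI ballI IntI CollectI D') auto
  qed auto
  show "best_constant (test_functions (D \<inter> {x. norm x > R})) (quad_form D V0) (weighted_mass D W) 1"
  proof (rule best_constant_subset)
    fix K :: "(real ^ 'n) set" assume K: "compact K" "K \<subseteq> D"
    obtain a where a: "a > 0" "\<And>x. x \<in> K \<Longrightarrow> a \<le> norm x"
    proof (cases "K = {}")
      case False
      have "\<exists>x\<in>K. \<forall>y\<in>K. norm x \<le> norm y" by (intro continuous_attains_inf K False continuous_intros)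
      then show ?thesis using that K(2) norm_pos by (metis subsetD)
    qed (use that[of 1] in auto)
    have "norm ((1 / (a / (2 * R))) *\<^sub>R x) > R" if "x \<in> K" for x
      using a(2)[OF that] a(1) R by (simp add: field_simps)
    then show "\<exists>c>0. \<forall>x\<in>K. (1 / c) *\<^sub>R x \<in> D \<inter> {x. norm x > R}"
      using a R K(2) by (intro exI[of _ "a / (2 * R)"] conjI ballI IntI CollectI D') auto
  qed auto
qed

end


subsection \<open>Null-criticality\<close>

text \<open>Cauchy-Schwarz for the derivative, obtained by integrating the tangent inequality 2 m G'
  - m^2 <= G'^2 with m the mean slope.\<close>

lemma sq_increment_le:
  assumes ab: "a < b" and G: "\<And>s. s \<in> {a..b} \<Longrightarrow> (G has_real_derivative G' s) (at s)"
    and cont: "continuous_on {a..b} G'"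
  shows "ennreal ((G b - G a)\<^sup>2 / (b - a)) \<le> (\<integral>\<^sup>+s. ennreal ((G' s)\<^sup>2) * indicator {a..b} s \<partial>lborel)"
proof -
  define m where "m = (G b - G a) / (b - a)"
  have "(G' has_integral (G b - G a)) {a..b}"
    by (rule fundamental_theorem_of_calculus)
       (use ab G in \<open>auto simp: has_real_derivative_iff_has_vector_derivative intro: has_vector_derivative_at_within\<close>)
  then have 1: "((\<lambda>s. 2 * m * G' s - m\<^sup>2) has_integral (2 * m * (G b - G a) - m\<^sup>2 * (b - a))) {a..b}"
    using has_integral_const_real[of "m\<^sup>2" a b] ab
    by (intro has_integral_diff has_integral_mult_right) (simp_all add: mult.commute)
  have "(\<lambda>s. (G' s)\<^sup>2) integrable_on {a..b}"
    by (intro integrable_continuous_real continuous_intros cont)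
  then obtain J where J: "((\<lambda>s. (G' s)\<^sup>2) has_integral J) {a..b}" by blast
  have "2 * m * G' s - m\<^sup>2 \<le> (G' s)\<^sup>2" for s
  proof -
    have "0 \<le> (G' s - m)\<^sup>2" by simp
    then show ?thesis by (simp add: power2_diff algebra_simps)
  qed
  then have "2 * m * (G b - G a) - m\<^sup>2 * (b - a) \<le> J" using has_integral_le[OF 1 J] by simp
  moreover have "2 * m * (G b - G a) - m\<^sup>2 * (b - a) = (G b - G a)\<^sup>2 / (b - a)"
    using ab by (simp add: m_def power2_eq_square divide_simps)
  ultimately have "(G b - G a)\<^sup>2 / (b - a) \<le> J" by simp
  moreover have "(\<integral>\<^sup>+s. ennreal ((G' s)\<^sup>2) * indicator {a..b} s \<partial>lborel) = ennreal J"
    by (rule nn_integral_has_integral_lebesgue'[OF _ J]) simp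
  ultimately show ?thesis by (simp add: ennreal_leI)
qed

lemma test_functions_radial_derivative:
  fixes \<phi> :: "real ^ 'n::finite \<Rightarrow> real"
  assumes "\<phi> \<in> test_functions D"
  shows "((\<lambda>s. \<phi> (s *\<^sub>R x)) has_real_derivative (\<Sum>i\<in>UNIV. x $ i * partial i \<phi> (s *\<^sub>R x))) (at s)"
proof -
  let ?F = "frechet_derivative \<phi> (at (s *\<^sub>R x))"
  have F: "(\<phi> has_derivative ?F) (at (s *\<^sub>R x))"
    using test_functions_differentiable[OF assms] frechet_derivative_works by blast
  have "((\<lambda>s. \<phi> (s *\<^sub>R x)) has_derivative (\<lambda>t. ?F (t *\<^sub>R x))) (at s)"
    by (rule has_derivative_compose[where f="\<lambda>s. s *\<^sub>R x" and g=\<phi>, OF _ F]) (auto intro!: derivative_eq_intros)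
  moreover have "?F (t *\<^sub>R x) = (\<Sum>i\<in>UNIV. x $ i * partial i \<phi> (s *\<^sub>R x)) * t" for t
  proof -
    have lin: "linear ?F" using F by (rule has_derivative_linear)
    have "x = (\<Sum>i\<in>UNIV. (x $ i) *\<^sub>R axis i 1)" by (simp add: vec_eq_iff axis_def if_distrib cong: if_cong)
    then have "?F x = ?F (\<Sum>i\<in>UNIV. (x $ i) *\<^sub>R axis i 1)" by simp
    also have "\<dots> = (\<Sum>i\<in>UNIV. x $ i * partial i \<phi> (s *\<^sub>R x))"
      by (simp add: linear_sum[OF lin] linear_scale[OF lin] partial_def)
    finally show ?thesis by (simp add: linear_scale[OF lin])
  qed
  ultimately show ?thesis by (simp add: has_field_derivative_def)
qed

context hardy_weights
begin

text \<open>The power of c makes the dilation an isometry for the weighted mass and leaves the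
  ground state invariant.\<close>

definition dil :: "real \<Rightarrow> (real ^ 'n \<Rightarrow> real) \<Rightarrow> real ^ 'n \<Rightarrow> real"
  where "dil c f x = c powr ((real n - 2) / 2) * f (c *\<^sub>R x)"

lemma scale_test:
  assumes \<phi>: "\<phi> \<in> test_functions D" and c: "c > 0"
  shows "(\<lambda>x. \<phi> (c *\<^sub>R x)) \<in> test_functions D"
proof -
  obtain K where K: "compact K" "K \<subseteq> D" "\<And>x. x \<notin> K \<Longrightarrow> \<phi> x = 0" using test_functionsE[OF \<phi>] by metis
  show ?thesis by (rule test_functions_scale[OF \<phi> K(1,3) c]) (use K(2) D_scale[of "1 / c"] c in auto)
qed

lemma dil_test: "\<phi> \<in> test_functions D \<Longrightarrow> c > 0 \<Longrightarrow> dil c \<phi> \<in> test_functions D"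
  unfolding dil_def[abs_def] by (intro test_functions_cmult scale_test)

lemma dil_mass:
  assumes \<phi>: "\<phi> \<in> test_functions D" and c: "c > 0"
  shows "weighted_mass D W (dil c \<phi>) = weighted_mass D W \<phi>"
proof -
  have "(c powr ((real n - 2) / 2))\<^sup>2 = c powr (real n - 2)" by (simp add: power2_eq_square powr_add[symmetric])
  also have "\<dots> = c ^ n / c\<^sup>2" using c by (simp add: powr_diff powr_realpow)
  finally have p: "(c powr ((real n - 2) / 2))\<^sup>2 = c ^ n / c\<^sup>2" .
  have "weighted_mass D W (dil c \<phi>) = (c powr ((real n - 2) / 2))\<^sup>2 * weighted_mass D W (\<lambda>x. \<phi> (c *\<^sub>R x))"
    unfolding weighted_mass_def set_lebesgue_integral_def dil_def
    by (simp add: power_mult_distrib mult_ac flip: integral_mult_right_zero)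
  also have "\<dots> = (c ^ n * weighted_mass D W (\<lambda>x. \<phi> (c *\<^sub>R x))) / c\<^sup>2" unfolding p by simp
  finally show ?thesis using c unfolding mass_scale[OF \<phi> c scale_test[OF \<phi> c]] by simp
qed

text \<open>Along a ray the derivative of \<open>s powr \<nu> * \<phi> (s x)\<close> only involves the radial part of the
  gradient \<open>dh\<close>, because \<open>exp hlog\<close> is homogeneous of degree \<open>- \<nu>\<close>.\<close>

lemma dil_increment:
  assumes \<phi>: "\<phi> \<in> test_functions D" and c: "c > 1"
  shows "weighted_mass D W (\<lambda>x. dil c \<phi> x - \<phi> x) \<le> \<beta> n * (c - 1)\<^sup>2 * En \<phi>"
proof -
  define \<nu> where "\<nu> = (real n - 2) / 2"
  let ?S = "\<lambda>x. \<Sum>i\<in>UNIV. (dh i \<phi> x)\<^sup>2"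
  have S0: "0 \<le> ?S x" for x by (intro sum_nonneg) simp
  have [measurable]: "?S \<in> borel_measurable borel"
    using borel_measurable_integrable[OF En_integrable[OF \<phi>]] by simp
  have d: "(\<lambda>x. dil c \<phi> x - \<phi> x) \<in> test_functions D" using c by (intro test_functions_diff dil_test \<phi>) auto
  \<comment> \<open>This times |x|^2 dominates the squared derivative of
    \<open>s powr \<nu> * \<phi> (s *\<^sub>R x)\<close> in s; the |x|^2 then cancels against
    W.\<close>
  define f where "f x s = ennreal (s powr (2 * \<nu>) * ?S (s *\<^sub>R x)) * indicator {1..c} s" for x :: "real ^ 'n" and s :: real
  have f_meas: "case_prod f \<in> borel_measurable (lborel \<Otimes>\<^sub>M lborel)"
    unfolding f_def by measurable
  have pointwise: "ennreal (W x * (dil c \<phi> x - \<phi> x)\<^sup>2) \<le> ennreal (\<beta> n * (c - 1)) * (\<integral>\<^sup>+s. f x s \<partial>lborel)" for x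
  proof -
    let ?G = "\<lambda>s. s powr \<nu> * \<phi> (s *\<^sub>R x)"
    let ?r = "\<lambda>s. \<Sum>i\<in>UNIV. (s *\<^sub>R x) $ i * dh i \<phi> (s *\<^sub>R x)"
    let ?G' = "\<lambda>s. s powr (\<nu> - 1) * ?r s"
    have r: "?r s = s * (\<Sum>i\<in>UNIV. x $ i * partial i \<phi> (s *\<^sub>R x)) + \<nu> * \<phi> (s *\<^sub>R x)" for s
    proof -
      have "?r s = s * (\<Sum>i\<in>UNIV. x $ i * partial i \<phi> (s *\<^sub>R x)) - (\<Sum>i\<in>UNIV. (s *\<^sub>R x) $ i * hgrad i (s *\<^sub>R x)) * \<phi> (s *\<^sub>R x)"
        by (simp add: dh_def right_diff_distrib sum_subtractf sum_distrib_left sum_distrib_right mult_ac)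
      also have "(\<Sum>i\<in>UNIV. (s *\<^sub>R x) $ i * hgrad i (s *\<^sub>R x)) * \<phi> (s *\<^sub>R x) = - \<nu> * \<phi> (s *\<^sub>R x)"
      proof (cases "s *\<^sub>R x \<in> D")
        case True then show ?thesis unfolding hgrad_Euler[OF True] by (simp add: \<nu>_def field_simps)
      next
        case False then show ?thesis using test_functions_zero[OF \<phi> False] by simp
      qed
      finally show ?thesis by simp
    qed
    have G: "(?G has_real_derivative ?G' s) (at s)" if s: "s \<in> {1..c}" for s
    proof -
      have "(?G has_real_derivative (\<nu> * s powr (\<nu> - 1)) * \<phi> (s *\<^sub>R x) + (\<Sum>i\<in>UNIV. x $ i * partial i \<phi> (s *\<^sub>R x)) * s powr \<nu>) (at s)"
        using s by (intro DERIV_mult has_real_derivative_powr test_functions_radial_derivative[OF \<phi>]) auto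
      moreover have "s powr \<nu> = s powr (\<nu> - 1) * s" using s by (simp add: powr_diff)
      ultimately show ?thesis unfolding r by (simp add: algebra_simps)
    qed
    have cont: "continuous_on {1..c} ?G'"
    proof -
      have "continuous_on {1..c} (\<lambda>s. dh i \<phi> (s *\<^sub>R x))" for i
        by (rule continuous_on_compose2[OF test_functions_continuous[OF dh_test[OF \<phi>], of UNIV]]) (auto intro!: continuous_intros)
      then show ?thesis by (auto intro!: continuous_intros)
    qed
    have "ennreal ((?G c - ?G 1)\<^sup>2 / (c - 1)) \<le> (\<integral>\<^sup>+s. ennreal ((?G' s)\<^sup>2) * indicator {1..c} s \<partial>lborel)"
      by (rule sq_increment_le[OF c G cont])
    also have "\<dots> \<le> (\<integral>\<^sup>+s. ennreal ((norm x)\<^sup>2) * f x s \<partial>lborel)"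
    proof (rule nn_integral_mono)
      fix s
      show "ennreal ((?G' s)\<^sup>2) * indicator {1..c} s \<le> ennreal ((norm x)\<^sup>2) * f x s"
      proof (cases "s \<in> {1..c}")
        case True
        have "(?r s)\<^sup>2 \<le> (\<Sum>i\<in>UNIV. ((s *\<^sub>R x) $ i)\<^sup>2) * ?S (s *\<^sub>R x)" by (rule Cauchy_Schwarz_ineq_sum)
        also have "(\<Sum>i\<in>UNIV. ((s *\<^sub>R x) $ i)\<^sup>2) = s\<^sup>2 * (norm x)\<^sup>2"
          unfolding sum_UNIV using rr_n[of "s *\<^sub>R x"] by (simp add: rr_def power_mult_distrib)
        finally have "(?r s)\<^sup>2 \<le> s\<^sup>2 * (norm x)\<^sup>2 * ?S (s *\<^sub>R x)" .
        then have "(?G' s)\<^sup>2 \<le> (s powr (\<nu> - 1))\<^sup>2 * (s\<^sup>2 * (norm x)\<^sup>2 * ?S (s *\<^sub>R x))"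
          unfolding power_mult_distrib by (intro mult_left_mono) auto
        also have "(s powr (\<nu> - 1))\<^sup>2 * (s\<^sup>2 * (norm x)\<^sup>2 * ?S (s *\<^sub>R x)) = (norm x)\<^sup>2 * (s powr (2 * \<nu>) * ?S (s *\<^sub>R x))"
        proof -
          have "s powr (\<nu> - 1) * s = s powr \<nu>" using True by (simp add: powr_diff)
          then have "(s powr (\<nu> - 1))\<^sup>2 * s\<^sup>2 = (s powr \<nu>)\<^sup>2" by (simp flip: power_mult_distrib)
          also have "\<dots> = s powr (2 * \<nu>)" by (simp add: power2_eq_square powr_add[symmetric])
          finally show ?thesis by (simp add: mult_ac)
        qed
        finally have "(?G' s)\<^sup>2 \<le> (norm x)\<^sup>2 * (s powr (2 * \<nu>) * ?S (s *\<^sub>R x))" .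
        from ennreal_leI[OF this] show ?thesis using True unfolding f_def by (simp add: ennreal_mult')
      qed (simp add: f_def)
    qed
    also have "\<dots> = ennreal ((norm x)\<^sup>2) * (\<integral>\<^sup>+s. f x s \<partial>lborel)"
      by (rule nn_integral_cmult) (use f_meas in measurable)
    finally have le: "ennreal ((?G c - ?G 1)\<^sup>2 / (c - 1)) \<le> ennreal ((norm x)\<^sup>2) * (\<integral>\<^sup>+s. f x s \<partial>lborel)" .
    show ?thesis
    proof (cases "x = 0")
      case False
      have "W x * (dil c \<phi> x - \<phi> x)\<^sup>2 = (W x * (c - 1)) * ((?G c - ?G 1)\<^sup>2 / (c - 1))"
        using c by (simp add: dil_def \<nu>_def)
      then have "ennreal (W x * (dil c \<phi> x - \<phi> x)\<^sup>2) = ennreal (W x * (c - 1)) * ennreal ((?G c - ?G 1)\<^sup>2 / (c - 1))"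
        using c \<beta>n_pos by (simp only:) (intro ennreal_mult', simp)
      also have "\<dots> \<le> ennreal (W x * (c - 1)) * (ennreal ((norm x)\<^sup>2) * (\<integral>\<^sup>+s. f x s \<partial>lborel))"
        by (intro mult_left_mono le) simp
      also have "\<dots> = ennreal (W x * (c - 1) * (norm x)\<^sup>2) * (\<integral>\<^sup>+s. f x s \<partial>lborel)"
        using c \<beta>n_pos by (subst ennreal_mult) (auto simp: mult.assoc)
      also have "W x * (c - 1) * (norm x)\<^sup>2 = \<beta> n * (c - 1)" using False by simp
      finally show ?thesis .
    qed simp
  qed
  have inner: "(\<integral>\<^sup>+x. f x s \<partial>lborel) \<le> ennreal (En \<phi>) * indicator {1..c} s" for s
  proof (cases "s \<in> {1..c}")
    case True
    then have s: "s > 0" "s \<ge> 1" by auto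
    have I: "ennreal (En \<phi>) = ennreal (s ^ n) * (\<integral>\<^sup>+x. ennreal (?S (s *\<^sub>R x)) \<partial>lborel)"
      unfolding ennreal_En[OF \<phi>] by (subst nn_integral_scaleR[OF _ s(1)]) (auto simp: card_n)
    \<comment> \<open>The substitution of s x for x costs s^n, which exceeds this power s^(n - 2)
      because s >= 1.\<close>
    have "2 * \<nu> = real n - 2" by (simp add: \<nu>_def)
    then have "s powr (2 * \<nu>) = s ^ n / s\<^sup>2" using s by (simp add: powr_diff powr_realpow)
    also have "\<dots> \<le> s ^ n" using s by (simp add: divide_le_eq mult_ge1_I)
    finally have p: "s powr (2 * \<nu>) \<le> s ^ n" .
    have "(\<integral>\<^sup>+x. f x s \<partial>lborel) = ennreal (s powr (2 * \<nu>)) * (\<integral>\<^sup>+x. ennreal (?S (s *\<^sub>R x)) \<partial>lborel)"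
      using True by (subst nn_integral_cmult[symmetric]) (auto simp: f_def ennreal_mult')
    also have "\<dots> \<le> ennreal (s ^ n) * (\<integral>\<^sup>+x. ennreal (?S (s *\<^sub>R x)) \<partial>lborel)"
      by (intro mult_right_mono ennreal_leI p) simp
    finally show ?thesis using True I by simp
  qed (simp add: f_def)
  have "ennreal (weighted_mass D W (\<lambda>x. dil c \<phi> x - \<phi> x)) \<le> (\<integral>\<^sup>+x. ennreal (\<beta> n * (c - 1)) * (\<integral>\<^sup>+s. f x s \<partial>lborel) \<partial>lborel)"
    unfolding ennreal_mass[OF d] by (rule nn_integral_mono) (rule pointwise)
  also have "\<dots> = ennreal (\<beta> n * (c - 1)) * (\<integral>\<^sup>+x. (\<integral>\<^sup>+s. f x s \<partial>lborel) \<partial>lborel)"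
    by (rule nn_integral_cmult) (rule lborel.borel_measurable_nn_integral[OF f_meas])
  also have "(\<integral>\<^sup>+x. (\<integral>\<^sup>+s. f x s \<partial>lborel) \<partial>lborel) = (\<integral>\<^sup>+s. (\<integral>\<^sup>+x. f x s \<partial>lborel) \<partial>lborel)"
    by (rule lborel_pair.Fubini'[OF f_meas, symmetric])
  also have "ennreal (\<beta> n * (c - 1)) * (\<integral>\<^sup>+s. (\<integral>\<^sup>+x. f x s \<partial>lborel) \<partial>lborel) \<le> ennreal (\<beta> n * (c - 1)) * (\<integral>\<^sup>+s. ennreal (En \<phi>) * indicator {1..c} s \<partial>lborel)"
    by (intro mult_left_mono nn_integral_mono inner) simp
  also have "\<dots> = ennreal (\<beta> n * (c - 1)) * (ennreal (En \<phi>) * ennreal (c - 1))" using c by (simp add: nn_integral_cmult)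
  also have "\<dots> = ennreal (\<beta> n * (c - 1)\<^sup>2 * En \<phi>)"
    using c \<beta>n_pos En_nonneg[of \<phi>] by (simp add: ennreal_mult'[symmetric] power2_eq_square mult_ac)
  finally show ?thesis using \<beta>n_pos En_nonneg[of \<phi>] by (simp add: ennreal_le_iff)
qed

definition mnorm :: "(real ^ 'n \<Rightarrow> real) \<Rightarrow> real"
  where "mnorm f = L2_norm M (cr f)"

lemma mnorm_sq: "\<phi> \<in> test_functions D \<Longrightarrow> (mnorm \<phi>)\<^sup>2 = weighted_mass D W \<phi>"
  unfolding mnorm_def by (rule L2_norm_of_real)

lemma mnorm_triangle:
  assumes "f \<in> test_functions D" "g \<in> test_functions D" "h \<in> test_functions D"
  shows "mnorm (\<lambda>x. f x - h x) \<le> mnorm (\<lambda>x. f x - g x) + mnorm (\<lambda>x. g x - h x)"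
  using L2_norm_triangle_diff[OF T_L2[OF test_functions_of_real[OF assms(1)]] T_L2[OF test_functions_of_real[OF assms(2)]]
      T_L2[OF test_functions_of_real[OF assms(3)]]] by (simp add: mnorm_def)

lemma mnorm_nonneg: "0 \<le> mnorm f" by (simp add: mnorm_def)

text \<open>No limit function is formed: a single member far along the sequence is compared with its
  dilate. For a large dilation the supports are disjoint and the two are far apart in mass, while
  \<open>dil_increment\<close>, applied to later members whose energy tends to zero, forces them to
  be close.\<close>

lemma no_rayleigh_minimizer:
  "\<not> rayleigh_minimizer (test_functions D) (quad_form D V0) (weighted_mass D W) \<Phi>"
proof
  assume "rayleigh_minimizer (test_functions D) (quad_form D V0) (weighted_mass D W) \<Phi>"
  then have comp: "\<Phi> \<in> completion (test_functions D) (quad_form D V0)"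
    and ne: "extend (weighted_mass D W) \<Phi> \<noteq> 0"
    and min: "\<And>\<Psi>. \<Psi> \<in> completion (test_functions D) (quad_form D V0) \<Longrightarrow> extend (weighted_mass D W) \<Psi> \<noteq> 0 \<Longrightarrow>
      extend (quad_form D V0) \<Phi> / extend (weighted_mass D W) \<Phi> \<le> extend (quad_form D V0) \<Psi> / extend (weighted_mass D W) \<Psi>"
    unfolding rayleigh_minimizer_def by blast+
  have t: "\<Phi> k \<in> test_functions D" for k using comp unfolding completion_def by blast
  have tc: "cr (\<Phi> k) \<in> T" for k by (rule test_functions_of_real[OF t])
  have td: "(\<lambda>x. \<Phi> k x - \<Phi> l x) \<in> test_functions D" for k l by (rule test_functions_diff[OF t t])
  have qd: "q (\<lambda>x. cr (\<Phi> k) x - cr (\<Phi> l) x) = quad_form D V0 (\<lambda>x. \<Phi> k x - \<Phi> l x)" for k l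
    using form_of_real[OF td[of k l]] by simp
  have Cq: "\<forall>\<epsilon>>0. \<exists>N. \<forall>k\<ge>N. \<forall>l\<ge>N. sqrt (q (\<lambda>x. cr (\<Phi> k) x - cr (\<Phi> l) x)) < \<epsilon>"
    unfolding qd using comp unfolding completion_def by blast
  have mq: "mnorm (\<lambda>x. \<Phi> k x - \<Phi> l x) \<le> sqrt (q (\<lambda>x. cr (\<Phi> k) x - cr (\<Phi> l) x))" for k l
  proof (rule real_le_rsqrt)
    show "(mnorm (\<lambda>x. \<Phi> k x - \<Phi> l x))\<^sup>2 \<le> q (\<lambda>x. cr (\<Phi> k) x - cr (\<Phi> l) x)"
      unfolding qd mnorm_sq[OF td] quad_form_V0[OF td] using En_nonneg by simp
  qed
  have Cm: "\<forall>\<epsilon>>0. \<exists>N. \<forall>k\<ge>N. \<forall>l\<ge>N. mnorm (\<lambda>x. \<Phi> k x - \<Phi> l x) < \<epsilon>"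
  proof (intro allI impI)
    fix \<epsilon> :: real assume "\<epsilon> > 0"
    then obtain N where N: "\<forall>k\<ge>N. \<forall>l\<ge>N. sqrt (q (\<lambda>x. cr (\<Phi> k) x - cr (\<Phi> l) x)) < \<epsilon>" using Cq by blast
    have "mnorm (\<lambda>x. \<Phi> k x - \<Phi> l x) < \<epsilon>" if "k \<ge> N" "l \<ge> N" for k l
      using mq[of k l] N that by (blast intro: order_le_less_trans)
    then show "\<exists>N. \<forall>k\<ge>N. \<forall>l\<ge>N. mnorm (\<lambda>x. \<Phi> k x - \<Phi> l x) < \<epsilon>" by blast
  qed
  have "convergent (\<lambda>k. q (cr (\<Phi> k)))" by (rule Cauchy_diag_convergent[OF tc Cq])
  then obtain a where a: "(\<lambda>k. quad_form D V0 (\<Phi> k)) \<longlonglongrightarrow> a"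
    unfolding form_of_real[OF t] convergent_def by blast
  have "convergent (\<lambda>k. Re (L2_inner M (cr (\<Phi> k)) (cr (\<Phi> k))))"
  proof (rule L2.Cauchy_diag_convergent)
    show "cr (\<Phi> k) \<in> L2 M" for k by (rule T_L2[OF tc])
    show "\<forall>\<epsilon>>0. \<exists>N. \<forall>k\<ge>N. \<forall>l\<ge>N. sqrt (Re (L2_inner M (\<lambda>x. cr (\<Phi> k) x - cr (\<Phi> l) x) (\<lambda>x. cr (\<Phi> k) x - cr (\<Phi> l) x))) < \<epsilon>"
      using Cm unfolding mnorm_def L2_norm_eq by simp
  qed
  then obtain b where b: "(\<lambda>k. weighted_mass D W (\<Phi> k)) \<longlonglongrightarrow> b"
    unfolding L2_inner_self_norm L2_norm_of_real[OF t] convergent_def by auto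
  have ea: "extend (quad_form D V0) \<Phi> = a" unfolding extend_def by (rule limI[OF a])
  have eb: "extend (weighted_mass D W) \<Phi> = b" unfolding extend_def by (rule limI[OF b])
  have "0 \<le> b" by (rule LIMSEQ_le_const[OF b]) (use mass_nonneg[OF t] in blast)
  then have b_pos: "b > 0" using ne eb by simp
  \<comment> \<open>Constant sequences of test functions belong to the completion, so the minimal
    quotient a / b is an admissible constant in the Hardy inequality.\<close>
  have "a / b \<le> 1"
  proof (rule constant_le_1)
    fix \<psi> :: "real ^ 'n \<Rightarrow> real" assume \<psi>: "\<psi> \<in> test_functions D"
    show "a / b * weighted_mass D W \<psi> \<le> quad_form D V0 \<psi>"
    proof (cases "weighted_mass D W \<psi> = 0")
      case True
      then show ?thesis using quad_form_V0[OF \<psi>] En_nonneg[of \<psi>] by simp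
    next
      case False
      have z: "quad_form D V0 (\<lambda>x. 0) = 0"
        using quad_form_V0[of "\<lambda>x. 0"] by (simp add: En_def dh_def weighted_mass_def)
      have ext: "extend f (\<lambda>k. \<psi>) = f \<psi>" for f :: "(real ^ 'n \<Rightarrow> real) \<Rightarrow> real"
        unfolding extend_def by (rule limI) simp
      have "(\<lambda>k. \<psi>) \<in> completion (test_functions D) (quad_form D V0)"
        unfolding completion_def using \<psi> z by simp
      from min[OF this] have "a / b \<le> quad_form D V0 \<psi> / weighted_mass D W \<psi>" using False unfolding ext ea eb by blast
      moreover have "weighted_mass D W \<psi> > 0" using False mass_nonneg[OF \<psi>] by simp
      ultimately show ?thesis by (simp add: pos_le_divide_eq)
    qed
  qed
  then have ab: "a \<le> b" using b_pos by simp
  have "En (\<Phi> k) = quad_form D V0 (\<Phi> k) - weighted_mass D W (\<Phi> k)" for k using quad_form_V0[OF t] by simp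
  then have "(\<lambda>k. En (\<Phi> k)) \<longlonglongrightarrow> a - b" using tendsto_diff[OF a b] by simp
  moreover from this have "0 \<le> a - b" by (rule LIMSEQ_le_const) (use En_nonneg in blast)
  ultimately have En0: "(\<lambda>k. En (\<Phi> k)) \<longlonglongrightarrow> 0" using ab by simp
  \<comment> \<open>The dilate of \<open>\<Phi> K\<close> will be at squared distance more than b
    from \<open>\<Phi> K\<close>, whereas the argument yields distance at most 2 epsilon, that is,
    squared distance at most b / 4.\<close>
  define \<epsilon> where "\<epsilon> = sqrt b / 4"
  have \<epsilon>: "\<epsilon> > 0" "\<epsilon>\<^sup>2 = b / 16" using b_pos by (auto simp: \<epsilon>_def power_divide)
  obtain N where N: "\<forall>k\<ge>N. \<forall>l\<ge>N. mnorm (\<lambda>x. \<Phi> k x - \<Phi> l x) < \<epsilon>" using Cm \<epsilon>(1) by blast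
  have "\<forall>\<^sub>F k in sequentially. b / 2 < weighted_mass D W (\<Phi> k)"
    by (rule order_tendstoD(1)[OF b]) (use b_pos in simp)
  then obtain K where K: "K \<ge> N" "b / 2 < weighted_mass D W (\<Phi> K)"
    unfolding eventually_sequentially by (metis linear)
  obtain S where S: "compact S" "S \<subseteq> D" "\<And>x. x \<notin> S \<Longrightarrow> \<Phi> K x = 0" using test_functionsE[OF t[of K]] by metis
  obtain r2 where r2: "r2 > 0" "\<And>x. x \<in> S \<Longrightarrow> norm x \<le> r2" using compact_imp_bounded[OF S(1)] unfolding bounded_pos by auto
  obtain r1 where r1: "r1 > 0" "\<And>x. x \<in> S \<Longrightarrow> r1 \<le> norm x"
  proof (cases "S = {}")
    case False
    have "\<exists>x\<in>S. \<forall>y\<in>S. norm x \<le> norm y" by (intro continuous_attains_inf S False continuous_intros)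
    then show ?thesis using that S(2) norm_pos by (metis subsetD)
  qed (use that[of 1] in auto)
  \<comment> \<open>If x and c x both lay in S, then c r1 <= r2, contradicting 2 r2 <= c r1. The 2
    in the maximum ensures c > 1.\<close>
  define c where "c = max 2 (2 * r2 / r1)"
  have c: "c > 1" "2 * r2 \<le> c * r1" using r1(1) by (auto simp: c_def max_mult_distrib_right)
  then have c0: "c > 0" by simp
  have disj: "dil c (\<Phi> K) x * \<Phi> K x = 0" for x
  proof (rule ccontr)
    assume "dil c (\<Phi> K) x * \<Phi> K x \<noteq> 0"
    then have "c *\<^sub>R x \<in> S" "x \<in> S" using S(3)[of x] S(3)[of "c *\<^sub>R x"] by (auto simp: dil_def)
    then have "c * norm x \<le> r2" "r1 \<le> norm x" using r1(2)[of x] r2(2)[of "c *\<^sub>R x"] c0 by auto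
    then have "c * r1 \<le> r2" using c0 mult_left_mono[of r1 "norm x" c] by linarith
    then show False using c(2) r2(1) by linarith
  qed
  have dt: "dil c (\<Phi> k) \<in> test_functions D" for k by (rule dil_test[OF t c0])
  have dd: "(\<lambda>x. dil c (\<Phi> k) x - \<Phi> k x) \<in> test_functions D" for k by (rule test_functions_diff[OF dt t])
  have "weighted_mass D W (\<lambda>x. dil c (\<Phi> K) x - \<Phi> K x) = weighted_mass D W (dil c (\<Phi> K)) + weighted_mass D W (\<Phi> K)"
  proof -
    have "W x * (dil c (\<Phi> K) x - \<Phi> K x)\<^sup>2 = W x * (dil c (\<Phi> K) x)\<^sup>2 + W x * (\<Phi> K x)\<^sup>2" for x
    proof -
      have "(dil c (\<Phi> K) x - \<Phi> K x)\<^sup>2 = (dil c (\<Phi> K) x)\<^sup>2 + (\<Phi> K x)\<^sup>2 - 2 * (dil c (\<Phi> K) x * \<Phi> K x)"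
        by (simp add: power2_diff)
      then show ?thesis unfolding disj by (simp add: distrib_left add_divide_distrib)
    qed
    then show ?thesis
      unfolding weighted_mass_eq[OF dd] weighted_mass_eq[OF dt] weighted_mass_eq[OF t]
      using W_integrable[OF dt] W_integrable[OF t] by simp
  qed
  also have "\<dots> > b" using K(2) unfolding dil_mass[OF t c0] by simp
  finally have big: "b < (mnorm (\<lambda>x. dil c (\<Phi> K) x - \<Phi> K x))\<^sup>2" unfolding mnorm_sq[OF dd] .
  have "mnorm (\<lambda>x. dil c (\<Phi> K) x - \<Phi> K x) \<le> 2 * \<epsilon> + sqrt (\<beta> n * (c - 1)\<^sup>2 * En (\<Phi> k))" if k: "k \<ge> N" for k
  proof -
    have dK: "(\<lambda>x. dil c (\<Phi> K) x - dil c (\<Phi> k) x) = dil c (\<lambda>x. \<Phi> K x - \<Phi> k x)"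
      by (rule ext) (simp add: dil_def algebra_simps)
    have "(mnorm (\<lambda>x. dil c (\<Phi> K) x - dil c (\<Phi> k) x))\<^sup>2 = (mnorm (\<lambda>x. \<Phi> K x - \<Phi> k x))\<^sup>2"
      unfolding dK mnorm_sq[OF dil_test[OF td c0]] mnorm_sq[OF td] by (rule dil_mass[OF td c0])
    then have 1: "mnorm (\<lambda>x. dil c (\<Phi> K) x - dil c (\<Phi> k) x) = mnorm (\<lambda>x. \<Phi> K x - \<Phi> k x)"
      using mnorm_nonneg power2_eq_iff_nonneg by blast
    have "(mnorm (\<lambda>x. dil c (\<Phi> k) x - \<Phi> k x))\<^sup>2 \<le> \<beta> n * (c - 1)\<^sup>2 * En (\<Phi> k)"
      unfolding mnorm_sq[OF dd] by (rule dil_increment[OF t c(1)])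
    then have 2: "mnorm (\<lambda>x. dil c (\<Phi> k) x - \<Phi> k x) \<le> sqrt (\<beta> n * (c - 1)\<^sup>2 * En (\<Phi> k))" by (rule real_le_rsqrt)
    have "mnorm (\<lambda>x. dil c (\<Phi> K) x - \<Phi> K x) \<le> mnorm (\<lambda>x. dil c (\<Phi> K) x - dil c (\<Phi> k) x) + mnorm (\<lambda>x. dil c (\<Phi> k) x - \<Phi> K x)"
      by (rule mnorm_triangle[OF dt dt t])
    also have "mnorm (\<lambda>x. dil c (\<Phi> k) x - \<Phi> K x) \<le> mnorm (\<lambda>x. dil c (\<Phi> k) x - \<Phi> k x) + mnorm (\<lambda>x. \<Phi> k x - \<Phi> K x)"
      by (rule mnorm_triangle[OF dt t t])
    finally show ?thesis using 1 2 N[rule_format, OF K(1) k] N[rule_format, OF k K(1)] by linarith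
  qed
  moreover have "(\<lambda>k. 2 * \<epsilon> + sqrt (\<beta> n * (c - 1)\<^sup>2 * En (\<Phi> k))) \<longlonglongrightarrow> 2 * \<epsilon> + sqrt (\<beta> n * (c - 1)\<^sup>2 * 0)"
    by (intro tendsto_intros En0)
  ultimately have "mnorm (\<lambda>x. dil c (\<Phi> K) x - \<Phi> K x) \<le> 2 * \<epsilon>"
    by (intro LIMSEQ_le_const[of _ "2 * \<epsilon>"]) auto
  then have "(mnorm (\<lambda>x. dil c (\<Phi> K) x - \<Phi> K x))\<^sup>2 \<le> (2 * \<epsilon>)\<^sup>2" by (intro power_mono mnorm_nonneg)
  also have "\<dots> = b / 4" using \<epsilon>(2) by (simp add: power_mult_distrib)
  finally show False using big b_pos by linarith
qed


subsection \<open>The spectrum\<close>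

lemma gs_norm_bound:
  assumes v: "radial_cutoff v (real N)" and B: "\<And>s. \<bar>v s\<bar> \<le> B"
  shows "(L2_norm M (cr (gs v)))\<^sup>2 \<le> \<beta> n * (B\<^sup>2 * (real (2 * N) * smass))"
proof -
  have "ennreal ((L2_norm M (cr (gs v)))\<^sup>2) \<le> ennreal (\<beta> n) * (ennreal (B\<^sup>2) * ennreal (real (2 * N) * smass))"
    unfolding gs_L2(2)[OF v] shell_sym[symmetric] by (intro mult_left_mono shell_bound[OF v B]) simp
  also have "\<dots> = ennreal (\<beta> n * (B\<^sup>2 * (real (2 * N) * smass)))"
    using \<beta>n_pos smass_pos by (simp add: ennreal_mult')
  finally show ?thesis using \<beta>n_pos smass_pos by (subst (asm) ennreal_le_iff) auto
qed

text \<open>Since f'' = - kappa^2 f, only terms containing a derivative of the rescaled bump remain,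
  and each such derivative brings a factor 1/N. The instances are cosine and sine.\<close>

lemma modulated_bump:
  assumes N: "N \<ge> 1" and b: "\<And>s. (smooth_bump has_real_derivative b1 s) (at s)" "\<And>s. (b1 has_real_derivative b2 s) (at s)"
      "B > 0" "\<And>s. \<bar>b1 s\<bar> \<le> B" "\<And>s. \<bar>b2 s\<bar> \<le> B"
    and f: "\<And>s. (f has_real_derivative f' s) (at s)" "\<And>s. (f' has_real_derivative - \<kappa>\<^sup>2 * f s) (at s)"
      "\<And>s. \<bar>f s\<bar> \<le> 1" "\<And>s. \<bar>f' s\<bar> \<le> \<bar>\<kappa>\<bar>" "\<And>k. Dk_on k UNIV f"
  defines "v \<equiv> \<lambda>s. f s * smooth_bump (s / real N)"
  shows "radial_cutoff v (2 * real N)" "\<And>s. \<bar>deriv (deriv v) s + \<kappa>\<^sup>2 * v s\<bar> \<le> (2 * \<bar>\<kappa>\<bar> + 1) * B / real N"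
proof -
  have N0: "real N > 0" "real N \<ge> 1" using N by auto
  have c: "radial_cutoff (\<lambda>s. smooth_bump (s / real N)) (2 * real N)" by (rule radial_cutoff_bump[OF N0(1)])
  show "radial_cutoff v (2 * real N)"
    using c f(5) unfolding v_def radial_cutoff_def by (auto intro!: Dk_on_mult)
  have d1: "((\<lambda>s. smooth_bump (s / real N)) has_real_derivative b1 (s / real N) * (1 / real N)) (at s)" for s
    by (rule DERIV_chain2[OF b(1)]) (use N0 in \<open>auto intro!: derivative_eq_intros\<close>)
  have d2: "((\<lambda>s. b1 (s / real N)) has_real_derivative b2 (s / real N) * (1 / real N)) (at s)" for s
    by (rule DERIV_chain2[OF b(2)]) (use N0 in \<open>auto intro!: derivative_eq_intros\<close>)
  let ?v1 = "\<lambda>s. f' s * smooth_bump (s / real N) + f s * (b1 (s / real N) * (1 / real N))"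
  have v1: "deriv v s = ?v1 s" for s
  proof (rule DERIV_imp_deriv)
    show "(v has_real_derivative ?v1 s) (at s)" unfolding v_def
      by (rule DERIV_cong[OF DERIV_mult[OF f(1) d1]]) simp
  qed
  have v2: "deriv (deriv v) s = - \<kappa>\<^sup>2 * v s + 2 * f' s * b1 (s / real N) / real N + f s * b2 (s / real N) / (real N)\<^sup>2" for s
  proof (rule DERIV_imp_deriv)
    have "(?v1 has_real_derivative - \<kappa>\<^sup>2 * v s + 2 * f' s * b1 (s / real N) / real N + f s * b2 (s / real N) / (real N)\<^sup>2) (at s)"
      by (rule DERIV_cong[OF DERIV_add[OF DERIV_mult[OF f(2) d1] DERIV_mult[OF f(1) DERIV_mult[OF d2 DERIV_const]]]])
         (simp add: v_def power2_eq_square divide_inverse algebra_simps)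
    then show "(deriv v has_real_derivative - \<kappa>\<^sup>2 * v s + 2 * f' s * b1 (s / real N) / real N + f s * b2 (s / real N) / (real N)\<^sup>2) (at s)"
      unfolding v1[abs_def] .
  qed
  show "\<bar>deriv (deriv v) s + \<kappa>\<^sup>2 * v s\<bar> \<le> (2 * \<bar>\<kappa>\<bar> + 1) * B / real N" for s
  proof -
    have "deriv (deriv v) s + \<kappa>\<^sup>2 * v s = 2 * f' s * b1 (s / real N) / real N + f s * b2 (s / real N) / (real N)\<^sup>2"
      unfolding v2 by simp
    also have "\<bar>\<dots>\<bar> \<le> \<bar>2 * f' s * b1 (s / real N) / real N\<bar> + \<bar>f s * b2 (s / real N) / (real N)\<^sup>2\<bar>" by (rule abs_triangle_ineq)
    also have "\<dots> \<le> 2 * \<bar>\<kappa>\<bar> * B / real N + 1 * B / real N"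
    proof (rule add_mono)
      have "\<bar>f' s\<bar> * \<bar>b1 (s / real N)\<bar> \<le> \<bar>\<kappa>\<bar> * B" using f(4) b(4) by (intro mult_mono) auto
      then show "\<bar>2 * f' s * b1 (s / real N) / real N\<bar> \<le> 2 * \<bar>\<kappa>\<bar> * B / real N"
        using N0 by (simp add: abs_mult divide_right_mono)
      have "\<bar>f s\<bar> * \<bar>b2 (s / real N)\<bar> \<le> 1 * B" using f(3) b(5) by (intro mult_mono) auto
      moreover have "real N \<le> (real N)\<^sup>2" using N0 by (simp add: power2_eq_square)
      ultimately have "\<bar>f s\<bar> * \<bar>b2 (s / real N)\<bar> / (real N)\<^sup>2 \<le> 1 * B / real N"
        using N0 b(3) by (intro frac_le) auto
      then show "\<bar>f s * b2 (s / real N) / (real N)\<^sup>2\<bar> \<le> 1 * B / real N" using N0 by (simp add: abs_mult)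
    qed
    also have "\<dots> = (2 * \<bar>\<kappa>\<bar> + 1) * B / real N" by (simp add: distrib_right add_divide_distrib)
    finally show ?thesis .
  qed
qed

text \<open>Both the real and the imaginary part of \<open>u |x| powr (\<i> \<kappa>)\<close>, cut off at \<open>|ln |x|| \<approx> N\<close>, are used:
  only together do they have an explicit norm.\<close>

lemma approximate_eigenfunctions:
  assumes \<mu>: "\<mu> \<ge> 1"
  shows "\<exists>(u, g)\<in>F. L2_norm M u > C * L2_norm M (\<lambda>x. g x - of_real \<mu> * u x)"
proof (rule ccontr)
  assume neg: "\<not> (\<exists>(u, g)\<in>F. L2_norm M u > C * L2_norm M (\<lambda>x. g x - of_real \<mu> * u x))"
  \<comment> \<open>Chosen so that v - v'' / \<open>\<beta> n\<close> equals mu v whenever v'' = -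
    kappa^2 v.\<close>
  define \<kappa> where "\<kappa> = sqrt (\<beta> n * (\<mu> - 1))"
  have \<kappa>: "\<kappa>\<^sup>2 = \<beta> n * (\<mu> - 1)" using \<mu> \<beta>n_pos by (simp add: \<kappa>_def)
  obtain b1 b2 B where b: "\<And>s. (smooth_bump has_real_derivative b1 s) (at s)" "\<And>s. (b1 has_real_derivative b2 s) (at s)"
    "B > 0" "\<And>s. \<bar>b1 s\<bar> \<le> B" "\<And>s. \<bar>b2 s\<bar> \<le> B" using smooth_bump_derivs by metis
  \<comment> \<open>Bounds N times the error v - v'' / \<open>\<beta> n\<close> - mu v of a
    modulated bump.\<close>
  define B3 where "B3 = (2 * \<bar>\<kappa>\<bar> + 1) * B / \<beta> n"
  have est: "(L2_norm M (cr (gs v)))\<^sup>2 \<le> C\<^sup>2 * (\<beta> n * ((B3 / real N)\<^sup>2 * (real (2 * (2 * N + 2)) * smass)))"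
    if N: "N \<ge> 1" and v: "radial_cutoff v (2 * real N)" "\<And>s. \<bar>deriv (deriv v) s + \<kappa>\<^sup>2 * v s\<bar> \<le> (2 * \<bar>\<kappa>\<bar> + 1) * B / real N" for v N
  proof -
    let ?w = "\<lambda>s. v s - deriv (deriv v) s / \<beta> n"
    let ?z = "\<lambda>s. ?w s - \<mu> * v s"
    note G = friedrichs_gs[OF v(1)]
    have z: "?z s = - (deriv (deriv v) s + \<kappa>\<^sup>2 * v s) / \<beta> n" for s
      using \<beta>n_pos by (simp add: \<kappa> field_simps)
    have zc: "radial_cutoff ?z (real (2 * N + 2))"
      unfolding radial_cutoff_def
    proof (intro conjI allI impI)
      show "0 < real (2 * N + 2)" by simp
      have "Dk_on k UNIV (\<lambda>s. ?w s + (- \<mu>) * v s)" for k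
        using v(1) G(2) unfolding radial_cutoff_def by (intro Dk_on_add Dk_on_mult Dk_on_const) auto
      then show "Dk_on k UNIV ?z" for k by simp
      show "?z s = 0" if "real (2 * N + 2) \<le> \<bar>s\<bar>" for s
        using v(1) G(2) that unfolding radial_cutoff_def by auto
    qed
    have zb: "\<bar>?z s\<bar> \<le> B3 / real N" for s
    proof -
      have "\<bar>?z s\<bar> = \<bar>deriv (deriv v) s + \<kappa>\<^sup>2 * v s\<bar> / \<beta> n" unfolding z using \<beta>n_pos by simp
      also have "\<dots> \<le> ((2 * \<bar>\<kappa>\<bar> + 1) * B / real N) / \<beta> n" using v(2) \<beta>n_pos by (intro divide_right_mono) auto
      finally show ?thesis by (simp add: B3_def mult.commute)
    qed
    have eq: "(\<lambda>x. cr (gs ?w) x - of_real \<mu> * cr (gs v) x) = cr (gs ?z)"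
      by (rule ext) (simp add: gs_def algebra_simps)
    have "L2_norm M (cr (gs v)) \<le> C * L2_norm M (\<lambda>x. cr (gs ?w) x - of_real \<mu> * cr (gs v) x)"
      using neg G(1) by (force simp: not_less)
    then have "(L2_norm M (cr (gs v)))\<^sup>2 \<le> (C * L2_norm M (cr (gs ?z)))\<^sup>2"
      unfolding eq by (intro power_mono) auto
    also have "\<dots> \<le> C\<^sup>2 * (\<beta> n * ((B3 / real N)\<^sup>2 * (real (2 * (2 * N + 2)) * smass)))"
      unfolding power_mult_distrib[of C] by (intro mult_left_mono gs_norm_bound[OF zc zb]) simp
    finally show ?thesis .
  qed
  \<comment> \<open>The squares of cosine and sine add up to one, so together the two squared norms
    are at least the mass of the shells with |ln |x|| <= N, which grows linearly in N. The assumed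
    resolvent bound then compares this with the error terms.\<close>
  have lower: "\<beta> n * (real (2 * N) * smass) \<le> 2 * (C\<^sup>2 * (\<beta> n * ((B3 / real N)\<^sup>2 * (real (2 * (2 * N + 2)) * smass))))"
    if N: "N \<ge> 1" for N
  proof -
    let ?bN = "\<lambda>s. smooth_bump (s / real N)"
    let ?v1 = "\<lambda>s. cos (\<kappa> * s) * ?bN s" and ?v2 = "\<lambda>s. sin (\<kappa> * s) * ?bN s"
    have Dk: "Dk_on k UNIV (\<lambda>s. cos (\<kappa> * s))" "Dk_on k UNIV (\<lambda>s. sin (\<kappa> * s))" for k
      using Dk_on_compose[OF conjunct2[OF Dk_on_sin_cos] Dk_on_affine[of k UNIV 0 \<kappa>], of UNIV]
        Dk_on_compose[OF conjunct1[OF Dk_on_sin_cos] Dk_on_affine[of k UNIV 0 \<kappa>], of UNIV] by simp_all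
    have cs: "((\<lambda>s. cos (\<kappa> * s)) has_real_derivative - \<kappa> * sin (\<kappa> * s)) (at s)"
      "((\<lambda>s. - \<kappa> * sin (\<kappa> * s)) has_real_derivative - \<kappa>\<^sup>2 * cos (\<kappa> * s)) (at s)"
      "((\<lambda>s. sin (\<kappa> * s)) has_real_derivative \<kappa> * cos (\<kappa> * s)) (at s)"
      "((\<lambda>s. \<kappa> * cos (\<kappa> * s)) has_real_derivative - \<kappa>\<^sup>2 * sin (\<kappa> * s)) (at s)" for s
      by (auto intro!: derivative_eq_intros simp: power2_eq_square)
    have le: "\<bar>cos (\<kappa> * s)\<bar> \<le> 1" "\<bar>- \<kappa> * sin (\<kappa> * s)\<bar> \<le> \<bar>\<kappa>\<bar>" "\<bar>sin (\<kappa> * s)\<bar> \<le> 1" "\<bar>\<kappa> * cos (\<kappa> * s)\<bar> \<le> \<bar>\<kappa>\<bar>" for s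
      by (simp_all add: abs_mult mult_left_le)
    note m1 = modulated_bump[OF N b cs(1,2) le(1,2) Dk(1)]
    note m2 = modulated_bump[OF N b cs(3,4) le(3,4) Dk(2)]
    have [measurable]: "?v1 \<in> borel_measurable borel" "?v2 \<in> borel_measurable borel"
      using measurable_radial_cutoff m1(1) m2(1) by blast+
    have "ennreal (\<beta> n * (real (2 * N) * smass)) = ennreal (\<beta> n) * shell (- real N) (real N)"
      unfolding shell_sym using \<beta>n_pos by (simp add: ennreal_mult')
    also have "\<dots> \<le> ennreal (\<beta> n) * (\<integral>\<^sup>+x. ennreal (rdens x * (?v1 (lr x))\<^sup>2) + ennreal (rdens x * (?v2 (lr x))\<^sup>2) \<partial>lborel)"
      unfolding shell_def
    proof (intro mult_left_mono nn_integral_mono)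
      fix x :: "real ^ 'n"
      show "indicator {x. exp (- real N) \<le> norm x \<and> norm x < exp (real N)} x * ennreal (rdens x) \<le>
        ennreal (rdens x * (?v1 (lr x))\<^sup>2) + ennreal (rdens x * (?v2 (lr x))\<^sup>2)"
      proof (cases "x \<in> D \<and> exp (- real N) \<le> norm x \<and> norm x < exp (real N)")
        case True
        then have x: "norm x > 0" using norm_pos by auto
        have "- real N \<le> ln (norm x)" "ln (norm x) \<le> real N"
          using True x by (metis exp_le_cancel_iff exp_ln, metis exp_less_cancel_iff exp_ln less_imp_le)
        then have "\<bar>lr x\<bar> \<le> real N" using lr_eq[of x] True by auto
        then have b1: "?bN (lr x) = 1" using N by (intro smooth_bump_eq_1) (simp add: divide_le_eq)
        have "rdens x * (?v1 (lr x))\<^sup>2 + rdens x * (?v2 (lr x))\<^sup>2 = rdens x"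
          unfolding b1 by (simp flip: distrib_left)
        then have "ennreal (rdens x * (?v1 (lr x))\<^sup>2) + ennreal (rdens x * (?v2 (lr x))\<^sup>2) = ennreal (rdens x)"
          using rdens_nonneg[of x] by (subst ennreal_plus[symmetric]) auto
        then show ?thesis by (simp add: indicator_def)
      next
        case False
        then have z: "indicator {x. exp (- real N) \<le> norm x \<and> norm x < exp (real N)} x * ennreal (rdens x) = 0"
          by (cases "x \<in> D") (auto simp: rdens_def)
        show ?thesis unfolding z by (rule zero_le)
      qed
    qed simp
    also have "\<dots> = ennreal ((L2_norm M (cr (gs ?v1)))\<^sup>2) + ennreal ((L2_norm M (cr (gs ?v2)))\<^sup>2)"
      unfolding gs_L2(2)[OF m1(1)] gs_L2(2)[OF m2(1)] by (subst nn_integral_add) (auto simp: distrib_left)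
    also have "\<dots> = ennreal ((L2_norm M (cr (gs ?v1)))\<^sup>2 + (L2_norm M (cr (gs ?v2)))\<^sup>2)"
      by (intro ennreal_plus[symmetric]) auto
    finally have "\<beta> n * (real (2 * N) * smass) \<le> (L2_norm M (cr (gs ?v1)))\<^sup>2 + (L2_norm M (cr (gs ?v2)))\<^sup>2"
      by (subst (asm) ennreal_le_iff) auto
    then show ?thesis using est[OF N m1] est[OF N m2] by linarith
  qed
  \<comment> \<open>The left side of \<open>lower\<close> grows like N, while its right side decays
    like 1/N because the squared error carries 1 / N^2; hence N is bounded, which is the
    contradiction.\<close>
  have bound: "(real N)\<^sup>2 \<le> 8 * C\<^sup>2 * B3\<^sup>2" if N: "N \<ge> 1" for N
  proof -
    have N0: "real N \<ge> 1" using N by simp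
    have "\<beta> n * smass * (2 * real N) \<le> \<beta> n * smass * (2 * (C\<^sup>2 * ((B3 / real N)\<^sup>2 * (4 * real N + 4))))"
      using lower[OF N] by (simp add: mult_ac add_ac)
    then have "2 * real N \<le> 2 * (C\<^sup>2 * ((B3 / real N)\<^sup>2 * (4 * real N + 4)))"
      using \<beta>n_pos smass_pos by (subst (asm) mult_le_cancel_left_pos) auto
    also have "\<dots> \<le> 2 * (C\<^sup>2 * ((B3 / real N)\<^sup>2 * (8 * real N)))"
      using N0 by (intro mult_left_mono) auto
    also have "\<dots> = 2 * real N * (8 * C\<^sup>2 * B3\<^sup>2 / (real N)\<^sup>2)" by (simp add: power_divide)
    finally have "(2 * real N) * 1 \<le> 2 * real N * (8 * C\<^sup>2 * B3\<^sup>2 / (real N)\<^sup>2)" by (simp only: mult_1_right)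
    then have "1 \<le> 8 * C\<^sup>2 * B3\<^sup>2 / (real N)\<^sup>2"
      by (rule mult_left_le_imp_le) (use N0 in simp)
    moreover have "0 < (real N)\<^sup>2" using N0 by simp
    ultimately show ?thesis by (simp only: pos_le_divide_eq mult_1_left)
  qed
  obtain N :: nat where N: "max 1 (8 * C\<^sup>2 * B3\<^sup>2) < real N" using reals_Archimedean2 by blast
  then have N1: "N \<ge> 1" "real N \<ge> 1" and lt: "8 * C\<^sup>2 * B3\<^sup>2 < real N" by auto
  have "real N * 1 \<le> real N * real N" using N1(2) by (intro mult_left_mono) auto
  then have "real N \<le> (real N)\<^sup>2" by (simp only: power2_eq_square mult_1_right)
  from order_less_le_trans[OF lt this] bound[OF N1(1)] show False by linarith
qed

lemma optimal: "optimal_weight D V0 (\<beta> n)"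
proof -
  have V: "(\<lambda>x. V0 x + W x) = Vn" by (rule ext) (simp add: hardy_potential_Suc)
  have G: "weighted_friedrichs D V0 W = F" by (simp add: weighted_friedrichs_def)
  have le: "weighted_mass D W \<phi> \<le> quad_form D V0 \<phi>" if "\<phi> \<in> test_functions D" for \<phi>
    using quad_form_V0[OF that] En_nonneg[of \<phi>] by simp
  show ?thesis
    unfolding optimal_weight_def Let_def V G
    using \<beta>n_pos subcritical_V0 le critical_Vn best_constants no_rayleigh_minimizer
      spectrum_eq_ray[OF approximate_eigenfunctions] by blast
qed

end

theorem theorem6p1:
  fixes n :: nat
    and e :: "nat \<Rightarrow> 'n::finite"
    and \<alpha> \<beta> :: "nat \<Rightarrow> real"
  assumes "n \<ge> 2"
    and "bij_betw e {1..n} UNIV"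
    and "\<And>i. i \<in> {1..n} \<Longrightarrow> \<alpha> i \<le> 0"
    and "\<beta> 1 = - (\<alpha> 1)\<^sup>2 + 1 / 4"
    and "\<And>i. i \<in> {2..n} \<Longrightarrow> \<beta> i = - (\<alpha> i)\<^sup>2 + (\<alpha> (i - 1) - 1 / 2)\<^sup>2"
    and "\<alpha> n = 0"
    and "inj_on \<alpha> {1..n - 1} \<or> (\<forall>i\<in>{1..n - 1}. \<alpha> i < 0)"
  shows "critical (half_space e) (quad_form (half_space e) (hardy_potential e \<beta> n)) \<and>
    optimal_weight (half_space e) (hardy_potential e \<beta> (n - 1)) (\<beta> n)"
proof -
  interpret hardy_weights n e \<alpha> \<beta> by unfold_locales (use assms in auto)
  show ?thesis using critical_Vn optimal by blast
qed

end
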